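(* Suppose $\mu_j\in\sigma(A_1)\setminus\sigma(\hat A_2)$. Then the eigenfunction $u_{\varepsilon,j}$ of (P$_\varepsilon$) with eigenvalue $\lambda_j^\varepsilon$ converges in $H^1(a,b)$, as $\varepsilon\to0$, towards the function $u$ given by $u=y$ on $I_a$ and $u=z$ on $I_b$, where $y$ is an eigenfunction of the problem $$(ky')'+\mu r y=0\ \text{ in } I_a,\qquad y(a)=y'(0)=0$$ with eigenvalue $\mu=\mu_j$, and $z$ is the unique solution of the problem $$(\kappa z')'+\mu_j\rho z=0\ \text{ in } I_b,\qquad z(0)=y(0),\quad z(b)=0.$$ If $z'(0)=0$, then $\lambda_j^\varepsilon=\varepsilon\mu_j$ and $u_{\varepsilon,j}=u$ for all $\varepsilon>0$. Otherwise $\lambda_j^\varepsilon$ and $u_{\varepsilon,j}$ admit the asymptotic expansions $$\lambda_j^\varepsilon\sim\varepsilon(\mu_j+\varepsilon\nu_1+\cdots+\varepsilon^n\nu_n+\cdots),$$ $$u_{\varepsilon,j}\sim y_0+\varepsilon y_1+\cdots+\varepsilon^n y_n+\cdots\ \text{ on } I_a,\qquad u_{\varepsilon,j}\sim z_0+\varepsilon z_1+\cdots+\varepsilon^n z_n+\cdots\ \text{ on } I_b,$$ with the coefficients $\nu_n,y_n,z_n$ constructed in the context for $\mu=\mu_j$. Moreover, the following estimates of the remainder terms hold, with constants $c_n,C_n$ independent of $\varepsilon$: $$\bigl|\varepsilon^{-1}\lambda_j^\varepsilon-(\mu_j+\varepsilon\nu_1+\cdots+\varepsilon^n\nu_n)\bigr|\le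 c_n\varepsilon^{n+1},\qquad \|u_{\varepsilon,j}-\vartheta_\varepsilon U_{\varepsilon,n}\|_{H^1(a,b)}\le C_n\varepsilon^{n+1},$$ where $U_{\varepsilon,n}=y_0+\varepsilon y_1+\cdots+\varepsilon^n y_n$ on $I_a$, $U_{\varepsilon,n}=z_0+\varepsilon z_1+\cdots+\varepsilon^n z_n$ on $I_b$, and $\vartheta_\varepsilon$ is a normalizing multiplier with strictly positive limit as $\varepsilon\to0$.
   Context: Let $a<0<b$, $I_a=(a,0)$, $I_b=(0,b)$. Let $k,r$ be smooth positive functions on $[a,0]$ and $\kappa,\rho$ smooth positive functions on $[0,b]$. Let $R=r$ on $I_a$ and $R=\rho$ on $I_b$. Perturbed problem (P$_\varepsilon$), with small parameter $\varepsilon>0$: $(k u_\varepsilon')'+\varepsilon^{-1}\lambda^\varepsilon r u_\varepsilon=0$ in $I_a$; $\ \varepsilon(\kappa u_\varepsilon')'+\lambda^\varepsilon\rho u_\varepsilon=0$ in $I_b$; $\ u_\varepsilon(-0)=u_\varepsilon(+0)$, $\ (ku_\varepsilon')(-0)=\varepsilon(\kappa u_\varepsilon')(+0)$; $\ u_\varepsilon(a)=0$, $u_\varepsilon(b)=0$. Its spectrum is real, discrete and simple, $0<\lambda_1^\varepsilon<\lambda_2^\varepsilon<\dots\to\infty$. The corresponding real-valued eigenfunctions $u_{\varepsilon,j}$ are normalized by $\int_a^b R\,u_{\varepsilon,j}^2\,dx=1$ and $u_{\varepsilon,j}'(b)>0$. Operators: $A_1=-\frac1r\frac{d}{dx}k\frac{d}{dx}$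 in the weighted space $L_2(r,I_a)$ with domain $\{u\in H^2(I_a):u(a)=0,\ u'(0)=0\}$; $\hat A_2=-\frac1\rho\frac{d}{dx}\kappa\frac{d}{dx}$ in the weighted space $L_2(\rho,I_b)$ with domain $\{u\in H^2(I_b):u(0)=u(b)=0\}$; $\mathcal{A}(u_1,u_2)=\bigl(-\frac1r(ku_1')',-\frac1\rho(\kappa u_2')'\bigr)$ in $L_2(r,I_a)\oplus L_2(\rho,I_b)$ with domain $\{(u_1,u_2)\in H^2(I_a)\oplus H^2(I_b): u_1(a)=u_1'(0)=0,\ u_2(b)=0,\ u_1(0)=u_2(0)\}$. The spectrum of $\mathcal{A}$ is real and discrete and equals $\sigma(A_1)\cup\sigma(\hat A_2)$; $\mu_1\le\mu_2\le\cdots$ are the eigenvalues of $\mathcal{A}$ in increasing order, repeated according to (algebraic) multiplicity. Construction of coefficients for $\mu\in\sigma(A_1)\setminus\sigma(\hat A_2)$. Let $y_0$ be the eigenfunction of $A_1$ with eigenvalue $\mu$ fixed by $\int_a^0 r y_0^2\,dx=1$ and $y_0(0)>0$, and let $z_0$ be the unique solution of $(\kappa z_0')'+\mu\rho z_0=0$ in $I_b$, $z_0(0)=y_0(0)$, $z_0(b)=0$. For $n=1,2,\dots$ put $\nu_n=-(\kappa z_{n-1}')(0)\,y_0(0)$ and let $y_n$, $z_n$ be the unique solutions of $$(ky_n')'+\mu r y_n=-\nu_n r y_0-r\sum_{i=1}^{n-1}\nu_i y_{n-i}\ \text{ in } I_a,\quad y_n(a)=0,\quad (ky_n')(0)=(\kappa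 z_{n-1}')(0),\quad \int_a^0 r y_n y_0\,dx=0,$$ $$(\kappa z_n')'+\mu\rho z_n=-\rho\sum_{i=1}^{n}\nu_i z_{n-i}\ \text{ in } I_b,\quad z_n(0)=y_n(0),\quad z_n(b)=0.$$
   Formalization: U and its expansions carry the extra sign factor sgn z_0'(b), as u'(b)>0 and y_0(0)>0 can orient oppositely; the expansion of u_{ε,j} holds up to the multiplier ϑ_ε, since without it it contradicts the normalization of u_{ε,j}. *)

theory Defs
  imports
    "HOL-Analysis.Analysis"
    "HOL-Library.Function_Algebras"
    "HOL-Library.Landau_Symbols"
begin

text \<open>One-sided at the end points of an interval S.\<close>

abbreviation deriv_within :: "(real \<Rightarrow> 'a::real_normed_vector) \<Rightarrow> real set \<Rightarrow> real \<Rightarrow> 'a" where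
  "deriv_within f S x \<equiv> vector_derivative f (at x within S)"

definition smooth_on :: "real set \<Rightarrow> (real \<Rightarrow> real) \<Rightarrow> bool" where
  "smooth_on S f \<longleftrightarrow>
     (\<exists>d :: nat \<Rightarrow> real \<Rightarrow> real. (\<forall>x\<in>S. d 0 x = f x) \<and>
        (\<forall>n. \<forall>x\<in>S. (d n has_real_derivative d (Suc n) x) (at x within S)))"

text \<open>\<open>(p u')' = f\<close> on the closed interval S, in the classical sense up to the end points.
  For continuous p > 0 and f this is the same as a classical solution in the interior whose
  derivative extends continuously to the end points.\<close>

definition sl_solution ::
  "(real \<Rightarrow> real) \<Rightarrow> real set \<Rightarrow> (real \<Rightarrow> 'a::real_normed_vector) \<Rightarrow> (real \<Rightarrow> 'a) \<Rightarrow> bool" where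
  "sl_solution p S f u \<longleftrightarrow>
     (\<forall>x\<in>S. u differentiable (at x within S) \<and>
        ((\<lambda>t. p t *\<^sub>R deriv_within u S t) has_vector_derivative f x) (at x within S))"

definition glue :: "(real \<Rightarrow> 'a) \<Rightarrow> (real \<Rightarrow> 'a) \<Rightarrow> real \<Rightarrow> 'a" where
  "glue f g x = (if x < 0 then f x else g x)"

text \<open>An element of \<open>H\<^sup>1(c,d)\<close> is identified with its absolutely continuous representative on
  \<open>[c,d]\<close>, an element of \<open>H\<^sup>2(c,d)\<close> with its \<open>C\<^sup>1\<close> representative; boundary values are
  values of these representatives. \<open>L2w w S\<close> is the weighted space \<open>L\<^sub>2(w, S)\<close> before passing
  to classes modulo null sets.\<close>

definition L2w :: "(real \<Rightarrow> real) \<Rightarrow> real set \<Rightarrow> (real \<Rightarrow> 'a::euclidean_space) set" where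
  "L2w w S = {f. f \<in> borel_measurable (lebesgue_on S) \<and> (\<lambda>x. w x * (norm (f x))\<^sup>2) integrable_on S}"

definition L2w_norm :: "(real \<Rightarrow> real) \<Rightarrow> real set \<Rightarrow> (real \<Rightarrow> 'a::euclidean_space) \<Rightarrow> real" where
  "L2w_norm w S f = sqrt (integral S (\<lambda>x. w x * (norm (f x))\<^sup>2))"

definition H1 :: "real \<Rightarrow> real \<Rightarrow> (real \<Rightarrow> 'a::euclidean_space) set" where
  "H1 c d = {f. \<exists>g\<in>L2w (\<lambda>_. 1) {c..d}. \<forall>x\<in>{c..d}. f x = f c + integral {c..x} g}"

definition H2 :: "real \<Rightarrow> real \<Rightarrow> (real \<Rightarrow> 'a::euclidean_space) set" where
  "H2 c d = {f. (\<forall>x\<in>{c..d}. f differentiable (at x within {c..d})) \<and>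
                deriv_within f {c..d} \<in> H1 c d}"

text \<open>For f in \<open>H1 c d\<close> the pointwise derivative exists almost everywhere and is the weak
  derivative.\<close>

definition H1_norm :: "real \<Rightarrow> real \<Rightarrow> (real \<Rightarrow> 'a::euclidean_space) \<Rightarrow> real" where
  "H1_norm c d f =
     sqrt (integral {c..d} (\<lambda>x. (norm (f x))\<^sup>2) +
           integral {c..d} (\<lambda>x. (norm (vector_derivative f (at x)))\<^sup>2))"

definition tendsto_H1 ::
  "real \<Rightarrow> real \<Rightarrow> ('i \<Rightarrow> real \<Rightarrow> real) \<Rightarrow> (real \<Rightarrow> real) \<Rightarrow> 'i filter \<Rightarrow> bool" where
  "tendsto_H1 c d f l F \<longleftrightarrow>
     l \<in> H1 c d \<and> (\<forall>\<^sub>F i in F. f i \<in> H1 c d) \<and>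
     ((\<lambda>i. H1_norm c d (\<lambda>x. f i x - l x)) \<longlongrightarrow> 0) F"

definition problem_P ::
  "real \<Rightarrow> real \<Rightarrow> (real \<Rightarrow> real) \<Rightarrow> (real \<Rightarrow> real) \<Rightarrow> (real \<Rightarrow> real) \<Rightarrow> (real \<Rightarrow> real) \<Rightarrow> real \<Rightarrow>
   'a::real_normed_field \<Rightarrow> (real \<Rightarrow> 'a) \<Rightarrow> bool" where
  "problem_P a b k r \<kappa> \<rho> \<epsilon> \<Lambda> u \<longleftrightarrow>
     sl_solution k {a..0} (\<lambda>x. - (inverse (of_real \<epsilon>) * \<Lambda> * of_real (r x) * u x)) u \<and>
     sl_solution (\<lambda>x. \<epsilon> * \<kappa> x) {0..b} (\<lambda>x. - (\<Lambda> * of_real (\<rho> x) * u x)) u \<and>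
     k 0 *\<^sub>R deriv_within u {a..0} 0 = \<epsilon> *\<^sub>R (\<kappa> 0 *\<^sub>R deriv_within u {0..b} 0) \<and>
     u a = 0 \<and> u b = 0"

definition spectrum_P ::
  "real \<Rightarrow> real \<Rightarrow> (real \<Rightarrow> real) \<Rightarrow> (real \<Rightarrow> real) \<Rightarrow> (real \<Rightarrow> real) \<Rightarrow> (real \<Rightarrow> real) \<Rightarrow> real \<Rightarrow>
   complex set" where
  "spectrum_P a b k r \<kappa> \<rho> \<epsilon> =
     {\<Lambda>. \<exists>u :: real \<Rightarrow> complex. problem_P a b k r \<kappa> \<rho> \<epsilon> \<Lambda> u \<and> (\<exists>x\<in>{a..b}. u x \<noteq> 0)}"

definition enumerates_spectrum_P ::
  "real \<Rightarrow> real \<Rightarrow> (real \<Rightarrow> real) \<Rightarrow> (real \<Rightarrow> real) \<Rightarrow> (real \<Rightarrow> real) \<Rightarrow> (real \<Rightarrow> real) \<Rightarrow> real \<Rightarrow>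
   (nat \<Rightarrow> real) \<Rightarrow> bool" where
  "enumerates_spectrum_P a b k r \<kappa> \<rho> \<epsilon> l \<longleftrightarrow>
     (\<lambda>i. complex_of_real (l i)) ` {1..} = spectrum_P a b k r \<kappa> \<rho> \<epsilon> \<and>
     0 < l 1 \<and> strict_mono_on {1..} l \<and> filterlim l at_top sequentially"

definition normalized_eigenfunction_P ::
  "real \<Rightarrow> real \<Rightarrow> (real \<Rightarrow> real) \<Rightarrow> (real \<Rightarrow> real) \<Rightarrow> (real \<Rightarrow> real) \<Rightarrow> (real \<Rightarrow> real) \<Rightarrow> real \<Rightarrow>
   real \<Rightarrow> (real \<Rightarrow> real) \<Rightarrow> bool" where
  "normalized_eigenfunction_P a b k r \<kappa> \<rho> \<epsilon> \<Lambda> u \<longleftrightarrow>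
     problem_P a b k r \<kappa> \<rho> \<epsilon> \<Lambda> u \<and>
     integral {a..b} (\<lambda>x. glue r \<rho> x * (u x)\<^sup>2) = 1 \<and>
     deriv_within u {0..b} b > 0"

text \<open>The expression \<open>-(1/w) (p u')'\<close>, determined almost everywhere for u in \<open>H\<^sup>2\<close>.\<close>

definition sl_expr ::
  "(real \<Rightarrow> real) \<Rightarrow> (real \<Rightarrow> real) \<Rightarrow> real set \<Rightarrow> (real \<Rightarrow> complex) \<Rightarrow> real \<Rightarrow> complex" where
  "sl_expr p w S u x = - ((1 / w x) *\<^sub>R deriv_within (\<lambda>t. p t *\<^sub>R deriv_within u S t) S x)"

text \<open>Each element of the domain of an operator is represented by exactly one function: the
  \<open>C\<^sup>1\<close> representative on the closed interval, extended by zero.\<close>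

definition dom_A1 :: "real \<Rightarrow> (real \<Rightarrow> complex) set" where
  "dom_A1 a = {u \<in> H2 a 0. u a = 0 \<and> deriv_within u {a..0} 0 = 0 \<and> (\<forall>x. x \<notin> {a..0} \<longrightarrow> u x = 0)}"

definition dom_A2 :: "real \<Rightarrow> (real \<Rightarrow> complex) set" where
  "dom_A2 b = {u \<in> H2 0 b. u 0 = 0 \<and> u b = 0 \<and> (\<forall>x. x \<notin> {0..b} \<longrightarrow> u x = 0)}"

definition dom_A :: "real \<Rightarrow> real \<Rightarrow> ((real \<Rightarrow> complex) \<times> (real \<Rightarrow> complex)) set" where
  "dom_A a b = {(u1, u2). u1 \<in> H2 a 0 \<and> u2 \<in> H2 0 b \<and>
     u1 a = 0 \<and> deriv_within u1 {a..0} 0 = 0 \<and> u2 b = 0 \<and> u1 0 = u2 0 \<and>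
     (\<forall>x. x \<notin> {a..0} \<longrightarrow> u1 x = 0) \<and> (\<forall>x. x \<notin> {0..b} \<longrightarrow> u2 x = 0)}"

text \<open>Spectrum of an operator T in \<open>L\<^sub>2(w, S)\<close> with domain D: the set of c for which
  \<open>T - c\<close> is not a bijection of D onto \<open>L\<^sub>2(w, S)\<close> with bounded inverse.\<close>

definition spectrum_L2 ::
  "(real \<Rightarrow> real) \<Rightarrow> real set \<Rightarrow> (real \<Rightarrow> complex) set \<Rightarrow>
   ((real \<Rightarrow> complex) \<Rightarrow> real \<Rightarrow> complex) \<Rightarrow> complex set" where
  "spectrum_L2 w S D T = {c. \<not> (\<exists>C. \<forall>f\<in>L2w w S.
     (\<exists>!u. u \<in> D \<and> (AE x in lebesgue_on S. T u x - c * u x = f x)) \<and>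
     (\<forall>u\<in>D. (AE x in lebesgue_on S. T u x - c * u x = f x) \<longrightarrow>
        L2w_norm w S u \<le> C * L2w_norm w S f))}"

definition spectrum_A1 :: "real \<Rightarrow> (real \<Rightarrow> real) \<Rightarrow> (real \<Rightarrow> real) \<Rightarrow> complex set" where
  "spectrum_A1 a k r = spectrum_L2 r {a..0} (dom_A1 a) (sl_expr k r {a..0})"

definition spectrum_A2 :: "real \<Rightarrow> (real \<Rightarrow> real) \<Rightarrow> (real \<Rightarrow> real) \<Rightarrow> complex set" where
  "spectrum_A2 b \<kappa> \<rho> = spectrum_L2 \<rho> {0..b} (dom_A2 b) (sl_expr \<kappa> \<rho> {0..b})"

text \<open>\<open>ker_A \<dots> c n\<close> is the kernel of the n-th power of \<open>\<A> - c\<close>.\<close>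

primrec ker_A ::
  "real \<Rightarrow> real \<Rightarrow> (real \<Rightarrow> real) \<Rightarrow> (real \<Rightarrow> real) \<Rightarrow> (real \<Rightarrow> real) \<Rightarrow> (real \<Rightarrow> real) \<Rightarrow> complex \<Rightarrow>
   nat \<Rightarrow> ((real \<Rightarrow> complex) \<times> (real \<Rightarrow> complex)) set" where
  "ker_A a b k r \<kappa> \<rho> c 0 = {0}"
| "ker_A a b k r \<kappa> \<rho> c (Suc n) =
     {(u1, u2) \<in> dom_A a b. \<exists>(w1, w2) \<in> ker_A a b k r \<kappa> \<rho> c n.
        (AE x in lebesgue_on {a..0}. sl_expr k r {a..0} u1 x - c * u1 x = w1 x) \<and>
        (AE x in lebesgue_on {0..b}. sl_expr \<kappa> \<rho> {0..b} u2 x - c * u2 x = w2 x)}"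

definition scale_pair ::
  "complex \<Rightarrow> (real \<Rightarrow> complex) \<times> (real \<Rightarrow> complex) \<Rightarrow> (real \<Rightarrow> complex) \<times> (real \<Rightarrow> complex)" where
  "scale_pair c v = ((\<lambda>x. c * fst v x), (\<lambda>x. c * snd v x))"

definition alg_mult_A ::
  "real \<Rightarrow> real \<Rightarrow> (real \<Rightarrow> real) \<Rightarrow> (real \<Rightarrow> real) \<Rightarrow> (real \<Rightarrow> real) \<Rightarrow> (real \<Rightarrow> real) \<Rightarrow> complex \<Rightarrow>
   nat" where
  "alg_mult_A a b k r \<kappa> \<rho> c = vector_space.dim scale_pair (\<Union>n. ker_A a b k r \<kappa> \<rho> c n)"

definition enumerates_eigenvalues_A ::
  "real \<Rightarrow> real \<Rightarrow> (real \<Rightarrow> real) \<Rightarrow> (real \<Rightarrow> real) \<Rightarrow> (real \<Rightarrow> real) \<Rightarrow> (real \<Rightarrow> real) \<Rightarrow>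
   (nat \<Rightarrow> real) \<Rightarrow> bool" where
  "enumerates_eigenvalues_A a b k r \<kappa> \<rho> \<mu> \<longleftrightarrow>
     mono_on {1..} \<mu> \<and>
     (\<forall>c. finite {i\<in>{1..}. complex_of_real (\<mu> i) = c} \<and>
          card {i\<in>{1..}. complex_of_real (\<mu> i) = c} = alg_mult_A a b k r \<kappa> \<rho> c)"

definition y_problem ::
  "real \<Rightarrow> (real \<Rightarrow> real) \<Rightarrow> (real \<Rightarrow> real) \<Rightarrow> real \<Rightarrow> (real \<Rightarrow> real) \<Rightarrow> bool" where
  "y_problem a k r \<mu> y \<longleftrightarrow>
     sl_solution k {a..0} (\<lambda>x. - (\<mu> * r x * y x)) y \<and> y a = 0 \<and> deriv_within y {a..0} 0 = 0"

definition z_problem ::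
  "real \<Rightarrow> (real \<Rightarrow> real) \<Rightarrow> (real \<Rightarrow> real) \<Rightarrow> real \<Rightarrow> real \<Rightarrow> (real \<Rightarrow> real) \<Rightarrow> bool" where
  "z_problem b \<kappa> \<rho> \<mu> h z \<longleftrightarrow>
     sl_solution \<kappa> {0..b} (\<lambda>x. - (\<mu> * \<rho> x * z x)) z \<and> z 0 = h \<and> z b = 0"

text \<open>The value \<open>\<nu> 0\<close> is irrelevant.\<close>

definition expansion_coeffs ::
  "real \<Rightarrow> real \<Rightarrow> (real \<Rightarrow> real) \<Rightarrow> (real \<Rightarrow> real) \<Rightarrow> (real \<Rightarrow> real) \<Rightarrow> (real \<Rightarrow> real) \<Rightarrow> real \<Rightarrow>
   (nat \<Rightarrow> real) \<Rightarrow> (nat \<Rightarrow> real \<Rightarrow> real) \<Rightarrow> (nat \<Rightarrow> real \<Rightarrow> real) \<Rightarrow> bool" where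
  "expansion_coeffs a b k r \<kappa> \<rho> \<mu> \<nu> y z \<longleftrightarrow>
     y_problem a k r \<mu> (y 0) \<and> integral {a..0} (\<lambda>x. r x * (y 0 x)\<^sup>2) = 1 \<and> y 0 0 > 0 \<and>
     z_problem b \<kappa> \<rho> \<mu> (y 0 0) (z 0) \<and>
     (\<forall>n\<ge>1.
        \<nu> n = - (\<kappa> 0 * deriv_within (z (n - 1)) {0..b} 0) * y 0 0 \<and>
        sl_solution k {a..0}
          (\<lambda>x. - \<nu> n * r x * y 0 x - r x * (\<Sum>i=1..<n. \<nu> i * y (n - i) x) - \<mu> * r x * y n x) (y n) \<and>
        y n a = 0 \<and>
        k 0 * deriv_within (y n) {a..0} 0 = \<kappa> 0 * deriv_within (z (n - 1)) {0..b} 0 \<and>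
        integral {a..0} (\<lambda>x. r x * y n x * y 0 x) = 0 \<and>
        sl_solution \<kappa> {0..b}
          (\<lambda>x. - \<rho> x * (\<Sum>i=1..n. \<nu> i * z (n - i) x) - \<mu> * \<rho> x * z n x) (z n) \<and>
        z n 0 = y n 0 \<and> z n b = 0)"

definition partial_sum :: "(nat \<Rightarrow> real \<Rightarrow> real) \<Rightarrow> real \<Rightarrow> nat \<Rightarrow> real \<Rightarrow> real" where
  "partial_sum f \<epsilon> n x = (\<Sum>i\<le>n. \<epsilon> ^ i * f i x)"

definition approx_U ::
  "(nat \<Rightarrow> real \<Rightarrow> real) \<Rightarrow> (nat \<Rightarrow> real \<Rightarrow> real) \<Rightarrow> real \<Rightarrow> nat \<Rightarrow> real \<Rightarrow> real" where
  "approx_U y z \<epsilon> n = glue (partial_sum y \<epsilon> n) (partial_sum z \<epsilon> n)"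

definition normalizer ::
  "real \<Rightarrow> real \<Rightarrow> (real \<Rightarrow> real) \<Rightarrow> (real \<Rightarrow> real) \<Rightarrow> (real \<Rightarrow> real) \<Rightarrow> real" where
  "normalizer a b r \<rho> U = 1 / sqrt (integral {a..b} (\<lambda>x. glue r \<rho> x * (U x)\<^sup>2))"

text \<open>The condition \<open>u'(b) > 0\<close> on the exact eigenfunctions and the condition \<open>y\<^sub>0(0) > 0\<close> on
  the leading term may select opposite orientations; they agree exactly when \<open>z\<^sub>0'(b) > 0\<close>.
  This sign reconciles the two.\<close>

definition orientation :: "real \<Rightarrow> (nat \<Rightarrow> real \<Rightarrow> real) \<Rightarrow> real" where
  "orientation b z = sgn (deriv_within (z 0) {0..b} b)"

end

theory Submission
  imports Defs
begin

text \<open>Write the spectral parameter as \<open>\<lambda> = \<epsilon> \<Lambda>\<close>. The equations on the two halves then become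
  \<open>(k u')' + \<Lambda> r u = 0\<close> and \<open>(\<kappa> u')' + \<Lambda> \<rho> u = 0\<close>, and \<open>\<epsilon>\<close> survives only in the condition
  \<open>(k u')(0) = \<epsilon> (\<kappa> u')(0)\<close>. Let \<open>(U\<^sub>l, V\<^sub>l)\<close> be value and flux at \<open>0\<close> of the left solution that
  starts at \<open>a\<close> with value \<open>0\<close> and flux \<open>1\<close>, and \<open>(U\<^sub>r, V\<^sub>r)\<close> the analogous pair for the reflected
  right half. All four are entire functions of \<open>\<Lambda>\<close>, and \<open>\<epsilon> \<Lambda>\<close> is an eigenvalue if and only if
  \<open>D\<^sub>\<epsilon>(\<Lambda>) = V\<^sub>l U\<^sub>r + \<epsilon> U\<^sub>l V\<^sub>r\<close> vanishes (\<open>spectrum_P_iff\<close>). At \<open>\<epsilon> = 0\<close> the zeros are those of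
  \<open>V\<^sub>l\<close>, the spectrum of \<open>A\<^sub>1\<close>, and those of \<open>U\<^sub>r\<close>, the spectrum of the right Dirichlet operator.

  The delicate point is the numbering: the \<open>j\<close>-th eigenvalue must converge to the \<open>j\<close>-th limit.
  The Lagrange identity gives \<open>V U' - U V' = \<integral> q u\<^sup>2 > 0\<close> for the derivatives in \<open>\<Lambda>\<close> on either
  half, with \<open>q\<close> the weight and \<open>u\<close> the solution there (\<open>endpoint_wronskian_pos\<close>), so the complex
  numbers \<open>V\<^sub>l + \<i> U\<^sub>l\<close> and \<open>U\<^sub>r - \<i> \<epsilon> V\<^sub>r\<close> rotate counterclockwise as \<open>\<Lambda>\<close> grows. The function
  \<open>D\<^sub>\<epsilon>\<close> is the real part of their product. Angles add, and the number of zeros of a real part up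
  to \<open>\<Lambda>\<close> is an integer part of its angle divided by \<open>\<pi>\<close>. Consequently \<open>D\<^sub>\<epsilon>\<close> has as many zeros up
  to \<open>\<Lambda>\<close> as \<open>V\<^sub>l\<close> and \<open>U\<^sub>r\<close> together, for small \<open>\<epsilon>\<close> if neither of them vanishes at \<open>\<Lambda>\<close>, and for
  every \<open>\<epsilon>\<close> if \<open>V\<^sub>l\<close> and \<open>V\<^sub>r\<close> both vanish there. On the side of the limit operator,
  self-adjointness of the two halves shows that the algebraic multiplicity of \<open>c\<close> is the number of
  the two spectra that contain it (\<open>alg_mult_A_eq\<close>), with a Jordan block at common points. As
  \<open>\<mu>\<^sub>j\<close> is not a Dirichlet eigenvalue, \<open>V\<^sub>l\<close> and \<open>U\<^sub>r\<close> together have exactly \<open>j\<close> zeros up to it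
  (\<open>eigenvalue_index\<close>), which yields \<open>\<lambda>\<^sub>j / \<epsilon> \<rightarrow> \<mu>\<^sub>j\<close> (\<open>scaled_eigenvalue_tendsto\<close>). The condition
  \<open>z'(0) = 0\<close> means \<open>V\<^sub>r = 0\<close> at \<open>\<mu>\<^sub>j\<close>; then \<open>\<mu>\<^sub>j\<close> is a zero of every \<open>D\<^sub>\<epsilon>\<close> and the same count
  gives \<open>\<lambda>\<^sub>j = \<epsilon> \<mu>\<^sub>j\<close> (\<open>scaled_eigenvalue_exact\<close>).

  The normalised eigenfunction is an explicit continuous function of the scaled eigenvalue alone
  (\<open>normalized_eigenfunction_form\<close>), so it converges uniformly together with its flux, hence in
  \<open>H\<^sup>1\<close>.

  For the expansions, the truncated series solves the equations up to \<open>O(\<epsilon>\<^bsup>n+1\<^esup>)\<close> and violates the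
  flux condition by the first omitted term. The Lagrange identity between it and the exact
  eigenfunction multiplies the eigenvalue error by a quantity with a nonzero limit
  (\<open>lagrange_identity\<close>, \<open>eigenvalue_expansion\<close>), which gives the eigenvalue expansion directly. On
  each half the eigenfunction minus a multiple of the truncated series then has zero data at the
  outer end and small forcing, and a Gronwall estimate bounds it (\<open>left_error\<close>, \<open>right_error\<close>).
  The multiples agree up to the same order with the projection onto \<open>y\<^sub>0\<close>, which is one multiplier
  for all \<open>n\<close> (\<open>eigenfunction_error\<close>). Comparing the weighted norms of both sides shows that the
  explicit normalising factor of the truncated series may be used as well (\<open>normalizer_error\<close>).\<close>

section \<open>First-order Sturm--Liouville systems\<close>

text \<open>The first-order form of \<open>(p u')' = f\<close>: the second component \<open>v\<close> is the flux \<open>p u'\<close>. The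
  right-hand side \<open>f\<close> is an arbitrary function of the point, so that homogeneous, inhomogeneous
  and perturbed equations are all instances and linear combinations stay within the notion.\<close>

definition sl_sys ::
  "(real \<Rightarrow> real) \<Rightarrow> real set \<Rightarrow> (real \<Rightarrow> real) \<Rightarrow> (real \<Rightarrow> real) \<Rightarrow> (real \<Rightarrow> real) \<Rightarrow> bool" where
  "sl_sys p S f u v \<longleftrightarrow>
     (\<forall>x\<in>S. (u has_real_derivative v x / p x) (at x within S) \<and>
             (v has_real_derivative f x) (at x within S))"

lemma DERIV_transform_on:
  assumes "(f has_real_derivative D) (at x within S)" "x \<in> S" "\<And>y. y \<in> S \<Longrightarrow> f y = g y"
  shows "(g has_real_derivative D) (at x within S)"
  using has_derivative_transform[of x S g f] assms by (simp add: has_field_derivative_def)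

lemma integral_nonneg_any:
  fixes f :: "real \<Rightarrow> real"
  assumes "\<And>x. x \<in> S \<Longrightarrow> 0 \<le> f x"
  shows "0 \<le> integral S f"
  using assms by (cases "f integrable_on S") (auto intro: integral_nonneg simp: not_integrable_integral)

lemma sl_sys_cong:
  assumes "sl_sys p S f u v" "\<And>x. x \<in> S \<Longrightarrow> f x = g x"
    "\<And>x. x \<in> S \<Longrightarrow> u x = u' x" "\<And>x. x \<in> S \<Longrightarrow> v x = v' x"
  shows "sl_sys p S g u' v'"
  unfolding sl_sys_def
proof (intro ballI conjI)
  fix x assume x: "x \<in> S"
  have "(u has_real_derivative v x / p x) (at x within S)"
       "(v has_real_derivative f x) (at x within S)"
    using assms(1) x by (auto simp: sl_sys_def)
  then show "(u' has_real_derivative v' x / p x) (at x within S)"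
       "(v' has_real_derivative g x) (at x within S)"
    using assms(2-4) x DERIV_transform_on by (metis (no_types, lifting))+
qed

lemma sl_sys_lincomb:
  assumes "sl_sys p S f u v" "sl_sys p S g U V"
  shows "sl_sys p S (\<lambda>x. s * f x + t * g x) (\<lambda>x. s * u x + t * U x) (\<lambda>x. s * v x + t * V x)"
  using assms unfolding sl_sys_def
  by (auto intro!: derivative_eq_intros simp: add_divide_distrib mult.commute)

lemma sl_sys_scale:
  assumes "sl_sys p S f u v"
  shows "sl_sys p S (\<lambda>x. s * f x) (\<lambda>x. s * u x) (\<lambda>x. s * v x)"
  using sl_sys_lincomb[OF assms assms, of s 0] by simp

text \<open>Differentiating \<open>u V - U v\<close>, the terms \<open>v V / p\<close> cancel. Every use of self-adjointness below is
  this identity, integrated.\<close>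

lemma sl_sys_wronskian:
  assumes "sl_sys p S f u v" "sl_sys p S g U V" "x \<in> S"
  shows "((\<lambda>x. u x * V x - U x * v x) has_real_derivative u x * g x - U x * f x) (at x within S)"
  using assms unfolding sl_sys_def
  by (auto intro!: derivative_eq_intros simp: field_simps)

lemma sl_sys_continuous:
  assumes "sl_sys p S f u v"
  shows "continuous_on S u" "continuous_on S v"
  using assms unfolding sl_sys_def by (auto intro!: DERIV_continuous_on)

text \<open>The right half-interval carries its Dirichlet condition at the right end. Reflection turns it
  into a problem with the condition at the left end, so that one theory of initial values serves
  both halves.\<close>

lemma sl_sys_reflect:
  assumes "sl_sys p {c..d} f u v"
  shows "sl_sys (\<lambda>x. p (- x)) {-d..-c} (\<lambda>x. f (- x)) (\<lambda>x. u (- x)) (\<lambda>x. - v (- x))"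
  unfolding sl_sys_def
proof (intro ballI conjI)
  fix x assume x: "x \<in> {-d..-c}"
  have im: "uminus ` {-d..-c} = {c..d}" by simp
  have "(u has_real_derivative v (-x) / p (-x)) (at (-x) within {c..d})"
       "(v has_real_derivative f (-x)) (at (-x) within {c..d})"
    using assms x by (auto simp: sl_sys_def)
  then have "((u \<circ> uminus) has_real_derivative v (-x) / p (-x) * (-1)) (at x within {-d..-c})"
       "((v \<circ> uminus) has_real_derivative f (-x) * (-1)) (at x within {-d..-c})"
    by (auto intro!: DERIV_image_chain derivative_intros simp only: im)
  then show "((\<lambda>x. u (- x)) has_real_derivative - v (- x) / p (- x)) (at x within {-d..-c})"
       "((\<lambda>x. - v (- x)) has_real_derivative f (- x)) (at x within {-d..-c})"
    by (auto intro!: derivative_eq_intros simp: o_def)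
qed

text \<open>A Gronwall argument: with \<open>E = u\<^sup>2 + v\<^sup>2\<close> the bounds on \<open>1 / p\<close> and \<open>f\<close> give
  \<open>E' \<le> (P + Q + 1) E + G\<^sup>2\<close>, hence \<open>exp (- (P + Q + 1) (x - c)) E - G\<^sup>2 (x - c)\<close> decreases.\<close>

lemma sl_sys_energy_bound:
  assumes s: "sl_sys p {c..d} f u v"
    and P: "\<And>x. x \<in> {c..d} \<Longrightarrow> \<bar>1 / p x\<bar> \<le> P"
    and Q: "\<And>x. x \<in> {c..d} \<Longrightarrow> \<bar>f x\<bar> \<le> Q * \<bar>u x\<bar> + G" and "0 \<le> P" "0 \<le> Q" "0 \<le> G"
    and x: "x \<in> {c..d}"
  shows "(u x)\<^sup>2 + (v x)\<^sup>2 \<le> exp ((P + Q + 1) * (d - c)) * ((u c)\<^sup>2 + (v c)\<^sup>2 + G\<^sup>2 * (d - c))"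
proof -
  let ?K = "P + Q + 1"
  define E where "E = (\<lambda>x. (u x)\<^sup>2 + (v x)\<^sup>2)"
  define E' where "E' = (\<lambda>x. 2 * u x * (v x / p x) + 2 * v x * f x)"
  have dE: "(E has_real_derivative E' x) (at x within {c..d})" if "x \<in> {c..d}" for x
    using s that unfolding sl_sys_def E_def E'_def
    by (auto intro!: derivative_eq_intros)
  have E'le: "E' x \<le> ?K * E x + G\<^sup>2" if x: "x \<in> {c..d}" for x
  proof -
    have "u x * v x * (1 / p x) \<le> \<bar>u x * v x\<bar> * \<bar>1 / p x\<bar>"
      by (simp only: abs_mult[symmetric] abs_ge_self)
    also have "\<dots> \<le> \<bar>u x * v x\<bar> * P" using P[OF x] by (intro mult_left_mono) auto
    finally have "u x * v x * (1 / p x) \<le> \<bar>u x * v x\<bar> * P" .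
    moreover have "v x * f x \<le> \<bar>v x\<bar> * \<bar>f x\<bar>"
      by (simp only: abs_mult[symmetric] abs_ge_self)
    then have "v x * f x \<le> \<bar>v x\<bar> * (Q * \<bar>u x\<bar> + G)"
      using mult_left_mono[OF Q[OF x], of "\<bar>v x\<bar>"] by simp
    ultimately have "2 * (u x * v x * (1 / p x)) + 2 * (v x * f x) \<le>
        2 * (\<bar>u x * v x\<bar> * P) + 2 * (\<bar>v x\<bar> * (Q * \<bar>u x\<bar> + G))" by linarith
    then have "E' x \<le> (P + Q) * (2 * \<bar>u x\<bar> * \<bar>v x\<bar>) + 2 * \<bar>v x\<bar> * G"
      unfolding E'_def by (simp add: algebra_simps abs_mult)
    moreover have "2 * \<bar>u x\<bar> * \<bar>v x\<bar> \<le> E x"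
      using sum_squares_bound[of "\<bar>u x\<bar>" "\<bar>v x\<bar>"] by (simp add: E_def)
    moreover have "2 * \<bar>v x\<bar> * G \<le> E x + G\<^sup>2"
      using sum_squares_bound[of "\<bar>v x\<bar>" G] zero_le_power2[of "u x"]
      unfolding E_def power2_abs by linarith
    moreover have "(P + Q) * (2 * \<bar>u x\<bar> * \<bar>v x\<bar>) \<le> (P + Q) * E x"
      using calculation(2) assms by (intro mult_left_mono) auto
    ultimately show ?thesis by (simp add: algebra_simps)
  qed
  define F where "F = (\<lambda>x. exp (- ?K * (x - c)) * E x - G\<^sup>2 * (x - c))"
  have "F x \<le> F c"
  proof (rule DERIV_nonpos_imp_decreasing_open[where f = F])
    show "c \<le> x" using x by simp
    show "continuous_on {c..x} F"
    proof -
      have "continuous_on {c..d} E" using dE by (blast intro: DERIV_continuous_on)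
      then have "continuous_on {c..x} E" using x by (auto intro: continuous_on_subset)
      then show ?thesis unfolding F_def by (intro continuous_intros)
    qed
    fix t assume t: "c < t" "t < x"
    then have td: "t \<in> {c..d}" using x by auto
    have at: "at t within {c..d} = at t" using t x by (intro at_within_interior) auto
    have "(F has_real_derivative exp (- ?K * (t - c)) * (E' t - ?K * E t) - G\<^sup>2) (at t)"
      unfolding F_def using dE[OF td] unfolding at
      by (auto intro!: derivative_eq_intros simp: algebra_simps)
    moreover have "exp (- ?K * (t - c)) * (E' t - ?K * E t) \<le> G\<^sup>2"
    proof -
      have "exp (- ?K * (t - c)) * (E' t - ?K * E t) \<le> exp (- ?K * (t - c)) * G\<^sup>2"
        using E'le[OF td] by (intro mult_left_mono) auto
      also have "\<dots> \<le> 1 * G\<^sup>2"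
      proof (intro mult_right_mono)
        have "0 \<le> ?K * (t - c)" using assms t by (intro mult_nonneg_nonneg) auto
        then show "exp (- ?K * (t - c)) \<le> 1" by (simp only: exp_le_one_iff mult_minus_left neg_le_0_iff_le)
      qed auto
      finally show ?thesis by simp
    qed
    ultimately show "\<exists>y. (F has_real_derivative y) (at t) \<and> y \<le> 0" by force
  qed
  then have "exp (- ?K * (x - c)) * E x \<le> E c + G\<^sup>2 * (x - c)" by (simp add: F_def)
  also have "\<dots> \<le> E c + G\<^sup>2 * (d - c)" using x by (intro add_left_mono mult_left_mono) auto
  finally have *: "exp (- ?K * (x - c)) * E x \<le> E c + G\<^sup>2 * (d - c)" .
  have "E x = exp (?K * (x - c)) * (exp (- ?K * (x - c)) * E x)"
    by (simp only: mult.assoc[symmetric] exp_add[symmetric] mult_minus_left) simp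
  also have "\<dots> \<le> exp (?K * (x - c)) * (E c + G\<^sup>2 * (d - c))"
    using * by (intro mult_left_mono) auto
  also have "\<dots> \<le> exp (?K * (d - c)) * (E c + G\<^sup>2 * (d - c))"
    using assms by (intro mult_right_mono) (auto simp: E_def intro!: mult_left_mono add_nonneg_nonneg)
  finally show ?thesis by (simp add: E_def)
qed

text \<open>The constant is a parameter that depends only on \<open>p\<close>, \<open>Q\<close> and the interval. It is independent of
  the solution and of the forcing \<open>G\<close>, which is what the estimates uniform in \<open>\<epsilon>\<close> require. The
  data may be prescribed at either end \<open>e\<close>.\<close>

definition apriori_const :: "real \<Rightarrow> real \<Rightarrow> (real \<Rightarrow> real) \<Rightarrow> real \<Rightarrow> real \<Rightarrow> bool" where
  "apriori_const c d p Q C \<longleftrightarrow>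
     (\<forall>f u v G e. sl_sys p {c..d} f u v \<longrightarrow> e = c \<or> e = d \<longrightarrow> 0 \<le> G \<longrightarrow>
        (\<forall>x\<in>{c..d}. \<bar>f x\<bar> \<le> Q * \<bar>u x\<bar> + G) \<longrightarrow>
        (\<forall>x\<in>{c..d}. \<bar>u x\<bar> \<le> C * (\<bar>u e\<bar> + \<bar>v e\<bar> + G) \<and> \<bar>v x\<bar> \<le> C * (\<bar>u e\<bar> + \<bar>v e\<bar> + G)))"

lemma apriori_constD:
  assumes "apriori_const c d p Q C" "sl_sys p {c..d} f u v" "e = c \<or> e = d" "0 \<le> G"
    "\<And>x. x \<in> {c..d} \<Longrightarrow> \<bar>f x\<bar> \<le> Q * \<bar>u x\<bar> + G" "x \<in> {c..d}"
  shows "\<bar>u x\<bar> \<le> C * (\<bar>u e\<bar> + \<bar>v e\<bar> + G)" "\<bar>v x\<bar> \<le> C * (\<bar>u e\<bar> + \<bar>v e\<bar> + G)"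
proof -
  have "\<forall>x\<in>{c..d}. \<bar>f x\<bar> \<le> Q * \<bar>u x\<bar> + G" using assms(5) by blast
  from assms(1)[unfolded apriori_const_def, THEN spec, THEN spec, THEN spec, THEN spec, THEN spec,
      THEN mp, OF assms(2), THEN mp, OF assms(3), THEN mp, OF assms(4), THEN mp, OF this]
  show "\<bar>u x\<bar> \<le> C * (\<bar>u e\<bar> + \<bar>v e\<bar> + G)" "\<bar>v x\<bar> \<le> C * (\<bar>u e\<bar> + \<bar>v e\<bar> + G)"
    using assms(6) by auto
qed

text \<open>Data at the left end: the energy bound. Data at the right end: the energy bound of the reflected
  system.\<close>

lemma sl_sys_apriori:
  fixes p :: "real \<Rightarrow> real"
  assumes cd: "c < d" and contp: "continuous_on {c..d} p"
    and ppos: "\<And>x. x \<in> {c..d} \<Longrightarrow> p x > 0" and "0 \<le> Q"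
  obtains C where "C > 0" "apriori_const c d p Q C"
proof -
  have "continuous_on {c..d} (\<lambda>x. 1 / p x)"
    using contp ppos by (intro continuous_intros) force+
  then have "bounded ((\<lambda>x. 1 / p x) ` {c..d})"
    by (intro compact_imp_bounded compact_continuous_image) auto
  then obtain P where P: "P > 0" "\<And>x. x \<in> {c..d} \<Longrightarrow> \<bar>1 / p x\<bar> \<le> P"
    unfolding bounded_pos by auto
  define K where "K = exp ((P + Q + 1) * (d - c)) * (1 + (d - c))"
  define C where "C = 1 + K"
  have K: "0 < K" using cd by (auto simp: K_def intro!: mult_pos_pos)
  have main: "\<bar>u x\<bar> \<le> C * (\<bar>u e\<bar> + \<bar>v e\<bar> + G) \<and> \<bar>v x\<bar> \<le> C * (\<bar>u e\<bar> + \<bar>v e\<bar> + G)"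
    if s: "sl_sys p {c..d} f u v" and e: "e = c \<or> e = d" and G: "0 \<le> G"
      and Q: "\<And>x. x \<in> {c..d} \<Longrightarrow> \<bar>f x\<bar> \<le> Q * \<bar>u x\<bar> + G" and x: "x \<in> {c..d}" for f u v G e x
  proof -
    have "(u x)\<^sup>2 + (v x)\<^sup>2 \<le> exp ((P + Q + 1) * (d - c)) * ((u e)\<^sup>2 + (v e)\<^sup>2 + G\<^sup>2 * (d - c))"
      using e
    proof
      assume "e = c" then show ?thesis
        using sl_sys_energy_bound[OF s P(2) Q _ _ G x] P(1) \<open>0 \<le> Q\<close> by simp
    next
      assume "e = d"
      have "(u (-(-x)))\<^sup>2 + (- v (- (-x)))\<^sup>2 \<le> exp ((P + Q + 1) * (- c - (- d))) *
         ((u (- (- d)))\<^sup>2 + (- v (- (- d)))\<^sup>2 + G\<^sup>2 * (- c - (- d)))"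
        by (rule sl_sys_energy_bound[OF sl_sys_reflect[OF s]])
           (use P Q G x \<open>0 \<le> Q\<close> in auto)
      then show ?thesis by (simp add: \<open>e = d\<close>)
    qed
    also have "\<dots> \<le> exp ((P + Q + 1) * (d - c)) * ((1 + (d - c)) * (\<bar>u e\<bar> + \<bar>v e\<bar> + G)\<^sup>2)"
    proof (intro mult_left_mono)
      have a: "(u e)\<^sup>2 + (v e)\<^sup>2 + G\<^sup>2 \<le> (\<bar>u e\<bar> + \<bar>v e\<bar> + G)\<^sup>2"
        using G by (simp add: power2_eq_square algebra_simps)
      have "(u e)\<^sup>2 + (v e)\<^sup>2 + G\<^sup>2 * (d - c) \<le> (1 + (d - c)) * ((u e)\<^sup>2 + (v e)\<^sup>2 + G\<^sup>2)"
      proof -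
        have "0 \<le> (d - c) * ((u e)\<^sup>2 + (v e)\<^sup>2)" "0 \<le> G\<^sup>2" using cd by auto
        then show ?thesis by (simp only: distrib_right distrib_left mult_1 mult.commute)
      qed
      also have "\<dots> \<le> (1 + (d - c)) * (\<bar>u e\<bar> + \<bar>v e\<bar> + G)\<^sup>2"
        using a cd by (intro mult_left_mono) auto
      finally show "(u e)\<^sup>2 + (v e)\<^sup>2 + G\<^sup>2 * (d - c) \<le> (1 + (d - c)) * (\<bar>u e\<bar> + \<bar>v e\<bar> + G)\<^sup>2" .
    qed auto
    also have "\<dots> = K * (\<bar>u e\<bar> + \<bar>v e\<bar> + G)\<^sup>2" by (simp add: K_def)
    also have "\<dots> \<le> (C * (\<bar>u e\<bar> + \<bar>v e\<bar> + G))\<^sup>2"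
    proof -
      have "K \<le> C\<^sup>2" using K by (simp add: C_def power2_eq_square algebra_simps)
      then show ?thesis by (simp add: power_mult_distrib mult_right_mono)
    qed
    finally have *: "(u x)\<^sup>2 + (v x)\<^sup>2 \<le> (C * (\<bar>u e\<bar> + \<bar>v e\<bar> + G))\<^sup>2" .
    have pos: "0 \<le> C * (\<bar>u e\<bar> + \<bar>v e\<bar> + G)" using K G by (simp add: C_def)
    from * have "\<bar>u x\<bar>\<^sup>2 \<le> (C * (\<bar>u e\<bar> + \<bar>v e\<bar> + G))\<^sup>2" "\<bar>v x\<bar>\<^sup>2 \<le> (C * (\<bar>u e\<bar> + \<bar>v e\<bar> + G))\<^sup>2"
      unfolding power2_abs using zero_le_power2[of "u x"] zero_le_power2[of "v x"] by linarith+
    then show ?thesis by (intro conjI power2_le_imp_le[OF _ pos])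
  qed
  have "C > 0" using K by (simp add: C_def)
  moreover have "apriori_const c d p Q C"
    unfolding apriori_const_def
  proof (intro allI impI ballI, goal_cases)
    case (1 f u v G e x)
    from bspec[OF 1(4)] have le: "\<And>y. y \<in> {c..d} \<Longrightarrow> \<bar>f y\<bar> \<le> Q * \<bar>u y\<bar> + G" .
    show ?case
      by (rule main[where f = f and u = u and v = v and e = e and G = G and x = x, OF 1(1-3) le 1(5)])
  qed
  ultimately show thesis by (rule that)
qed

section \<open>Power series in the spectral parameter\<close>

locale sl_interval =
  fixes c d :: real and p q :: "real \<Rightarrow> real"
  assumes cd: "c < d"
    and contp: "continuous_on {c..d} p" and contq: "continuous_on {c..d} q"
    and ppos: "\<And>x. x \<in> {c..d} \<Longrightarrow> p x > 0" and qpos: "\<And>x. x \<in> {c..d} \<Longrightarrow> q x > 0"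
begin

lemma bounds:
  obtains P Q where "P > 0" "Q > 0" "\<And>x. x \<in> {c..d} \<Longrightarrow> 1 / p x \<le> P" "\<And>x. x \<in> {c..d} \<Longrightarrow> q x \<le> Q"
proof -
  have "continuous_on {c..d} (\<lambda>x. 1 / p x)"
    using contp ppos by (intro continuous_intros) force+
  then have "bounded ((\<lambda>x. 1 / p x) ` {c..d})" "bounded (q ` {c..d})"
    using contq by (auto intro!: compact_imp_bounded compact_continuous_image)
  then obtain P Q where "P > 0" "\<And>x. x \<in> {c..d} \<Longrightarrow> \<bar>1 / p x\<bar> \<le> P"
     "Q > 0" "\<And>x. x \<in> {c..d} \<Longrightarrow> \<bar>q x\<bar> \<le> Q"
    unfolding bounded_pos by auto
  then show thesis by (intro that[of P Q]) (force simp: abs_le_iff simp del: abs_divide)+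
qed

text \<open>Formally expanding a solution of \<open>u' = v / p\<close>, \<open>v' = h' - \<Lambda> q u\<close>, \<open>u c = 0\<close>, \<open>v c = h c\<close> in
  powers of \<open>- \<Lambda>\<close> gives coefficients \<open>phi\<close> (of \<open>u\<close>) and \<open>psi\<close> (of \<open>v\<close>), each a weighted integral
  of the previous one. The function \<open>h\<close> is \<open>1\<close> for the fundamental solution and a primitive of the
  forcing for the inhomogeneous equation.\<close>

primrec psi :: "(real \<Rightarrow> real) \<Rightarrow> nat \<Rightarrow> real \<Rightarrow> real" where
  "psi h 0 = h"
| "psi h (Suc n) = (\<lambda>x. integral {c..x} (\<lambda>t. q t * integral {c..t} (\<lambda>s. psi h n s / p s)))"

definition phi :: "(real \<Rightarrow> real) \<Rightarrow> nat \<Rightarrow> real \<Rightarrow> real" where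
  "phi h n x = integral {c..x} (\<lambda>s. psi h n s / p s)"

lemma psi_Suc: "psi h (Suc n) x = integral {c..x} (\<lambda>t. q t * phi h n t)"
  by (simp add: phi_def)

lemma phi_deriv_aux:
  assumes "continuous_on {c..d} (psi h n)" "x \<in> {c..d}"
  shows "(phi h n has_real_derivative psi h n x / p x) (at x within {c..d})"
  unfolding phi_def
  by (rule integral_has_real_derivative)
     (use assms contp ppos in \<open>auto intro!: continuous_intros simp: less_imp_neq[THEN not_sym]\<close>)

lemma psi_deriv_aux:
  assumes "continuous_on {c..d} (phi h n)" "x \<in> {c..d}"
  shows "(psi h (Suc n) has_real_derivative q x * phi h n x) (at x within {c..d})"
  unfolding psi.simps(2) phi_def[symmetric]
  by (rule integral_has_real_derivative) (use assms contq in \<open>auto intro!: continuous_intros\<close>)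

lemma psi_continuous: "continuous_on {c..d} h \<Longrightarrow> continuous_on {c..d} (psi h n)"
proof (induction n)
  case (Suc n)
  then have "continuous_on {c..d} (phi h n)"
    by (intro DERIV_continuous_on[OF phi_deriv_aux]) auto
  then show ?case by (intro DERIV_continuous_on[OF psi_deriv_aux]) auto
qed simp

lemma phi_continuous: "continuous_on {c..d} h \<Longrightarrow> continuous_on {c..d} (phi h n)"
  by (intro DERIV_continuous_on[OF phi_deriv_aux] psi_continuous)

text \<open>All weights are positive, so positivity passes through the iterated integrals; for \<open>\<Lambda> \<le> 0\<close> the
  series then has nonnegative terms only.\<close>

lemma psi_phi_nonneg:
  assumes h: "continuous_on {c..d} h" and "\<And>x. x \<in> {c..d} \<Longrightarrow> h x \<ge> 0"
  shows "x \<in> {c..d} \<Longrightarrow> psi h n x \<ge> 0 \<and> phi h n x \<ge> 0"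
proof (induction n arbitrary: x)
  have phi: "phi h n x \<ge> 0" if "\<And>x. x \<in> {c..d} \<Longrightarrow> psi h n x \<ge> 0" "x \<in> {c..d}" for n x
    unfolding phi_def
    using that ppos by (intro integral_nonneg_any divide_nonneg_pos) auto
  {
    case 0
    then show ?case using assms phi[of 0] by auto
  next
    case (Suc n)
    have psi: "psi h (Suc n) x \<ge> 0" if "x \<in> {c..d}" for x
      unfolding psi_Suc
      using that Suc.IH qpos by (intro integral_nonneg_any) (auto intro!: mult_nonneg_nonneg simp: less_imp_le)
    then show ?case using phi[of "Suc n"] Suc.prems by blast
  }
qed

text \<open>Each step from \<open>psi n\<close> to \<open>psi (n + 1)\<close> integrates once more over \<open>{c..x}\<close>, which produces the
  factor \<open>(x - c) / (n + 1)\<close>. The resulting factorials make the series entire in \<open>\<Lambda>\<close>.\<close>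

lemma psi_phi_bound:
  assumes h: "continuous_on {c..d} h" and H: "\<And>x. x \<in> {c..d} \<Longrightarrow> \<bar>h x\<bar> \<le> H"
  obtains A C where "A \<ge> 0" "C \<ge> 0"
    "\<And>n x. x \<in> {c..d} \<Longrightarrow> \<bar>psi h n x\<bar> \<le> H * (C ^ n / fact n)"
    "\<And>n x. x \<in> {c..d} \<Longrightarrow> \<bar>phi h n x\<bar> \<le> A * (C ^ n / fact n)"
proof -
  obtain P Q where PQ: "P > 0" "Q > 0" "\<And>x. x \<in> {c..d} \<Longrightarrow> 1 / p x \<le> P" "\<And>x. x \<in> {c..d} \<Longrightarrow> q x \<le> Q"
    by (rule bounds) (rule that; assumption)
  have H0: "H \<ge> 0" using H[of c] cd by auto
  define B where "B = P * (d - c)"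
  define D where "D = Q * B"
  have B: "B > 0" "D > 0" using PQ cd by (auto simp: B_def D_def)
  \<comment> \<open>The inner integral is estimated crudely by the length \<open>d - c\<close>; only the outer one must
    contribute to the factorial.\<close>
  have phib: "\<bar>phi h n x\<bar> \<le> B * H * (D ^ n * (x - c) ^ n / fact n)"
    if psib: "\<And>x. x \<in> {c..d} \<Longrightarrow> \<bar>psi h n x\<bar> \<le> H * (D ^ n * (x - c) ^ n / fact n)" and x: "x \<in> {c..d}" for n x
  proof -
    have "norm (phi h n x) \<le> (P * (H * (D ^ n * (x - c) ^ n / fact n))) * (x - c)"
      unfolding phi_def
    proof (rule integral_bound)
      show "c \<le> x" using x by simp
      show "continuous_on {c..x} (\<lambda>s. psi h n s / p s)"
        using continuous_on_subset[OF psi_continuous[OF h], of "{c..x}"]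
          continuous_on_subset[OF contp, of "{c..x}"] ppos x
        by (intro continuous_intros) (auto simp: less_imp_neq[THEN not_sym])
      fix t assume t: "t \<in> {c..x}"
      then have td: "t \<in> {c..d}" using x by auto
      have "\<bar>psi h n t / p t\<bar> = \<bar>psi h n t\<bar> * (1 / p t)" using ppos[OF td] by (simp add: abs_divide)
      also have "\<dots> \<le> (H * (D ^ n * (t - c) ^ n / fact n)) * P"
        using psib[OF td] PQ(3)[OF td] ppos[OF td] H0 B t by (intro mult_mono) auto
      also have "\<dots> \<le> (H * (D ^ n * (x - c) ^ n / fact n)) * P"
        using PQ(1) H0 B t by (intro mult_right_mono mult_left_mono divide_right_mono power_mono) auto
      finally show "norm (psi h n t / p t) \<le> P * (H * (D ^ n * (x - c) ^ n / fact n))"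
        by (simp add: mult.commute)
    qed
    also have "\<dots> \<le> (P * (H * (D ^ n * (x - c) ^ n / fact n))) * (d - c)"
      using x PQ H0 B by (intro mult_left_mono) auto
    finally show ?thesis by (simp add: B_def mult_ac)
  qed
  have psib: "\<bar>psi h n x\<bar> \<le> H * (D ^ n * (x - c) ^ n / fact n)" if "x \<in> {c..d}" for n x
    using that
  proof (induction n arbitrary: x)
    case 0 then show ?case using H by simp
  next
    case (Suc n)
    have x: "c \<le> x" "x \<le> d" using Suc.prems by auto
    define g where "g = (\<lambda>t. Q * (B * H * (D ^ n * (t - c) ^ n / fact n)))"
    have gi: "(g has_integral H * (D ^ Suc n * (x - c) ^ Suc n / fact (Suc n)) - H * (D ^ Suc n * (c - c) ^ Suc n / fact (Suc n))) {c..x}"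
    proof (rule fundamental_theorem_of_calculus[OF x(1)])
      fix t
      have "((\<lambda>t. H * (D ^ Suc n * (t - c) ^ Suc n / fact (Suc n))) has_real_derivative g t) (at t within {c..x})"
        unfolding g_def D_def
        by (rule derivative_eq_intros refl | simp)+
      then show "((\<lambda>t. H * (D ^ Suc n * (t - c) ^ Suc n / fact (Suc n))) has_vector_derivative g t) (at t within {c..x})"
        by (simp add: has_real_derivative_iff_has_vector_derivative)
    qed
    have "norm (psi h (Suc n) x) \<le> integral {c..x} g"
      unfolding psi_Suc
    proof (rule integral_norm_bound_integral)
      show "(\<lambda>t. q t * phi h n t) integrable_on {c..x}"
        using continuous_on_subset[OF phi_continuous[OF h], of "{c..x}"] continuous_on_subset[OF contq, of "{c..x}"] x
        by (intro integrable_continuous_interval continuous_intros) auto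
      show "g integrable_on {c..x}" using gi by blast
      fix t assume t: "t \<in> {c..x}"
      then have td: "t \<in> {c..d}" using x by auto
      have "\<bar>q t\<bar> * \<bar>phi h n t\<bar> \<le> Q * (B * H * (D ^ n * (t - c) ^ n / fact n))"
        using phib[OF Suc.IH td] PQ(4)[OF td] qpos[OF td] PQ(2) by (intro mult_mono) auto
      then show "norm (q t * phi h n t) \<le> g t" by (simp add: g_def abs_mult)
    qed
    also have "\<dots> = H * (D ^ Suc n * (x - c) ^ Suc n / fact (Suc n))"
      using gi by (simp add: integral_unique)
    finally show ?case by simp
  qed
  have le: "D ^ n * (x - c) ^ n / fact n \<le> (D * (d - c)) ^ n / fact n" if "x \<in> {c..d}" for n x
    using that B by (auto simp: power_mult_distrib intro!: divide_right_mono mult_left_mono power_mono)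
  show thesis
  proof (rule that[of "B * H" "D * (d - c)"])
    show "0 \<le> B * H" "0 \<le> D * (d - c)" using B H0 cd by auto
    fix n x assume x: "x \<in> {c..d}"
    have "H * (D ^ n * (x - c) ^ n / fact n) \<le> H * ((D * (d - c)) ^ n / fact n)"
      by (intro mult_left_mono le x H0)
    then show "\<bar>psi h n x\<bar> \<le> H * ((D * (d - c)) ^ n / fact n)"
      using psib[OF x, of n] by linarith
    have "B * H * (D ^ n * (x - c) ^ n / fact n) \<le> B * H * ((D * (d - c)) ^ n / fact n)"
      by (intro mult_left_mono le x) (use B H0 in auto)
    then show "\<bar>phi h n x\<bar> \<le> B * H * ((D * (d - c)) ^ n / fact n)"
      using phib[OF psib x, of n] by linarith
  qed
qed

definition usol :: "(real \<Rightarrow> real) \<Rightarrow> real \<Rightarrow> real \<Rightarrow> real" where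
  "usol h \<Lambda> x = (\<Sum>n. (-1) ^ n * phi h n x * \<Lambda> ^ n)"

definition vsol :: "(real \<Rightarrow> real) \<Rightarrow> real \<Rightarrow> real \<Rightarrow> real" where
  "vsol h \<Lambda> x = (\<Sum>n. (-1) ^ n * psi h n x * \<Lambda> ^ n)"

lemma exp_weierstrass_bound:
  fixes f :: "nat \<Rightarrow> real"
  assumes "\<And>n. \<bar>f n\<bar> \<le> A * (C ^ n / fact n)"
  shows "\<bar>(-1) ^ n * f n * \<Lambda> ^ n\<bar> \<le> A * ((C * \<bar>\<Lambda>\<bar>) ^ n / fact n)"
proof -
  have "\<bar>(-1) ^ n * f n * \<Lambda> ^ n\<bar> = \<bar>f n\<bar> * \<bar>\<Lambda>\<bar> ^ n"
    by (subst abs_mult, subst abs_mult) (simp add: power_abs)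
  also have "\<dots> \<le> (A * (C ^ n / fact n)) * \<bar>\<Lambda>\<bar> ^ n" by (intro mult_right_mono assms) auto
  finally show ?thesis by (simp add: power_mult_distrib)
qed

lemma summable_exp_like: "summable (\<lambda>n. A * ((C::real) ^ n / fact n))"
  using summable_exp[of C] by (intro summable_mult) (simp add: divide_inverse mult.commute)

context
  fixes h :: "real \<Rightarrow> real" assumes h: "continuous_on {c..d} h"
begin

lemma psi_phi_exp_bound:
  obtains A C where "A \<ge> 0" "C \<ge> 0"
    "\<And>n x. x \<in> {c..d} \<Longrightarrow> \<bar>psi h n x\<bar> \<le> A * (C ^ n / fact n)"
    "\<And>n x. x \<in> {c..d} \<Longrightarrow> \<bar>phi h n x\<bar> \<le> A * (C ^ n / fact n)"
proof -
  have "bounded (h ` {c..d})" using h by (intro compact_imp_bounded compact_continuous_image) auto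
  then obtain H where H: "H > 0" "\<And>x. x \<in> {c..d} \<Longrightarrow> \<bar>h x\<bar> \<le> H" unfolding bounded_pos by auto
  obtain A C where AC: "A \<ge> 0" "C \<ge> 0"
    "\<And>n x. x \<in> {c..d} \<Longrightarrow> \<bar>psi h n x\<bar> \<le> H * (C ^ n / fact n)"
    "\<And>n x. x \<in> {c..d} \<Longrightarrow> \<bar>phi h n x\<bar> \<le> A * (C ^ n / fact n)" proof (rule psi_phi_bound[OF h H(2)], goal_cases)
    case (2 A C) then show ?case using 2(1)[OF 2(2-5)] by blast
  qed
  have "H * (C ^ n / fact n) \<le> max A H * (C ^ n / fact n)"
       "A * (C ^ n / fact n) \<le> max A H * (C ^ n / fact n)" for n
    using AC by (intro mult_right_mono; simp)+
  note le = this
  show thesis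
    by (rule that[of "max A H" C]) (use AC in \<open>auto intro: order_trans[OF AC(3) le(1)] order_trans[OF AC(4) le(2)] simp del: times_divide_eq_right\<close>)
qed

lemma sol_summable:
  assumes "x \<in> {c..d}"
  shows "summable (\<lambda>n. (-1) ^ n * phi h n x * \<Lambda> ^ n)" "summable (\<lambda>n. (-1) ^ n * psi h n x * \<Lambda> ^ n)"
proof -
  obtain A C where "A \<ge> 0" "C \<ge> 0" and
    b: "\<And>n x. x \<in> {c..d} \<Longrightarrow> \<bar>psi h n x\<bar> \<le> A * (C ^ n / fact n)"
    "\<And>n x. x \<in> {c..d} \<Longrightarrow> \<bar>phi h n x\<bar> \<le> A * (C ^ n / fact n)" by (rule psi_phi_exp_bound) (rule that; assumption)
  show "summable (\<lambda>n. (-1) ^ n * phi h n x * \<Lambda> ^ n)" "summable (\<lambda>n. (-1) ^ n * psi h n x * \<Lambda> ^ n)"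
    using exp_weierstrass_bound[of "\<lambda>n. phi h n x", OF b(2)[OF assms]]
      exp_weierstrass_bound[of "\<lambda>n. psi h n x", OF b(1)[OF assms]]
    by (auto intro!: summable_comparison_test'[OF summable_exp_like[of A "C * \<bar>\<Lambda>\<bar>"]])
qed

lemma sol_uniform:
  "uniform_limit {c..d} (\<lambda>n x. \<Sum>i<n. (-1) ^ i * phi h i x * \<Lambda> ^ i) (usol h \<Lambda>) sequentially"
  "uniform_limit {c..d} (\<lambda>n x. \<Sum>i<n. (-1) ^ i * psi h i x * \<Lambda> ^ i) (vsol h \<Lambda>) sequentially"
proof -
  obtain A C where "A \<ge> 0" "C \<ge> 0" and
    b: "\<And>n x. x \<in> {c..d} \<Longrightarrow> \<bar>psi h n x\<bar> \<le> A * (C ^ n / fact n)"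
    "\<And>n x. x \<in> {c..d} \<Longrightarrow> \<bar>phi h n x\<bar> \<le> A * (C ^ n / fact n)" by (rule psi_phi_exp_bound) (rule that; assumption)
  show "uniform_limit {c..d} (\<lambda>n x. \<Sum>i<n. (-1) ^ i * phi h i x * \<Lambda> ^ i) (usol h \<Lambda>) sequentially"
    unfolding usol_def
    using exp_weierstrass_bound[of "\<lambda>n. phi h n x" for x, OF b(2)]
    by (intro Weierstrass_m_test[OF _ summable_exp_like[of A "C * \<bar>\<Lambda>\<bar>"]]) auto
  show "uniform_limit {c..d} (\<lambda>n x. \<Sum>i<n. (-1) ^ i * psi h i x * \<Lambda> ^ i) (vsol h \<Lambda>) sequentially"
    unfolding vsol_def
    using exp_weierstrass_bound[of "\<lambda>n. psi h n x" for x, OF b(1)]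
    by (intro Weierstrass_m_test[OF _ summable_exp_like[of A "C * \<bar>\<Lambda>\<bar>"]]) auto
qed

text \<open>Termwise differentiation: the series of derivatives is \<open>vsol / p\<close> term by term and converges
  uniformly.\<close>

lemma usol_deriv:
  assumes x: "x \<in> {c..d}"
  shows "(usol h \<Lambda> has_real_derivative vsol h \<Lambda> x / p x) (at x within {c..d})"
proof -
  obtain P Q where PQ: "P > 0" "\<And>x. x \<in> {c..d} \<Longrightarrow> 1 / p x \<le> P" using bounds by metis
  have bp: "bounded ((\<lambda>x. 1 / p x) ` {c..d})"
    unfolding bounded_iff using PQ ppos by (auto intro!: exI[of _ P] simp: less_imp_le)
  have bv: "bounded (vsol h \<Lambda> ` {c..d})"
    by (intro compact_imp_bounded compact_continuous_image
          uniform_limit_theorem[OF _ sol_uniform(2)] always_eventually allI continuous_intros psi_continuous h) auto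
  have "uniform_limit {c..d} (\<lambda>n x. (1 / p x) * (\<Sum>i<n. (-1) ^ i * psi h i x * \<Lambda> ^ i))
      (\<lambda>x. (1 / p x) * vsol h \<Lambda> x) sequentially"
    by (intro uniform_lim_mult[OF _ sol_uniform(2)] bp bv uniform_limit_const)
  then have "uniform_limit {c..d} (\<lambda>n x. \<Sum>i<n. (-1) ^ i * (psi h i x / p x) * \<Lambda> ^ i)
      (\<lambda>x. vsol h \<Lambda> x / p x) sequentially"
    by (simp add: sum_distrib_left mult_ac)
  note unif = this
  have dd: "((\<lambda>x. (-1) ^ n * phi h n x * \<Lambda> ^ n) has_real_derivative (-1) ^ n * (psi h n x / p x) * \<Lambda> ^ n)
      (at x within {c..d})" if "x \<in> {c..d}" for n x
    by (intro DERIV_cmult DERIV_cmult_right phi_deriv_aux[OF psi_continuous[OF h] that])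
  have "\<exists>g. \<forall>x\<in>{c..d}. (\<lambda>n. (- 1) ^ n * phi h n x * \<Lambda> ^ n) sums g x \<and>
      (g has_real_derivative vsol h \<Lambda> x / p x) (at x within {c..d})"
    using has_field_derivative_series[of "{c..d}" "\<lambda>n x. (- 1) ^ n * phi h n x * \<Lambda> ^ n", OF _ dd unif x]
      sol_summable(1)[OF x] by simp
  then obtain g where g: "\<forall>x\<in>{c..d}. (\<lambda>n. (- 1) ^ n * phi h n x * \<Lambda> ^ n) sums g x \<and>
      (g has_real_derivative vsol h \<Lambda> x / p x) (at x within {c..d})" by (elim exE)
  note g = bspec[OF g]
  have "g y = usol h \<Lambda> y" if "y \<in> {c..d}" for y
    using g[OF that] by (simp add: usol_def sums_iff)
  then show ?thesis using DERIV_transform_on[OF _ x, of g] g[OF x] by simp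
qed

text \<open>Termwise differentiation of the series without its first term \<open>h\<close>, which contributes the forcing
  \<open>g\<close> separately.\<close>

lemma vsol_deriv:
  assumes x: "x \<in> {c..d}" and g: "(h has_real_derivative g) (at x within {c..d})"
  shows "(vsol h \<Lambda> has_real_derivative g - \<Lambda> * q x * usol h \<Lambda> x) (at x within {c..d})"
proof -
  obtain Q where Q: "Q > 0" "\<And>x. x \<in> {c..d} \<Longrightarrow> q x \<le> Q" using bounds by metis
  have bq: "bounded ((\<lambda>x. - \<Lambda> * q x) ` {c..d})"
    using contq by (intro compact_imp_bounded compact_continuous_image continuous_intros) auto
  have bu: "bounded (usol h \<Lambda> ` {c..d})"
    by (intro compact_imp_bounded compact_continuous_image DERIV_continuous_on[OF usol_deriv]) auto
  have "uniform_limit {c..d} (\<lambda>n x. (- \<Lambda> * q x) * (\<Sum>i<n. (-1) ^ i * phi h i x * \<Lambda> ^ i))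
      (\<lambda>x. (- \<Lambda> * q x) * usol h \<Lambda> x) sequentially"
    by (intro uniform_lim_mult[OF _ sol_uniform(1)] bq bu uniform_limit_const)
  then have "uniform_limit {c..d} (\<lambda>n x. \<Sum>i<n. (-1) ^ Suc i * (q x * phi h i x) * \<Lambda> ^ Suc i)
      (\<lambda>x. - \<Lambda> * q x * usol h \<Lambda> x) sequentially"
    by (simp add: sum_distrib_left mult_ac)
  note unif = this
  have dd: "((\<lambda>x. (-1) ^ Suc n * psi h (Suc n) x * \<Lambda> ^ Suc n) has_real_derivative
      (-1) ^ Suc n * (q x * phi h n x) * \<Lambda> ^ Suc n) (at x within {c..d})" if "x \<in> {c..d}" for n x
    by (intro DERIV_cmult DERIV_cmult_right psi_deriv_aux[OF phi_continuous[OF h] that])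
  have "\<exists>G. \<forall>x\<in>{c..d}. (\<lambda>n. (-1) ^ Suc n * psi h (Suc n) x * \<Lambda> ^ Suc n) sums G x \<and>
      (G has_real_derivative - \<Lambda> * q x * usol h \<Lambda> x) (at x within {c..d})"
    using has_field_derivative_series[of "{c..d}" "\<lambda>n x. (-1) ^ Suc n * psi h (Suc n) x * \<Lambda> ^ Suc n", OF _ dd unif x]
      summable_Suc_iff[THEN iffD2, OF sol_summable(2)[OF x, of \<Lambda>]] by (simp del: psi.simps power_Suc)
  then obtain G where G: "\<forall>x\<in>{c..d}. (\<lambda>n. (-1) ^ Suc n * psi h (Suc n) x * \<Lambda> ^ Suc n) sums G x \<and>
      (G has_real_derivative - \<Lambda> * q x * usol h \<Lambda> x) (at x within {c..d})" by (elim exE)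
  note G = bspec[OF G]
  have eq: "G y + h y = vsol h \<Lambda> y" if "y \<in> {c..d}" for y
  proof -
    have "(\<lambda>n. (-1) ^ n * psi h n y * \<Lambda> ^ n) sums (G y + (-1) ^ 0 * psi h 0 y * \<Lambda> ^ 0)"
      using G[OF that] by (subst sums_Suc_iff[symmetric]) blast
    then show ?thesis by (simp add: vsol_def sums_iff)
  qed
  have "((\<lambda>y. G y + h y) has_real_derivative - \<Lambda> * q x * usol h \<Lambda> x + g) (at x within {c..d})"
    using G[OF x] g by (auto intro!: derivative_eq_intros)
  then have "((\<lambda>y. G y + h y) has_real_derivative g - \<Lambda> * q x * usol h \<Lambda> x) (at x within {c..d})"
    by simp
  then show ?thesis by (rule DERIV_transform_on[OF _ x]) (simp add: eq)
qed

end

section \<open>The fundamental solution and its end values\<close>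

lemma sys_unique:
  assumes "sl_sys p {c..d} (\<lambda>x. - \<Lambda> * q x * u x) u v" and "e = c \<or> e = d" and "u e = 0" "v e = 0"
    and "x \<in> {c..d}"
  shows "u x = 0" "v x = 0"
proof -
  obtain P Q where PQ: "Q > 0" "\<And>x. x \<in> {c..d} \<Longrightarrow> q x \<le> Q"
    by (rule bounds) (rule that; assumption)
  have "\<bar>\<Lambda>\<bar> * Q \<ge> 0" using PQ by simp
  from sl_sys_apriori[OF cd contp ppos this] obtain C where C: "apriori_const c d p (\<bar>\<Lambda>\<bar> * Q) C" by blast
  have le: "\<bar>- \<Lambda> * q y * u y\<bar> \<le> \<bar>\<Lambda>\<bar> * Q * \<bar>u y\<bar> + 0" if y: "y \<in> {c..d}" for y
  proof -
    have "\<bar>\<Lambda>\<bar> * q y * \<bar>u y\<bar> \<le> \<bar>\<Lambda>\<bar> * Q * \<bar>u y\<bar>"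
      using PQ(2)[OF y] by (intro mult_right_mono mult_left_mono) auto
    then show "\<bar>- \<Lambda> * q y * u y\<bar> \<le> \<bar>\<Lambda>\<bar> * Q * \<bar>u y\<bar> + 0"
      using qpos[OF y] by (simp add: abs_mult)
  qed
  show "u x = 0" "v x = 0"
    using apriori_constD[OF C assms(1,2) order_refl le assms(5)] assms(3,4) by auto
qed

text \<open>\<open>(U \<Lambda>, V \<Lambda>)\<close> is the solution with value \<open>0\<close> and flux \<open>1\<close> at the left end; it spans the solutions
  that satisfy the Dirichlet condition there.\<close>

definition U :: "real \<Rightarrow> real \<Rightarrow> real" where "U = usol (\<lambda>_. 1)"
definition V :: "real \<Rightarrow> real \<Rightarrow> real" where "V = vsol (\<lambda>_. 1)"

lemma phi_left [simp]: "phi h n c = 0" by (simp add: phi_def)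
lemma psi_left [simp]: "psi h (Suc n) c = 0" by simp
lemma usol_left [simp]: "usol h \<Lambda> c = 0" by (simp add: usol_def)
lemma vsol_left [simp]: "vsol h \<Lambda> c = h c"
proof -
  have "(\<lambda>n. (-1) ^ n * psi h n c * \<Lambda> ^ n) = (\<lambda>n. if n = 0 then h c else 0)"
    by (rule ext) (metis (no_types, lifting) mult_cancel_left1 mult_cancel_right2 mult_zero_left mult_zero_right not0_implies_Suc power_0 psi.simps(1) psi_left)
  then show ?thesis using suminf_finite[of "{0}" "\<lambda>n. if n = 0 then h c else 0"] by (simp add: vsol_def)
qed

lemma sys_UV: "sl_sys p {c..d} (\<lambda>x. - \<Lambda> * q x * U \<Lambda> x) (U \<Lambda>) (V \<Lambda>)"
proof -
  have "((\<lambda>_. 1) has_real_derivative 0) (at x within {c..d})" for x by simp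
  from vsol_deriv[OF _ _ this] show ?thesis
    unfolding sl_sys_def U_def V_def using usol_deriv[of "\<lambda>_. 1"] by auto
qed

lemma UV_left [simp]: "U \<Lambda> c = 0" "V \<Lambda> c = 1"
  by (simp_all add: U_def V_def)

lemma sys_inhomogeneous:
  assumes "continuous_on {c..d} g"
  obtains u v where "sl_sys p {c..d} (\<lambda>x. g x - \<Lambda> * q x * u x) u v" "u c = 0" "v c = 0"
proof -
  define h where "h = (\<lambda>x. integral {c..x} g)"
  have h: "(h has_real_derivative g x) (at x within {c..d})" if "x \<in> {c..d}" for x
    unfolding h_def using integral_has_real_derivative[OF assms that] .
  then have "continuous_on {c..d} h" by (rule DERIV_continuous_on)
  with h usol_deriv vsol_deriv have "sl_sys p {c..d} (\<lambda>x. g x - \<Lambda> * q x * usol h \<Lambda> x) (usol h \<Lambda>) (vsol h \<Lambda>)"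
    unfolding sl_sys_def by blast
  then show thesis by (rule that) (simp_all add: h_def)
qed

lemma sys_multiple:
  assumes s: "sl_sys p {c..d} (\<lambda>x. - \<Lambda> * q x * u x) u v" and "u c = 0" and x: "x \<in> {c..d}"
  shows "u x = v c * U \<Lambda> x" "v x = v c * V \<Lambda> x"
proof -
  have "sl_sys p {c..d} (\<lambda>x. - \<Lambda> * q x * (u x - v c * U \<Lambda> x)) (\<lambda>x. u x - v c * U \<Lambda> x) (\<lambda>x. v x - v c * V \<Lambda> x)"
    by (rule sl_sys_cong[OF sl_sys_lincomb[OF s sys_UV[of \<Lambda>], of 1 "- v c"]]) (auto simp: algebra_simps)
  from sys_unique[OF this, of c x] assms show "u x = v c * U \<Lambda> x" "v x = v c * V \<Lambda> x" by auto
qed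

lemma UV_not_both_zero: "U \<Lambda> d \<noteq> 0 \<or> V \<Lambda> d \<noteq> 0"
  using sys_unique[OF sys_UV[of \<Lambda>], of d c] cd by auto

lemma U_nontrivial: "\<exists>x\<in>{c..d}. U \<Lambda> x \<noteq> 0"
proof (rule ccontr)
  assume "\<not> ?thesis"
  then have z: "U \<Lambda> x = 0" if "x \<in> {c..d}" for x using that by blast
  have "(U \<Lambda> has_real_derivative V \<Lambda> c / p c) (at c within {c..d})"
    using sys_UV[of \<Lambda>] cd unfolding sl_sys_def by (metis atLeastAtMost_iff less_imp_le order_refl)
  moreover have "(U \<Lambda> has_real_derivative 0) (at c within {c..d})"
    by (rule DERIV_transform_on[where f = "\<lambda>_. 0"]) (use z cd in auto)
  ultimately have "V \<Lambda> c / p c = 0"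
    using cd vector_derivative_unique_within_closed_interval[of c d c "U \<Lambda>" "V \<Lambda> c / p c" 0]
    by (simp add: has_real_derivative_iff_has_vector_derivative)
  then show False using ppos[of c] cd by auto
qed

text \<open>For \<open>\<Lambda> \<le> 0\<close> both series have nonnegative terms and their first terms \<open>\<integral> 1 / p\<close> and \<open>1\<close> are
  positive. Hence neither the Neumann nor the Dirichlet problem at the right end has an eigenvalue
  \<open>\<le> 0\<close>, and counting zeros may start at \<open>\<Lambda> = 0\<close>.\<close>

lemma U_V_pos:
  assumes "\<Lambda> \<le> 0"
  shows "U \<Lambda> d > 0" "V \<Lambda> d > 0"
proof -
  have d: "d \<in> {c..d}" using cd by auto
  have nn: "psi (\<lambda>_. 1) n d \<ge> 0 \<and> phi (\<lambda>_. 1) n d \<ge> 0" for n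
    by (rule psi_phi_nonneg) (use d in auto)
  have eq: "(-1) ^ n * y * \<Lambda> ^ n = y * (- \<Lambda>) ^ n" for n and y :: real
    by (simp add: power_minus[of \<Lambda>])
  have s: "summable (\<lambda>n. phi (\<lambda>_. 1) n d * (- \<Lambda>) ^ n)" "summable (\<lambda>n. psi (\<lambda>_. 1) n d * (- \<Lambda>) ^ n)"
    using sol_summable[OF _ d, of "\<lambda>_. 1" \<Lambda>] by (auto simp: eq)
  have "phi (\<lambda>_. 1) 0 d * (- \<Lambda>) ^ 0 \<le> (\<Sum>n. phi (\<lambda>_. 1) n d * (- \<Lambda>) ^ n)"
    using sum_le_suminf[OF s(1), of "{0}"] nn assms by simp
  moreover have "phi (\<lambda>_. 1) 0 d > 0"
  proof -
    obtain P Q where PQ: "P > 0" "\<And>x. x \<in> {c..d} \<Longrightarrow> 1 / p x \<le> P"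
      by (rule bounds) (rule that; assumption)
    have "bounded (p ` {c..d})" using contp by (intro compact_imp_bounded compact_continuous_image) auto
    then obtain M where M: "M > 0" "\<And>x. x \<in> {c..d} \<Longrightarrow> \<bar>p x\<bar> \<le> M" unfolding bounded_pos by auto
    have "integral {c..d} (\<lambda>_. 1 / M) \<le> integral {c..d} (\<lambda>x. 1 / p x)"
    proof (rule integral_le)
      show "(\<lambda>x. 1 / p x) integrable_on {c..d}"
        using contp ppos by (intro integrable_continuous_interval continuous_intros) (auto simp: less_imp_neq[THEN not_sym])
      fix x assume x: "x \<in> {c..d}"
      show "1 / M \<le> 1 / p x" using M(2)[OF x] ppos[OF x] by (intro divide_left_mono) auto
    qed auto
    moreover have "integral {c..d} (\<lambda>_. 1 / M) > 0" using cd M by simp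
    ultimately show ?thesis by (simp add: phi_def)
  qed
  ultimately show "U \<Lambda> d > 0" by (simp add: U_def usol_def eq)
  have "psi (\<lambda>_. 1) 0 d * (- \<Lambda>) ^ 0 \<le> (\<Sum>n. psi (\<lambda>_. 1) n d * (- \<Lambda>) ^ n)"
    using sum_le_suminf[OF s(2), of "{0}"] nn assms by simp
  then show "V \<Lambda> d > 0" by (simp add: V_def vsol_def eq)
qed

text \<open>The difference of two fundamental solutions starts from zero data and is forced by
  \<open>(\<Lambda> - \<mu>) q U\<close>, so the a priori bound applies. This gives continuity in \<open>\<Lambda>\<close> uniformly in the
  point.\<close>

lemma UV_lipschitz:
  obtains B where "B > 0"
    "\<And>\<Lambda> x. \<bar>\<Lambda> - \<mu>\<bar> \<le> 1 \<Longrightarrow> x \<in> {c..d} \<Longrightarrow> \<bar>U \<Lambda> x - U \<mu> x\<bar> \<le> B * \<bar>\<Lambda> - \<mu>\<bar> \<and> \<bar>V \<Lambda> x - V \<mu> x\<bar> \<le> B * \<bar>\<Lambda> - \<mu>\<bar>"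
proof -
  obtain P Q where PQ: "Q > 0" "\<And>x. x \<in> {c..d} \<Longrightarrow> q x \<le> Q"
    by (rule bounds) (rule that; assumption)
  have "bounded (U \<mu> ` {c..d})"
    by (intro compact_imp_bounded compact_continuous_image sl_sys_continuous[OF sys_UV]) auto
  then obtain M where M: "M > 0" "\<And>x. x \<in> {c..d} \<Longrightarrow> \<bar>U \<mu> x\<bar> \<le> M" unfolding bounded_pos by auto
  have "(\<bar>\<mu>\<bar> + 1) * Q \<ge> 0" using PQ by simp
  from sl_sys_apriori[OF cd contp ppos this] obtain C
    where "C > 0" and C: "apriori_const c d p ((\<bar>\<mu>\<bar> + 1) * Q) C" by blast
  have main: "\<bar>U \<Lambda> x - U \<mu> x\<bar> \<le> C * Q * M * \<bar>\<Lambda> - \<mu>\<bar> \<and> \<bar>V \<Lambda> x - V \<mu> x\<bar> \<le> C * Q * M * \<bar>\<Lambda> - \<mu>\<bar>"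
    if L: "\<bar>\<Lambda> - \<mu>\<bar> \<le> 1" and x: "x \<in> {c..d}" for \<Lambda> x
  proof -
    define w where "w = (\<lambda>x. U \<Lambda> x - U \<mu> x)"
    define y where "y = (\<lambda>x. V \<Lambda> x - V \<mu> x)"
    have s: "sl_sys p {c..d} (\<lambda>x. - \<Lambda> * q x * w x - (\<Lambda> - \<mu>) * q x * U \<mu> x) w y"
      by (rule sl_sys_cong[OF sl_sys_lincomb[OF sys_UV[of \<Lambda>] sys_UV[of \<mu>], of 1 "- 1"]])
         (auto simp: algebra_simps w_def y_def)
    have le: "\<bar>- \<Lambda> * q t * w t - (\<Lambda> - \<mu>) * q t * U \<mu> t\<bar> \<le> (\<bar>\<mu>\<bar> + 1) * Q * \<bar>w t\<bar> + \<bar>\<Lambda> - \<mu>\<bar> * Q * M"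
      if t: "t \<in> {c..d}" for t
    proof -
      have "\<bar>- \<Lambda> * q t * w t - (\<Lambda> - \<mu>) * q t * U \<mu> t\<bar> \<le> \<bar>\<Lambda>\<bar> * q t * \<bar>w t\<bar> + \<bar>\<Lambda> - \<mu>\<bar> * q t * \<bar>U \<mu> t\<bar>"
        using abs_triangle_ineq4[of "- \<Lambda> * q t * w t" "(\<Lambda> - \<mu>) * q t * U \<mu> t"] qpos[OF t] by (simp add: abs_mult)
      also have "\<dots> \<le> (\<bar>\<mu>\<bar> + 1) * Q * \<bar>w t\<bar> + \<bar>\<Lambda> - \<mu>\<bar> * Q * M"
        using qpos[OF t] PQ t L M by (intro add_mono mult_mono) (auto intro: less_imp_le)
      finally show ?thesis .
    qed
    have "0 \<le> \<bar>\<Lambda> - \<mu>\<bar> * Q * M" using PQ M by auto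
    from apriori_constD[OF C s _ this le x, of c] show ?thesis by (simp add: w_def y_def mult_ac)
  qed
  have "C * Q * M > 0" using \<open>C > 0\<close> PQ M by simp
  then show thesis using main by (rule that)
qed

definition U' :: "real \<Rightarrow> real" where
  "U' \<Lambda> = (\<Sum>n. diffs (\<lambda>n. (-1) ^ n * phi (\<lambda>_. 1) n d) n * \<Lambda> ^ n)"
definition V' :: "real \<Rightarrow> real" where
  "V' \<Lambda> = (\<Sum>n. diffs (\<lambda>n. (-1) ^ n * psi (\<lambda>_. 1) n d) n * \<Lambda> ^ n)"

lemma endpoint_deriv:
  "((\<lambda>\<Lambda>. U \<Lambda> d) has_real_derivative U' \<Lambda>) (at \<Lambda>)" "isCont U' \<Lambda>"
  "((\<lambda>\<Lambda>. V \<Lambda> d) has_real_derivative V' \<Lambda>) (at \<Lambda>)" "isCont V' \<Lambda>"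
proof -
  have d: "d \<in> {c..d}" using cd by auto
  note s = sol_summable[OF _ d, of "\<lambda>_. 1", OF continuous_on_const]
  have *: "((\<lambda>x. \<Sum>n. a n * x ^ n) has_real_derivative (\<Sum>n. diffs a n * \<Lambda> ^ n)) (at \<Lambda>)
        \<and> isCont (\<lambda>x. \<Sum>n. diffs a n * x ^ n) \<Lambda>"
    if "\<And>x. summable (\<lambda>n. a n * x ^ n)" for a :: "nat \<Rightarrow> real"
  proof -
    have "summable (\<lambda>n. diffs a n * x ^ n)" for x
      by (rule termdiff_converges_all) (use that in blast)
    then show ?thesis using that termdiffs_strong_converges_everywhere DERIV_isCont by metis
  qed
  show "((\<lambda>\<Lambda>. U \<Lambda> d) has_real_derivative U' \<Lambda>) (at \<Lambda>)" "isCont U' \<Lambda>"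
    using *[OF s(1)] unfolding U_def usol_def U'_def by blast+
  show "((\<lambda>\<Lambda>. V \<Lambda> d) has_real_derivative V' \<Lambda>) (at \<Lambda>)" "isCont V' \<Lambda>"
    using *[OF s(2)] unfolding V_def vsol_def V'_def by blast+
qed

lemma wronskian_UV:
  "((\<lambda>x. q x * U \<Lambda> x * U \<mu> x) has_integral (U \<Lambda> d * V \<mu> d - U \<mu> d * V \<Lambda> d) / (\<Lambda> - \<mu>)) {c..d}"
  if "\<Lambda> \<noteq> \<mu>"
proof -
  have "((\<lambda>x. (\<Lambda> - \<mu>) * (q x * U \<Lambda> x * U \<mu> x)) has_integral
     ((U \<Lambda> d * V \<mu> d - U \<mu> d * V \<Lambda> d) - (U \<Lambda> c * V \<mu> c - U \<mu> c * V \<Lambda> c))) {c..d}"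
  proof (rule fundamental_theorem_of_calculus)
    fix x assume "x \<in> {c..d}"
    from sl_sys_wronskian[OF sys_UV[of \<Lambda>] sys_UV[of \<mu>] this]
    show "((\<lambda>x. U \<Lambda> x * V \<mu> x - U \<mu> x * V \<Lambda> x) has_vector_derivative (\<Lambda> - \<mu>) * (q x * U \<Lambda> x * U \<mu> x)) (at x within {c..d})"
      by (simp add: has_real_derivative_iff_has_vector_derivative algebra_simps)
  qed (use cd in simp)
  from has_integral_mult_right[OF this, of "1 / (\<Lambda> - \<mu>)"] that show ?thesis by simp
qed

text \<open>The expression equals \<open>\<integral> q (U \<mu>)\<^sup>2\<close>: divide the Lagrange identity between \<open>\<Lambda>\<close> and \<open>\<mu>\<close> by \<open>\<Lambda> - \<mu>\<close>
  and let \<open>\<Lambda>\<close> tend to \<open>\<mu>\<close>. It says that the planar curve \<open>(V, U)\<close> of end values turns strictly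
  counterclockwise as \<open>\<Lambda>\<close> grows.\<close>

lemma endpoint_wronskian_pos: "U' \<mu> * V \<mu> d - V' \<mu> * U \<mu> d > 0"
proof -
  obtain B where B: "B > 0"
    "\<And>\<Lambda> x. \<bar>\<Lambda> - \<mu>\<bar> \<le> 1 \<Longrightarrow> x \<in> {c..d} \<Longrightarrow> \<bar>U \<Lambda> x - U \<mu> x\<bar> \<le> B * \<bar>\<Lambda> - \<mu>\<bar> \<and> \<bar>V \<Lambda> x - V \<mu> x\<bar> \<le> B * \<bar>\<Lambda> - \<mu>\<bar>"
    by (rule UV_lipschitz) (rule that; assumption)
  have cU: "continuous_on {c..d} (U \<Lambda>)" for \<Lambda> by (rule sl_sys_continuous[OF sys_UV])
  have "((\<lambda>\<Lambda>. integral {c..d} (\<lambda>x. q x * U \<Lambda> x * U \<mu> x)) \<longlongrightarrow> integral {c..d} (\<lambda>x. q x * U \<mu> x * U \<mu> x)) (at \<mu>)"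
  proof -
    have ul: "uniform_limit {c..d} (\<lambda>\<Lambda> x. U \<Lambda> x) (U \<mu>) (at \<mu>)"
    proof (rule uniform_limitI)
      fix e :: real assume e: "e > 0"
      have "eventually (\<lambda>\<Lambda>. dist \<Lambda> \<mu> < min 1 (e / B)) (at \<mu>)"
        using e B by (auto simp: eventually_at intro!: exI[of _ "min 1 (e / B)"])
      then show "\<forall>\<^sub>F \<Lambda> in at \<mu>. \<forall>x\<in>{c..d}. dist (U \<Lambda> x) (U \<mu> x) < e"
      proof eventually_elim
        case (elim \<Lambda>)
        then have "\<bar>\<Lambda> - \<mu>\<bar> \<le> 1" "B * \<bar>\<Lambda> - \<mu>\<bar> < e" using B by (auto simp: dist_real_def field_simps)
        then show ?case using B(2)[of \<Lambda>] by (force simp: dist_real_def)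
      qed
    qed
    have ul2: "uniform_limit {c..d} (\<lambda>\<Lambda> x. (q x * U \<mu> x) * U \<Lambda> x) (\<lambda>x. (q x * U \<mu> x) * U \<mu> x) (at \<mu>)"
      by (intro uniform_lim_mult[OF uniform_limit_const ul] compact_imp_bounded compact_continuous_image
          continuous_intros contq cU) auto
    have "((\<lambda>\<Lambda>. integral {c..d} (\<lambda>x. (q x * U \<mu> x) * U \<Lambda> x)) \<longlongrightarrow> integral {c..d} (\<lambda>x. (q x * U \<mu> x) * U \<mu> x)) (at \<mu>)"
    proof -
      obtain I J where I: "\<And>\<Lambda>. ((\<lambda>x. (q x * U \<mu> x) * U \<Lambda> x) has_integral I \<Lambda>) {c..d}"
        "((\<lambda>x. (q x * U \<mu> x) * U \<mu> x) has_integral J) {c..d}" "(I \<longlongrightarrow> J) (at \<mu>)"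
        by (rule uniform_limit_integral[OF ul2]) (use contq cU in \<open>auto intro!: continuous_intros\<close>)
      moreover have "integral {c..d} (\<lambda>x. (q x * U \<mu> x) * U \<Lambda> x) = I \<Lambda>" for \<Lambda>
        by (rule integral_unique) (rule I)
      moreover have "integral {c..d} (\<lambda>x. (q x * U \<mu> x) * U \<mu> x) = J"
        by (rule integral_unique) (rule I)
      ultimately show ?thesis using I(3) by simp
    qed
    then show ?thesis by (simp add: mult_ac)
  qed
  moreover have "((\<lambda>\<Lambda>. integral {c..d} (\<lambda>x. q x * U \<Lambda> x * U \<mu> x)) \<longlongrightarrow> U' \<mu> * V \<mu> d - V' \<mu> * U \<mu> d) (at \<mu>)"
  proof -
    have "((\<lambda>\<Lambda>. (U \<Lambda> d - U \<mu> d) / (\<Lambda> - \<mu>) * V \<mu> d - (V \<Lambda> d - V \<mu> d) / (\<Lambda> - \<mu>) * U \<mu> d)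
        \<longlongrightarrow> U' \<mu> * V \<mu> d - V' \<mu> * U \<mu> d) (at \<mu>)"
      using endpoint_deriv[of \<mu>] by (intro tendsto_intros) (simp_all add: has_field_derivative_iff)
    then show ?thesis
    proof (rule Lim_transform_eventually)
      show "\<forall>\<^sub>F \<Lambda> in at \<mu>. (U \<Lambda> d - U \<mu> d) / (\<Lambda> - \<mu>) * V \<mu> d - (V \<Lambda> d - V \<mu> d) / (\<Lambda> - \<mu>) * U \<mu> d
          = integral {c..d} (\<lambda>x. q x * U \<Lambda> x * U \<mu> x)"
        unfolding eventually_at_filter
        by (intro always_eventually allI impI)
           (subst integral_unique[OF wronskian_UV], auto simp: diff_divide_distrib[symmetric] algebra_simps)
    qed
  qed
  ultimately have eq: "U' \<mu> * V \<mu> d - V' \<mu> * U \<mu> d = integral {c..d} (\<lambda>x. q x * U \<mu> x * U \<mu> x)"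
    by (rule tendsto_unique[OF trivial_limit_at, symmetric])
  have cont: "continuous_on {c..d} (\<lambda>x. q x * U \<mu> x * U \<mu> x)" using contq cU by (intro continuous_intros)
  have nn: "q x * U \<mu> x * U \<mu> x \<ge> 0" if "x \<in> {c..d}" for x
    using qpos[OF that] by (simp add: mult.assoc less_imp_le)
  have "integral {c..d} (\<lambda>x. q x * U \<mu> x * U \<mu> x) \<noteq> 0"
  proof
    assume "integral {c..d} (\<lambda>x. q x * U \<mu> x * U \<mu> x) = 0"
    then have "\<forall>x\<in>{c..d}. q x * U \<mu> x * U \<mu> x = 0"
      using integral_eq_0_iff[OF cont cd nn] by simp
    then show False using U_nontrivial[of \<mu>] qpos by force
  qed
  then show ?thesis unfolding eq
    using integral_nonneg[OF integrable_continuous_interval[OF cont] nn] by simp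
qed

end

section \<open>Counting zeros of rotating planar curves\<close>

text \<open>\<open>\<theta>\<close> is a continuous, strictly increasing polar angle of the curve \<open>(f, g)\<close>. The radius may be
  negative, because only the zeros of \<open>f\<close> matter and \<open>\<theta>\<close> is needed modulo \<open>\<pi>\<close>; the bound on \<open>\<theta> 0\<close>
  fixes the branch at the start.\<close>

definition rotates_with :: "(real \<Rightarrow> real) \<Rightarrow> (real \<Rightarrow> real) \<Rightarrow> (real \<Rightarrow> real) \<Rightarrow> bool" where
  "rotates_with \<theta> f g \<longleftrightarrow> continuous_on {0..} \<theta> \<and> strict_mono_on {0..} \<theta> \<and> \<bar>\<theta> 0\<bar> < pi / 2 \<and>
     (\<forall>x\<ge>0. \<exists>R. R \<noteq> 0 \<and> f x = R * cos (\<theta> x) \<and> g x = R * sin (\<theta> x))"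

text \<open>The angle must satisfy \<open>\<theta>' = (f g' - f' g) / (f\<^sup>2 + g\<^sup>2)\<close>, so it is defined as the integral of
  the right-hand side. That it is an angle of the curve means \<open>f sin \<theta> = g cos \<theta>\<close>.\<close>

lemma angle_lift:
  fixes f g f' g' :: "real \<Rightarrow> real"
  assumes df: "\<And>x. (f has_real_derivative f' x) (at x)" and dg: "\<And>x. (g has_real_derivative g' x) (at x)"
    and cf: "\<And>x. isCont f' x" and cg: "\<And>x. isCont g' x"
    and W: "\<And>x. f x * g' x - f' x * g x > 0" and f0: "f 0 > 0"
  obtains \<theta> where "rotates_with \<theta> f g"
proof -
  define n where "n = (\<lambda>x. (f x)\<^sup>2 + (g x)\<^sup>2)"
  define h where "h = (\<lambda>x. (f x * g' x - f' x * g x) / n x)"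
  define \<theta> where "\<theta> = (\<lambda>x. arctan (g 0 / f 0) + integral {0..x} h)"
  have n: "n x > 0" for x
    using W[of x] unfolding n_def by (cases "f x = 0"; cases "g x = 0") (auto simp: add_pos_nonneg add_nonneg_pos)
  have ch: "isCont h x" for x
    unfolding h_def n_def using n[of x] df dg cf cg
    by (intro continuous_intros) (auto simp: n_def intro: DERIV_isCont)
  have d\<theta>': "(\<theta> has_real_derivative h x) (at x within {0..b})" if "x \<in> {0..b}" for x b
  proof -
    have "continuous_on {0..b} h" using ch by (simp add: continuous_at_imp_continuous_on)
    from integral_has_real_derivative[OF this that] show ?thesis
      unfolding \<theta>_def by (auto intro!: derivative_eq_intros)
  qed
  have d\<theta>: "(\<theta> has_real_derivative h x) (at x)" if "x > 0" for x
    using d\<theta>'[of x "x + 1"] that by (simp add: at_within_interior[of x "{0..x+1}"])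
  have c\<theta>: "continuous_on {0..b} \<theta>" for b using d\<theta>' by (rule DERIV_continuous_on)
  have cont: "continuous_on {0..} \<theta>"
    unfolding continuous_on_eq_continuous_within
  proof
    fix x :: real assume x: "x \<in> {0..}"
    have "continuous (at x within {0..x+1}) \<theta>"
      using c\<theta>[of "x+1"] x by (simp add: continuous_on_eq_continuous_within)
    moreover have "at x within {0..} = at x within {0..x+1}"
    proof (rule at_within_nhd[of x "{..<x+1}"])
      show "{0..} \<inter> {..<x + 1} - {x} = {0..x + 1} \<inter> {..<x + 1} - {x}" by auto
    qed auto
    ultimately show "continuous (at x within {0..}) \<theta>" by simp
  qed
  have mono: "strict_mono_on {0..} \<theta>"
  proof (rule strict_mono_onI)
    fix r s :: real assume rs: "r \<in> {0..}" "s \<in> {0..}" "r < s"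
    show "\<theta> r < \<theta> s"
    proof (rule DERIV_pos_imp_increasing_open[OF rs(3)])
      fix x assume "r < x" "x < s"
      then show "\<exists>y. (\<theta> has_real_derivative y) (at x) \<and> 0 < y"
        using d\<theta>[of x] W[of x] n[of x] rs by (intro exI[of _ "h x"]) (auto simp: h_def)
    next
      show "continuous_on {r..s} \<theta>"
        using c\<theta>[of s] rs by (auto intro: continuous_on_subset)
    qed
  qed
  have \<theta>0: "\<bar>\<theta> 0\<bar> < pi / 2"
  proof -
    have "\<theta> 0 = arctan (g 0 / f 0)" by (simp add: \<theta>_def)
    then show ?thesis using arctan_bounded[of "g 0 / f 0"] by linarith
  qed
  \<comment> \<open>\<open>E\<^sup>2 / (f\<^sup>2 + g\<^sup>2)\<close> is the squared sine of the deviation between \<open>\<theta>\<close> and the true angle;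
    its derivative vanishes identically and it starts at zero.\<close>
  define E where "E = (\<lambda>x. f x * sin (\<theta> x) - g x * cos (\<theta> x))"
  define Q where "Q = (\<lambda>x. (E x)\<^sup>2 / n x)"
  have E0: "E 0 = 0"
  proof -
    have "tan (\<theta> 0) = g 0 / f 0" by (simp add: \<theta>_def tan_arctan)
    moreover have "cos (\<theta> 0) \<noteq> 0"
    proof -
      have "- (pi / 2) < \<theta> 0" "\<theta> 0 < pi / 2" using \<theta>0 by linarith+
      from cos_gt_zero_pi[OF this] show ?thesis by simp
    qed
    ultimately show ?thesis using f0 by (simp add: E_def tan_def field_simps)
  qed
  have E: "E x = 0" if "x \<ge> 0" for x
  proof (cases "x = 0")
    case False
    then have x: "0 < x" using that by simp
    have "Q x = Q 0"
    proof (rule DERIV_isconst_end[OF x])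
      have "continuous_on {0..x} f" "continuous_on {0..x} g"
        using df dg by (auto intro!: DERIV_isCont continuous_at_imp_continuous_on)
      moreover have "(f t)\<^sup>2 + (g t)\<^sup>2 \<noteq> 0" for t using n[of t] unfolding n_def by linarith
      ultimately show "continuous_on {0..x} Q"
        unfolding Q_def E_def n_def using c\<theta>[of x] by (intro continuous_intros ballI)
      fix t assume t: "0 < t" "t < x"
      have n': "(n has_real_derivative 2 * f t * f' t + 2 * g t * g' t) (at t)"
        unfolding n_def using df[of t] dg[of t] by (auto intro!: derivative_eq_intros)
      have nz: "n t \<noteq> 0" using n[of t] by simp
      define e where "e = f' t * sin (\<theta> t) - g' t * cos (\<theta> t) + (f t * cos (\<theta> t) + g t * sin (\<theta> t)) * h t"
      have E': "(E has_real_derivative e) (at t)"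
        unfolding E_def e_def using df[of t] dg[of t] d\<theta>[OF t(1)]
        by (auto intro!: derivative_eq_intros simp: algebra_simps)
      have "h t * n t = f t * g' t - f' t * g t" using nz by (simp add: h_def)
      then have "e * n t = (f' t * sin (\<theta> t) - g' t * cos (\<theta> t)) * n t
           + (f t * cos (\<theta> t) + g t * sin (\<theta> t)) * (f t * g' t - f' t * g t)"
        unfolding e_def by (metis distrib_right mult.assoc)
      also have "\<dots> = (f t * f' t + g t * g' t) * E t"
        unfolding n_def E_def by (simp add: power2_eq_square algebra_simps)
      finally have en: "e * n t = (f t * f' t + g t * g' t) * E t" .
      have "(Q has_real_derivative (2 * E t * e * n t - (E t)\<^sup>2 * (2 * f t * f' t + 2 * g t * g' t)) / (n t * n t)) (at t)"
        unfolding Q_def using E' n' nz by (auto intro!: derivative_eq_intros)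
      moreover have "2 * E t * e * n t - (E t)\<^sup>2 * (2 * f t * f' t + 2 * g t * g' t) = 0"
      proof -
        have "2 * E t * e * n t = 2 * E t * (e * n t)" by simp
        then show ?thesis unfolding en by (simp add: power2_eq_square algebra_simps)
      qed
      ultimately show "(Q has_real_derivative 0) (at t)" by simp
    qed
    then have "(E x)\<^sup>2 / n x = 0" using E0 by (simp add: Q_def)
    then show ?thesis using n[of x] by simp
  qed (simp add: E0)
  have "\<exists>R. R \<noteq> 0 \<and> f x = R * cos (\<theta> x) \<and> g x = R * sin (\<theta> x)" if x: "x \<ge> 0" for x
  proof -
    let ?s = "sin (\<theta> x)" and ?c = "cos (\<theta> x)"
    define R where "R = f x * ?c + g x * ?s"
    have e: "f x * ?s = g x * ?c" using E[OF x] by (simp add: E_def)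
    have sc: "?s * ?s + ?c * ?c = 1" using sin_cos_squared_add3[of "\<theta> x"] by linarith
    have "R * ?c = f x * (?c * ?c) + (g x * ?c) * ?s" by (simp add: R_def algebra_simps)
    also have "\<dots> = f x * (?s * ?s + ?c * ?c)"
      by (simp only: e[symmetric] distrib_left mult.assoc add.commute)
    finally have f: "f x = R * ?c" by (simp only: sc mult_1_right)
    have "R * ?s = (f x * ?s) * ?c + g x * (?s * ?s)" by (simp add: R_def algebra_simps)
    also have "\<dots> = g x * (?s * ?s + ?c * ?c)"
      by (simp only: e distrib_left mult.assoc add.commute)
    finally have g: "g x = R * ?s" by (simp only: sc mult_1_right)
    have "R \<noteq> 0" using f g W[of x] by auto
    then show ?thesis using f g by blast
  qed
  then show thesis using that[of \<theta>] cont mono \<theta>0 by (auto simp: rotates_with_def)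
qed

text \<open>\<open>\<theta>\<close> maps the zeros of \<open>cos \<theta>\<close> bijectively onto the numbers \<open>(m + 1/2) \<pi>\<close> with \<open>m \<ge> 0\<close> that do
  not exceed \<open>\<theta> X\<close>.\<close>

lemma rotation_zero_count:
  fixes \<theta> :: "real \<Rightarrow> real"
  assumes cont: "continuous_on {0..} \<theta>" and mono: "strict_mono_on {0..} \<theta>"
    and lo: "- (pi / 2) < \<theta> 0" and hi: "\<theta> 0 < pi / 2" and X: "X \<ge> 0"
  shows "int (card {x \<in> {0..X}. cos (\<theta> x) = 0}) = \<lfloor>\<theta> X / pi + 1 / 2\<rfloor>"
    and "finite {x \<in> {0..X}. cos (\<theta> x) = 0}"
proof -
  let ?Z = "{x \<in> {0..X}. cos (\<theta> x) = 0}"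
  define N where "N = nat \<lfloor>\<theta> X / pi + 1 / 2\<rfloor>"
  have le: "\<theta> x \<le> \<theta> y" if "0 \<le> x" "x \<le> y" for x y
    using mono that by (metis atLeast_iff less_eq_real_def order.trans strict_mono_onD)
  have lX: "- (pi / 2) < \<theta> X" using le[of 0 X] X lo by simp
  have N: "int N = \<lfloor>\<theta> X / pi + 1 / 2\<rfloor>"
  proof -
    have "0 \<le> \<theta> X / pi + 1 / 2" using lX pi_gt_zero by (simp add: field_simps)
    then show ?thesis by (simp add: N_def)
  qed
  have mN: "(real m + 1 / 2) * pi \<le> \<theta> X \<longleftrightarrow> m < N" for m
  proof -
    have "(real m + 1 / 2) * pi \<le> \<theta> X \<longleftrightarrow> real m + 1 \<le> \<theta> X / pi + 1 / 2"
      using pi_gt_zero by (simp add: field_simps)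
    also have "\<dots> \<longleftrightarrow> int m + 1 \<le> \<lfloor>\<theta> X / pi + 1 / 2\<rfloor>" by (simp add: le_floor_iff)
    also have "\<dots> \<longleftrightarrow> m < N" using N by linarith
    finally show ?thesis .
  qed
  have img: "\<theta> ` ?Z = (\<lambda>m. (real m + 1 / 2) * pi) ` {..<N}"
  proof (intro equalityI subsetI)
    fix t assume "t \<in> \<theta> ` ?Z"
    then obtain x where x: "0 \<le> x" "x \<le> X" "cos (\<theta> x) = 0" "t = \<theta> x" by auto
    then obtain i where i: "odd i" "\<theta> x = of_int i * (pi / 2)" using cos_zero_iff_int by blast
    then obtain m where m: "i = 2 * m + 1" by (elim oddE)
    have eq: "\<theta> x = (of_int m + 1 / 2) * pi" by (simp add: i(2) m field_simps)
    have "- (pi / 2) < (of_int m + 1 / 2) * pi" using le[of 0 x] x lo eq by simp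
    then have "0 < (of_int m + 1) * pi" by (simp add: field_simps)
    then have "0 < (of_int m + 1 :: real)" using pi_gt_zero by (simp add: zero_less_mult_iff)
    then have "m \<ge> 0" by linarith
    then have eq': "\<theta> x = (real (nat m) + 1 / 2) * pi" using eq by simp
    moreover have "nat m < N" using mN[of "nat m"] eq' le[of x X] x by simp
    ultimately show "t \<in> (\<lambda>m. (real m + 1 / 2) * pi) ` {..<N}" using x by auto
  next
    fix t assume "t \<in> (\<lambda>m. (real m + 1 / 2) * pi) ` {..<N}"
    then obtain m where m: "m < N" "t = (real m + 1 / 2) * pi" by auto
    have "(0 + 1 / 2) * pi \<le> (real m + 1 / 2) * pi" by (intro mult_right_mono) auto
    moreover have "(0 + 1 / 2) * pi = pi / 2" by simp
    ultimately have "\<theta> 0 \<le> t" using hi unfolding m(2) by linarith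
    moreover have "t \<le> \<theta> X" using mN m by simp
    ultimately obtain x where x: "0 \<le> x" "x \<le> X" "\<theta> x = t"
      using IVT'[of \<theta> 0 t X] X continuous_on_subset[OF cont, of "{0..X}"] by auto
    have "cos t = 0"
    proof -
      have "t = of_int (2 * int m + 1) * (pi / 2)" by (simp add: m field_simps)
      moreover have "odd (2 * int m + 1)" by simp
      ultimately show ?thesis using cos_zero_iff_int by blast
    qed
    then show "t \<in> \<theta> ` ?Z" using x by auto
  qed
  have inj: "inj_on \<theta> ?Z"
    using strict_mono_on_imp_inj_on[OF mono] by (rule inj_on_subset) auto
  have inj2: "inj_on (\<lambda>m. (real m + 1 / 2) * pi) {..<N}" by (auto simp: inj_on_def)
  have "card ?Z = card (\<theta> ` ?Z)" using inj by (simp add: card_image)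
  also have "\<dots> = N" unfolding img using inj2 by (simp add: card_image)
  finally show "int (card ?Z) = \<lfloor>\<theta> X / pi + 1 / 2\<rfloor>" using N by simp
  have "finite (\<theta> ` ?Z)" unfolding img by simp
  then show "finite ?Z" using inj finite_imageD by blast
qed

abbreviation nzeros :: "(real \<Rightarrow> real) \<Rightarrow> real \<Rightarrow> nat" where
  "nzeros f X \<equiv> card {x \<in> {0..X}. f x = 0}"

lemma rotates_zeros:
  assumes "rotates_with \<theta> f g" "X \<ge> 0"
  shows "int (nzeros f X) = \<lfloor>\<theta> X / pi + 1 / 2\<rfloor>" "finite {x \<in> {0..X}. f x = 0}"
proof -
  have "{x \<in> {0..X}. f x = 0} = {x \<in> {0..X}. cos (\<theta> x) = 0}"
  proof (rule Collect_cong, rule conj_cong[OF refl])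
    fix x assume "x \<in> {0..X}"
    then obtain R where "R \<noteq> 0" "f x = R * cos (\<theta> x)"
      using assms unfolding rotates_with_def by (metis atLeastAtMost_iff)
    then show "(f x = 0) = (cos (\<theta> x) = 0)" by simp
  qed
  then show "int (nzeros f X) = \<lfloor>\<theta> X / pi + 1 / 2\<rfloor>" "finite {x \<in> {0..X}. f x = 0}"
    using rotation_zero_count[of \<theta> X] assms unfolding rotates_with_def by (auto simp: abs_less_iff)
qed

text \<open>The combination is the real part of \<open>(f1 + \<i> g1) (f2 + \<i> g2)\<close>, and angles of a product add.\<close>

lemma rotates_product_zeros:
  assumes r1: "rotates_with \<theta>1 f1 g1" and r2: "rotates_with \<theta>2 f2 g2" and X: "X \<ge> 0"
    and start: "\<bar>\<theta>1 0 + \<theta>2 0\<bar> < pi / 2"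
  shows "int (nzeros (\<lambda>x. f1 x * f2 x - g1 x * g2 x) X) = \<lfloor>(\<theta>1 X + \<theta>2 X) / pi + 1 / 2\<rfloor>"
    and "finite {x \<in> {0..X}. f1 x * f2 x - g1 x * g2 x = 0}"
proof -
  have "rotates_with (\<lambda>x. \<theta>1 x + \<theta>2 x) (\<lambda>x. f1 x * f2 x - g1 x * g2 x) (\<lambda>x. f1 x * g2 x + g1 x * f2 x)"
    unfolding rotates_with_def
  proof (intro conjI allI impI start)
    show "continuous_on {0..} (\<lambda>x. \<theta>1 x + \<theta>2 x)"
      using r1 r2 by (auto simp: rotates_with_def intro!: continuous_intros)
    show "strict_mono_on {0..} (\<lambda>x. \<theta>1 x + \<theta>2 x)"
      using r1 r2 unfolding rotates_with_def strict_mono_on_def by (meson add_strict_mono)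
    fix x :: real assume "0 \<le> x"
    then obtain R1 R2 where "R1 \<noteq> 0" "f1 x = R1 * cos (\<theta>1 x)" "g1 x = R1 * sin (\<theta>1 x)"
      "R2 \<noteq> 0" "f2 x = R2 * cos (\<theta>2 x)" "g2 x = R2 * sin (\<theta>2 x)"
      using r1 r2 unfolding rotates_with_def by meson
    then show "\<exists>R. R \<noteq> 0 \<and> f1 x * f2 x - g1 x * g2 x = R * cos (\<theta>1 x + \<theta>2 x) \<and>
        f1 x * g2 x + g1 x * f2 x = R * sin (\<theta>1 x + \<theta>2 x)"
      by (intro exI[of _ "R1 * R2"]) (simp add: cos_add sin_add algebra_simps)
  qed
  from rotates_zeros[OF this X] show
    "int (nzeros (\<lambda>x. f1 x * f2 x - g1 x * g2 x) X) = \<lfloor>(\<theta>1 X + \<theta>2 X) / pi + 1 / 2\<rfloor>"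
    "finite {x \<in> {0..X}. f1 x * f2 x - g1 x * g2 x = 0}" by auto
qed

text \<open>Where \<open>g2\<close> vanishes, \<open>\<theta>2 X\<close> is an integer multiple of \<open>\<pi>\<close>, so the integer part of the sum of the
  angles splits exactly.\<close>

lemma product_zeros_at_common:
  assumes r1: "rotates_with \<theta>1 f1 g1" and r2: "rotates_with \<theta>2 f2 g2" and X: "X \<ge> 0"
    and start: "\<bar>\<theta>1 0 + \<theta>2 0\<bar> < pi / 2" and z: "f1 X = 0" "g2 X = 0"
  shows "nzeros (\<lambda>x. f1 x * f2 x - g1 x * g2 x) X = nzeros f1 X + nzeros f2 X"
proof -
  obtain R2 where "R2 \<noteq> 0" "g2 X = R2 * sin (\<theta>2 X)" using r2 X unfolding rotates_with_def by meson
  then have "sin (\<theta>2 X) = 0" using z by simp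
  then obtain i :: int where i: "\<theta>2 X = of_int i * pi" using sin_zero_iff_int2 by blast
  have "\<lfloor>(\<theta>1 X + \<theta>2 X) / pi + 1 / 2\<rfloor> = \<lfloor>\<theta>1 X / pi + 1 / 2 + of_int i\<rfloor>"
    by (simp add: i add_divide_distrib algebra_simps)
  also have "\<dots> = \<lfloor>\<theta>1 X / pi + 1 / 2\<rfloor> + i" by simp
  also have "i = \<lfloor>\<theta>2 X / pi + 1 / 2\<rfloor>" by (simp add: i floor_unique)
  finally have "int (nzeros (\<lambda>x. f1 x * f2 x - g1 x * g2 x) X) = int (nzeros f1 X + nzeros f2 X)"
    using rotates_product_zeros[OF r1 r2 X start] rotates_zeros[OF r1 X] rotates_zeros[OF r2 X] by simp
  then show ?thesis by linarith
qed

text \<open>A second curve that is almost horizontal at \<open>X\<close> has an angle close to a multiple of \<open>\<pi>\<close>. Since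
  \<open>f1 X \<noteq> 0\<close>, the number \<open>\<theta>1 X / \<pi> + 1/2\<close> has positive distance from the integers, and a smaller
  perturbation does not change the integer part. The distance \<open>\<delta>\<close> depends on the first curve only.\<close>

lemma product_zeros_near:
  assumes r1: "rotates_with \<theta>1 f1 g1" and X: "X \<ge> 0" and f1: "f1 X \<noteq> 0"
  obtains \<delta> where "\<delta> > 0"
    "\<And>\<theta>2 f2 g2. rotates_with \<theta>2 f2 g2 \<Longrightarrow> \<bar>\<theta>1 0 + \<theta>2 0\<bar> < pi / 2 \<Longrightarrow> f2 X \<noteq> 0 \<Longrightarrow> \<bar>g2 X / f2 X\<bar> < \<delta>
       \<Longrightarrow> nzeros (\<lambda>x. f1 x * f2 x - g1 x * g2 x) X = nzeros f1 X + nzeros f2 X"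
proof -
  define t where "t = \<theta>1 X / pi + 1 / 2"
  define N where "N = \<lfloor>t\<rfloor>"
  have "t \<noteq> of_int N"
  proof
    assume "t = of_int N"
    then have "\<theta>1 X = of_int (2 * N - 1) * (pi / 2)" by (simp add: t_def field_simps)
    moreover have "odd (2 * N - 1)" by simp
    ultimately have "cos (\<theta>1 X) = 0" using cos_zero_iff_int by blast
    then show False using r1 X f1 unfolding rotates_with_def by (metis mult_zero_right)
  qed
  then have tN: "of_int N < t" "t < of_int N + 1" unfolding N_def by linarith+
  define \<delta> where "\<delta> = min (t - of_int N) (of_int N + 1 - t)"
  have "\<delta> > 0" using tN by (simp add: \<delta>_def)
  moreover have "nzeros (\<lambda>x. f1 x * f2 x - g1 x * g2 x) X = nzeros f1 X + nzeros f2 X"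
    if r2: "rotates_with \<theta>2 f2 g2" and start: "\<bar>\<theta>1 0 + \<theta>2 0\<bar> < pi / 2"
      and f2: "f2 X \<noteq> 0" and small: "\<bar>g2 X / f2 X\<bar> < \<delta>" for \<theta>2 f2 g2
  proof -
    obtain R2 where R2: "R2 \<noteq> 0" "f2 X = R2 * cos (\<theta>2 X)" "g2 X = R2 * sin (\<theta>2 X)"
      using r2 X unfolding rotates_with_def by meson
    then have c: "cos (\<theta>2 X) \<noteq> 0" using f2 by auto
    have tan: "tan (\<theta>2 X) = g2 X / f2 X" using R2 by (simp add: tan_def)
    define M where "M = \<lfloor>\<theta>2 X / pi + 1 / 2\<rfloor>"
    \<comment> \<open>\<open>\<tau>\<close> is the deviation from the nearest multiple of \<open>\<pi>\<close>; it equals \<open>arctan (g2 X / f2 X)\<close>.\<close>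
    define \<tau> where "\<tau> = \<theta>2 X - of_int M * pi"
    have "of_int M \<le> \<theta>2 X / pi + 1 / 2" "\<theta>2 X / pi + 1 / 2 < of_int M + 1"
      unfolding M_def by linarith+
    then have "(of_int M - 1/2) * pi \<le> \<theta>2 X" "\<theta>2 X < (of_int M + 1/2) * pi"
      using pi_gt_zero by (simp_all add: field_simps)
    then have \<tau>: "- (pi / 2) \<le> \<tau>" "\<tau> < pi / 2" by (simp_all add: \<tau>_def algebra_simps)
    have "\<theta>2 X = \<tau> + of_int M * pi" by (simp add: \<tau>_def)
    moreover have "cos \<tau> \<noteq> 0"
    proof
      assume "cos \<tau> = 0"
      then have "cos (\<tau> + of_int M * pi) = 0"
        using sin_zero_iff_int2[of "of_int M * pi"] by (auto simp: cos_add)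
      then show False using c \<open>\<theta>2 X = \<tau> + of_int M * pi\<close> by simp
    qed
    then have "\<tau> \<noteq> - (pi / 2)" by auto
    moreover have "sin (of_int M * pi) = 0" using sin_zero_iff_int2 by blast
    moreover from this have "cos (of_int M * pi) \<noteq> 0"
      using sin_cos_squared_add3[of "of_int M * pi"] by auto
    ultimately have "tan \<tau> = tan (\<theta>2 X)"
      by (simp add: tan_def cos_add sin_add)
    then have "\<tau> = arctan (g2 X / f2 X)"
      using arctan_tan[of \<tau>] \<tau> \<open>\<tau> \<noteq> - (pi / 2)\<close> tan by simp
    then have "\<bar>\<tau>\<bar> \<le> \<bar>g2 X / f2 X\<bar>" using abs_arctan_le by metis
    then have "\<bar>\<tau>\<bar> < \<delta>" using small by simp
    moreover have "\<bar>\<tau> / pi\<bar> \<le> \<bar>\<tau>\<bar>"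
      using pi_gt3 mult_right_mono[of 1 pi "\<bar>\<tau>\<bar>"] by (simp add: abs_divide field_simps)
    ultimately have "\<bar>\<tau> / pi\<bar> < \<delta>" by linarith
    then have "of_int N \<le> t + \<tau> / pi" "t + \<tau> / pi < of_int N + 1" unfolding \<delta>_def by linarith+
    then have "\<lfloor>t + \<tau> / pi\<rfloor> = N" by (simp add: floor_unique)
    moreover have "(\<theta>1 X + \<theta>2 X) / pi + 1 / 2 = (t + \<tau> / pi) + of_int M"
      by (simp add: t_def \<tau>_def add_divide_distrib diff_divide_distrib)
    ultimately have "\<lfloor>(\<theta>1 X + \<theta>2 X) / pi + 1 / 2\<rfloor> = N + M" by simp
    then have "int (nzeros (\<lambda>x. f1 x * f2 x - g1 x * g2 x) X) = int (nzeros f1 X + nzeros f2 X)"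
      using rotates_product_zeros[OF r1 r2 X start] rotates_zeros[OF r1 X] rotates_zeros[OF r2 X]
      by (simp add: N_def M_def t_def)
    then show ?thesis by linarith
  qed
  ultimately show thesis by (rule that)
qed

section \<open>The transmission problem and its characteristic function\<close>

lemma deriv_within_eq:
  fixes u :: "real \<Rightarrow> 'a::real_normed_vector"
  assumes "(u has_vector_derivative y) (at x within {c..d})" "c < d" "x \<in> {c..d}"
  shows "deriv_within u {c..d} x = y"
  using assms by (intro vector_derivative_within) (auto simp: trivial_limit_within islimpt_Icc)

lemma sl_sys_deriv_within:
  assumes "sl_sys p {c..d} f u v" "c < d" "x \<in> {c..d}"
  shows "deriv_within u {c..d} x = v x / p x"
  using assms by (intro deriv_within_eq) (auto simp: sl_sys_def has_real_derivative_iff_has_vector_derivative)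

lemma sl_solution_imp_sys:
  fixes u :: "real \<Rightarrow> real"
  assumes s: "sl_solution p {c..d} f u" and pos: "\<And>x. x \<in> {c..d} \<Longrightarrow> p x > 0"
  shows "sl_sys p {c..d} f u (\<lambda>x. p x * deriv_within u {c..d} x)"
  unfolding sl_sys_def
proof (intro ballI conjI)
  fix x assume x: "x \<in> {c..d}"
  have "u differentiable (at x within {c..d})" using s x by (simp add: sl_solution_def)
  then have "(u has_vector_derivative deriv_within u {c..d} x) (at x within {c..d})"
    by (simp add: vector_derivative_works)
  then show "(u has_real_derivative p x * deriv_within u {c..d} x / p x) (at x within {c..d})"
    using pos[OF x] by (simp add: has_real_derivative_iff_has_vector_derivative)
  show "((\<lambda>x. p x * deriv_within u {c..d} x) has_real_derivative f x) (at x within {c..d})"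
    using s x by (simp add: sl_solution_def has_real_derivative_iff_has_vector_derivative)
qed

lemma sl_sys_imp_solution:
  assumes s: "sl_sys p {c..d} f u v" and "c < d" and pos: "\<And>x. x \<in> {c..d} \<Longrightarrow> p x > 0"
  shows "sl_solution p {c..d} f u"
  unfolding sl_solution_def
proof (intro ballI conjI)
  fix x assume x: "x \<in> {c..d}"
  have ux: "(u has_real_derivative v x / p x) (at x within {c..d})"
       "(v has_real_derivative f x) (at x within {c..d})"
    using s x by (auto simp: sl_sys_def)
  then show "u differentiable (at x within {c..d})"
    using differentiableI_vector[of u "v x / p x"] by (simp add: has_real_derivative_iff_has_vector_derivative)
  have "((\<lambda>t. p t * deriv_within u {c..d} t) has_real_derivative f x) (at x within {c..d})"
    by (rule DERIV_transform_on[OF ux(2) x])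
       (use sl_sys_deriv_within[OF s assms(2)] pos in \<open>force\<close>)
  then show "((\<lambda>t. p t *\<^sub>R deriv_within u {c..d} t) has_vector_derivative f x) (at x within {c..d})"
    by (simp add: has_real_derivative_iff_has_vector_derivative)
qed

text \<open>Removes the factor \<open>\<epsilon>\<close> from the equation on the right half, so that with \<open>\<lambda> = \<epsilon> \<Lambda>\<close> both halves
  have the same spectral parameter \<open>\<Lambda>\<close>.\<close>

lemma sl_sys_rescale:
  assumes "e \<noteq> 0"
  shows "sl_sys (\<lambda>x. e * p x) S f u v \<longleftrightarrow> sl_sys p S (\<lambda>x. f x / e) u (\<lambda>x. v x / e)"
proof -
  have "(v has_real_derivative f x) (at x within S) \<longleftrightarrow> ((\<lambda>x. v x / e) has_real_derivative f x / e) (at x within S)" for x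
  proof
    assume "((\<lambda>x. v x / e) has_real_derivative f x / e) (at x within S)"
    from DERIV_cmult[OF this, of e] show "(v has_real_derivative f x) (at x within S)" using assms by simp
  qed (rule DERIV_cdivide)
  then show ?thesis by (simp add: sl_sys_def)
qed

text \<open>The spectra are defined with complex functions, the solution theory is real. Applied to the real
  part, the imaginary part and the embedding of the reals, this lemma passes between the two.\<close>

lemma sl_solution_linear:
  fixes h :: "'a::real_normed_vector \<Rightarrow> 'b::real_normed_vector"
  assumes h: "bounded_linear h" and s: "sl_solution p {c..d} f u" and cd: "c < d"
  shows "sl_solution p {c..d} (\<lambda>x. h (f x)) (\<lambda>x. h (u x))"
    and "x \<in> {c..d} \<Longrightarrow> deriv_within (\<lambda>x. h (u x)) {c..d} x = h (deriv_within u {c..d} x)"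
proof -
  interpret h: bounded_linear h by fact
  have du: "(u has_vector_derivative deriv_within u {c..d} x) (at x within {c..d})" if "x \<in> {c..d}" for x
    using s that by (simp add: sl_solution_def vector_derivative_works)
  have dw: "deriv_within (\<lambda>x. h (u x)) {c..d} x = h (deriv_within u {c..d} x)" if "x \<in> {c..d}" for x
    by (rule deriv_within_eq[OF h.has_vector_derivative[OF du[OF that]] cd that])
  then show "x \<in> {c..d} \<Longrightarrow> deriv_within (\<lambda>x. h (u x)) {c..d} x = h (deriv_within u {c..d} x)" .
  show "sl_solution p {c..d} (\<lambda>x. h (f x)) (\<lambda>x. h (u x))"
    unfolding sl_solution_def
  proof (intro ballI conjI)
    fix x assume x: "x \<in> {c..d}"
    show "(\<lambda>x. h (u x)) differentiable at x within {c..d}"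
      using h.has_vector_derivative[OF du[OF x]] differentiableI_vector by blast
    have "((\<lambda>t. h (p t *\<^sub>R deriv_within u {c..d} t)) has_vector_derivative h (f x)) (at x within {c..d})"
      using s x by (intro h.has_vector_derivative) (simp add: sl_solution_def)
    then have "((\<lambda>t. h (p t *\<^sub>R deriv_within u {c..d} t)) has_derivative (\<lambda>y. y *\<^sub>R h (f x))) (at x within {c..d})"
      by (simp add: has_vector_derivative_def)
    then have "((\<lambda>t. p t *\<^sub>R deriv_within (\<lambda>x. h (u x)) {c..d} t) has_derivative (\<lambda>y. y *\<^sub>R h (f x))) (at x within {c..d})"
      by (rule has_derivative_transform[OF x, rotated]) (simp add: dw h.scaleR)
    then show "((\<lambda>t. p t *\<^sub>R deriv_within (\<lambda>x. h (u x)) {c..d} t) has_vector_derivative h (f x)) (at x within {c..d})"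
      by (simp add: has_vector_derivative_def)
  qed
qed

lemma sl_solution_cong:
  assumes "sl_solution p S f u" "\<And>x. x \<in> S \<Longrightarrow> f x = g x"
  shows "sl_solution p S g u"
  using assms by (simp add: sl_solution_def)

lemma problem_P_linear:
  fixes h :: "'a::real_normed_field \<Rightarrow> 'b::real_normed_field"
  assumes h: "bounded_linear h" and P: "problem_P a b k r \<kappa> \<rho> \<epsilon> (of_real l) u" and "a < 0" "0 < b"
  shows "problem_P a b k r \<kappa> \<rho> \<epsilon> (of_real l) (\<lambda>x. h (u x))"
proof -
  interpret h: bounded_linear h by fact
  have hr: "h (of_real s * z) = of_real s * h z" for s z
    using h.scaleR[of s z] by (simp add: scaleR_conv_of_real)
  have 1: "sl_solution k {a..0} (\<lambda>x. - (inverse (of_real \<epsilon>) * of_real l * of_real (r x) * u x)) u"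
   and 2: "sl_solution (\<lambda>x. \<epsilon> * \<kappa> x) {0..b} (\<lambda>x. - (of_real l * of_real (\<rho> x) * u x)) u"
   and 3: "k 0 *\<^sub>R deriv_within u {a..0} 0 = \<epsilon> *\<^sub>R (\<kappa> 0 *\<^sub>R deriv_within u {0..b} 0)" "u a = 0" "u b = 0"
    using P by (auto simp: problem_P_def)
  show ?thesis
    unfolding problem_P_def
  proof (intro conjI)
    show "sl_solution k {a..0} (\<lambda>x. - (inverse (of_real \<epsilon>) * of_real l * of_real (r x) * h (u x))) (\<lambda>x. h (u x))"
      by (rule sl_solution_cong[OF sl_solution_linear(1)[OF h 1 \<open>a < 0\<close>]])
         (simp add: h.neg of_real_inverse[symmetric] of_real_mult[symmetric] hr del: of_real_inverse of_real_mult)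
    show "sl_solution (\<lambda>x. \<epsilon> * \<kappa> x) {0..b} (\<lambda>x. - (of_real l * of_real (\<rho> x) * h (u x))) (\<lambda>x. h (u x))"
      by (rule sl_solution_cong[OF sl_solution_linear(1)[OF h 2 \<open>0 < b\<close>]])
         (simp add: h.neg of_real_mult[symmetric] hr del: of_real_mult)
    show "k 0 *\<^sub>R deriv_within (\<lambda>x. h (u x)) {a..0} 0 = \<epsilon> *\<^sub>R \<kappa> 0 *\<^sub>R deriv_within (\<lambda>x. h (u x)) {0..b} 0"
      using arg_cong[OF 3(1), of h] sl_solution_linear(2)[OF h 1 \<open>a < 0\<close>, of 0]
        sl_solution_linear(2)[OF h 2 \<open>0 < b\<close>, of 0] \<open>a < 0\<close> \<open>0 < b\<close>
      by (simp add: h.scaleR)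
    show "h (u a) = 0" "h (u b) = 0" using 3 by simp_all
  qed
qed

locale transmission =
  fixes a b :: real and k r \<kappa> \<rho> :: "real \<Rightarrow> real"
  assumes a0: "a < 0" and b0: "0 < b"
    and contk: "continuous_on {a..0} k" and contr: "continuous_on {a..0} r"
    and cont\<kappa>: "continuous_on {0..b} \<kappa>" and cont\<rho>: "continuous_on {0..b} \<rho>"
    and posk: "\<And>x. x \<in> {a..0} \<Longrightarrow> k x > 0" and posr: "\<And>x. x \<in> {a..0} \<Longrightarrow> r x > 0"
    and pos\<kappa>: "\<And>x. x \<in> {0..b} \<Longrightarrow> \<kappa> x > 0" and pos\<rho>: "\<And>x. x \<in> {0..b} \<Longrightarrow> \<rho> x > 0"
begin

sublocale left: sl_interval a 0 k r
  by unfold_locales (use a0 contk contr posk posr in auto)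

sublocale right: sl_interval "- b" 0 "\<lambda>x. \<kappa> (- x)" "\<lambda>x. \<rho> (- x)"
  by unfold_locales
     (use b0 pos\<kappa> pos\<rho> in \<open>auto intro!: continuous_on_compose2[OF cont\<kappa>] continuous_on_compose2[OF cont\<rho>] continuous_intros\<close>)

text \<open>The solution on the right half with value \<open>0\<close> and flux \<open>1\<close> at \<open>b\<close>. The sign comes from the
  reflection, which reverses the flux.\<close>

definition ur :: "real \<Rightarrow> real \<Rightarrow> real" where "ur \<Lambda> x = - right.U \<Lambda> (- x)"
definition vr :: "real \<Rightarrow> real \<Rightarrow> real" where "vr \<Lambda> x = right.V \<Lambda> (- x)"

lemma ur_vr_right [simp]: "ur \<Lambda> b = 0" "vr \<Lambda> b = 1"
  by (simp_all add: ur_def vr_def)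

lemma ur_nontrivial: "\<exists>x\<in>{0..b}. ur \<Lambda> x \<noteq> 0"
proof -
  obtain x where "x \<in> {-b..0}" "right.U \<Lambda> x \<noteq> 0" using right.U_nontrivial[of \<Lambda>] by blast
  then show ?thesis by (intro bexI[of _ "- x"]) (auto simp: ur_def)
qed

lemma sys_left: "sl_sys k {a..0} (\<lambda>x. - \<Lambda> * r x * left.U \<Lambda> x) (left.U \<Lambda>) (left.V \<Lambda>)"
  by (rule left.sys_UV)

lemma sys_right: "sl_sys \<kappa> {0..b} (\<lambda>x. - \<Lambda> * \<rho> x * ur \<Lambda> x) (ur \<Lambda>) (vr \<Lambda>)"
proof -
  have "sl_sys \<kappa> {0..b} (\<lambda>x. - 1 * (- \<Lambda> * \<rho> x * right.U \<Lambda> (- x))) (\<lambda>x. - 1 * right.U \<Lambda> (- x)) (\<lambda>x. - 1 * - right.V \<Lambda> (- x))"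
    using sl_sys_scale[OF sl_sys_reflect[OF right.sys_UV[of \<Lambda>]], of "-1"] by simp
  then show ?thesis by (rule sl_sys_cong) (auto simp: ur_def vr_def)
qed

lemma sys_right_multiple:
  assumes s: "sl_sys \<kappa> {0..b} (\<lambda>x. - \<Lambda> * \<rho> x * u x) u v" and "u b = 0" and x: "x \<in> {0..b}"
  shows "u x = v b * ur \<Lambda> x" "v x = v b * vr \<Lambda> x"
proof -
  have "sl_sys (\<lambda>x. \<kappa> (- x)) {-b..0} (\<lambda>x. - \<Lambda> * \<rho> (- x) * u (- x)) (\<lambda>x. u (- x)) (\<lambda>x. - v (- x))"
    using sl_sys_reflect[OF s] by simp
  from right.sys_multiple[OF this, of "- x"] assms
  show "u x = v b * ur \<Lambda> x" "v x = v b * vr \<Lambda> x" by (auto simp: ur_def vr_def)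
qed

text \<open>The determinant of the matching conditions at \<open>0\<close> for a multiple of \<open>left.U\<close> on the left and a
  multiple of \<open>ur\<close> on the right. At \<open>\<epsilon> = 0\<close> it factors into \<open>left.V\<close>, whose zeros are the
  eigenvalues of the left problem with a Neumann condition at \<open>0\<close>, and \<open>right.U\<close>, whose zeros are
  those of the right Dirichlet problem.\<close>

definition D :: "real \<Rightarrow> real \<Rightarrow> real" where
  "D \<epsilon> \<Lambda> = left.V \<Lambda> 0 * right.U \<Lambda> 0 + \<epsilon> * (left.U \<Lambda> 0 * right.V \<Lambda> 0)"

text \<open>With \<open>\<lambda> = \<epsilon> \<Lambda>\<close> both equations lose \<open>\<epsilon>\<close>, so a solution is determined on each half by its flux at
  the outer end; \<open>\<epsilon>\<close> survives only in the flux condition at \<open>0\<close>.\<close>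

lemma problem_P_cases:
  fixes u :: "real \<Rightarrow> real"
  assumes P: "problem_P a b k r \<kappa> \<rho> \<epsilon> (\<epsilon> * \<Lambda>) u" and e: "\<epsilon> > 0"
  defines "\<alpha> \<equiv> k a * deriv_within u {a..0} a" and "\<beta> \<equiv> \<kappa> b * deriv_within u {0..b} b"
  shows "\<And>x. x \<in> {a..0} \<Longrightarrow> u x = \<alpha> * left.U \<Lambda> x \<and> k x * deriv_within u {a..0} x = \<alpha> * left.V \<Lambda> x"
    and "\<And>x. x \<in> {0..b} \<Longrightarrow> u x = \<beta> * ur \<Lambda> x \<and> \<kappa> x * deriv_within u {0..b} x = \<beta> * vr \<Lambda> x"
    and "\<alpha> * left.U \<Lambda> 0 = \<beta> * ur \<Lambda> 0" and "\<alpha> * left.V \<Lambda> 0 = \<epsilon> * (\<beta> * vr \<Lambda> 0)"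
proof -
  from P have 1: "sl_solution k {a..0} (\<lambda>x. - (inverse \<epsilon> * (\<epsilon> * \<Lambda>) * r x * u x)) u"
    and 2: "sl_solution (\<lambda>x. \<epsilon> * \<kappa> x) {0..b} (\<lambda>x. - (\<epsilon> * \<Lambda> * \<rho> x * u x)) u"
    and 3: "k 0 * deriv_within u {a..0} 0 = \<epsilon> * (\<kappa> 0 * deriv_within u {0..b} 0)" "u a = 0" "u b = 0"
    by (auto simp: problem_P_def)
  have s1: "sl_sys k {a..0} (\<lambda>x. - \<Lambda> * r x * u x) u (\<lambda>x. k x * deriv_within u {a..0} x)"
    by (rule sl_sys_cong[OF sl_solution_imp_sys[OF 1 posk]]) (use e in auto)
  have "sl_sys (\<lambda>x. \<epsilon> * \<kappa> x) {0..b} (\<lambda>x. - (\<epsilon> * \<Lambda> * \<rho> x * u x)) u (\<lambda>x. \<epsilon> * \<kappa> x * deriv_within u {0..b} x)"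
    by (rule sl_solution_imp_sys[OF 2]) (use e pos\<kappa> in auto)
  then have s2: "sl_sys \<kappa> {0..b} (\<lambda>x. - \<Lambda> * \<rho> x * u x) u (\<lambda>x. \<kappa> x * deriv_within u {0..b} x)"
    using e by (subst (asm) sl_sys_rescale) (auto elim!: sl_sys_cong simp: field_simps)
  show A: "u x = \<alpha> * left.U \<Lambda> x \<and> k x * deriv_within u {a..0} x = \<alpha> * left.V \<Lambda> x" if "x \<in> {a..0}" for x
    using left.sys_multiple[OF s1 3(2) that] by (simp add: \<alpha>_def)
  show B: "u x = \<beta> * ur \<Lambda> x \<and> \<kappa> x * deriv_within u {0..b} x = \<beta> * vr \<Lambda> x" if "x \<in> {0..b}" for x
    using sys_right_multiple[OF s2 3(3) that] by (simp add: \<beta>_def)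
  show "\<alpha> * left.U \<Lambda> 0 = \<beta> * ur \<Lambda> 0" "\<alpha> * left.V \<Lambda> 0 = \<epsilon> * (\<beta> * vr \<Lambda> 0)"
    using A[of 0] B[of 0] 3(1) a0 b0 by auto
qed

lemma problem_P_glue:
  assumes e: "\<epsilon> > 0" and "\<alpha> * left.U \<Lambda> 0 = \<beta> * ur \<Lambda> 0" "\<alpha> * left.V \<Lambda> 0 = \<epsilon> * (\<beta> * vr \<Lambda> 0)"
  shows "problem_P a b k r \<kappa> \<rho> \<epsilon> (\<epsilon> * \<Lambda>) (glue (\<lambda>x. \<alpha> * left.U \<Lambda> x) (\<lambda>x. \<beta> * ur \<Lambda> x))"
proof -
  let ?u = "glue (\<lambda>x. \<alpha> * left.U \<Lambda> x) (\<lambda>x. \<beta> * ur \<Lambda> x)"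
  have s1: "sl_sys k {a..0} (\<lambda>x. - (inverse (of_real \<epsilon>) * (\<epsilon> * \<Lambda>) * of_real (r x) * ?u x)) ?u (\<lambda>x. \<alpha> * left.V \<Lambda> x)"
    by (rule sl_sys_cong[OF sl_sys_scale[OF sys_left[of \<Lambda>], of \<alpha>]]) (use e assms in \<open>auto simp: glue_def\<close>)
  have s2: "sl_sys (\<lambda>x. \<epsilon> * \<kappa> x) {0..b} (\<lambda>x. - (\<epsilon> * \<Lambda> * of_real (\<rho> x) * ?u x)) ?u (\<lambda>x. \<epsilon> * (\<beta> * vr \<Lambda> x))"
    by (subst sl_sys_rescale, use e in simp)
       (rule sl_sys_cong[OF sl_sys_scale[OF sys_right[of \<Lambda>], of \<beta>]], use e in \<open>auto simp: glue_def\<close>)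
  show ?thesis
    unfolding problem_P_def
  proof (intro conjI)
    show "sl_solution k {a..0} (\<lambda>x. - (inverse (of_real \<epsilon>) * (\<epsilon> * \<Lambda>) * of_real (r x) * ?u x)) ?u"
      by (rule sl_sys_imp_solution[OF s1 a0 posk])
    show "sl_solution (\<lambda>x. \<epsilon> * \<kappa> x) {0..b} (\<lambda>x. - (\<epsilon> * \<Lambda> * of_real (\<rho> x) * ?u x)) ?u"
      by (rule sl_sys_imp_solution[OF s2 b0]) (use e pos\<kappa> in auto)
    show "k 0 *\<^sub>R deriv_within ?u {a..0} 0 = \<epsilon> *\<^sub>R \<kappa> 0 *\<^sub>R deriv_within ?u {0..b} 0"
      using sl_sys_deriv_within[OF s1 a0, of 0] sl_sys_deriv_within[OF s2 b0, of 0] a0 b0 posk[of 0] pos\<kappa>[of 0] e assms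
      by simp
    show "?u a = 0" "?u b = 0" using a0 b0 by (auto simp: glue_def)
  qed
qed

text \<open>The two matching conditions at \<open>0\<close> are a homogeneous linear system for the coefficients \<open>\<alpha>\<close> and
  \<open>\<beta>\<close> of the two halves, with determinant \<open>D \<epsilon> (l / \<epsilon>)\<close> up to sign.\<close>

lemma spectrum_P_iff:
  assumes e: "\<epsilon> > 0"
  shows "complex_of_real l \<in> spectrum_P a b k r \<kappa> \<rho> \<epsilon> \<longleftrightarrow> D \<epsilon> (l / \<epsilon>) = 0"
proof
  define \<Lambda> where "\<Lambda> = l / \<epsilon>"
  have l: "l = \<epsilon> * \<Lambda>" using e by (simp add: \<Lambda>_def)
  assume "complex_of_real l \<in> spectrum_P a b k r \<kappa> \<rho> \<epsilon>"
  then obtain w :: "real \<Rightarrow> complex" and x where w: "problem_P a b k r \<kappa> \<rho> \<epsilon> (of_real l) w"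
    and x: "x \<in> {a..b}" "w x \<noteq> 0"
    by (auto simp: spectrum_P_def)
  have "\<exists>u :: real \<Rightarrow> real. problem_P a b k r \<kappa> \<rho> \<epsilon> (of_real l) u \<and> u x \<noteq> 0"
  proof (cases "Re (w x) = 0")
    case True
    then have "Im (w x) \<noteq> 0" using x by (simp add: complex_eq_iff)
    then show ?thesis using problem_P_linear[OF bounded_linear_Im w a0 b0] by (intro exI[of _ "\<lambda>x. Im (w x)"]) auto
  next
    case False
    then show ?thesis using problem_P_linear[OF bounded_linear_Re w a0 b0] by (intro exI[of _ "\<lambda>x. Re (w x)"]) auto
  qed
  then obtain u :: "real \<Rightarrow> real" where u: "problem_P a b k r \<kappa> \<rho> \<epsilon> (\<epsilon> * \<Lambda>) u" "u x \<noteq> 0"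
    by (auto simp: l)
  define \<alpha> where "\<alpha> = k a * deriv_within u {a..0} a"
  define \<beta> where "\<beta> = \<kappa> b * deriv_within u {0..b} b"
  note c = problem_P_cases[OF u(1) e, folded \<alpha>_def \<beta>_def]
  have nz: "\<alpha> \<noteq> 0 \<or> \<beta> \<noteq> 0"
  proof (rule ccontr)
    assume "\<not> ?thesis"
    then have "u x = 0" using c(1)[of x] c(2)[of x] x by (cases "x \<le> 0") auto
    then show False using u by simp
  qed
  have i: "\<alpha> * left.U \<Lambda> 0 = - (\<beta> * right.U \<Lambda> 0)" "\<alpha> * left.V \<Lambda> 0 = \<epsilon> * (\<beta> * right.V \<Lambda> 0)"
    using c(3,4) by (simp_all add: ur_def vr_def)
  have "\<alpha> * D \<epsilon> \<Lambda> = (\<alpha> * left.V \<Lambda> 0) * right.U \<Lambda> 0 + \<epsilon> * ((\<alpha> * left.U \<Lambda> 0) * right.V \<Lambda> 0)"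
    by (simp add: D_def algebra_simps)
  also have "\<dots> = 0" unfolding i by (simp add: algebra_simps)
  finally have 1: "\<alpha> * D \<epsilon> \<Lambda> = 0" .
  have "\<beta> * D \<epsilon> \<Lambda> = left.V \<Lambda> 0 * (\<beta> * right.U \<Lambda> 0) + (\<epsilon> * (\<beta> * right.V \<Lambda> 0)) * left.U \<Lambda> 0"
    by (simp add: D_def algebra_simps)
  also have "\<dots> = - left.V \<Lambda> 0 * (\<alpha> * left.U \<Lambda> 0) + (\<alpha> * left.V \<Lambda> 0) * left.U \<Lambda> 0"
    unfolding i by simp
  finally have "\<beta> * D \<epsilon> \<Lambda> = 0" by (simp add: algebra_simps)
  with 1 nz show "D \<epsilon> (l / \<epsilon>) = 0" by (auto simp: \<Lambda>_def)
next
  define \<Lambda> where "\<Lambda> = l / \<epsilon>"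
  have l: "l = \<epsilon> * \<Lambda>" using e by (simp add: \<Lambda>_def)
  assume "D \<epsilon> (l / \<epsilon>) = 0"
  then have D: "D \<epsilon> \<Lambda> = 0" by (simp add: \<Lambda>_def)
  \<comment> \<open>The first row of the system is \<open>(left.U, right.U)\<close>. If \<open>right.U \<noteq> 0\<close>, its kernel is explicit;
    otherwise \<open>D = 0\<close> makes the whole row zero, and the kernel of the second row is taken.\<close>
  have "\<exists>\<alpha> \<beta>. (\<alpha> \<noteq> 0 \<or> \<beta> \<noteq> 0) \<and> \<alpha> * left.U \<Lambda> 0 = \<beta> * ur \<Lambda> 0 \<and> \<alpha> * left.V \<Lambda> 0 = \<epsilon> * (\<beta> * vr \<Lambda> 0)"
  proof (cases "right.U \<Lambda> 0 = 0")
    case False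
    then show ?thesis using D by (intro exI[of _ "right.U \<Lambda> 0"] exI[of _ "- left.U \<Lambda> 0"])
       (auto simp: ur_def vr_def D_def algebra_simps)
  next
    case True
    then have V: "right.V \<Lambda> 0 \<noteq> 0" using right.UV_not_both_zero[of \<Lambda>] by auto
    then have "left.U \<Lambda> 0 = 0" using D True e by (simp add: D_def)
    then show ?thesis using V True e by (intro exI[of _ "\<epsilon> * right.V \<Lambda> 0"] exI[of _ "left.V \<Lambda> 0"])
       (auto simp: ur_def vr_def)
  qed
  then obtain \<alpha> \<beta> where ab: "\<alpha> \<noteq> 0 \<or> \<beta> \<noteq> 0" "\<alpha> * left.U \<Lambda> 0 = \<beta> * ur \<Lambda> 0" "\<alpha> * left.V \<Lambda> 0 = \<epsilon> * (\<beta> * vr \<Lambda> 0)"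
    by blast
  define u where "u = glue (\<lambda>x. \<alpha> * left.U \<Lambda> x) (\<lambda>x. \<beta> * ur \<Lambda> x)"
  have P: "problem_P a b k r \<kappa> \<rho> \<epsilon> (of_real l) u"
    using problem_P_glue[OF e ab(2,3)] by (simp add: u_def l)
  have "\<exists>x\<in>{a..b}. u x \<noteq> 0"
  proof (cases "\<alpha> = 0")
    case True
    then have "\<beta> \<noteq> 0" using ab by simp
    obtain x where x: "x \<in> {-b..0}" "right.U \<Lambda> x \<noteq> 0" using right.U_nontrivial[of \<Lambda>] by blast
    then show ?thesis using \<open>\<beta> \<noteq> 0\<close> a0 by (intro bexI[of _ "- x"]) (auto simp: u_def glue_def ur_def)
  next
    case False
    obtain x where x: "x \<in> {a..0}" "left.U \<Lambda> x \<noteq> 0" using left.U_nontrivial[of \<Lambda>] by blast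
    then show ?thesis using False b0 ab(2) by (intro bexI[of _ x]) (auto simp: u_def glue_def)
  qed
  then show "complex_of_real l \<in> spectrum_P a b k r \<kappa> \<rho> \<epsilon>"
    using problem_P_linear[OF bounded_linear_of_real P a0 b0]
    unfolding spectrum_P_def by force
qed

section \<open>Numbering of the scaled eigenvalues\<close>

abbreviation n1 :: "real \<Rightarrow> nat" where "n1 \<equiv> nzeros (\<lambda>\<Lambda>. left.V \<Lambda> 0)"
abbreviation n2 :: "real \<Rightarrow> nat" where "n2 \<equiv> nzeros (\<lambda>\<Lambda>. right.U \<Lambda> 0)"

lemma rotates_left: obtains \<theta> where "rotates_with \<theta> (\<lambda>\<Lambda>. left.V \<Lambda> 0) (\<lambda>\<Lambda>. left.U \<Lambda> 0)"
  by (rule angle_lift[OF left.endpoint_deriv(3,1,4,2)])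
     (use left.endpoint_wronskian_pos left.U_V_pos in \<open>auto simp: algebra_simps\<close>)

lemma rotates_right:
  assumes e: "\<epsilon> > 0"
  obtains \<theta> where "rotates_with \<theta> (\<lambda>\<Lambda>. right.U \<Lambda> 0) (\<lambda>\<Lambda>. - \<epsilon> * right.V \<Lambda> 0)"
proof (rule angle_lift)
  show "((\<lambda>\<Lambda>. right.U \<Lambda> 0) has_real_derivative right.U' x) (at x)" for x by (rule right.endpoint_deriv)
  show "((\<lambda>\<Lambda>. - \<epsilon> * right.V \<Lambda> 0) has_real_derivative - \<epsilon> * right.V' x) (at x)" for x
    by (intro DERIV_cmult right.endpoint_deriv)
  show "isCont right.U' x" for x by (rule right.endpoint_deriv)
  show "isCont (\<lambda>x. - \<epsilon> * right.V' x) x" for x by (intro continuous_intros right.endpoint_deriv)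
  show "0 < right.U x 0 * (- \<epsilon> * right.V' x) - right.U' x * (- \<epsilon> * right.V x 0)" for x
    using mult_pos_pos[OF e right.endpoint_wronskian_pos[of x]] by (simp add: algebra_simps)
  show "0 < right.U 0 0" by (rule right.U_V_pos) simp
qed

lemma rotates_start:
  assumes "rotates_with \<theta> f g" "f 0 > 0"
  shows "g 0 > 0 \<Longrightarrow> \<theta> 0 > 0" "g 0 < 0 \<Longrightarrow> \<theta> 0 < 0"
proof -
  obtain R where R: "f 0 = R * cos (\<theta> 0)" "g 0 = R * sin (\<theta> 0)" and t: "\<bar>\<theta> 0\<bar> < pi / 2"
    using assms(1) unfolding rotates_with_def by (metis order_refl)
  have "cos (\<theta> 0) > 0" using t by (intro cos_gt_zero_pi) auto
  then have R0: "R > 0" using R(1) assms(2) by (simp add: zero_less_mult_iff)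
  show "\<theta> 0 > 0" if "g 0 > 0"
  proof (rule ccontr)
    assume "\<not> \<theta> 0 > 0"
    then have "sin (- \<theta> 0) \<ge> 0" using t by (intro sin_ge_zero) auto
    then show False using R(2) R0 that by (simp add: zero_less_mult_iff)
  qed
  show "\<theta> 0 < 0" if "g 0 < 0"
  proof (rule ccontr)
    assume "\<not> \<theta> 0 < 0"
    then have "sin (\<theta> 0) \<ge> 0" using t by (intro sin_ge_zero) auto
    then show False using R(2) R0 that by (simp add: mult_less_0_iff)
  qed
qed

text \<open>At \<open>\<Lambda> = 0\<close> the curve \<open>(left.V, left.U)\<close> lies in the first quadrant and \<open>(right.U, - \<epsilon> right.V)\<close>
  in the fourth, so the two starting angles have opposite signs.\<close>

lemma start_angle:
  assumes r1: "rotates_with \<theta>1 (\<lambda>\<Lambda>. left.V \<Lambda> 0) (\<lambda>\<Lambda>. left.U \<Lambda> 0)"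
    and r2: "rotates_with \<theta>2 (\<lambda>\<Lambda>. right.U \<Lambda> 0) (\<lambda>\<Lambda>. - \<epsilon> * right.V \<Lambda> 0)" and e: "\<epsilon> > 0"
  shows "\<bar>\<theta>1 0 + \<theta>2 0\<bar> < pi / 2"
proof -
  have "\<theta>1 0 > 0" using rotates_start(1)[OF r1] left.U_V_pos[of 0] by simp
  moreover have "\<theta>2 0 < 0" using rotates_start(2)[OF r2] right.U_V_pos[of 0] e by simp
  moreover have "\<bar>\<theta>1 0\<bar> < pi / 2" "\<bar>\<theta>2 0\<bar> < pi / 2" using r1 r2 by (auto simp: rotates_with_def)
  ultimately show ?thesis by linarith
qed

text \<open>\<open>D \<epsilon>\<close> is the real part of \<open>(left.V + \<i> left.U) (right.U - \<i> \<epsilon> right.V)\<close>.\<close>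

lemma D_eq: "D \<epsilon> = (\<lambda>\<Lambda>. left.V \<Lambda> 0 * right.U \<Lambda> 0 - left.U \<Lambda> 0 * (- \<epsilon> * right.V \<Lambda> 0))"
  by (rule ext) (simp add: D_def)

lemma zeros_finite:
  assumes "X \<ge> 0"
  shows "finite {x \<in> {0..X}. left.V x 0 = 0}" "finite {x \<in> {0..X}. right.U x 0 = 0}"
    "\<epsilon> > 0 \<Longrightarrow> finite {x \<in> {0..X}. D \<epsilon> x = 0}"
proof -
  obtain \<theta>1 where r1: "rotates_with \<theta>1 (\<lambda>\<Lambda>. left.V \<Lambda> 0) (\<lambda>\<Lambda>. left.U \<Lambda> 0)" by (rule rotates_left)
  show "finite {x \<in> {0..X}. left.V x 0 = 0}" using rotates_zeros[OF r1 assms] by simp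
  obtain \<theta>2 where r2: "rotates_with \<theta>2 (\<lambda>\<Lambda>. right.U \<Lambda> 0) (\<lambda>\<Lambda>. - 1 * right.V \<Lambda> 0)"
    by (rule rotates_right[of 1]) simp_all
  show "finite {x \<in> {0..X}. right.U x 0 = 0}" using rotates_zeros[OF r2 assms] by simp
  assume e: "\<epsilon> > 0"
  obtain \<theta>2 where r2: "rotates_with \<theta>2 (\<lambda>\<Lambda>. right.U \<Lambda> 0) (\<lambda>\<Lambda>. - \<epsilon> * right.V \<Lambda> 0)"
    by (rule rotates_right[OF e])
  show "finite {x \<in> {0..X}. D \<epsilon> x = 0}"
    unfolding D_eq using rotates_product_zeros(2)[OF r1 r2 assms start_angle[OF r1 r2 e]] .
qed

text \<open>Common zeros of \<open>left.V\<close> and \<open>right.V\<close> are zeros of every \<open>D \<epsilon>\<close>. There the count is exact for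
  all \<open>\<epsilon>\<close>, not just for small ones.\<close>

lemma D_zeros_at_common:
  assumes "X \<ge> 0" "left.V X 0 = 0" "right.V X 0 = 0" and e: "\<epsilon> > 0"
  shows "nzeros (D \<epsilon>) X = n1 X + n2 X"
proof -
  obtain \<theta>1 where r1: "rotates_with \<theta>1 (\<lambda>\<Lambda>. left.V \<Lambda> 0) (\<lambda>\<Lambda>. left.U \<Lambda> 0)" by (rule rotates_left)
  obtain \<theta>2 where r2: "rotates_with \<theta>2 (\<lambda>\<Lambda>. right.U \<Lambda> 0) (\<lambda>\<Lambda>. - \<epsilon> * right.V \<Lambda> 0)"
    by (rule rotates_right[OF e])
  show ?thesis unfolding D_eq
    by (rule product_zeros_at_common[OF r1 r2 assms(1) start_angle[OF r1 r2 e]]) (use assms in auto)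
qed

text \<open>As \<open>\<epsilon>\<close> tends to \<open>0\<close>, the curve \<open>(right.U, - \<epsilon> right.V)\<close> flattens onto the horizontal axis.\<close>

lemma D_zeros_near:
  assumes X: "X \<ge> 0" and p: "left.V X 0 \<noteq> 0" and \<Phi>: "right.U X 0 \<noteq> 0"
  shows "\<forall>\<^sub>F \<epsilon> in at_right 0. nzeros (D \<epsilon>) X = n1 X + n2 X"
proof -
  obtain \<theta>1 where r1: "rotates_with \<theta>1 (\<lambda>\<Lambda>. left.V \<Lambda> 0) (\<lambda>\<Lambda>. left.U \<Lambda> 0)" by (rule rotates_left)
  obtain \<delta> where \<delta>: "\<delta> > 0" "\<And>\<theta>2 f2 g2. rotates_with \<theta>2 f2 g2 \<Longrightarrow> \<bar>\<theta>1 0 + \<theta>2 0\<bar> < pi / 2 \<Longrightarrow> f2 X \<noteq> 0 \<Longrightarrow> \<bar>g2 X / f2 X\<bar> < \<delta>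
       \<Longrightarrow> nzeros (\<lambda>x. left.V x 0 * f2 x - left.U x 0 * g2 x) X = n1 X + nzeros f2 X"
    using product_zeros_near[OF r1 X p] by blast
  have "((\<lambda>\<epsilon>. \<bar>- \<epsilon> * right.V X 0 / right.U X 0\<bar>) \<longlongrightarrow> \<bar>- 0 * right.V X 0 / right.U X 0\<bar>) (at_right 0)"
    by (intro tendsto_intros) (use \<Phi> in auto)
  then have "\<forall>\<^sub>F \<epsilon> in at_right 0. \<bar>- \<epsilon> * right.V X 0 / right.U X 0\<bar> < \<delta>"
    by (rule order_tendstoD) (use \<delta> in simp)
  moreover have "\<forall>\<^sub>F \<epsilon> :: real in at_right 0. \<epsilon> > 0" by (simp add: eventually_at_right_less)
  ultimately show ?thesis
  proof eventually_elim
    case (elim \<epsilon>)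
    obtain \<theta>2 where r2: "rotates_with \<theta>2 (\<lambda>\<Lambda>. right.U \<Lambda> 0) (\<lambda>\<Lambda>. - \<epsilon> * right.V \<Lambda> 0)"
      by (rule rotates_right[OF elim(2)])
    show ?case unfolding D_eq
      by (rule \<delta>(2)[OF r2 start_angle[OF r1 r2 elim(2)] \<Phi>]) (use elim in simp)
  qed
qed

text \<open>The scaled eigenvalues \<open>l i / \<epsilon>\<close> are exactly the zeros of \<open>D \<epsilon>\<close>, in increasing order and all
  positive; so the index of an eigenvalue is the number of zeros up to it.\<close>

lemma enumerated_zero_count:
  assumes en: "enumerates_spectrum_P a b k r \<kappa> \<rho> \<epsilon> l" and e: "\<epsilon> > 0"
  shows "\<And>i. i \<ge> 1 \<Longrightarrow> D \<epsilon> (l i / \<epsilon>) = 0" "\<And>i. i \<ge> 1 \<Longrightarrow> l i > 0"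
    "\<And>x. D \<epsilon> x = 0 \<Longrightarrow> \<exists>i\<ge>1. x = l i / \<epsilon>"
    "\<And>i. i \<ge> 1 \<Longrightarrow> nzeros (D \<epsilon>) (l i / \<epsilon>) = i"
    "\<And>i m. 1 \<le> i \<Longrightarrow> i < m \<Longrightarrow> l i < l m"
proof -
  have sp: "(\<lambda>i. complex_of_real (l i)) ` {1..} = spectrum_P a b k r \<kappa> \<rho> \<epsilon>"
    and l1: "0 < l 1" and m: "strict_mono_on {1..} l"
    using en by (auto simp: enumerates_spectrum_P_def)
  show mono: "l i < l m" if "1 \<le> i" "i < m" for i m
    using strict_mono_onD[OF m, of i m] that by simp
  show pos: "l i > 0" if "i \<ge> 1" for i
    using that l1 mono[of 1 i] by (cases "i = 1") auto
  show z: "D \<epsilon> (l i / \<epsilon>) = 0" if "i \<ge> 1" for i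
    using spectrum_P_iff[OF e, of "l i"] sp that by auto
  show ex: "\<exists>i\<ge>1. x = l i / \<epsilon>" if "D \<epsilon> x = 0" for x
  proof -
    have "complex_of_real (\<epsilon> * x) \<in> spectrum_P a b k r \<kappa> \<rho> \<epsilon>"
      using spectrum_P_iff[OF e, of "\<epsilon> * x"] that e by simp
    then obtain i where "i \<ge> 1" "complex_of_real (\<epsilon> * x) = complex_of_real (l i)"
      unfolding sp[symmetric] by auto
    then have "\<epsilon> * x = l i" "i \<ge> 1" by (auto simp del: of_real_mult)
    then show ?thesis using e by (intro exI[of _ i]) (simp add: eq_divide_eq mult.commute)
  qed
  show "nzeros (D \<epsilon>) (l i / \<epsilon>) = i" if i: "i \<ge> 1" for i
  proof -
    have "{x \<in> {0..l i / \<epsilon>}. D \<epsilon> x = 0} = (\<lambda>m. l m / \<epsilon>) ` {1..i}"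
    proof (intro equalityI subsetI)
      fix x assume x: "x \<in> {x \<in> {0..l i / \<epsilon>}. D \<epsilon> x = 0}"
      then obtain m where m: "m \<ge> 1" "x = l m / \<epsilon>" using ex by blast
      have "m \<le> i"
      proof (rule ccontr)
        assume "\<not> m \<le> i"
        then have "l i < l m" using mono i by simp
        then show False using x m e by (simp add: divide_right_mono field_simps)
      qed
      then show "x \<in> (\<lambda>m. l m / \<epsilon>) ` {1..i}" using m by auto
    next
      fix x assume "x \<in> (\<lambda>m. l m / \<epsilon>) ` {1..i}"
      then obtain m where m: "1 \<le> m" "m \<le> i" "x = l m / \<epsilon>" by auto
      have "l m \<le> l i" using mono[of m i] m by (cases "m = i") auto
      then show "x \<in> {x \<in> {0..l i / \<epsilon>}. D \<epsilon> x = 0}"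
        using m z pos[of m] e by (auto simp: divide_right_mono)
    qed
    moreover have "inj_on (\<lambda>m. l m / \<epsilon>) {1..i}"
      using m e by (auto simp: inj_on_def strict_mono_on_eqD[of "{1..}" l])
    ultimately show ?thesis by (simp add: card_image)
  qed
qed

lemma nzeros_mono:
  assumes "X \<le> Y" "finite {x \<in> {0..Y}. f x = 0}"
  shows "nzeros f X \<le> nzeros f Y"
  using assms by (intro card_mono) auto

text \<open>\<open>\<epsilon> \<mu>\<close> is an eigenvalue for every \<open>\<epsilon>\<close>, and the zero count at \<open>\<mu>\<close> identifies its index.\<close>

lemma scaled_eigenvalue_exact:
  assumes en: "enumerates_spectrum_P a b k r \<kappa> \<rho> \<epsilon> l" and e: "\<epsilon> > 0" and "\<mu> \<ge> 0"
    and z: "left.V \<mu> 0 = 0" "right.V \<mu> 0 = 0" and j: "n1 \<mu> + n2 \<mu> = j"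
  shows "l j = \<epsilon> * \<mu>"
proof -
  note c = enumerated_zero_count[OF en e]
  have "D \<epsilon> \<mu> = 0" using z by (simp add: D_def)
  then obtain i where i: "i \<ge> 1" "\<mu> = l i / \<epsilon>" using c(3) by blast
  have "i = j" using c(4)[OF i(1)] D_zeros_at_common[OF \<open>\<mu> \<ge> 0\<close> z e] j i(2) by simp
  then show ?thesis using i e by simp
qed

text \<open>Choose \<open>\<delta>\<close> such that \<open>\<mu>\<close> is the only limit eigenvalue in \<open>{\<mu> - \<delta>..\<mu> + \<delta>}\<close>. For small \<open>\<epsilon>\<close> the
  function \<open>D \<epsilon>\<close> has \<open>j\<close> zeros up to \<open>\<mu> + \<delta>\<close> but only \<open>j - 1\<close> up to \<open>\<mu> - \<delta>\<close>, so its \<open>j\<close>-th zero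
  lies between.\<close>

lemma scaled_eigenvalue_tendsto:
  assumes en: "\<And>\<epsilon>. \<epsilon> > 0 \<Longrightarrow> enumerates_spectrum_P a b k r \<kappa> \<rho> \<epsilon> (lam \<epsilon>)" and \<mu>: "\<mu> > 0"
    and z: "left.V \<mu> 0 = 0" and \<Phi>: "right.U \<mu> 0 \<noteq> 0" and j: "n1 \<mu> + n2 \<mu> = j" "j \<ge> 1"
  shows "((\<lambda>\<epsilon>. lam \<epsilon> j / \<epsilon>) \<longlongrightarrow> \<mu>) (at_right 0)"
proof (rule tendstoI)
  fix e :: real assume e: "e > 0"
  define F where "F = {x \<in> {0..\<mu>+1}. left.V x 0 = 0} \<union> {x \<in> {0..\<mu>+1}. right.U x 0 = 0}"
  have "finite F" using zeros_finite[of "\<mu> + 1"] \<mu> by (simp add: F_def)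
  then obtain d where d: "d > 0" "\<And>x. x \<in> F \<Longrightarrow> x \<noteq> \<mu> \<Longrightarrow> d \<le> dist \<mu> x"
    using finite_set_avoid[of F \<mu>] by blast
  define \<delta> where "\<delta> = min (min (e / 2) (d / 2)) (min (1 / 2) (\<mu> / 2))"
  have \<delta>: "0 < \<delta>" "\<delta> < e" "\<delta> < d" "\<delta> < 1" "\<delta> < \<mu>" using e d \<mu> by (auto simp: \<delta>_def)
  have nz: "left.V x 0 \<noteq> 0" "right.U x 0 \<noteq> 0" if "\<bar>x - \<mu>\<bar> \<le> \<delta>" "x \<noteq> \<mu>" for x
  proof -
    have "x \<notin> F" using d(2)[of x] that \<delta> by (auto simp: dist_real_def)
    moreover have "x \<in> {0..\<mu>+1}" using that \<delta> by auto
    ultimately show "left.V x 0 \<noteq> 0" "right.U x 0 \<noteq> 0" by (auto simp: F_def)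
  qed
  have nz2: "right.U x 0 \<noteq> 0" if "\<bar>x - \<mu>\<bar> \<le> \<delta>" for x
    using nz(2)[OF that] \<Phi> by (cases "x = \<mu>") auto
  have up: "n1 (\<mu> + \<delta>) = n1 \<mu>" "n2 (\<mu> + \<delta>) = n2 \<mu>"
  proof -
    have "x \<le> \<mu>" if "left.V x 0 = 0 \<or> right.U x 0 = 0" "x \<le> \<mu> + \<delta>" for x
      using nz[of x] that by force
    then have "{x \<in> {0..\<mu>+\<delta>}. left.V x 0 = 0} = {x \<in> {0..\<mu>}. left.V x 0 = 0}"
      "{x \<in> {0..\<mu>+\<delta>}. right.U x 0 = 0} = {x \<in> {0..\<mu>}. right.U x 0 = 0}"
      using \<delta> by auto
    then show "n1 (\<mu> + \<delta>) = n1 \<mu>" "n2 (\<mu> + \<delta>) = n2 \<mu>" by simp_all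
  qed
  have fin: "finite {x \<in> {0..\<mu>}. left.V x 0 = 0}" using zeros_finite[of \<mu>] \<mu> by simp
  have low: "left.V x 0 \<noteq> 0" "right.U x 0 \<noteq> 0" if "\<mu> - \<delta> < x" "x < \<mu>" for x
    using nz[of x] that by auto
  have low1: "x \<le> \<mu> - \<delta>" if "left.V x 0 = 0" "x \<le> \<mu>" "x \<noteq> \<mu>" for x using low(1)[of x] that by force
  have low2: "x \<le> \<mu> - \<delta>" if "right.U x 0 = 0" "x \<le> \<mu>" for x
    using low(2)[of x] that \<Phi> by (cases "x = \<mu>") force+
  have "{x \<in> {0..\<mu>-\<delta>}. left.V x 0 = 0} = {x \<in> {0..\<mu>}. left.V x 0 = 0} - {\<mu>}"
    using \<delta> low1 by auto
  then have lo1: "n1 (\<mu> - \<delta>) = n1 \<mu> - 1" using fin z \<mu> by (simp add: card_Diff_singleton)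
  have lo2: "n2 (\<mu> - \<delta>) = n2 \<mu>"
  proof -
    have "{x \<in> {0..\<mu>-\<delta>}. right.U x 0 = 0} = {x \<in> {0..\<mu>}. right.U x 0 = 0}"
      using \<delta> low2 by auto
    then show ?thesis by simp
  qed
  have n1pos: "n1 \<mu> \<ge> 1"
    using fin z \<mu> card_0_eq[OF fin] by (auto simp: Suc_le_eq card_gt_0_iff)
  have E1: "\<forall>\<^sub>F \<epsilon> in at_right 0. nzeros (D \<epsilon>) (\<mu> + \<delta>) = n1 (\<mu> + \<delta>) + n2 (\<mu> + \<delta>)"
    by (rule D_zeros_near) (use nz \<delta> \<mu> in auto)
  have E2: "\<forall>\<^sub>F \<epsilon> in at_right 0. nzeros (D \<epsilon>) (\<mu> - \<delta>) = n1 (\<mu> - \<delta>) + n2 (\<mu> - \<delta>)"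
    by (rule D_zeros_near) (use nz \<delta> \<mu> in auto)
  have "\<forall>\<^sub>F \<epsilon> :: real in at_right 0. \<epsilon> > 0" by (simp add: eventually_at_right_less)
  with E1 E2 show "\<forall>\<^sub>F \<epsilon> in at_right 0. dist (lam \<epsilon> j / \<epsilon>) \<mu> < e"
  proof eventually_elim
    case (elim \<epsilon>)
    note c = enumerated_zero_count[OF en[OF elim(3)] elim(3)]
    define L where "L = lam \<epsilon> j / \<epsilon>"
    have nL: "nzeros (D \<epsilon>) L = j" using c(4)[OF j(2)] by (simp add: L_def)
    have DL: "D \<epsilon> L = 0" using c(1)[OF j(2)] by (simp add: L_def)
    have Lpos: "L > 0" using c(2)[OF j(2)] elim(3) by (simp add: L_def)
    have 1: "nzeros (D \<epsilon>) (\<mu> + \<delta>) = j" using elim(1) up j by simp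
    have 2: "nzeros (D \<epsilon>) (\<mu> - \<delta>) < j" using elim(2) lo1 lo2 j n1pos by simp
    have "\<mu> - \<delta> < L"
    proof (rule ccontr)
      assume "\<not> \<mu> - \<delta> < L"
      then have "nzeros (D \<epsilon>) L \<le> nzeros (D \<epsilon>) (\<mu> - \<delta>)"
        using zeros_finite(3)[of "\<mu> - \<delta>" \<epsilon>] \<delta> elim(3) by (intro nzeros_mono) auto
      then show False using 2 nL by simp
    qed
    moreover have "L \<le> \<mu> + \<delta>"
    proof (rule ccontr)
      assume L: "\<not> L \<le> \<mu> + \<delta>"
      have fL: "finite {x \<in> {0..L}. D \<epsilon> x = 0}" using zeros_finite(3)[of L \<epsilon>] Lpos elim(3) by simp
      have "{x \<in> {0..\<mu>+\<delta>}. D \<epsilon> x = 0} \<subset> {x \<in> {0..L}. D \<epsilon> x = 0}"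
      proof (rule psubsetI)
        show "{x \<in> {0..\<mu>+\<delta>}. D \<epsilon> x = 0} \<subseteq> {x \<in> {0..L}. D \<epsilon> x = 0}" using L by auto
        have "L \<in> {x \<in> {0..L}. D \<epsilon> x = 0}" "L \<notin> {x \<in> {0..\<mu>+\<delta>}. D \<epsilon> x = 0}"
          using DL Lpos L by auto
        then show "{x \<in> {0..\<mu>+\<delta>}. D \<epsilon> x = 0} \<noteq> {x \<in> {0..L}. D \<epsilon> x = 0}" by metis
      qed
      from psubset_card_mono[OF fL this] show False using 1 nL by simp
    qed
    ultimately show ?case using \<delta>(2) by (simp add: L_def[symmetric] dist_real_def abs_less_iff)
  qed
qed

end

section \<open>Solutions in the Sobolev space are classical\<close>

text \<open>Lebesgue differentiation in one dimension. The averages over \<open>{x..x + h}\<close> converge almost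
  everywhere; the same statement for the reflected function covers \<open>{x - h..x}\<close>.\<close>

lemma indefinite_integral_ae_derivative:
  fixes g :: "real \<Rightarrow> 'a::euclidean_space"
  assumes g: "g integrable_on {c..d}"
  obtains N where "negligible N"
    "\<And>x. x \<in> {c..d} \<Longrightarrow> x \<notin> N \<Longrightarrow>
       ((\<lambda>x. integral {c..x} g) has_vector_derivative g x) (at x within {c..d})"
proof -
  \<comment> \<open>Extension by zero makes the averages at the end points meaningful.\<close>
  define G where "G = (\<lambda>x. if x \<in> {c..d} then g x else 0)"
  have Gint: "G integrable_on cbox l u" for l u
  proof -
    have "g integrable_on {c..d} \<inter> {l..u}"
      using g by (simp add: integrable_on_subinterval)
    then show ?thesis unfolding G_def using integrable_restrict_Int[of "{c..d}" g "{l..u}"] by simp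
  qed
  have Gint': "(\<lambda>x. G (- x)) integrable_on cbox l u" for l u
    using Gint[of "-u" "-l"] integrable_reflect[of G "-l" "-u"] by simp
  obtain N1 where N1: "negligible N1" "\<And>x e. x \<notin> N1 \<Longrightarrow> 0 < e \<Longrightarrow>
     \<exists>\<delta>>0. \<forall>h. 0 < h \<and> h < \<delta> \<longrightarrow> norm (integral (cbox x (x + h *\<^sub>R One)) G /\<^sub>R h ^ DIM(real) - G x) < e"
    using integrable_ccontinuous_explicit[of G] Gint by metis
  obtain N2 where N2: "negligible N2" "\<And>x e. x \<notin> N2 \<Longrightarrow> 0 < e \<Longrightarrow>
     \<exists>\<delta>>0. \<forall>h. 0 < h \<and> h < \<delta> \<longrightarrow> norm (integral (cbox x (x + h *\<^sub>R One)) (\<lambda>x. G (- x)) /\<^sub>R h ^ DIM(real) - G (- x)) < e"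
    using integrable_ccontinuous_explicit[of "\<lambda>x. G (- x)"] Gint' by metis
  define N where "N = N1 \<union> uminus ` N2"
  have "negligible (uminus ` N2)"
    by (rule negligible_differentiable_image_negligible[OF order_refl N2(1)])
       (intro linear_imp_differentiable_on linear_uminus)
  then have "negligible N" using N1 by (simp add: N_def)
  moreover have "((\<lambda>x. integral {c..x} g) has_vector_derivative g x) (at x within {c..d})"
    if x: "x \<in> {c..d}" "x \<notin> N" for x
    unfolding has_vector_derivative_def has_derivative_within_alt
  proof (intro conjI allI impI)
    show "bounded_linear (\<lambda>y. y *\<^sub>R g x)" by (rule bounded_linear_scaleR_left)
    fix e :: real assume e: "0 < e"
    have "- x \<notin> N2" using x by (auto simp: N_def image_iff)
    with N2(2)[of "- x" e] e obtain d2 where d2: "d2 > 0"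
      "\<And>h. 0 < h \<Longrightarrow> h < d2 \<Longrightarrow> norm (integral {- x..- x + h} (\<lambda>x. G (- x)) /\<^sub>R h - G x) < e"
      by auto
    have "x \<notin> N1" using x by (auto simp: N_def)
    with N1(2)[of x e] e obtain d1 where d1: "d1 > 0"
      "\<And>h. 0 < h \<Longrightarrow> h < d1 \<Longrightarrow> norm (integral {x..x + h} G /\<^sub>R h - G x) < e"
      by auto
    have Gx: "G x = g x" using x by (simp add: G_def)
    have comb: "integral {c..y} g - integral {c..y'} g = integral {y'..y} G" if "c \<le> y'" "y' \<le> y" "y \<le> d" for y y'
    proof -
      have "integral {c..y'} g + integral {y'..y} g = integral {c..y} g"
        using that g by (intro Henstock_Kurzweil_Integration.integral_combine) (auto intro: integrable_on_subinterval)
      moreover have "integral {y'..y} g = integral {y'..y} G"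
        using that by (intro integral_cong) (auto simp: G_def)
      ultimately show ?thesis by (simp add: algebra_simps)
    qed
    have scale: "norm (I - h *\<^sub>R v) \<le> e * h" if "norm (I /\<^sub>R h - v) < e" "h > 0" for I v :: 'a and h
    proof -
      have "I - h *\<^sub>R v = h *\<^sub>R (I /\<^sub>R h - v)" using that by (simp add: scaleR_diff_right)
      then have "norm (I - h *\<^sub>R v) = h * norm (I /\<^sub>R h - v)" using that by simp
      also have "\<dots> \<le> h * e" using that by (intro mult_left_mono) auto
      finally show ?thesis by (simp add: mult.commute)
    qed
    show "\<exists>\<delta>>0. \<forall>y\<in>{c..d}. norm (y - x) < \<delta> \<longrightarrow>
         norm (integral {c..y} g - integral {c..x} g - (y - x) *\<^sub>R g x) \<le> e * norm (y - x)"
    proof (intro exI[of _ "min d1 d2"] conjI ballI impI)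
      show "0 < min d1 d2" using d1 d2 by simp
      fix y assume y: "y \<in> {c..d}" "norm (y - x) < min d1 d2"
      consider "y = x" | "y > x" | "y < x" by linarith
      then show "norm (integral {c..y} g - integral {c..x} g - (y - x) *\<^sub>R g x) \<le> e * norm (y - x)"
      proof cases
        case 2
        then show ?thesis using scale[OF d1(2)[of "y - x"]] comb[of x y] x y Gx by auto
      next
        case 3
        have "integral {- x..- x + (x - y)} (\<lambda>x. G (- x)) = integral {y..x} G"
          using integral_reflect_real[of x y G] by simp
        then have *: "norm (integral {y..x} G - (x - y) *\<^sub>R G x) \<le> e * (x - y)"
          using scale[OF d2(2)[of "x - y"]] 3 y by auto
        have "integral {c..y} g - integral {c..x} g - (y - x) *\<^sub>R g x = - (integral {y..x} G - (x - y) *\<^sub>R G x)"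
          using comb[of y x] 3 x y Gx by (simp add: algebra_simps)
        then show ?thesis using * 3 by (simp only: norm_minus_cancel) (simp add: abs_if)
      qed simp
    qed
  qed
  ultimately show thesis by (rule that)
qed

lemma L2w_imp_integrable:
  fixes g :: "real \<Rightarrow> 'a::euclidean_space"
  assumes "g \<in> L2w (\<lambda>_. 1) {c..d}"
  shows "g integrable_on {c..d}"
proof (rule measurable_bounded_by_integrable_imp_integrable)
  show "g \<in> borel_measurable (lebesgue_on {c..d})" using assms by (simp add: L2w_def)
  show "(\<lambda>x. 1 + 1 * (norm (g x))\<^sup>2) integrable_on {c..d}"
    using assms by (intro integrable_add) (auto simp: L2w_def)
  fix x
  have "2 * norm (g x) \<le> 1 + (norm (g x))\<^sup>2"
    using sum_squares_bound[of 1 "norm (g x)"] by simp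
  then show "norm (g x) \<le> 1 + 1 * (norm (g x))\<^sup>2" using norm_ge_zero[of "g x"] by linarith
qed auto

lemma continuous_imp_L2w:
  fixes g :: "real \<Rightarrow> 'a::euclidean_space"
  assumes "continuous_on {c..d} g"
  shows "g \<in> L2w (\<lambda>_. 1) {c..d}"
  unfolding L2w_def
  using assms by (auto intro!: integrable_continuous_interval continuous_intros
      integrable_imp_measurable)

lemma AE_lebesgue_on_negligible:
  assumes "AE x in lebesgue_on {c..d}. P x"
  obtains N where "negligible N" "\<And>x::real. x \<in> {c..d} \<Longrightarrow> x \<notin> N \<Longrightarrow> P x"
proof -
  from assms obtain N where N: "{x \<in> space (lebesgue_on {c..d}). \<not> P x} \<subseteq> N"
    "emeasure (lebesgue_on {c..d}) N = 0" "N \<in> sets (lebesgue_on {c..d})"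
    by (rule AE_E)
  have "N \<in> null_sets (lebesgue_on {c..d})" using N by auto
  then have "N \<in> null_sets lebesgue" by (subst (asm) null_sets_restrict_space) auto
  then have "negligible N" by (simp add: negligible_iff_null_sets)
  moreover have "P x" if "x \<in> {c..d}" "x \<notin> N" for x using N(1) that by auto
  ultimately show thesis by (rule that)
qed

text \<open>In \<open>H\<^sup>2\<close> the derivative \<open>v = u'\<close> is the integral of a square integrable density, and the
  equation holds almost everywhere. Solved for the density, the equation says that it equals a
  continuous function \<open>F\<close> almost everywhere; hence \<open>v\<close> is the integral of \<open>F\<close> and the equation
  holds at every point. It is here that \<open>p\<close> must be continuously differentiable.\<close>

lemma H2_weak_solution_imp_classical:
  fixes u :: "real \<Rightarrow> complex"
  assumes cd: "c < d" and dp: "\<And>x. x \<in> {c..d} \<Longrightarrow> (p has_real_derivative p' x) (at x within {c..d})"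
    and cp': "continuous_on {c..d} p'" and contq: "continuous_on {c..d} q"
    and ppos: "\<And>x. x \<in> {c..d} \<Longrightarrow> p x > 0" and qpos: "\<And>x. x \<in> {c..d} \<Longrightarrow> q x > 0"
    and u: "u \<in> H2 c d" and w: "continuous_on {c..d} w"
    and ae: "AE x in lebesgue_on {c..d}. sl_expr p q {c..d} u x - l * u x = w x"
  shows "sl_solution p {c..d} (\<lambda>x. - (of_real (q x) * (l * u x + w x))) u"
proof -
  define v where "v = deriv_within u {c..d}"
  have udiff: "u differentiable (at x within {c..d})" if "x \<in> {c..d}" for x
    using u that by (auto simp: H2_def)
  have contu: "continuous_on {c..d} u"
    using udiff by (auto simp: continuous_on_eq_continuous_within intro: differentiable_imp_continuous_within)
  have contp: "continuous_on {c..d} p" using dp by (rule DERIV_continuous_on)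
  have pnz: "p x \<noteq> 0" if "x \<in> {c..d}" for x using ppos[OF that] by simp
  have "v \<in> H1 c d" using u by (simp add: H2_def v_def)
  then obtain g where g: "g \<in> L2w (\<lambda>_. 1) {c..d}" and v: "\<And>x. x \<in> {c..d} \<Longrightarrow> v x = v c + integral {c..x} g"
    unfolding H1_def by blast
  have gi: "g integrable_on {c..d}" by (rule L2w_imp_integrable[OF g])
  have contv: "continuous_on {c..d} v"
  proof -
    have "continuous_on {c..d} (\<lambda>x. v c + integral {c..x} g)"
      by (intro continuous_intros indefinite_integral_continuous_1 gi)
    then show ?thesis by (rule continuous_on_eq) (rule v[symmetric])
  qed
  define F where "F = (\<lambda>x. - (p' x *\<^sub>R v x + of_real (q x) * (l * u x + w x)) /\<^sub>R p x)"
  have contF: "continuous_on {c..d} F"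
  proof -
    have "continuous_on {c..d} (\<lambda>x. complex_of_real (q x) * (l * u x + w x))"
      using contq contu w by (intro continuous_on_mult continuous_on_of_real continuous_on_add continuous_on_const)
    then have "continuous_on {c..d} (\<lambda>x. p' x *\<^sub>R v x + of_real (q x) * (l * u x + w x))"
      by (intro continuous_on_add continuous_on_scaleR[OF cp' contv])
    moreover have "continuous_on {c..d} (\<lambda>x. inverse (p x))"
      using contp pnz by (intro continuous_on_inverse) auto
    ultimately show ?thesis
      unfolding F_def by (intro continuous_on_scaleR continuous_on_minus)
  qed
  obtain N1 where N1: "negligible N1" "\<And>x. x \<in> {c..d} \<Longrightarrow> x \<notin> N1 \<Longrightarrow>
       ((\<lambda>x. integral {c..x} g) has_vector_derivative g x) (at x within {c..d})"
    using indefinite_integral_ae_derivative[OF gi] by metis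
  obtain N2 where N2: "negligible N2" "\<And>x. x \<in> {c..d} \<Longrightarrow> x \<notin> N2 \<Longrightarrow> sl_expr p q {c..d} u x - l * u x = w x"
    using AE_lebesgue_on_negligible[OF ae] by metis
  have gF: "g x = F x" if x: "x \<in> {c..d} - (N1 \<union> N2)" for x
  proof -
    have xs: "x \<in> {c..d}" using x by auto
    have "((\<lambda>x. v c + integral {c..x} g) has_vector_derivative g x) (at x within {c..d})"
      using N1(2)[of x] x by (auto intro!: derivative_eq_intros)
    then have dv: "(v has_vector_derivative g x) (at x within {c..d})"
      unfolding has_vector_derivative_def by (rule has_derivative_transform[OF xs, rotated]) (rule v)
    have "((\<lambda>t. p t *\<^sub>R v t) has_vector_derivative p x *\<^sub>R g x + p' x *\<^sub>R v x) (at x within {c..d})"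
      by (intro has_vector_derivative_scaleR dp xs dv)
    from deriv_within_eq[OF this cd xs]
    have "sl_expr p q {c..d} u x = - ((1 / q x) *\<^sub>R (p x *\<^sub>R g x + p' x *\<^sub>R v x))"
      by (simp add: sl_expr_def v_def)
    then have "- ((1 / q x) *\<^sub>R (p x *\<^sub>R g x + p' x *\<^sub>R v x)) = l * u x + w x"
      using N2(2)[of x] x by (simp add: algebra_simps)
    then have "q x *\<^sub>R (- ((1 / q x) *\<^sub>R (p x *\<^sub>R g x + p' x *\<^sub>R v x))) = q x *\<^sub>R (l * u x + w x)" by simp
    then have "- (p x *\<^sub>R g x + p' x *\<^sub>R v x) = q x *\<^sub>R (l * u x + w x)"
      using qpos[OF xs] by simp
    then have "p x *\<^sub>R g x = - (p' x *\<^sub>R v x + q x *\<^sub>R (l * u x + w x))"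
      by (simp add: algebra_simps) (metis add.commute add_diff_cancel_right' diff_minus_eq_add minus_add_distrib)
    then have "(p x *\<^sub>R g x) /\<^sub>R p x = F x" by (simp add: F_def scaleR_conv_of_real)
    then show ?thesis using ppos[OF xs] by simp
  qed
  have v': "v x = v c + integral {c..x} F" if "x \<in> {c..d}" for x
  proof -
    have "integral {c..x} g = integral {c..x} F"
      by (rule integral_spike[of "N1 \<union> N2"]) (use N1(1) N2(1) gF that in auto)
    then show ?thesis using v[OF that] by simp
  qed
  have dv: "(v has_vector_derivative F x) (at x within {c..d})" if x: "x \<in> {c..d}" for x
  proof -
    have "((\<lambda>x. v c + integral {c..x} F) has_vector_derivative F x) (at x within {c..d})"
      using integral_has_vector_derivative[OF contF x] by (auto intro!: derivative_eq_intros)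
    then show ?thesis
      unfolding has_vector_derivative_def by (rule has_derivative_transform[OF x, rotated]) (rule v')
  qed
  show ?thesis
    unfolding sl_solution_def
  proof (intro ballI conjI udiff)
    fix x assume x: "x \<in> {c..d}"
    have "((\<lambda>t. p t *\<^sub>R v t) has_vector_derivative p x *\<^sub>R F x + p' x *\<^sub>R v x) (at x within {c..d})"
      by (intro has_vector_derivative_scaleR dp x dv)
    moreover have "p x *\<^sub>R F x + p' x *\<^sub>R v x = - (of_real (q x) * (l * u x + w x))"
      using ppos[OF x] by (simp add: F_def)
    ultimately show "((\<lambda>t. p t *\<^sub>R deriv_within u {c..d} t) has_vector_derivative
         - (of_real (q x) * (l * u x + w x))) (at x within {c..d})" by (simp add: v_def)
  qed
qed

lemma classical_imp_H2_weak_solution: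
  fixes u :: "real \<Rightarrow> complex"
  assumes cd: "c < d" and dp: "\<And>x. x \<in> {c..d} \<Longrightarrow> (p has_real_derivative p' x) (at x within {c..d})"
    and cp': "continuous_on {c..d} p'" and contq: "continuous_on {c..d} q"
    and ppos: "\<And>x. x \<in> {c..d} \<Longrightarrow> p x > 0" and qpos: "\<And>x. x \<in> {c..d} \<Longrightarrow> q x > 0"
    and w: "continuous_on {c..d} w"
    and s: "sl_solution p {c..d} (\<lambda>x. - (of_real (q x) * (l * u x + w x))) u"
  shows "u \<in> H2 c d" "AE x in lebesgue_on {c..d}. sl_expr p q {c..d} u x - l * u x = w x"
proof -
  define v where "v = deriv_within u {c..d}"
  define f where "f = (\<lambda>x. - (of_real (q x) * (l * u x + w x)))"
  have udiff: "u differentiable (at x within {c..d})" if "x \<in> {c..d}" for x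
    using s that by (auto simp: sl_solution_def)
  have contu: "continuous_on {c..d} u"
    using udiff by (auto simp: continuous_on_eq_continuous_within intro: differentiable_imp_continuous_within)
  have contp: "continuous_on {c..d} p" using dp by (rule DERIV_continuous_on)
  have pnz: "p x \<noteq> 0" if "x \<in> {c..d}" for x using ppos[OF that] by simp
  have dpv: "((\<lambda>t. p t *\<^sub>R v t) has_vector_derivative f x) (at x within {c..d})" if "x \<in> {c..d}" for x
    using s that by (auto simp: sl_solution_def v_def f_def)
  have contf: "continuous_on {c..d} f"
    unfolding f_def using contu w contq by (intro continuous_intros)
  have contpv: "continuous_on {c..d} (\<lambda>t. p t *\<^sub>R v t)"
    using dpv by (rule continuous_on_vector_derivative)
  define g where "g = (\<lambda>x. (1 / p x) *\<^sub>R f x + (- p' x / (p x * p x)) *\<^sub>R (p x *\<^sub>R v x))"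
  have contg: "continuous_on {c..d} g"
    unfolding g_def by (intro continuous_intros contpv contp cp' contf) (use pnz in auto)
  have dv: "(v has_vector_derivative g x) (at x within {c..d})" if x: "x \<in> {c..d}" for x
  proof -
    have "((\<lambda>t. 1 / p t) has_real_derivative - p' x / (p x * p x)) (at x within {c..d})"
      using dp[OF x] ppos[OF x] by (auto intro!: derivative_eq_intros)
    then have "((\<lambda>t. (1 / p t) *\<^sub>R (p t *\<^sub>R v t)) has_vector_derivative g x) (at x within {c..d})"
      unfolding g_def by (intro has_vector_derivative_scaleR dpv x)
    then show ?thesis
      unfolding has_vector_derivative_def
      by (rule has_derivative_transform[OF x, rotated]) (use ppos in force)
  qed
  have "v \<in> H1 c d"
    unfolding H1_def
  proof (intro CollectI bexI[of _ g] ballI)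
    show "g \<in> L2w (\<lambda>_. 1) {c..d}" by (rule continuous_imp_L2w[OF contg])
    fix x assume x: "x \<in> {c..d}"
    have "(g has_integral v x - v c) {c..x}"
      using x by (intro fundamental_theorem_of_calculus)
        (auto intro: has_vector_derivative_within_subset[OF dv])
    then show "v x = v c + integral {c..x} g" by (simp add: integral_unique)
  qed
  then show "u \<in> H2 c d" using udiff by (simp add: H2_def v_def)
  have "sl_expr p q {c..d} u x - l * u x = w x" if x: "x \<in> {c..d}" for x
  proof -
    have "deriv_within (\<lambda>t. p t *\<^sub>R v t) {c..d} x = f x" by (rule deriv_within_eq[OF dpv[OF x] cd x])
    then have "sl_expr p q {c..d} u x = - ((1 / q x) *\<^sub>R f x)" by (simp add: sl_expr_def v_def)
    then show ?thesis using qpos[OF x] by (simp add: f_def scaleR_conv_of_real)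
  qed
  then show "AE x in lebesgue_on {c..d}. sl_expr p q {c..d} u x - l * u x = w x"
    by (intro AE_I2) auto
qed

lemma sl_solution_lincomb:
  fixes u w :: "real \<Rightarrow> 'a::real_normed_field"
  assumes u: "sl_solution p {c..d} f u" and w: "sl_solution p {c..d} g w" and cd: "c < d"
  shows "sl_solution p {c..d} (\<lambda>x. s * f x + t * g x) (\<lambda>x. s * u x + t * w x)"
    and "x \<in> {c..d} \<Longrightarrow> deriv_within (\<lambda>x. s * u x + t * w x) {c..d} x
       = s * deriv_within u {c..d} x + t * deriv_within w {c..d} x"
proof -
  have d: "((\<lambda>x. s * u x + t * w x) has_vector_derivative s * deriv_within u {c..d} x + t * deriv_within w {c..d} x) (at x within {c..d})"
    if "x \<in> {c..d}" for x
    using u w that by (intro derivative_intros) (auto simp: sl_solution_def vector_derivative_works)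
  have dw: "deriv_within (\<lambda>x. s * u x + t * w x) {c..d} x
       = s * deriv_within u {c..d} x + t * deriv_within w {c..d} x" if "x \<in> {c..d}" for x
    by (rule deriv_within_eq[OF d[OF that] cd that])
  then show "x \<in> {c..d} \<Longrightarrow> deriv_within (\<lambda>x. s * u x + t * w x) {c..d} x
       = s * deriv_within u {c..d} x + t * deriv_within w {c..d} x" .
  show "sl_solution p {c..d} (\<lambda>x. s * f x + t * g x) (\<lambda>x. s * u x + t * w x)"
    unfolding sl_solution_def
  proof (intro ballI conjI)
    fix x assume x: "x \<in> {c..d}"
    show "(\<lambda>x. s * u x + t * w x) differentiable at x within {c..d}"
      using d[OF x] differentiableI_vector by blast
    have "((\<lambda>y. s * (p y *\<^sub>R deriv_within u {c..d} y) + t * (p y *\<^sub>R deriv_within w {c..d} y))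
       has_vector_derivative s * f x + t * g x) (at x within {c..d})"
      using u w x by (intro derivative_intros) (auto simp: sl_solution_def)
    then show "((\<lambda>y. p y *\<^sub>R deriv_within (\<lambda>x. s * u x + t * w x) {c..d} y)
       has_vector_derivative s * f x + t * g x) (at x within {c..d})"
      unfolding has_vector_derivative_def
      by (rule has_derivative_transform[OF x, rotated]) (simp add: dw scaleR_add_right)
  qed
qed

section \<open>Root subspaces of the limit operator\<close>

text \<open>Real and imaginary part are separately multiples of the real fundamental solution.\<close>

lemma complex_multiple:
  fixes u :: "real \<Rightarrow> complex"
  assumes multiple: "\<And>u v x. sl_sys p {c..d} (\<lambda>x. - \<Lambda> * q x * u x) u v \<Longrightarrow> u e = 0 \<Longrightarrow> x \<in> {c..d} \<Longrightarrow>
      u x = v e * U x \<and> v x = v e * V x"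
    and cd: "c < d" and ppos: "\<And>x. x \<in> {c..d} \<Longrightarrow> p x > 0"
    and s: "sl_solution p {c..d} (\<lambda>x. - (of_real (q x) * (of_real \<Lambda> * u x))) u" and e: "u e = 0"
  obtains \<gamma> where "\<And>x. x \<in> {c..d} \<Longrightarrow> u x = \<gamma> * of_real (U x)"
    "\<And>x. x \<in> {c..d} \<Longrightarrow> p x *\<^sub>R deriv_within u {c..d} x = \<gamma> * of_real (V x)"
proof -
  have part: "\<exists>A. \<forall>x\<in>{c..d}. h (u x) = A * U x \<and> p x * h (deriv_within u {c..d} x) = A * V x"
    if h: "bounded_linear h" for h :: "complex \<Rightarrow> real"
  proof -
    interpret h: bounded_linear h by fact
    have hr: "h (of_real s * z) = s * h z" for s z
      using h.scaleR[of s z] by (simp add: scaleR_conv_of_real)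
    have "sl_solution p {c..d} (\<lambda>x. - \<Lambda> * q x * h (u x)) (\<lambda>x. h (u x))"
      by (rule sl_solution_cong[OF sl_solution_linear(1)[OF h s cd]]) (simp add: h.neg hr)
    from sl_solution_imp_sys[OF this ppos]
    have "sl_sys p {c..d} (\<lambda>x. - \<Lambda> * q x * h (u x)) (\<lambda>x. h (u x)) (\<lambda>x. p x * h (deriv_within u {c..d} x))"
      by (rule sl_sys_cong) (auto simp: sl_solution_linear(2)[OF h s cd])
    from multiple[OF this] e have "\<forall>x\<in>{c..d}. h (u x) = (p e * h (deriv_within u {c..d} e)) * U x \<and>
        p x * h (deriv_within u {c..d} x) = (p e * h (deriv_within u {c..d} e)) * V x" by simp
    then show ?thesis by blast
  qed
  obtain A where A: "\<forall>x\<in>{c..d}. Re (u x) = A * U x \<and> p x * Re (deriv_within u {c..d} x) = A * V x"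
    using part[OF bounded_linear_Re] by (elim exE)
  obtain B where B: "\<forall>x\<in>{c..d}. Im (u x) = B * U x \<and> p x * Im (deriv_within u {c..d} x) = B * V x"
    using part[OF bounded_linear_Im] by (elim exE)
  show thesis
    by (rule that[of "Complex A B"]) (use A B in \<open>auto simp: complex_eq_iff\<close>)
qed

text \<open>The solvability condition for a self-adjoint problem: integrating the Lagrange identity between
  the solution \<open>u\<close> of \<open>(A - \<Lambda>) u = \<gamma> U\<close> and \<open>U\<close> itself, the boundary terms cancel and
  \<open>\<gamma> \<integral> q U\<^sup>2 = 0\<close> remains.\<close>

lemma resonance_excluded_real:
  assumes U: "sl_sys p {c..d} (\<lambda>x. - \<Lambda> * q x * U x) U V"
    and u: "sl_sys p {c..d} (\<lambda>x. - (q x * (\<Lambda> * u x + \<gamma> * U x))) u v"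
    and bd: "u c * V c - U c * v c = u d * V d - U d * v d"
    and cd: "c < d" and q: "continuous_on {c..d} q" "\<And>x. x \<in> {c..d} \<Longrightarrow> q x > 0"
    and nt: "\<exists>x\<in>{c..d}. U x \<noteq> 0"
  shows "\<gamma> = 0"
proof -
  have cont: "continuous_on {c..d} (\<lambda>x. q x * (U x)\<^sup>2)"
    using sl_sys_continuous(1)[OF U] q(1) by (intro continuous_intros)
  have nn: "q x * (U x)\<^sup>2 \<ge> 0" if "x \<in> {c..d}" for x using q(2)[OF that] by simp
  have "((\<lambda>x. \<gamma> * (q x * (U x)\<^sup>2)) has_integral ((u d * V d - U d * v d) - (u c * V c - U c * v c))) {c..d}"
  proof (rule fundamental_theorem_of_calculus)
    fix x assume "x \<in> {c..d}"
    from sl_sys_wronskian[OF u U this]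
    show "((\<lambda>x. u x * V x - U x * v x) has_vector_derivative \<gamma> * (q x * (U x)\<^sup>2)) (at x within {c..d})"
      by (simp add: has_real_derivative_iff_has_vector_derivative algebra_simps power2_eq_square)
  qed (use cd in simp)
  from integral_unique[OF this] have "\<gamma> * integral {c..d} (\<lambda>x. q x * (U x)\<^sup>2) = 0" using bd by simp
  moreover have "integral {c..d} (\<lambda>x. q x * (U x)\<^sup>2) \<noteq> 0"
    using integral_eq_0_iff[OF cont cd nn] nt q(2) by force
  ultimately show ?thesis by simp
qed

lemma resonance_excluded:
  fixes u :: "real \<Rightarrow> complex"
  assumes U: "sl_sys p {c..d} (\<lambda>x. - \<Lambda> * q x * U x) U V"
    and u: "sl_solution p {c..d} (\<lambda>x. - (of_real (q x) * (of_real \<Lambda> * u x + \<gamma> * of_real (U x)))) u"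
    and bd: "u c * of_real (V c) - of_real (U c) * (p c *\<^sub>R deriv_within u {c..d} c)
       = u d * of_real (V d) - of_real (U d) * (p d *\<^sub>R deriv_within u {c..d} d)"
    and cd: "c < d" and q: "continuous_on {c..d} q" "\<And>x. x \<in> {c..d} \<Longrightarrow> q x > 0"
    and ppos: "\<And>x. x \<in> {c..d} \<Longrightarrow> p x > 0"
    and nt: "\<exists>x\<in>{c..d}. U x \<noteq> 0"
  shows "\<gamma> = 0"
proof -
  have part: "h \<gamma> = 0" if h: "bounded_linear h" for h :: "complex \<Rightarrow> real"
  proof -
    interpret h: bounded_linear h by fact
    have hr: "h (of_real s * z) = s * h z" for s z
      using h.scaleR[of s z] by (simp add: scaleR_conv_of_real)
    have hr': "h (z * of_real s) = h z * s" for s z using hr[of s z] by (simp add: mult.commute)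
    have "sl_solution p {c..d} (\<lambda>x. - (q x * (\<Lambda> * h (u x) + h \<gamma> * U x))) (\<lambda>x. h (u x))"
      by (rule sl_solution_cong[OF sl_solution_linear(1)[OF h u cd]]) (simp add: h.neg h.add hr hr')
    from sl_solution_imp_sys[OF this ppos]
    have s: "sl_sys p {c..d} (\<lambda>x. - (q x * (\<Lambda> * h (u x) + h \<gamma> * U x))) (\<lambda>x. h (u x)) (\<lambda>x. p x * h (deriv_within u {c..d} x))"
      by (rule sl_sys_cong) (auto simp: sl_solution_linear(2)[OF h u cd])
    show ?thesis
      by (rule resonance_excluded_real[OF U s _ cd q nt])
         (use arg_cong[OF bd, of h] in \<open>simp add: h.diff hr hr' h.scaleR mult.left_commute\<close>)
  qed
  show ?thesis using part[OF bounded_linear_Re] part[OF bounded_linear_Im] by (simp add: complex_eq_iff)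
qed

text \<open>The domain of the limit operator contains one representative of each element, the one that
  vanishes outside the interval.\<close>

definition extend0 :: "real set \<Rightarrow> (real \<Rightarrow> complex) \<Rightarrow> real \<Rightarrow> complex" where
  "extend0 S f = (\<lambda>x. if x \<in> S then f x else 0)"

lemma sl_solution_extend0:
  assumes s: "sl_solution p {c..d} f u" and cd: "c < d" and fg: "\<And>x. x \<in> {c..d} \<Longrightarrow> f x = g x"
  shows "sl_solution p {c..d} g (extend0 {c..d} u)"
    and "x \<in> {c..d} \<Longrightarrow> deriv_within (extend0 {c..d} u) {c..d} x = deriv_within u {c..d} x"
proof -
  have d: "(extend0 {c..d} u has_vector_derivative deriv_within u {c..d} x) (at x within {c..d})" if x: "x \<in> {c..d}" for x
  proof -
    have "(u has_vector_derivative deriv_within u {c..d} x) (at x within {c..d})"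
      using s x by (simp add: sl_solution_def vector_derivative_works)
    then show ?thesis unfolding has_vector_derivative_def
      by (rule has_derivative_transform[OF x, rotated]) (simp add: extend0_def)
  qed
  have dw: "deriv_within (extend0 {c..d} u) {c..d} x = deriv_within u {c..d} x" if "x \<in> {c..d}" for x
    by (rule deriv_within_eq[OF d[OF that] cd that])
  then show "x \<in> {c..d} \<Longrightarrow> deriv_within (extend0 {c..d} u) {c..d} x = deriv_within u {c..d} x" .
  show "sl_solution p {c..d} g (extend0 {c..d} u)"
    unfolding sl_solution_def
  proof (intro ballI conjI)
    fix x assume x: "x \<in> {c..d}"
    show "extend0 {c..d} u differentiable at x within {c..d}" using d[OF x] differentiableI_vector by blast
    have "((\<lambda>t. p t *\<^sub>R deriv_within u {c..d} t) has_vector_derivative g x) (at x within {c..d})"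
      using s x fg by (simp add: sl_solution_def)
    then show "((\<lambda>t. p t *\<^sub>R deriv_within (extend0 {c..d} u) {c..d} t) has_vector_derivative g x) (at x within {c..d})"
      unfolding has_vector_derivative_def
      by (rule has_derivative_transform[OF x, rotated]) (simp add: dw)
  qed
qed

lemma sl_sys_imp_complex_solution:
  assumes s: "sl_sys p {c..d} f u v" and cd: "c < d" and ppos: "\<And>x. x \<in> {c..d} \<Longrightarrow> p x > 0"
    and fg: "\<And>x. x \<in> {c..d} \<Longrightarrow> of_real (f x) = g x"
  shows "sl_solution p {c..d} g (extend0 {c..d} (\<lambda>x. of_real (u x)))"
    and "x \<in> {c..d} \<Longrightarrow> deriv_within (extend0 {c..d} (\<lambda>x. of_real (u x))) {c..d} x = of_real (v x / p x)"
proof -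
  have r: "sl_solution p {c..d} f u" by (rule sl_sys_imp_solution[OF s cd ppos])
  have "bounded_linear complex_of_real" by (rule bounded_linear_of_real)
  note c = sl_solution_linear[OF this r cd]
  show "sl_solution p {c..d} g (extend0 {c..d} (\<lambda>x. of_real (u x)))"
    by (rule sl_solution_extend0(1)[OF c(1) cd fg])
  show "deriv_within (extend0 {c..d} (\<lambda>x. of_real (u x))) {c..d} x = of_real (v x / p x)" if "x \<in> {c..d}"
    using sl_solution_extend0(2)[OF c(1) cd refl that] c(2)[OF that] sl_sys_deriv_within[OF s cd that] by simp
qed

lemma sl_solution_zero:
  assumes "c < d"
  shows "x \<in> {c..d} \<Longrightarrow> deriv_within (\<lambda>_. 0 :: 'a::real_normed_vector) {c..d} x = 0"
    and "sl_solution p {c..d} (\<lambda>_. 0) (\<lambda>_. 0 :: 'a)"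
proof -
  have dz: "deriv_within (\<lambda>_. 0 :: 'a) {c..d} x = 0" if "x \<in> {c..d}" for x
    by (rule deriv_within_eq[OF has_vector_derivative_const assms that])
  then show "x \<in> {c..d} \<Longrightarrow> deriv_within (\<lambda>_. 0 :: 'a) {c..d} x = 0" .
  show "sl_solution p {c..d} (\<lambda>_. 0) (\<lambda>_. 0 :: 'a)"
    unfolding sl_solution_def
  proof (intro ballI conjI)
    fix x assume x: "x \<in> {c..d}"
    have "((\<lambda>t. 0 :: 'a) has_vector_derivative 0) (at x within {c..d})"
      by (rule has_vector_derivative_const)
    then show "((\<lambda>t. p t *\<^sub>R deriv_within (\<lambda>_. 0 :: 'a) {c..d} t) has_vector_derivative 0) (at x within {c..d})"
      unfolding has_vector_derivative_def
      by (rule has_derivative_transform[OF x, rotated]) (simp add: dz)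
  qed simp
qed

lemma vector_space_scale_pair: "vector_space scale_pair"
  by unfold_locales (auto simp: scale_pair_def fun_eq_iff algebra_simps prod_eq_iff)

lemma H2_continuous: "u \<in> H2 c d \<Longrightarrow> continuous_on {c..d} u"
  by (auto simp: H2_def continuous_on_eq_continuous_within intro: differentiable_imp_continuous_within)

locale transmission_C1 = transmission +
  fixes k' \<kappa>' :: "real \<Rightarrow> real"
  assumes dk: "\<And>x. x \<in> {a..0} \<Longrightarrow> (k has_real_derivative k' x) (at x within {a..0})"
    and contk': "continuous_on {a..0} k'"
    and d\<kappa>: "\<And>x. x \<in> {0..b} \<Longrightarrow> (\<kappa> has_real_derivative \<kappa>' x) (at x within {0..b})"
    and cont\<kappa>': "continuous_on {0..b} \<kappa>'"
begin

abbreviation "ker \<equiv> ker_A a b k r \<kappa> \<rho>"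

lemma ker_continuous:
  assumes "(w1, w2) \<in> ker c n"
  shows "continuous_on {a..0} w1" "continuous_on {0..b} w2"
proof -
  have "(w1, w2) = 0 \<or> (w1, w2) \<in> dom_A a b" using assms by (cases n) auto
  then show "continuous_on {a..0} w1" "continuous_on {0..b} w2"
    by (auto simp: dom_A_def zero_prod_def zero_fun_def intro: H2_continuous)
qed

lemma ker_zero_outside:
  assumes "(w1, w2) \<in> ker c n"
  shows "x \<notin> {a..0} \<Longrightarrow> w1 x = 0" "x \<notin> {0..b} \<Longrightarrow> w2 x = 0"
proof -
  have "(w1, w2) = 0 \<or> (w1, w2) \<in> dom_A a b" using assms by (cases n) auto
  then show "x \<notin> {a..0} \<Longrightarrow> w1 x = 0" "x \<notin> {0..b} \<Longrightarrow> w2 x = 0"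
    by (auto simp: dom_A_def zero_prod_def zero_fun_def)
qed

text \<open>\<open>(\<A> - c) (u1, u2) = (w1, w2)\<close>, stated with classical solutions instead of almost everywhere.\<close>

definition ker_step :: "complex \<Rightarrow> (real \<Rightarrow> complex) \<Rightarrow> (real \<Rightarrow> complex) \<Rightarrow> (real \<Rightarrow> complex) \<Rightarrow> (real \<Rightarrow> complex) \<Rightarrow> bool" where
  "ker_step c u1 u2 w1 w2 \<longleftrightarrow>
     sl_solution k {a..0} (\<lambda>x. - (of_real (r x) * (c * u1 x + w1 x))) u1 \<and>
     sl_solution \<kappa> {0..b} (\<lambda>x. - (of_real (\<rho> x) * (c * u2 x + w2 x))) u2 \<and>
     u1 a = 0 \<and> deriv_within u1 {a..0} 0 = 0 \<and> u2 b = 0 \<and> u1 0 = u2 0 \<and>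
     (\<forall>x. x \<notin> {a..0} \<longrightarrow> u1 x = 0) \<and> (\<forall>x. x \<notin> {0..b} \<longrightarrow> u2 x = 0)"

lemma ker_Suc_iff:
  "(u1, u2) \<in> ker c (Suc n) \<longleftrightarrow> (\<exists>w1 w2. (w1, w2) \<in> ker c n \<and> ker_step c u1 u2 w1 w2)"
proof
  assume "(u1, u2) \<in> ker c (Suc n)"
  then obtain w1 w2 where d: "(u1, u2) \<in> dom_A a b" and w: "(w1, w2) \<in> ker c n"
    and ae: "AE x in lebesgue_on {a..0}. sl_expr k r {a..0} u1 x - c * u1 x = w1 x"
        "AE x in lebesgue_on {0..b}. sl_expr \<kappa> \<rho> {0..b} u2 x - c * u2 x = w2 x"
    by auto
  have H: "u1 \<in> H2 a 0" "u2 \<in> H2 0 b" using d by (auto simp: dom_A_def)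
  have "ker_step c u1 u2 w1 w2"
    unfolding ker_step_def
    using H2_weak_solution_imp_classical[OF a0 dk contk' contr posk posr H(1) ker_continuous(1)[OF w] ae(1)]
      H2_weak_solution_imp_classical[OF b0 d\<kappa> cont\<kappa>' cont\<rho> pos\<kappa> pos\<rho> H(2) ker_continuous(2)[OF w] ae(2)] d
    by (simp add: dom_A_def)
  then show "\<exists>w1 w2. (w1, w2) \<in> ker c n \<and> ker_step c u1 u2 w1 w2" using w by blast
next
  assume "\<exists>w1 w2. (w1, w2) \<in> ker c n \<and> ker_step c u1 u2 w1 w2"
  then obtain w1 w2 where w: "(w1, w2) \<in> ker c n" and s: "ker_step c u1 u2 w1 w2" by blast
  have s1: "sl_solution k {a..0} (\<lambda>x. - (of_real (r x) * (c * u1 x + w1 x))) u1"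
   and s2: "sl_solution \<kappa> {0..b} (\<lambda>x. - (of_real (\<rho> x) * (c * u2 x + w2 x))) u2"
    using s by (auto simp: ker_step_def)
  note e1 = classical_imp_H2_weak_solution[OF a0 dk contk' contr posk posr ker_continuous(1)[OF w] s1]
  note e2 = classical_imp_H2_weak_solution[OF b0 d\<kappa> cont\<kappa>' cont\<rho> pos\<kappa> pos\<rho> ker_continuous(2)[OF w] s2]
  have "(u1, u2) \<in> dom_A a b" using s e1(1) e2(1) by (simp add: dom_A_def ker_step_def)
  then show "(u1, u2) \<in> ker c (Suc n)" using w e1(2) e2(2) by auto
qed

lemma ker_step_zero: "ker_step c (\<lambda>_. 0) (\<lambda>_. 0) (\<lambda>_. 0) (\<lambda>_. 0)"
  using sl_solution_zero(1)[OF a0, of 0, where 'a = complex] sl_solution_zero(2)[OF a0, where 'a = complex]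
    sl_solution_zero(2)[OF b0, where 'a = complex] a0
  by (simp add: ker_step_def)

lemma ker_step_lincomb:
  assumes A: "ker_step c u1 u2 w1 w2" and B: "ker_step c y1 y2 z1 z2"
  shows "ker_step c (\<lambda>x. s * u1 x + t * y1 x) (\<lambda>x. s * u2 x + t * y2 x) (\<lambda>x. s * w1 x + t * z1 x) (\<lambda>x. s * w2 x + t * z2 x)"
proof -
  have 1: "sl_solution k {a..0} (\<lambda>x. - (of_real (r x) * (c * u1 x + w1 x))) u1"
   "sl_solution k {a..0} (\<lambda>x. - (of_real (r x) * (c * y1 x + z1 x))) y1"
   and 2: "sl_solution \<kappa> {0..b} (\<lambda>x. - (of_real (\<rho> x) * (c * u2 x + w2 x))) u2"
   "sl_solution \<kappa> {0..b} (\<lambda>x. - (of_real (\<rho> x) * (c * y2 x + z2 x))) y2"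
    using A B by (auto simp: ker_step_def)
  have "sl_solution k {a..0} (\<lambda>x. - (of_real (r x) * (c * (s * u1 x + t * y1 x) + (s * w1 x + t * z1 x)))) (\<lambda>x. s * u1 x + t * y1 x)"
    by (rule sl_solution_cong[OF sl_solution_lincomb(1)[OF 1 a0]]) (simp add: algebra_simps)
  moreover have "sl_solution \<kappa> {0..b} (\<lambda>x. - (of_real (\<rho> x) * (c * (s * u2 x + t * y2 x) + (s * w2 x + t * z2 x)))) (\<lambda>x. s * u2 x + t * y2 x)"
    by (rule sl_solution_cong[OF sl_solution_lincomb(1)[OF 2 b0]]) (simp add: algebra_simps)
  moreover have "deriv_within (\<lambda>x. s * u1 x + t * y1 x) {a..0} 0 = 0"
    using sl_solution_lincomb(2)[OF 1 a0, of 0] a0 A B by (simp add: ker_step_def)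
  ultimately show ?thesis using A B by (simp add: ker_step_def)
qed

lemma ker_0: "(u1, u2) \<in> ker c 0 \<longleftrightarrow> u1 = (\<lambda>_. 0) \<and> u2 = (\<lambda>_. 0)"
  by (simp add: zero_prod_def zero_fun_def)

lemma ker_mono_Suc: "(u1, u2) \<in> ker c n \<Longrightarrow> (u1, u2) \<in> ker c (Suc n)"
proof (induction n arbitrary: u1 u2)
  case 0
  then have "u1 = (\<lambda>_. 0)" "u2 = (\<lambda>_. 0)" by (simp_all only: ker_0)
  then show ?case unfolding ker_Suc_iff
    using ker_step_zero by (intro exI[of _ "\<lambda>_. 0"]) (simp del: ker_A.simps add: ker_0)
next
  case (Suc n)
  then obtain w1 w2 where "(w1, w2) \<in> ker c n" "ker_step c u1 u2 w1 w2" unfolding ker_Suc_iff by blast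
  then show ?case using Suc.IH unfolding ker_Suc_iff[of u1 u2 c "Suc n"] by blast
qed

lemma ker_mono: "n \<le> m \<Longrightarrow> (u1, u2) \<in> ker c n \<Longrightarrow> (u1, u2) \<in> ker c m"
  by (induction rule: dec_induct) (auto simp del: ker_A.simps intro: ker_mono_Suc)

lemma ker_lincomb:
  "(u1, u2) \<in> ker c n \<Longrightarrow> (y1, y2) \<in> ker c n \<Longrightarrow>
    ((\<lambda>x. s * u1 x + t * y1 x), (\<lambda>x. s * u2 x + t * y2 x)) \<in> ker c n"
proof (induction n arbitrary: u1 u2 y1 y2)
  case 0
  then show ?case by (simp only: ker_0) simp
next
  case (Suc n)
  obtain w1 w2 where w: "(w1, w2) \<in> ker c n" "ker_step c u1 u2 w1 w2" using Suc.prems(1) unfolding ker_Suc_iff by blast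
  obtain z1 z2 where z: "(z1, z2) \<in> ker c n" "ker_step c y1 y2 z1 z2" using Suc.prems(2) unfolding ker_Suc_iff by blast
  show ?case unfolding ker_Suc_iff
    using Suc.IH[OF w(1) z(1)] ker_step_lincomb[OF w(2) z(2)] by blast
qed

definition Y :: "real \<Rightarrow> real \<Rightarrow> complex" where "Y c = extend0 {a..0} (\<lambda>x. of_real (left.U c x))"
definition Z :: "real \<Rightarrow> real \<Rightarrow> complex" where "Z c = extend0 {0..b} (\<lambda>x. of_real (ur c x))"

lemma Y_solution: "sl_solution k {a..0} (\<lambda>x. - (of_real (r x) * (of_real c * Y c x))) (Y c)"
  "deriv_within (Y c) {a..0} 0 = of_real (left.V c 0 / k 0)"
proof -
  have eq: "of_real (- c * r x * left.U c x) = - (of_real (r x) * (of_real c * Y c x))" if "x \<in> {a..0}" for x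
    using that by (simp add: Y_def extend0_def)
  note sol = sl_sys_imp_complex_solution[OF sys_left a0 posk eq, folded Y_def]
  show "sl_solution k {a..0} (\<lambda>x. - (of_real (r x) * (of_real c * Y c x))) (Y c)" by (rule sol(1))
  show "deriv_within (Y c) {a..0} 0 = of_real (left.V c 0 / k 0)" by (rule sol(2)) (use a0 in auto)
qed

lemma Z_solution: "sl_solution \<kappa> {0..b} (\<lambda>x. - (of_real (\<rho> x) * (of_real c * Z c x))) (Z c)"
  unfolding Z_def
  by (rule sl_sys_imp_complex_solution(1)[OF sys_right b0 pos\<kappa>]) (auto simp: extend0_def)

lemma left_multiple_complex:
  fixes u :: "real \<Rightarrow> complex"
  assumes "sl_solution k {a..0} (\<lambda>x. - (of_real (r x) * (of_real c * u x))) u" "u a = 0" "\<And>x. x \<notin> {a..0} \<Longrightarrow> u x = 0"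
  obtains \<gamma> where "u = (\<lambda>x. \<gamma> * Y c x)" "k 0 *\<^sub>R deriv_within u {a..0} 0 = \<gamma> * of_real (left.V c 0)"
proof (rule complex_multiple[OF _ a0 posk assms(1,2)])
  show "u x = v a * left.U c x \<and> v x = v a * left.V c x"
    if "sl_sys k {a..0} (\<lambda>x. - c * r x * u x) u v" "u a = 0" "x \<in> {a..0}" for u v x
    using left.sys_multiple[OF that] by blast
  fix \<gamma> assume g: "\<And>x. x \<in> {a..0} \<Longrightarrow> u x = \<gamma> * of_real (left.U c x)"
    "\<And>x. x \<in> {a..0} \<Longrightarrow> k x *\<^sub>R deriv_within u {a..0} x = \<gamma> * of_real (left.V c x)"
  have "u = (\<lambda>x. \<gamma> * Y c x)" using g(1) assms(3) by (auto simp: fun_eq_iff Y_def extend0_def)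
  then show thesis using g(2)[of 0] a0 by (intro that) auto
qed

lemma right_multiple_complex:
  fixes u :: "real \<Rightarrow> complex"
  assumes "sl_solution \<kappa> {0..b} (\<lambda>x. - (of_real (\<rho> x) * (of_real c * u x))) u" "u b = 0" "\<And>x. x \<notin> {0..b} \<Longrightarrow> u x = 0"
  obtains \<gamma> where "u = (\<lambda>x. \<gamma> * Z c x)"
proof (rule complex_multiple[OF _ b0 pos\<kappa> assms(1,2)])
  show "u x = v b * ur c x \<and> v x = v b * vr c x"
    if "sl_sys \<kappa> {0..b} (\<lambda>x. - c * \<rho> x * u x) u v" "u b = 0" "x \<in> {0..b}" for u v x
    using sys_right_multiple[OF that] by blast
  fix \<gamma> assume g: "\<And>x. x \<in> {0..b} \<Longrightarrow> u x = \<gamma> * of_real (ur c x)"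
  have "u = (\<lambda>x. \<gamma> * Z c x)" using g(1) assms(3) by (auto simp: fun_eq_iff Z_def extend0_def)
  then show thesis by (rule that)
qed

lemma YZ_nonzero: "Y c \<noteq> (\<lambda>_. 0)" "Z c \<noteq> (\<lambda>_. 0)"
proof -
  obtain x where "x \<in> {a..0}" "left.U c x \<noteq> 0" using left.U_nontrivial[of c] by blast
  then have "Y c x \<noteq> 0" by (simp add: Y_def extend0_def)
  then show "Y c \<noteq> (\<lambda>_. 0)" by metis
  obtain x where "x \<in> {0..b}" "ur c x \<noteq> 0" using ur_nontrivial[of c] by blast
  then have "Z c x \<noteq> 0" by (simp add: Z_def extend0_def)
  then show "Z c \<noteq> (\<lambda>_. 0)" by metis
qed

text \<open>\<open>c\<close> is an eigenvalue of \<open>A\<^sub>1\<close>, respectively of the right Dirichlet operator, in terms of the end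
  values of the fundamental solutions.\<close>

definition E1 :: "real \<Rightarrow> bool" where "E1 c \<longleftrightarrow> left.V c 0 = 0"
definition E2 :: "real \<Rightarrow> bool" where "E2 c \<longleftrightarrow> right.U c 0 = 0"

text \<open>The first component of \<open>\<A> - c\<close> does not involve the second one: it is \<open>A\<^sub>1 - c\<close>, whose root
  vectors are eigenvectors because resonance is excluded.\<close>

lemma ker_first:
  "(w1, w2) \<in> ker (of_real c) n \<Longrightarrow> \<exists>\<alpha>. w1 = (\<lambda>x. \<alpha> * Y c x) \<and> (\<not> E1 c \<longrightarrow> \<alpha> = 0)"
proof (induction n arbitrary: w1 w2)
  case 0
  then show ?case by (intro exI[of _ 0]) (simp only: ker_0, simp)
next
  case (Suc n)
  then obtain g1 g2 where g: "(g1, g2) \<in> ker (of_real c) n" and s: "ker_step (of_real c) w1 w2 g1 g2"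
    unfolding ker_Suc_iff by blast
  obtain \<alpha> where \<alpha>: "g1 = (\<lambda>x. \<alpha> * Y c x)" "\<not> E1 c \<longrightarrow> \<alpha> = 0" using Suc.IH[OF g] by blast
  have s1: "sl_solution k {a..0} (\<lambda>x. - (of_real (r x) * (of_real c * w1 x + g1 x))) w1"
    and w1: "w1 a = 0" "deriv_within w1 {a..0} 0 = 0" "\<And>x. x \<notin> {a..0} \<Longrightarrow> w1 x = 0"
    using s by (auto simp: ker_step_def)
  have "\<alpha> = 0"
  proof (cases "E1 c")
    case True
    have s1': "sl_solution k {a..0} (\<lambda>x. - (of_real (r x) * (of_real c * w1 x + \<alpha> * of_real (left.U c x)))) w1"
      by (rule sl_solution_cong[OF s1]) (simp add: \<alpha>(1) Y_def extend0_def)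
    show ?thesis
      by (rule resonance_excluded[OF sys_left s1' _ a0 contr posr posk left.U_nontrivial])
         (use w1 True in \<open>auto simp: E1_def\<close>)
  qed (use \<alpha> in auto)
  then have s1': "sl_solution k {a..0} (\<lambda>x. - (of_real (r x) * (of_real c * w1 x))) w1"
    using s1 \<alpha>(1) by simp
  obtain \<gamma> where \<gamma>: "w1 = (\<lambda>x. \<gamma> * Y c x)" "k 0 *\<^sub>R deriv_within w1 {a..0} 0 = \<gamma> * of_real (left.V c 0)"
    by (rule left_multiple_complex[OF s1' w1(1,3)])
  have "\<not> E1 c \<longrightarrow> \<gamma> = 0" using \<gamma>(2) w1(2) by (auto simp: E1_def)
  then show ?case using \<gamma>(1) by blast
qed

text \<open>If the first component vanishes, the coupling condition becomes \<open>u2 0 = 0\<close>, and the second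
  component obeys the right Dirichlet problem; again resonance is excluded.\<close>

lemma ker_second:
  "((\<lambda>_. 0), w) \<in> ker (of_real c) n \<Longrightarrow> \<exists>\<beta>. w = (\<lambda>x. \<beta> * Z c x) \<and> (\<not> E2 c \<longrightarrow> \<beta> = 0)"
proof (induction n arbitrary: w)
  case 0
  then show ?case by (intro exI[of _ 0]) (simp only: ker_0, simp)
next
  case (Suc n)
  then obtain g1 g2 where g: "(g1, g2) \<in> ker (of_real c) n" and s: "ker_step (of_real c) (\<lambda>_. 0) w g1 g2"
    unfolding ker_Suc_iff by blast
  have g1: "g1 = (\<lambda>_. 0)"
  proof
    fix x show "g1 x = 0"
    proof (cases "x \<in> {a..0}")
      case True
      have z: "((\<lambda>t. k t *\<^sub>R deriv_within (\<lambda>_. 0 :: complex) {a..0} t) has_vector_derivative 0) (at x within {a..0})"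
        using sl_solution_zero(2)[OF a0] True unfolding sl_solution_def by blast
      have "((\<lambda>t. k t *\<^sub>R deriv_within (\<lambda>_. 0 :: complex) {a..0} t) has_vector_derivative
          - (of_real (r x) * (of_real c * 0 + g1 x))) (at x within {a..0})"
        using s True by (simp add: ker_step_def sl_solution_def)
      from deriv_within_eq[OF this a0 True] deriv_within_eq[OF z a0 True]
      show ?thesis using posr[OF True] by simp
    qed (rule ker_zero_outside(1)[OF g])
  qed
  obtain \<beta> where \<beta>: "g2 = (\<lambda>x. \<beta> * Z c x)" "\<not> E2 c \<longrightarrow> \<beta> = 0" using Suc.IH g g1 by blast
  have s1: "sl_solution \<kappa> {0..b} (\<lambda>x. - (of_real (\<rho> x) * (of_real c * w x + g2 x))) w"
    and w: "w b = 0" "w 0 = 0" "\<And>x. x \<notin> {0..b} \<Longrightarrow> w x = 0"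
    using s by (auto simp: ker_step_def)
  have "\<beta> = 0"
  proof (cases "E2 c")
    case True
    have s1': "sl_solution \<kappa> {0..b} (\<lambda>x. - (of_real (\<rho> x) * (of_real c * w x + \<beta> * of_real (ur c x)))) w"
      by (rule sl_solution_cong[OF s1]) (simp add: \<beta>(1) Z_def extend0_def)
    show ?thesis
      by (rule resonance_excluded[OF sys_right s1' _ b0 cont\<rho> pos\<rho> pos\<kappa> ur_nontrivial])
         (use w True in \<open>auto simp: E2_def ur_def\<close>)
  qed (use \<beta> in auto)
  then have s1': "sl_solution \<kappa> {0..b} (\<lambda>x. - (of_real (\<rho> x) * (of_real c * w x))) w"
    using s1 \<beta>(1) by simp
  obtain \<gamma> where \<gamma>: "w = (\<lambda>x. \<gamma> * Z c x)"
    by (rule right_multiple_complex[OF s1' w(1,3)])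
  have "\<not> E2 c \<longrightarrow> \<gamma> = 0" using \<gamma> w(2) b0 by (auto simp: E2_def Z_def extend0_def ur_def fun_eq_iff)
  then show ?case using \<gamma> by blast
qed

lemma ker_step_Z:
  assumes "E2 c"
  shows "ker_step (of_real c) (\<lambda>_. 0) (Z c) (\<lambda>_. 0) (\<lambda>_. 0)"
  using ker_step_zero[of "of_real c"] Z_solution[of c] assms b0
  by (auto simp: ker_step_def Z_def extend0_def E2_def ur_def)

lemma Z_in_ker: "E2 c \<Longrightarrow> ((\<lambda>_. 0), (\<lambda>x. s * Z c x)) \<in> ker (of_real c) 1"
proof -
  assume E: "E2 c"
  have "((\<lambda>_. 0), (\<lambda>_. 0)) \<in> ker (of_real c) 0" by (simp only: ker_0)
  then have Z: "((\<lambda>_. 0), Z c) \<in> ker (of_real c) (Suc 0)"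
    using ker_step_Z[OF E] unfolding ker_Suc_iff by blast
  from ker_lincomb[OF Z Z, of s 0] show ?thesis by simp
qed

text \<open>Every eigenfunction of \<open>A\<^sub>1\<close> is the first component of a root vector. If \<open>c\<close> is not a Dirichlet
  eigenvalue, a multiple of \<open>Z c\<close> matches \<open>Y c\<close> at \<open>0\<close> and gives an eigenvector. Otherwise \<open>Z c\<close>
  vanishes at \<open>0\<close>, no eigenvector with first component \<open>Y c\<close> exists, and one solves
  \<open>(\<A> - c) (Y c, z) = \<sigma> (0, Z c)\<close> for a suitable \<open>\<sigma>\<close>.\<close>

lemma Y_in_ker:
  assumes E: "E1 c"
  obtains z where "(Y c, z) \<in> ker (of_real c) 2"
proof -
  have Y: "sl_solution k {a..0} (\<lambda>x. - (of_real (r x) * (of_real c * Y c x + 0))) (Y c)"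
    "Y c a = 0" "deriv_within (Y c) {a..0} 0 = 0" "\<And>x. x \<notin> {a..0} \<Longrightarrow> Y c x = 0"
    using Y_solution[of c] E by (auto simp: E1_def Y_def extend0_def)
  show thesis
  proof (cases "E2 c")
    case False
    define z where "z = (\<lambda>x. (Y c 0 / Z c 0) * Z c x)"
    have Z0: "Z c 0 \<noteq> 0" using False b0 by (simp add: Z_def extend0_def E2_def ur_def)
    have "sl_solution \<kappa> {0..b} (\<lambda>x. - (of_real (\<rho> x) * (of_real c * z x + 0))) z"
      using sl_solution_lincomb(1)[OF Z_solution[of c] Z_solution[of c] b0, of "Y c 0 / Z c 0" 0]
      by (simp add: z_def mult_ac)
    then have "ker_step (of_real c) (Y c) z (\<lambda>_. 0) (\<lambda>_. 0)"
      using Y Z0 b0 by (auto simp: ker_step_def z_def Z_def extend0_def)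
    moreover have "((\<lambda>_. 0), (\<lambda>_. 0)) \<in> ker (of_real c) 0" by (simp only: ker_0)
    ultimately have "(Y c, z) \<in> ker (of_real c) (Suc 0)" unfolding ker_Suc_iff by blast
    then have "(Y c, z) \<in> ker (of_real c) 2" by (rule ker_mono[rotated]) simp
    then show thesis by (rule that)
  next
    case True
    have "continuous_on {-b..0} (\<lambda>x. \<rho> (- x) * right.U c x)"
      using right.contq sl_sys_continuous(1)[OF right.sys_UV] by (intro continuous_intros)
    then have "continuous_on {-b..0} (\<lambda>x. - (\<rho> (- x) * ur c (- x)))"
      by (simp add: ur_def)
    then obtain u v where uv: "sl_sys (\<lambda>x. \<kappa> (- x)) {-b..0} (\<lambda>x. - (\<rho> (- x) * ur c (- x)) - c * \<rho> (- x) * u x) u v"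
      "u (- b) = 0" "v (- b) = 0"
      by (rule right.sys_inhomogeneous)
    define y where "y = (\<lambda>x. u (- x))"
    define w where "w = (\<lambda>x. - v (- x))"
    have s: "sl_sys \<kappa> {0..b} (\<lambda>x. - (\<rho> x * (c * y x + 1 * ur c x))) y w"
      by (rule sl_sys_cong[of _ _ "\<lambda>x. - (\<rho> x * ur c x) - c * \<rho> x * u (- x)" y w])
         (use sl_sys_reflect[OF uv(1)] in \<open>auto simp: y_def w_def algebra_simps\<close>)
    \<comment> \<open>If \<open>y\<close> vanished at \<open>0\<close>, it would solve the resonant Dirichlet problem with coefficient \<open>\<gamma> = 1\<close>.\<close>
    have y0: "y 0 \<noteq> 0"
    proof
      assume "y 0 = 0"
      have "(1 :: real) = 0"
        by (rule resonance_excluded_real[OF sys_right s _ b0 cont\<rho> pos\<rho> ur_nontrivial])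
           (use \<open>y 0 = 0\<close> True uv in \<open>simp add: y_def w_def E2_def ur_def\<close>)
      then show False by simp
    qed
    \<comment> \<open>\<open>\<sigma>\<close> scales the particular solution so that the two components agree at \<open>0\<close>.\<close>
    define \<sigma> where "\<sigma> = Y c 0 / of_real (y 0)"
    define z where "z = (\<lambda>x. \<sigma> * extend0 {0..b} (\<lambda>x. of_real (y x)) x)"
    have "sl_solution \<kappa> {0..b} (\<lambda>x. - (of_real (\<rho> x) * (of_real c * extend0 {0..b} (\<lambda>x. of_real (y x)) x + Z c x)))
        (extend0 {0..b} (\<lambda>x. of_real (y x)))"
      by (rule sl_sys_imp_complex_solution(1)[OF s b0 pos\<kappa>]) (auto simp: extend0_def Z_def)
    from sl_solution_lincomb(1)[OF this this b0, of \<sigma> 0]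
    have "sl_solution \<kappa> {0..b} (\<lambda>x. - (of_real (\<rho> x) * (of_real c * z x + \<sigma> * Z c x))) z"
      by (simp add: z_def algebra_simps)
    then have "ker_step (of_real c) (Y c) z (\<lambda>_. 0) (\<lambda>x. \<sigma> * Z c x)"
      using Y y0 b0 uv by (auto simp: ker_step_def z_def extend0_def \<sigma>_def y_def)
    then have "(Y c, z) \<in> ker (of_real c) (Suc 1)"
      using Z_in_ker[OF True, of \<sigma>] unfolding ker_Suc_iff by blast
    then have "(Y c, z) \<in> ker (of_real c) 2" by (simp only: numeral_2_eq_2 One_nat_def)
    then show thesis by (rule that)
  qed
qed

text \<open>The root subspace is spanned by \<open>(0, Z c)\<close> if \<open>E2 c\<close> and a root vector \<open>(Y c, z)\<close> if \<open>E1 c\<close>. At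
  a common eigenvalue \<open>\<A>\<close> has a Jordan block of size two, so it is the algebraic multiplicity that
  counts both spectra.\<close>

theorem alg_mult_A_eq:
  "alg_mult_A a b k r \<kappa> \<rho> (complex_of_real c) = (if E1 c then 1 else 0) + (if E2 c then 1 else 0)"
proof -
  interpret VS: vector_space scale_pair by (rule vector_space_scale_pair)
  define G where "G = (\<Union>n. ker (of_real c) n)"
  define e1 :: "(real \<Rightarrow> complex) \<times> (real \<Rightarrow> complex)" where "e1 = ((\<lambda>_. 0), Z c)"
  obtain z where z: "E1 c \<Longrightarrow> (Y c, z) \<in> ker (of_real c) 2"
    by (metis Y_in_ker)
  define e2 where "e2 = (Y c, z)"
  define B where "B = (if E1 c then {e2} else {}) \<union> (if E2 c then {e1} else {})"
  have ne: "e1 \<noteq> e2" using YZ_nonzero[of c] by (auto simp: e1_def e2_def)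
  have BG: "B \<subseteq> G"
    using z Z_in_ker[of c 1] by (auto simp: B_def G_def e1_def e2_def simp del: ker_A.simps)
  have GB: "G \<subseteq> VS.span B"
  proof
    fix w assume "w \<in> G"
    then obtain w1 w2 n where w: "w = (w1, w2)" "(w1, w2) \<in> ker (of_real c) n"
      by (cases w) (auto simp: G_def simp del: ker_A.simps)
    obtain \<alpha> where \<alpha>: "w1 = (\<lambda>x. \<alpha> * Y c x)" "\<not> E1 c \<longrightarrow> \<alpha> = 0" using ker_first[OF w(2)] by blast
    have "\<exists>w'. ((\<lambda>_. 0), w') \<in> ker (of_real c) (max n 2) \<and> w = scale_pair \<alpha> e2 + ((\<lambda>_. 0), w')"
    proof (cases "E1 c")
      case True
      have "(w1, w2) \<in> ker (of_real c) (max n 2)" "(Y c, z) \<in> ker (of_real c) (max n 2)"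
        using ker_mono[OF _ w(2), of "max n 2"] ker_mono[OF _ z[OF True], of "max n 2"] by auto
      from ker_lincomb[OF this, of 1 "- \<alpha>"]
      have "((\<lambda>_. 0), (\<lambda>x. w2 x - \<alpha> * z x)) \<in> ker (of_real c) (max n 2)"
        by (simp add: \<alpha>(1) del: ker_A.simps)
      then show ?thesis
        by (intro exI[of _ "\<lambda>x. w2 x - \<alpha> * z x"]) (simp add: w(1) \<alpha>(1) e2_def scale_pair_def fun_eq_iff del: ker_A.simps)
    next
      case False
      then have "w1 = (\<lambda>_. 0)" using \<alpha> by simp
      then have "((\<lambda>_. 0), w2) \<in> ker (of_real c) (max n 2)"
        using ker_mono[OF _ w(2), of "max n 2"] by simp
      then show ?thesis using False \<alpha>
        by (intro exI[of _ w2]) (simp add: w(1) e2_def scale_pair_def fun_eq_iff del: ker_A.simps)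
    qed
    then obtain w' where w': "((\<lambda>_. 0), w') \<in> ker (of_real c) (max n 2)" "w = scale_pair \<alpha> e2 + ((\<lambda>_. 0), w')" by blast
    obtain \<beta> where \<beta>: "w' = (\<lambda>x. \<beta> * Z c x)" "\<not> E2 c \<longrightarrow> \<beta> = 0" using ker_second[OF w'(1)] by blast
    have eq: "w = scale_pair \<alpha> e2 + scale_pair \<beta> e1"
      using w'(2) by (simp add: \<beta>(1) e1_def scale_pair_def)
    have "scale_pair \<alpha> e2 \<in> VS.span B"
    proof (cases "E1 c")
      case True then show ?thesis by (intro VS.span_scale VS.span_base) (simp add: B_def)
    next
      case False then show ?thesis using \<alpha>(2) VS.span_zero by (simp add: VS.scale_zero_left)
    qed
    moreover have "scale_pair \<beta> e1 \<in> VS.span B"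
    proof (cases "E2 c")
      case True then show ?thesis by (intro VS.span_scale VS.span_base) (simp add: B_def)
    next
      case False then show ?thesis using \<beta>(2) VS.span_zero by (simp add: VS.scale_zero_left)
    qed
    ultimately show "w \<in> VS.span B" unfolding eq by (rule VS.span_add)
  qed
  have ind: "VS.independent B"
  proof -
    have e1nz: "e1 \<noteq> 0" "e2 \<noteq> 0" using YZ_nonzero[of c] by (auto simp: e1_def e2_def zero_prod_def zero_fun_def)
    have "e2 \<notin> VS.span {e1}"
    proof
      assume "e2 \<in> VS.span {e1}"
      then obtain s where "e2 = scale_pair s e1" by (auto simp: VS.span_singleton)
      then have "Y c = (\<lambda>_. 0)" by (simp add: e1_def e2_def scale_pair_def)
      then show False using YZ_nonzero(1) by blast
    qed
    then have "VS.independent {e2, e1}" "VS.independent {e1}" "VS.independent {e2}"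
      using e1nz ne by (auto simp: VS.independent_insert)
    then show ?thesis by (auto simp: B_def VS.independent_empty insert_commute)
  qed
  have "VS.dim G = card B" by (rule VS.dim_unique[OF BG GB ind refl])
  also have "\<dots> = (if E1 c then 1 else 0) + (if E2 c then 1 else 0)" using ne by (auto simp: B_def)
  finally show ?thesis by (simp add: alg_mult_A_def G_def)
qed

lemma E_pos: "E1 c \<Longrightarrow> c > 0" "E2 c \<Longrightarrow> c > 0"
  using left.U_V_pos[of c] right.U_V_pos[of c] by (auto simp: E1_def E2_def not_less[symmetric])

text \<open>Summing the multiplicities \<open>[E1 c] + [E2 c]\<close> over the eigenvalues \<open>c \<le> \<mu> j\<close> counts the zeros of
  \<open>left.V\<close> and of \<open>right.U\<close> up to \<open>\<mu> j\<close>. As \<open>\<mu> j\<close> is simple, the sum is the index \<open>j\<close> itself. This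
  translates the numbering of the eigenvalues of \<open>\<A>\<close> into the zero count for \<open>D \<epsilon>\<close>.\<close>

theorem eigenvalue_index:
  assumes en: "enumerates_eigenvalues_A a b k r \<kappa> \<rho> \<mu>" and j: "j \<ge> 1" and nE2: "\<not> E2 (\<mu> j)"
  shows "E1 (\<mu> j)" "n1 (\<mu> j) + n2 (\<mu> j) = j"
proof -
  have mono: "mono_on {1..} \<mu>" using en by (simp add: enumerates_eigenvalues_A_def)
  have fin: "finite {i\<in>{1..}. \<mu> i = c}" and card: "card {i\<in>{1..}. \<mu> i = c} = (if E1 c then 1 else 0) + (if E2 c then 1 else 0)" for c
  proof -
    have "finite {i\<in>{1..}. complex_of_real (\<mu> i) = of_real c} \<and>
       card {i\<in>{1..}. complex_of_real (\<mu> i) = of_real c} = alg_mult_A a b k r \<kappa> \<rho> (of_real c)"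
      using en[unfolded enumerates_eigenvalues_A_def, THEN conjunct2, THEN spec, of "of_real c"] .
    then show "finite {i\<in>{1..}. \<mu> i = c}" "card {i\<in>{1..}. \<mu> i = c} = (if E1 c then 1 else 0) + (if E2 c then 1 else 0)"
      unfolding alg_mult_A_eq of_real_eq_iff by simp_all
  qed
  have occurs: "E1 (\<mu> i) \<or> E2 (\<mu> i)" if "i \<ge> 1" for i
  proof (rule ccontr)
    assume "\<not> ?thesis"
    then have "{m\<in>{1..}. \<mu> m = \<mu> i} = {}" using card[of "\<mu> i"] fin[of "\<mu> i"] by simp
    then show False using that by auto
  qed
  show E1: "E1 (\<mu> j)" using occurs[OF j] nE2 by simp
  have single: "i = j" if "i \<ge> 1" "\<mu> i = \<mu> j" for i
  proof -
    have "card {i\<in>{1..}. \<mu> i = \<mu> j} = 1" using card[of "\<mu> j"] E1 nE2 by simp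
    then obtain m where "{i\<in>{1..}. \<mu> i = \<mu> j} = {m}" using card_1_singletonE by blast
    then have "i \<in> {m}" "j \<in> {m}" using that j by auto
    then show ?thesis by simp
  qed
  define A where "A = {x \<in> {0..\<mu> j}. left.V x 0 = 0}"
  define B where "B = {x \<in> {0..\<mu> j}. right.U x 0 = 0}"
  have "\<mu> j > 0" using E_pos E1 by blast
  then have finAB: "finite A" "finite B" using zeros_finite[of "\<mu> j"] by (simp_all add: A_def B_def)
  have "{1..j} = (\<Union>c\<in>A \<union> B. {i\<in>{1..}. \<mu> i = c})"
  proof (intro equalityI subsetI)
    fix i assume i: "i \<in> {1..j}"
    then have "\<mu> i \<le> \<mu> j" using mono_onD[OF mono, of i j] by auto
    moreover have "E1 (\<mu> i) \<or> E2 (\<mu> i)" using occurs i by simp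
    ultimately have "\<mu> i \<in> A \<union> B" using E_pos[of "\<mu> i"] by (auto simp: A_def B_def E1_def E2_def)
    then show "i \<in> (\<Union>c\<in>A \<union> B. {i\<in>{1..}. \<mu> i = c})" using i by auto
  next
    fix i assume "i \<in> (\<Union>c\<in>A \<union> B. {i\<in>{1..}. \<mu> i = c})"
    then have i: "i \<ge> 1" "\<mu> i \<le> \<mu> j" by (auto simp: A_def B_def)
    show "i \<in> {1..j}"
    proof (rule ccontr)
      assume "i \<notin> {1..j}"
      then have "j < i" using i by simp
      then have "\<mu> j \<le> \<mu> i" using mono_onD[OF mono, of j i] j by simp
      then have "\<mu> i = \<mu> j" using i by simp
      then show False using single i(1) \<open>j < i\<close> by blast
    qed
  qed
  then have "j = card (\<Union>c\<in>A \<union> B. {i\<in>{1..}. \<mu> i = c})" by (metis card_atLeastAtMost diff_Suc_1)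
  also have "\<dots> = (\<Sum>c\<in>A \<union> B. card {i\<in>{1..}. \<mu> i = c})"
    using finAB fin by (intro card_UN_disjoint) auto
  also have "\<dots> = (\<Sum>c\<in>A \<union> B. (if c \<in> A then 1 else 0) + (if c \<in> B then 1 else 0))"
    by (rule sum.cong[OF refl], subst card) (auto simp: A_def B_def E1_def E2_def)
  also have "\<dots> = card A + card B"
    using finAB by (simp add: sum.distrib sum.If_cases Int_absorb1 Int_absorb2)
  finally show "n1 (\<mu> j) + n2 (\<mu> j) = j" by (simp add: A_def B_def)
qed

end

section \<open>Uniform orders in the small parameter\<close>

text \<open>\<open>f \<epsilon> x = O(\<epsilon>\<^sup>m)\<close> as \<open>\<epsilon>\<close> varies along \<open>F\<close>, uniformly for \<open>x \<in> S\<close>. The filter is \<open>at_right 0\<close> for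
  asymptotic statements and the principal filter of \<open>{0<..<\<epsilon>0}\<close> for estimates on a whole interval
  of parameters. A quantity without a space variable is treated as constant in \<open>x\<close>.\<close>

definition ordo :: "real filter \<Rightarrow> real set \<Rightarrow> nat \<Rightarrow> (real \<Rightarrow> real \<Rightarrow> real) \<Rightarrow> bool" where
  "ordo F S m f \<longleftrightarrow> (\<exists>C. \<forall>\<^sub>F \<epsilon> in F. \<forall>x\<in>S. \<bar>f \<epsilon> x\<bar> \<le> C * \<bar>\<epsilon>\<bar> ^ m)"

lemma ordoI: "\<forall>\<^sub>F \<epsilon> in F. \<forall>x\<in>S. \<bar>f \<epsilon> x\<bar> \<le> C * \<bar>\<epsilon>\<bar> ^ m \<Longrightarrow> ordo F S m f"
  unfolding ordo_def by blast

lemma ordoE: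
  assumes "ordo F S m f"
  obtains C where "C \<ge> 0" "\<forall>\<^sub>F \<epsilon> in F. \<forall>x\<in>S. \<bar>f \<epsilon> x\<bar> \<le> C * \<bar>\<epsilon>\<bar> ^ m"
proof -
  obtain C where C: "\<forall>\<^sub>F \<epsilon> in F. \<forall>x\<in>S. \<bar>f \<epsilon> x\<bar> \<le> C * \<bar>\<epsilon>\<bar> ^ m"
    using assms unfolding ordo_def by blast
  have "\<forall>\<^sub>F \<epsilon> in F. \<forall>x\<in>S. \<bar>f \<epsilon> x\<bar> \<le> \<bar>C\<bar> * \<bar>\<epsilon>\<bar> ^ m"
    using C
  proof eventually_elim
    case (elim \<epsilon>)
    have "C * \<bar>\<epsilon>\<bar> ^ m \<le> \<bar>C\<bar> * \<bar>\<epsilon>\<bar> ^ m" by (intro mult_right_mono) auto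
    then show ?case using elim order_trans by blast
  qed
  then show thesis by (rule that[rotated]) simp
qed

lemma ordo_cong:
  assumes "ordo F S m f" "\<forall>\<^sub>F \<epsilon> in F. \<forall>x\<in>S. f \<epsilon> x = g \<epsilon> x"
  shows "ordo F S m g"
proof -
  obtain C where "\<forall>\<^sub>F \<epsilon> in F. \<forall>x\<in>S. \<bar>f \<epsilon> x\<bar> \<le> C * \<bar>\<epsilon>\<bar> ^ m" using assms(1) unfolding ordo_def by blast
  with assms(2) have "\<forall>\<^sub>F \<epsilon> in F. \<forall>x\<in>S. \<bar>g \<epsilon> x\<bar> \<le> C * \<bar>\<epsilon>\<bar> ^ m" by eventually_elim simp
  then show ?thesis by (rule ordoI)
qed

lemma ordo_add:
  assumes "ordo F S m f" "ordo F S m g"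
  shows "ordo F S m (\<lambda>\<epsilon> x. f \<epsilon> x + g \<epsilon> x)"
proof -
  obtain C D where C: "\<forall>\<^sub>F \<epsilon> in F. \<forall>x\<in>S. \<bar>f \<epsilon> x\<bar> \<le> C * \<bar>\<epsilon>\<bar> ^ m" and D: "\<forall>\<^sub>F \<epsilon> in F. \<forall>x\<in>S. \<bar>g \<epsilon> x\<bar> \<le> D * \<bar>\<epsilon>\<bar> ^ m"
    using assms unfolding ordo_def by blast
  from C D have "\<forall>\<^sub>F \<epsilon> in F. \<forall>x\<in>S. \<bar>f \<epsilon> x + g \<epsilon> x\<bar> \<le> (C + D) * \<bar>\<epsilon>\<bar> ^ m"
  proof eventually_elim
    case (elim \<epsilon>)
    show ?case
    proof
      fix x assume "x \<in> S"
      then have "\<bar>f \<epsilon> x\<bar> \<le> C * \<bar>\<epsilon>\<bar> ^ m" "\<bar>g \<epsilon> x\<bar> \<le> D * \<bar>\<epsilon>\<bar> ^ m" using elim by auto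
      then show "\<bar>f \<epsilon> x + g \<epsilon> x\<bar> \<le> (C + D) * \<bar>\<epsilon>\<bar> ^ m"
        using abs_triangle_ineq[of "f \<epsilon> x" "g \<epsilon> x"] by (simp add: distrib_right)
    qed
  qed
  then show ?thesis by (rule ordoI)
qed

lemma ordo_mult:
  assumes "ordo F S m f" "ordo F S l g"
  shows "ordo F S (m + l) (\<lambda>\<epsilon> x. f \<epsilon> x * g \<epsilon> x)"
proof -
  obtain C where C0: "C \<ge> 0" and C: "\<forall>\<^sub>F \<epsilon> in F. \<forall>x\<in>S. \<bar>f \<epsilon> x\<bar> \<le> C * \<bar>\<epsilon>\<bar> ^ m" by (rule ordoE[OF assms(1)])
  obtain D where D0: "D \<ge> 0" and D: "\<forall>\<^sub>F \<epsilon> in F. \<forall>x\<in>S. \<bar>g \<epsilon> x\<bar> \<le> D * \<bar>\<epsilon>\<bar> ^ l" by (rule ordoE[OF assms(2)])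
  from C D have "\<forall>\<^sub>F \<epsilon> in F. \<forall>x\<in>S. \<bar>f \<epsilon> x * g \<epsilon> x\<bar> \<le> (C * D) * \<bar>\<epsilon>\<bar> ^ (m + l)"
  proof eventually_elim
    case (elim \<epsilon>)
    show ?case
    proof
      fix x assume "x \<in> S"
      then have "\<bar>f \<epsilon> x\<bar> * \<bar>g \<epsilon> x\<bar> \<le> (C * \<bar>\<epsilon>\<bar> ^ m) * (D * \<bar>\<epsilon>\<bar> ^ l)"
        using elim C0 by (intro mult_mono) auto
      then show "\<bar>f \<epsilon> x * g \<epsilon> x\<bar> \<le> (C * D) * \<bar>\<epsilon>\<bar> ^ (m + l)"
        by (simp add: abs_mult power_add mult_ac)
    qed
  qed
  then show ?thesis by (rule ordoI)
qed

lemma ordo_mult_left: "ordo F S 0 f \<Longrightarrow> ordo F S m g \<Longrightarrow> ordo F S m (\<lambda>\<epsilon> x. f \<epsilon> x * g \<epsilon> x)"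
  using ordo_mult[of F S 0 f m g] by simp

lemma ordo_mult_right: "ordo F S m f \<Longrightarrow> ordo F S 0 g \<Longrightarrow> ordo F S m (\<lambda>\<epsilon> x. f \<epsilon> x * g \<epsilon> x)"
  using ordo_mult[of F S m f 0 g] by simp

lemma ordo_const: "ordo F S 0 (\<lambda>_ _. c)"
  by (rule ordoI[where C = "\<bar>c\<bar>"]) simp

lemma ordo_uminus: "ordo F S m f \<Longrightarrow> ordo F S m (\<lambda>\<epsilon> x. - f \<epsilon> x)"
  by (simp add: ordo_def)

lemma ordo_diff: "ordo F S m f \<Longrightarrow> ordo F S m g \<Longrightarrow> ordo F S m (\<lambda>\<epsilon> x. f \<epsilon> x - g \<epsilon> x)"
  using ordo_add[OF _ ordo_uminus, of F S m f g] by simp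

lemma ordo_param_power: "ordo F S m (\<lambda>\<epsilon> _. \<epsilon> ^ m)"
  by (rule ordoI[where C = 1]) (simp add: power_abs)

lemma ordo_param_power_0:
  assumes "\<forall>\<^sub>F \<epsilon> in F. \<bar>\<epsilon>\<bar> \<le> 1"
  shows "ordo F S 0 (\<lambda>\<epsilon> _. \<epsilon> ^ m)"
  by (rule ordoI[where C = 1], use assms in eventually_elim) (simp add: power_abs power_le_one)

lemma ordo_sum: "finite I \<Longrightarrow> (\<And>i. i \<in> I \<Longrightarrow> ordo F S m (f i)) \<Longrightarrow> ordo F S m (\<lambda>\<epsilon> x. \<Sum>i\<in>I. f i \<epsilon> x)"
proof (induction I rule: finite_induct)
  case empty
  show ?case by (rule ordoI[where C = 0]) simp
next
  case (insert i I)
  then show ?case by (simp add: ordo_add)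
qed

lemma ordo_continuous:
  assumes "continuous_on {c..d} h"
  shows "ordo F {c..d} 0 (\<lambda>_. h)"
proof -
  have "bounded (h ` {c..d})" using assms by (intro compact_imp_bounded compact_continuous_image) auto
  then obtain B where "\<forall>y\<in>h ` {c..d}. norm y \<le> B" unfolding bounded_iff by blast
  then show ?thesis by (intro ordoI[where C = B]) auto
qed

lemma ordo_tendsto:
  assumes "(s \<longlongrightarrow> l) F"
  shows "ordo F S 0 (\<lambda>\<epsilon> _. s \<epsilon>)"
proof (rule ordoI[where C = "\<bar>l\<bar> + 1"])
  have "\<forall>\<^sub>F \<epsilon> in F. dist (s \<epsilon>) l < 1" using assms tendstoD zero_less_one by blast
  then show "\<forall>\<^sub>F \<epsilon> in F. \<forall>x\<in>S. \<bar>s \<epsilon>\<bar> \<le> (\<bar>l\<bar> + 1) * \<bar>\<epsilon>\<bar> ^ 0"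
  proof eventually_elim
    case (elim \<epsilon>)
    then have "\<bar>s \<epsilon>\<bar> \<le> \<bar>l\<bar> + 1" unfolding dist_real_def by linarith
    then show ?case by simp
  qed
qed

lemma ordo_uniform_limit:
  assumes "uniform_limit {c..d} f l F" "continuous_on {c..d} l"
  shows "ordo F {c..d} 0 f"
proof -
  have "ordo F {c..d} 0 (\<lambda>\<epsilon> x. f \<epsilon> x - l x)"
  proof (rule ordoI[where C = 1])
    have "\<forall>\<^sub>F \<epsilon> in F. \<forall>x\<in>{c..d}. dist (f \<epsilon> x) (l x) < 1" using assms(1) uniform_limitD zero_less_one by blast
    then show "\<forall>\<^sub>F \<epsilon> in F. \<forall>x\<in>{c..d}. \<bar>f \<epsilon> x - l x\<bar> \<le> 1 * \<bar>\<epsilon>\<bar> ^ 0"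
      by eventually_elim (auto simp: dist_real_def less_imp_le)
  qed
  from ordo_add[OF this ordo_continuous[OF assms(2)]] show ?thesis by simp
qed

lemma ordo_at: "ordo F S m f \<Longrightarrow> x \<in> S \<Longrightarrow> ordo F T m (\<lambda>\<epsilon> _. f \<epsilon> x)"
  unfolding ordo_def by (elim exE) (auto elim!: eventually_mono)

lemma ordo_integral:
  assumes "ordo F {c..d} m f" "c \<le> d"
  shows "ordo F T m (\<lambda>\<epsilon> _. integral {c..d} (f \<epsilon>))"
proof -
  obtain C where C0: "C \<ge> 0" and C: "\<forall>\<^sub>F \<epsilon> in F. \<forall>x\<in>{c..d}. \<bar>f \<epsilon> x\<bar> \<le> C * \<bar>\<epsilon>\<bar> ^ m" by (rule ordoE[OF assms(1)])
  have "\<forall>\<^sub>F \<epsilon> in F. \<forall>x\<in>T. \<bar>integral {c..d} (f \<epsilon>)\<bar> \<le> (C * (d - c)) * \<bar>\<epsilon>\<bar> ^ m"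
    using C
  proof eventually_elim
    case (elim \<epsilon>)
    have "norm (integral {c..d} (f \<epsilon>)) \<le> C * \<bar>\<epsilon>\<bar> ^ m * (d - c)"
    proof (cases "f \<epsilon> integrable_on {c..d}")
      case True
      have "norm (integral {c..d} (f \<epsilon>)) \<le> integral {c..d} (\<lambda>_. C * \<bar>\<epsilon>\<bar> ^ m)"
        by (rule integral_norm_bound_integral[OF True]) (use elim in auto)
      then show ?thesis using assms(2) by (simp add: mult_ac)
    next
      case False
      then show ?thesis using C0 assms(2) by (simp add: not_integrable_integral)
    qed
    then show ?case by (simp add: mult_ac)
  qed
  then show ?thesis by (rule ordoI)
qed

text \<open>The constant of the a priori bound does not depend on \<open>\<epsilon>\<close>, so a family of solutions with zero
  data at one end inherits the order of its forcing.\<close>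

lemma ordo_apriori:
  fixes p :: "real \<Rightarrow> real"
  assumes cd: "c < d" and contp: "continuous_on {c..d} p"
    and ppos: "\<And>x. x \<in> {c..d} \<Longrightarrow> p x > 0"
    and s: "\<forall>\<^sub>F \<epsilon> in F. sl_sys p {c..d} (\<lambda>x. h \<epsilon> x * u \<epsilon> x + g \<epsilon> x) (u \<epsilon>) (v \<epsilon>)"
    and h: "ordo F {c..d} 0 h" and g: "ordo F {c..d} m g"
    and e: "e = c \<or> e = d" and init: "\<forall>\<^sub>F \<epsilon> in F. u \<epsilon> e = 0 \<and> v \<epsilon> e = 0"
  shows "ordo F {c..d} m u" "ordo F {c..d} m v"
proof -
  obtain Q where Q0: "Q \<ge> 0" and Q: "\<forall>\<^sub>F \<epsilon> in F. \<forall>x\<in>{c..d}. \<bar>h \<epsilon> x\<bar> \<le> Q * \<bar>\<epsilon>\<bar> ^ 0" by (rule ordoE[OF h])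
  obtain G where G0: "G \<ge> 0" and G: "\<forall>\<^sub>F \<epsilon> in F. \<forall>x\<in>{c..d}. \<bar>g \<epsilon> x\<bar> \<le> G * \<bar>\<epsilon>\<bar> ^ m" by (rule ordoE[OF g])
  from sl_sys_apriori[OF cd contp ppos Q0] obtain C where C: "apriori_const c d p Q C" by blast
  have "\<forall>\<^sub>F \<epsilon> in F. \<forall>x\<in>{c..d}. \<bar>u \<epsilon> x\<bar> \<le> (C * G) * \<bar>\<epsilon>\<bar> ^ m \<and> \<bar>v \<epsilon> x\<bar> \<le> (C * G) * \<bar>\<epsilon>\<bar> ^ m"
    using s Q G init
  proof eventually_elim
    case (elim \<epsilon>)
    have le: "\<bar>h \<epsilon> x * u \<epsilon> x + g \<epsilon> x\<bar> \<le> Q * \<bar>u \<epsilon> x\<bar> + G * \<bar>\<epsilon>\<bar> ^ m" if x: "x \<in> {c..d}" for x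
    proof -
      have "\<bar>h \<epsilon> x\<bar> * \<bar>u \<epsilon> x\<bar> \<le> Q * \<bar>u \<epsilon> x\<bar>" using elim(2) x by (intro mult_right_mono) auto
      moreover have "\<bar>g \<epsilon> x\<bar> \<le> G * \<bar>\<epsilon>\<bar> ^ m" using elim(3) x by auto
      ultimately show ?thesis using abs_triangle_ineq[of "h \<epsilon> x * u \<epsilon> x" "g \<epsilon> x"] by (simp add: abs_mult)
    qed
    have "0 \<le> G * \<bar>\<epsilon>\<bar> ^ m" using G0 by simp
    from apriori_constD[OF C elim(1) e this le] elim(4) show ?case by (simp add: mult.assoc)
  qed
  then have "\<forall>\<^sub>F \<epsilon> in F. \<forall>x\<in>{c..d}. \<bar>u \<epsilon> x\<bar> \<le> (C * G) * \<bar>\<epsilon>\<bar> ^ m" "\<forall>\<^sub>F \<epsilon> in F. \<forall>x\<in>{c..d}. \<bar>v \<epsilon> x\<bar> \<le> (C * G) * \<bar>\<epsilon>\<bar> ^ m"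
    by (auto elim: eventually_mono)
  then show "ordo F {c..d} m u" "ordo F {c..d} m v" by (auto intro: ordoI)
qed

text \<open>For \<open>\<epsilon> \<ge> \<delta>\<close> a bounded quantity is at most a constant times \<open>\<epsilon>\<^sup>m / \<delta>\<^sup>m\<close>. Hence an estimate that
  holds for small \<open>\<epsilon>\<close>, with the threshold depending on the order, extends to a fixed interval of
  parameters at the price of a larger constant.\<close>

lemma ordo_principal:
  assumes loc: "ordo (at_right 0) S m f" and bd: "ordo (principal {0<..<\<epsilon>0}) S 0 f"
  shows "ordo (principal {0<..<\<epsilon>0}) S m f"
proof -
  obtain C where C0: "C \<ge> 0" and C: "\<forall>\<^sub>F \<epsilon> in at_right 0. \<forall>x\<in>S. \<bar>f \<epsilon> x\<bar> \<le> C * \<bar>\<epsilon>\<bar> ^ m" by (rule ordoE[OF loc])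
  obtain D where D0: "D \<ge> 0" and D: "\<forall>\<^sub>F \<epsilon> in principal {0<..<\<epsilon>0}. \<forall>x\<in>S. \<bar>f \<epsilon> x\<bar> \<le> D * \<bar>\<epsilon>\<bar> ^ 0" by (rule ordoE[OF bd])
  obtain \<delta> where \<delta>: "\<delta> > 0" "\<And>\<epsilon>. 0 < \<epsilon> \<Longrightarrow> \<epsilon> < \<delta> \<Longrightarrow> \<forall>x\<in>S. \<bar>f \<epsilon> x\<bar> \<le> C * \<bar>\<epsilon>\<bar> ^ m"
    using C unfolding eventually_at_right_field by auto
  show ?thesis
  proof (rule ordoI[where C = "C + D / \<delta> ^ m"], unfold eventually_principal, intro ballI)
    fix \<epsilon> x assume \<epsilon>: "\<epsilon> \<in> {0<..<\<epsilon>0}" and x: "x \<in> S"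
    show "\<bar>f \<epsilon> x\<bar> \<le> (C + D / \<delta> ^ m) * \<bar>\<epsilon>\<bar> ^ m"
    proof (cases "\<epsilon> < \<delta>")
      case True
      then have "\<bar>f \<epsilon> x\<bar> \<le> C * \<bar>\<epsilon>\<bar> ^ m" using \<delta>(2)[of \<epsilon>] \<epsilon> x by auto
      also have "\<dots> \<le> (C + D / \<delta> ^ m) * \<bar>\<epsilon>\<bar> ^ m" using D0 \<delta> by (intro mult_right_mono) auto
      finally show ?thesis .
    next
      case False
      have "\<bar>f \<epsilon> x\<bar> \<le> D / \<delta> ^ m * \<delta> ^ m" using D \<epsilon> x \<delta> by (simp add: eventually_principal)
      also have "\<dots> \<le> D / \<delta> ^ m * \<bar>\<epsilon>\<bar> ^ m"
        using False \<delta> D0 by (intro mult_left_mono power_mono) auto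
      also have "\<dots> \<le> (C + D / \<delta> ^ m) * \<bar>\<epsilon>\<bar> ^ m" using C0 by (intro mult_right_mono) auto
      finally show ?thesis .
    qed
  qed
qed

lemma ordo_imp_smallo:
  assumes "ordo (at_right 0) S (Suc m) (\<lambda>\<epsilon> _. f \<epsilon>)" "S \<noteq> {}"
  shows "f \<in> o[at_right 0](\<lambda>\<epsilon>. \<epsilon> ^ m)"
proof -
  obtain C where C: "\<forall>\<^sub>F \<epsilon> in at_right 0. \<forall>x\<in>S. \<bar>f \<epsilon>\<bar> \<le> C * \<bar>\<epsilon>\<bar> ^ Suc m" by (rule ordoE[OF assms(1)])
  then have "\<forall>\<^sub>F \<epsilon> in at_right 0. norm (f \<epsilon>) \<le> C * norm (\<epsilon> ^ Suc m)"
    using assms(2) by (auto elim!: eventually_mono simp: power_abs[symmetric] abs_mult)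
  then have "f \<in> O[at_right 0](\<lambda>\<epsilon>. \<epsilon> ^ Suc m)" by (rule bigoI)
  moreover have "(\<lambda>\<epsilon>::real. \<epsilon> ^ Suc m) \<in> o[at_right 0](\<lambda>\<epsilon>. \<epsilon> ^ m)"
  proof (rule smalloI_tendsto)
    have "((\<lambda>\<epsilon>::real. \<epsilon>) \<longlongrightarrow> 0) (at_right 0)" by (rule tendsto_ident_at)
    then show "((\<lambda>\<epsilon>::real. \<epsilon> ^ Suc m / \<epsilon> ^ m) \<longlongrightarrow> 0) (at_right 0)"
      by (rule Lim_transform_eventually)
         (use eventually_at_right_less[of "0::real"] in eventually_elim, simp)
    show "\<forall>\<^sub>F \<epsilon>::real in at_right 0. \<epsilon> ^ m \<noteq> 0"
      using eventually_at_right_less[of "0::real"] by eventually_elim simp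
  qed
  ultimately show ?thesis by (rule landau_o.big_small_trans)
qed

section \<open>The Sobolev norm of functions glued at the interface\<close>

lemma H1_norm_nonneg: "H1_norm c d f \<ge> 0"
  unfolding H1_norm_def by (intro real_sqrt_ge_zero add_nonneg_nonneg integral_nonneg_any) auto

lemma integral_le_const_off_finite:
  fixes g :: "real \<Rightarrow> real"
  assumes "finite X" "\<And>x. x \<in> {c..d} \<Longrightarrow> x \<notin> X \<Longrightarrow> g x \<le> B" "0 \<le> B" "c \<le> d"
  shows "integral {c..d} g \<le> B * (d - c)"
proof (cases "g integrable_on {c..d}")
  case True
  define g' where "g' = (\<lambda>x. if x \<in> X then 0 else g x)"
  have neg: "negligible X" using assms(1) by (rule negligible_finite)
  have "integral {c..d} g = integral {c..d} g'"
    by (rule integral_spike[OF neg]) (simp add: g'_def)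
  also have "\<dots> \<le> integral {c..d} (\<lambda>_. B)"
  proof (rule integral_le)
    show "g' integrable_on {c..d}"
      by (rule integrable_spike[OF True neg]) (simp add: g'_def)
    show "g' x \<le> B" if "x \<in> {c..d}" for x using assms(2,3) that by (simp add: g'_def)
  qed auto
  finally show ?thesis using assms(4) by (simp add: mult.commute)
next
  case False
  then show ?thesis using assms by (simp add: not_integrable_integral)
qed

text \<open>The norm only sees the function and its derivative almost everywhere, so finitely many corners,
  such as the interface, may be left out.\<close>

lemma H1_norm_le:
  fixes f :: "real \<Rightarrow> real"
  assumes cd: "c \<le> d" and fin: "finite X" and M: "0 \<le> M"
    and f: "\<And>x. c < x \<Longrightarrow> x < d \<Longrightarrow> x \<notin> X \<Longrightarrow> \<bar>f x\<bar> \<le> M"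
    and f': "\<And>x. c < x \<Longrightarrow> x < d \<Longrightarrow> x \<notin> X \<Longrightarrow> \<exists>D. (f has_real_derivative D) (at x) \<and> \<bar>D\<bar> \<le> M"
  shows "H1_norm c d f \<le> sqrt (2 * (d - c)) * M"
proof -
  have fin': "finite (X \<union> {c, d})" using fin by simp
  have sq: "y\<^sup>2 \<le> M\<^sup>2" if "\<bar>y\<bar> \<le> M" for y :: real
    using power_mono[OF that, of 2] by simp
  have "integral {c..d} (\<lambda>x. (norm (f x))\<^sup>2) \<le> M\<^sup>2 * (d - c)"
    by (rule integral_le_const_off_finite[OF fin']) (use f cd in \<open>auto intro!: sq\<close>)
  moreover have "integral {c..d} (\<lambda>x. (norm (vector_derivative f (at x)))\<^sup>2) \<le> M\<^sup>2 * (d - c)"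
  proof (rule integral_le_const_off_finite[OF fin'])
    fix x assume "x \<in> {c..d}" "x \<notin> X \<union> {c, d}"
    then obtain D where "(f has_real_derivative D) (at x)" "\<bar>D\<bar> \<le> M" using f'[of x] by auto
    then show "(norm (vector_derivative f (at x)))\<^sup>2 \<le> M\<^sup>2"
      by (auto intro!: sq simp: has_real_derivative_iff_has_vector_derivative vector_derivative_at)
  qed (use cd in auto)
  ultimately have "H1_norm c d f \<le> sqrt (2 * (d - c) * M\<^sup>2)"
    unfolding H1_norm_def by (intro real_sqrt_le_mono) (simp add: algebra_simps)
  then show ?thesis using M by (simp add: real_sqrt_mult)
qed

context transmission begin

text \<open>\<open>g1\<close> and \<open>g2\<close> are the fluxes of \<open>f1\<close> and \<open>f2\<close>. Bounds on function and flux are what the systems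
  deliver, and the coefficients \<open>k\<close> and \<open>\<kappa>\<close> are bounded away from zero.\<close>

definition flux_bounded :: "real \<Rightarrow> (real \<Rightarrow> real) \<Rightarrow> (real \<Rightarrow> real) \<Rightarrow> (real \<Rightarrow> real) \<Rightarrow> (real \<Rightarrow> real) \<Rightarrow> bool" where
  "flux_bounded M f1 g1 f2 g2 \<longleftrightarrow>
    (\<forall>x\<in>{a..0}. (f1 has_real_derivative g1 x / k x) (at x within {a..0}) \<and> \<bar>f1 x\<bar> \<le> M \<and> \<bar>g1 x\<bar> \<le> M) \<and>
    (\<forall>x\<in>{0..b}. (f2 has_real_derivative g2 x / \<kappa> x) (at x within {0..b}) \<and> \<bar>f2 x\<bar> \<le> M \<and> \<bar>g2 x\<bar> \<le> M)"

lemma H1_norm_glue_bound: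
  obtains K where "K \<ge> 0"
    "\<forall>M f1 g1 f2 g2. flux_bounded M f1 g1 f2 g2 \<longrightarrow>
       H1_norm a b (glue f1 f2) \<le> K * M \<and> H1_norm a 0 f1 \<le> K * M \<and> H1_norm 0 b f2 \<le> K * M"
proof -
  obtain P1 Q1 where P1: "P1 > 0" "\<And>x. x \<in> {a..0} \<Longrightarrow> 1 / k x \<le> P1" using left.bounds by metis
  obtain P2 Q2 where P2: "P2 > 0" "\<And>x. x \<in> {-b..0} \<Longrightarrow> 1 / \<kappa> (- x) \<le> P2" using right.bounds by metis
  define P where "P = 1 + P1 + P2"
  have Pk: "1 / k x \<le> P" if "x \<in> {a..0}" for x using P1(2)[OF that] P1(1) P2(1) unfolding P_def by linarith
  have P\<kappa>: "1 / \<kappa> x \<le> P" if "x \<in> {0..b}" for x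
  proof -
    have "1 / \<kappa> (- (- x)) \<le> P2" by (rule P2(2)) (use that in auto)
    then show ?thesis using P1(1) P2(1) by (simp add: P_def)
  qed
  define K where "K = sqrt (2 * (b - a)) * P"
  have P: "P \<ge> 1" using P1 P2 by (simp add: P_def)
  have K: "K \<ge> 0" using P a0 b0 by (simp add: K_def)
  have "H1_norm a b (glue f1 f2) \<le> K * M \<and> H1_norm a 0 f1 \<le> K * M \<and> H1_norm 0 b f2 \<le> K * M"
    if fb: "flux_bounded M f1 g1 f2 g2" for M f1 g1 f2 g2
  proof -
    have M: "M \<ge> 0" using fb a0 abs_ge_zero[of "f1 0"] unfolding flux_bounded_def by force
    then have MP: "M \<le> P * M" "0 \<le> P * M" using P mult_right_mono[of 1 P M] by auto
    have quot: "\<bar>y / q\<bar> \<le> P * M" if "\<bar>y\<bar> \<le> M" "1 / q \<le> P" "q > 0" for y q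
    proof -
      have "\<bar>y / q\<bar> = (1 / q) * \<bar>y\<bar>" using that by (simp add: abs_divide)
      also have "\<dots> \<le> P * M" using that P M by (intro mult_mono) auto
      finally show ?thesis .
    qed
    have l: "(f1 has_real_derivative g1 x / k x) (at x)" "\<bar>g1 x / k x\<bar> \<le> P * M" "\<bar>f1 x\<bar> \<le> P * M" if "a < x" "x < 0" for x
    proof -
      have x: "x \<in> {a..0}" using that by auto
      have "(f1 has_real_derivative g1 x / k x) (at x within {a..0})" "\<bar>f1 x\<bar> \<le> M" "\<bar>g1 x\<bar> \<le> M"
        using fb x unfolding flux_bounded_def by auto
      then show "(f1 has_real_derivative g1 x / k x) (at x)" "\<bar>g1 x / k x\<bar> \<le> P * M" "\<bar>f1 x\<bar> \<le> P * M"
        using that quot[OF _ Pk[OF x] posk[OF x]] MP by (auto simp: at_within_Icc_at)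
    qed
    have r: "(f2 has_real_derivative g2 x / \<kappa> x) (at x)" "\<bar>g2 x / \<kappa> x\<bar> \<le> P * M" "\<bar>f2 x\<bar> \<le> P * M" if "0 < x" "x < b" for x
    proof -
      have x: "x \<in> {0..b}" using that by auto
      have "(f2 has_real_derivative g2 x / \<kappa> x) (at x within {0..b})" "\<bar>f2 x\<bar> \<le> M" "\<bar>g2 x\<bar> \<le> M"
        using fb x unfolding flux_bounded_def by auto
      then show "(f2 has_real_derivative g2 x / \<kappa> x) (at x)" "\<bar>g2 x / \<kappa> x\<bar> \<le> P * M" "\<bar>f2 x\<bar> \<le> P * M"
        using that quot[OF _ P\<kappa>[OF x] pos\<kappa>[OF x]] MP by (auto simp: at_within_Icc_at)
    qed
    have le: "sqrt (2 * (d - c)) * (P * M) \<le> K * M" if "d - c \<le> b - a" for c d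
    proof -
      have "sqrt (2 * (d - c)) \<le> sqrt (2 * (b - a))" using that by simp
      then show ?thesis using MP by (simp add: K_def mult.assoc mult_right_mono)
    qed
    have "H1_norm a 0 f1 \<le> sqrt (2 * (0 - a)) * (P * M)"
    proof (rule H1_norm_le[of _ _ "{}"])
      fix x assume x: "a < x" "x < 0"
      show "\<bar>f1 x\<bar> \<le> P * M" by (rule l(3)[OF x])
      show "\<exists>D. (f1 has_real_derivative D) (at x) \<and> \<bar>D\<bar> \<le> P * M" using l(1,2)[OF x] by blast
    qed (use a0 MP in auto)
    moreover have "H1_norm 0 b f2 \<le> sqrt (2 * (b - 0)) * (P * M)"
    proof (rule H1_norm_le[of _ _ "{}"])
      fix x assume x: "0 < x" "x < b"
      show "\<bar>f2 x\<bar> \<le> P * M" by (rule r(3)[OF x])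
      show "\<exists>D. (f2 has_real_derivative D) (at x) \<and> \<bar>D\<bar> \<le> P * M" using r(1,2)[OF x] by blast
    qed (use b0 MP in auto)
    moreover have "H1_norm a b (glue f1 f2) \<le> sqrt (2 * (b - a)) * (P * M)"
    proof (rule H1_norm_le[of _ _ "{0}"])
      fix x assume x: "a < x" "x < b" "x \<notin> {0}"
      show "\<bar>glue f1 f2 x\<bar> \<le> P * M"
        using l(3)[of x] r(3)[of x] x by (cases "x < 0") (auto simp: glue_def)
      show "\<exists>D. (glue f1 f2 has_real_derivative D) (at x) \<and> \<bar>D\<bar> \<le> P * M"
      proof (cases "x < 0")
        case True
        have "(glue f1 f2 has_real_derivative g1 x / k x) (at x)"
          by (rule has_field_derivative_transform_within_open[OF l(1)[OF x(1) True], of "{..<0}"])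
             (use True in \<open>auto simp: glue_def\<close>)
        then show ?thesis using l(2)[OF x(1) True] by blast
      next
        case False
        then have x0: "0 < x" using x by auto
        have "(glue f1 f2 has_real_derivative g2 x / \<kappa> x) (at x)"
          by (rule has_field_derivative_transform_within_open[OF r(1)[OF x0 x(2)], of "{0<..}"])
             (use x0 in \<open>auto simp: glue_def\<close>)
        then show ?thesis using r(2)[OF x0 x(2)] by blast
      qed
    qed (use a0 b0 MP in auto)
    ultimately show ?thesis using le[of 0 a] le[of b 0] le[of b a] a0 b0 by fastforce
  qed
  then show thesis using that[OF K] by blast
qed

text \<open>The glued function is continuous and piecewise continuously differentiable, so it is the
  integral of its piecewise derivative.\<close>

lemma glue_in_H1:
  assumes f1: "\<And>x. x \<in> {a..0} \<Longrightarrow> (f1 has_real_derivative g1 x) (at x within {a..0})"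
    and f2: "\<And>x. x \<in> {0..b} \<Longrightarrow> (f2 has_real_derivative g2 x) (at x within {0..b})"
    and g1: "continuous_on {a..0} g1" and g2: "continuous_on {0..b} g2"
    and e1: "\<And>x. x \<in> {a..0} \<Longrightarrow> f x = f1 x" and e2: "\<And>x. x \<in> {0..b} \<Longrightarrow> f x = f2 x"
  shows "f \<in> H1 a b"
proof -
  define g where "g = glue g1 g2"
  have ab: "{a..0} \<union> {0..b} = {a..b}" using a0 b0 by auto
  have "continuous_on {a..0} f1" using f1 by (rule DERIV_continuous_on)
  then have c1: "continuous_on {a..0} f" by (rule continuous_on_eq) (simp add: e1)
  have "continuous_on {0..b} f2" using f2 by (rule DERIV_continuous_on)
  then have c2: "continuous_on {0..b} f" by (rule continuous_on_eq) (simp add: e2)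
  have contf: "continuous_on {a..b} f"
    using continuous_on_closed_Un[OF _ _ c1 c2] ab by simp
  have int: "(\<lambda>x. h (g x)) integrable_on {a..b}" if h: "continuous_on UNIV h" for h :: "real \<Rightarrow> real"
  proof (rule Henstock_Kurzweil_Integration.integrable_combine[where c = 0])
    have "(\<lambda>x. h (g1 x)) integrable_on {a..0}"
      by (intro integrable_continuous_interval continuous_on_compose2[OF h g1]) auto
    then show "(\<lambda>x. h (g x)) integrable_on {a..0}"
      by (rule integrable_spike[OF _ negligible_sing[of 0]]) (auto simp: g_def glue_def)
    have "(\<lambda>x. h (g2 x)) integrable_on {0..b}"
      by (intro integrable_continuous_interval continuous_on_compose2[OF h g2]) auto
    then show "(\<lambda>x. h (g x)) integrable_on {0..b}"
      by (rule integrable_eq) (auto simp: g_def glue_def)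
  qed (use a0 b0 in auto)
  have "continuous_on UNIV (\<lambda>y::real. y\<^sup>2)" by (intro continuous_intros)
  then have "g \<in> L2w (\<lambda>_. 1) {a..b}"
    unfolding L2w_def using integrable_imp_measurable[OF int[OF continuous_on_id]] int[of "\<lambda>y. y\<^sup>2"]
    by simp
  moreover have "f x = f a + integral {a..x} g" if x: "x \<in> {a..b}" for x
  proof -
    have "(g has_integral f x - f a) {a..x}"
    proof (rule fundamental_theorem_of_calculus_interior_strong[of "{0}"])
      show "continuous_on {a..x} f" using contf x by (auto intro: continuous_on_subset)
      fix t assume t: "t \<in> {a<..<x} - {0}"
      show "(f has_vector_derivative g t) (at t)"
      proof (cases "t < 0")
        case True
        then have "(f1 has_real_derivative g1 t) (at t)" using f1[of t] t by (simp add: at_within_Icc_at)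
        then have "(f has_real_derivative g1 t) (at t)"
          by (rule has_field_derivative_transform_within_open[of _ _ _ "{a<..<0}"]) (use True t e1 in auto)
        then show ?thesis using True by (simp add: g_def glue_def has_real_derivative_iff_has_vector_derivative)
      next
        case False
        then have t0: "0 < t" "t < b" using t x by auto
        then have "(f2 has_real_derivative g2 t) (at t)" using f2[of t] by (simp add: at_within_Icc_at)
        then have "(f has_real_derivative g2 t) (at t)"
          by (rule has_field_derivative_transform_within_open[of _ _ _ "{0<..<b}"]) (use t0 e2 in auto)
        then show ?thesis using t0 by (simp add: g_def glue_def has_real_derivative_iff_has_vector_derivative)
      qed
    qed (use x in auto)
    then show ?thesis by (simp add: integral_unique)
  qed
  ultimately show ?thesis unfolding H1_def by blast
qed

lemma weighted_integral_split:
  assumes e1: "\<And>x. x \<in> {a..0} \<Longrightarrow> f x = f1 x" and e2: "\<And>x. x \<in> {0..b} \<Longrightarrow> f x = f2 x"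
    and c1: "continuous_on {a..0} f1" and c2: "continuous_on {0..b} f2"
  shows "integral {a..b} (\<lambda>x. glue r \<rho> x * (f x)\<^sup>2) =
     integral {a..0} (\<lambda>x. r x * (f1 x)\<^sup>2) + integral {0..b} (\<lambda>x. \<rho> x * (f2 x)\<^sup>2)"
proof -
  have "((\<lambda>x. r x * (f1 x)\<^sup>2) has_integral integral {a..0} (\<lambda>x. r x * (f1 x)\<^sup>2)) {a..0}"
    using contr c1 by (intro integrable_integral integrable_continuous_interval continuous_intros)
  then have 1: "((\<lambda>x. glue r \<rho> x * (f x)\<^sup>2) has_integral integral {a..0} (\<lambda>x. r x * (f1 x)\<^sup>2)) {a..0}"
    by (rule has_integral_spike[OF negligible_sing[of 0], rotated]) (auto simp: glue_def e1)
  have "((\<lambda>x. \<rho> x * (f2 x)\<^sup>2) has_integral integral {0..b} (\<lambda>x. \<rho> x * (f2 x)\<^sup>2)) {0..b}"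
    using cont\<rho> c2 by (intro integrable_integral integrable_continuous_interval continuous_intros)
  then have 2: "((\<lambda>x. glue r \<rho> x * (f x)\<^sup>2) has_integral integral {0..b} (\<lambda>x. \<rho> x * (f2 x)\<^sup>2)) {0..b}"
    by (rule has_integral_eq[rotated]) (auto simp: glue_def e2)
  show ?thesis
    by (rule integral_unique, rule has_integral_combine[OF _ _ 1 2]) (use a0 b0 in auto)
qed

end

section \<open>Convergence of the eigenfunctions\<close>

lemma uniform_limit_scalar:
  fixes f :: "'i \<Rightarrow> real \<Rightarrow> real"
  assumes s: "(s \<longlongrightarrow> l) F" and f: "uniform_limit {c..d} f g F" and g: "continuous_on {c..d} g"
  shows "uniform_limit {c..d} (\<lambda>\<epsilon> x. s \<epsilon> * f \<epsilon> x) (\<lambda>x. l * g x) F"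
proof (rule uniform_lim_mult)
  show "uniform_limit {c..d} (\<lambda>\<epsilon> _. s \<epsilon>) (\<lambda>_. l) F"
    using s by (auto simp: uniform_limit_iff tendsto_iff elim!: eventually_mono)
  show "uniform_limit {c..d} f g F" by (rule f)
  show "bounded ((\<lambda>_. l) ` {c..d})" by (auto simp: image_constant_conv)
  show "bounded (g ` {c..d})" using g by (intro compact_imp_bounded compact_continuous_image) auto
qed

lemma uniform_limit_integral_product:
  fixes f g :: "'i \<Rightarrow> real \<Rightarrow> real"
  assumes f: "uniform_limit {c..d} f f0 F" and g: "uniform_limit {c..d} g g0 F"
    and cf: "continuous_on {c..d} f0" and cg: "continuous_on {c..d} g0" and q: "continuous_on {c..d} q"
    and int: "\<forall>\<^sub>F \<epsilon> in F. continuous_on {c..d} (f \<epsilon>) \<and> continuous_on {c..d} (g \<epsilon>)"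
    and F: "F \<noteq> bot"
  shows "((\<lambda>\<epsilon>. integral {c..d} (\<lambda>x. q x * f \<epsilon> x * g \<epsilon> x)) \<longlongrightarrow> integral {c..d} (\<lambda>x. q x * f0 x * g0 x)) F"
proof -
  have bd: "bounded (h ` {c..d})" if "continuous_on {c..d} h" for h :: "real \<Rightarrow> real"
    using that by (intro compact_imp_bounded compact_continuous_image) auto
  have "uniform_limit {c..d} (\<lambda>\<epsilon> x. q x * f \<epsilon> x * g \<epsilon> x) (\<lambda>x. q x * f0 x * g0 x) F"
    by (intro uniform_lim_mult uniform_limit_const f g bd continuous_intros cf cg q)
  define h where "h = (\<lambda>\<epsilon>. if continuous_on {c..d} (f \<epsilon>) \<and> continuous_on {c..d} (g \<epsilon>) then (\<lambda>x. q x * f \<epsilon> x * g \<epsilon> x) else (\<lambda>_. 0))"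
  have "uniform_limit {c..d} h (\<lambda>x. q x * f0 x * g0 x) F"
    by (rule uniform_limit_cong[THEN iffD1, OF _ _ \<open>uniform_limit {c..d} (\<lambda>\<epsilon> x. q x * f \<epsilon> x * g \<epsilon> x) (\<lambda>x. q x * f0 x * g0 x) F\<close>])
       (use int in \<open>auto elim!: eventually_mono simp: h_def\<close>)
  moreover have "continuous_on {c..d} (h \<epsilon>)" for \<epsilon>
    using q by (auto simp: h_def intro!: continuous_intros)
  ultimately obtain I J where IJ: "\<And>\<epsilon>. (h \<epsilon> has_integral I \<epsilon>) {c..d}"
      "((\<lambda>x. q x * f0 x * g0 x) has_integral J) {c..d}" "(I \<longlongrightarrow> J) F"
    by (rule uniform_limit_integral[OF _ _ F]) auto
  have "(I \<longlongrightarrow> integral {c..d} (\<lambda>x. q x * f0 x * g0 x)) F"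
    using IJ(3) integral_unique[OF IJ(2)] by simp
  moreover have "\<forall>\<^sub>F \<epsilon> in F. I \<epsilon> = integral {c..d} (\<lambda>x. q x * f \<epsilon> x * g \<epsilon> x)"
    using int
  proof eventually_elim
    case (elim \<epsilon>)
    then have "h \<epsilon> = (\<lambda>x. q x * f \<epsilon> x * g \<epsilon> x)" by (simp add: h_def)
    then show ?case using integral_unique[OF IJ(1)[of \<epsilon>]] by simp
  qed
  ultimately show ?thesis by (rule Lim_transform_eventually)
qed

context sl_interval begin

lemma UV_uniform_limit:
  assumes "(L \<longlongrightarrow> \<mu>) F"
  shows "uniform_limit {c..d} (\<lambda>\<epsilon>. U (L \<epsilon>)) (U \<mu>) F" "uniform_limit {c..d} (\<lambda>\<epsilon>. V (L \<epsilon>)) (V \<mu>) F"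
proof -
  obtain B where B: "B > 0"
    "\<And>\<Lambda> x. \<bar>\<Lambda> - \<mu>\<bar> \<le> 1 \<Longrightarrow> x \<in> {c..d} \<Longrightarrow> \<bar>U \<Lambda> x - U \<mu> x\<bar> \<le> B * \<bar>\<Lambda> - \<mu>\<bar> \<and> \<bar>V \<Lambda> x - V \<mu> x\<bar> \<le> B * \<bar>\<Lambda> - \<mu>\<bar>"
    by (rule UV_lipschitz) (rule that; assumption)
  have *: "\<forall>\<^sub>F \<epsilon> in F. \<forall>x\<in>{c..d}. \<bar>U (L \<epsilon>) x - U \<mu> x\<bar> < e \<and> \<bar>V (L \<epsilon>) x - V \<mu> x\<bar> < e" if e: "e > 0" for e
  proof -
    have "\<forall>\<^sub>F \<epsilon> in F. dist (L \<epsilon>) \<mu> < min 1 (e / B)"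
      by (rule tendstoD[OF assms]) (use e B in simp)
    then show ?thesis
    proof eventually_elim
      case (elim \<epsilon>)
      then have "\<bar>L \<epsilon> - \<mu>\<bar> \<le> 1" "B * \<bar>L \<epsilon> - \<mu>\<bar> < e" using B by (auto simp: dist_real_def field_simps)
      then show ?case using B(2)[of "L \<epsilon>"] by force
    qed
  qed
  show "uniform_limit {c..d} (\<lambda>\<epsilon>. U (L \<epsilon>)) (U \<mu>) F" "uniform_limit {c..d} (\<lambda>\<epsilon>. V (L \<epsilon>)) (V \<mu>) F"
    by (rule uniform_limitI, drule *, erule eventually_mono, simp add: dist_real_def)+
qed

end

context transmission begin

lemma left_continuous: "continuous_on {a..0} (left.U \<Lambda>)" "continuous_on {a..0} (left.V \<Lambda>)"
  by (rule sl_sys_continuous[OF sys_left])+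

lemma right_continuous: "continuous_on {0..b} (ur \<Lambda>)" "continuous_on {0..b} (vr \<Lambda>)"
  by (rule sl_sys_continuous[OF sys_right])+

lemma right_uniform_limit:
  assumes "(L \<longlongrightarrow> \<mu>) F"
  shows "uniform_limit {0..b} (\<lambda>\<epsilon>. ur (L \<epsilon>)) (ur \<mu>) F" "uniform_limit {0..b} (\<lambda>\<epsilon>. vr (L \<epsilon>)) (vr \<mu>) F"
proof -
  note u = right.UV_uniform_limit[OF assms]
  show "uniform_limit {0..b} (\<lambda>\<epsilon>. ur (L \<epsilon>)) (ur \<mu>) F"
  proof (rule uniform_limitI)
    fix e :: real assume "e > 0"
    from uniform_limitD[OF u(1) this]
    show "\<forall>\<^sub>F \<epsilon> in F. \<forall>x\<in>{0..b}. dist (ur (L \<epsilon>) x) (ur \<mu> x) < e"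
      by eventually_elim (auto simp: ur_def dist_real_def abs_minus_commute)
  qed
  show "uniform_limit {0..b} (\<lambda>\<epsilon>. vr (L \<epsilon>)) (vr \<mu>) F"
  proof (rule uniform_limitI)
    fix e :: real assume "e > 0"
    from uniform_limitD[OF u(2) this]
    show "\<forall>\<^sub>F \<epsilon> in F. \<forall>x\<in>{0..b}. dist (vr (L \<epsilon>) x) (vr \<mu> x) < e"
      by eventually_elim (auto simp: vr_def)
  qed
qed

definition I1 :: "real \<Rightarrow> real" where "I1 \<Lambda> = integral {a..0} (\<lambda>x. r x * (left.U \<Lambda> x)\<^sup>2)"
definition I2 :: "real \<Rightarrow> real" where "I2 \<Lambda> = integral {0..b} (\<lambda>x. \<rho> x * (ur \<Lambda> x)\<^sup>2)"
text \<open>The normalised eigenfunction with scaled eigenvalue \<open>\<Lambda>\<close> is \<open>amplitude\<close> times the function that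
  equals \<open>ratio * left.U\<close> on the left and \<open>ur\<close> on the right; \<open>ratio\<close> makes it continuous.\<close>

definition ratio :: "real \<Rightarrow> real" where "ratio \<Lambda> = ur \<Lambda> 0 / left.U \<Lambda> 0"
definition amplitude :: "real \<Rightarrow> real" where
  "amplitude \<Lambda> = 1 / sqrt ((ratio \<Lambda>)\<^sup>2 * I1 \<Lambda> + I2 \<Lambda>)"

lemma I1_nonneg: "I1 \<Lambda> \<ge> 0"
  unfolding I1_def using posr by (intro integral_nonneg_any) (auto simp: less_imp_le)

lemma I2_pos: "I2 \<Lambda> > 0"
proof -
  have cont: "continuous_on {0..b} (\<lambda>x. \<rho> x * (ur \<Lambda> x)\<^sup>2)"
    using cont\<rho> right_continuous(1) by (intro continuous_intros)
  have nn: "\<rho> x * (ur \<Lambda> x)\<^sup>2 \<ge> 0" if "x \<in> {0..b}" for x using pos\<rho>[OF that] by simp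
  have "I2 \<Lambda> \<noteq> 0"
    using integral_eq_0_iff[OF cont b0 nn] ur_nontrivial[of \<Lambda>] pos\<rho> unfolding I2_def by force
  moreover have "I2 \<Lambda> \<ge> 0" unfolding I2_def using nn by (intro integral_nonneg_any) auto
  ultimately show ?thesis by simp
qed

lemma amplitude_arg_pos: "(ratio \<Lambda>)\<^sup>2 * I1 \<Lambda> + I2 \<Lambda> > 0"
  using I1_nonneg[of \<Lambda>] I2_pos[of \<Lambda>] by (intro add_nonneg_pos mult_nonneg_nonneg) auto

lemma amplitude_pos: "amplitude \<Lambda> > 0"
  using amplitude_arg_pos[of \<Lambda>] by (simp add: amplitude_def)

text \<open>The condition \<open>u' b > 0\<close> fixes the sign because \<open>ur\<close> has flux \<open>1\<close> at \<open>b\<close>. The eigenfunction is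
  thus an explicit function of its scaled eigenvalue, in which \<open>\<epsilon>\<close> does not appear.\<close>

lemma normalized_eigenfunction_form:
  assumes n: "normalized_eigenfunction_P a b k r \<kappa> \<rho> \<epsilon> (\<epsilon> * \<Lambda>) u" and e: "\<epsilon> > 0" and U: "left.U \<Lambda> 0 \<noteq> 0"
  shows "x \<in> {a..0} \<Longrightarrow> u x = amplitude \<Lambda> * ratio \<Lambda> * left.U \<Lambda> x"
    and "x \<in> {a..0} \<Longrightarrow> k x * deriv_within u {a..0} x = amplitude \<Lambda> * ratio \<Lambda> * left.V \<Lambda> x"
    and "x \<in> {0..b} \<Longrightarrow> u x = amplitude \<Lambda> * ur \<Lambda> x"
    and "x \<in> {0..b} \<Longrightarrow> \<kappa> x * deriv_within u {0..b} x = amplitude \<Lambda> * vr \<Lambda> x"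
proof -
  have P: "problem_P a b k r \<kappa> \<rho> \<epsilon> (\<epsilon> * \<Lambda>) u"
    and nrm: "integral {a..b} (\<lambda>x. glue r \<rho> x * (u x)\<^sup>2) = 1" and pos: "deriv_within u {0..b} b > 0"
    using n by (auto simp: normalized_eigenfunction_P_def)
  define \<alpha> where "\<alpha> = k a * deriv_within u {a..0} a"
  define \<beta> where "\<beta> = \<kappa> b * deriv_within u {0..b} b"
  note c = problem_P_cases[OF P e, folded \<alpha>_def \<beta>_def]
  have \<beta>: "\<beta> > 0" using pos pos\<kappa>[of b] b0 by (simp add: \<beta>_def)
  have \<alpha>: "\<alpha> = \<beta> * ratio \<Lambda>" using c(3) U by (simp add: ratio_def field_simps)
  have "1 = integral {a..0} (\<lambda>x. r x * (\<alpha> * left.U \<Lambda> x)\<^sup>2) + integral {0..b} (\<lambda>x. \<rho> x * (\<beta> * ur \<Lambda> x)\<^sup>2)"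
    unfolding nrm[symmetric]
    by (rule weighted_integral_split) (use c(1,2) left_continuous right_continuous in \<open>auto intro!: continuous_intros\<close>)
  also have "\<dots> = \<alpha>\<^sup>2 * I1 \<Lambda> + \<beta>\<^sup>2 * I2 \<Lambda>"
    by (simp add: I1_def I2_def power_mult_distrib integral_mult_right[symmetric] mult.left_commute del: integral_mult_right)
  also have "\<dots> = \<beta>\<^sup>2 * ((ratio \<Lambda>)\<^sup>2 * I1 \<Lambda> + I2 \<Lambda>)"
    by (simp add: \<alpha> power_mult_distrib algebra_simps)
  finally have "\<beta>\<^sup>2 = (amplitude \<Lambda>)\<^sup>2"
    using amplitude_arg_pos[of \<Lambda>] by (simp add: amplitude_def power_divide field_simps)
  then have "\<beta> = amplitude \<Lambda>" using \<beta> amplitude_pos[of \<Lambda>] by (simp add: power2_eq_iff_nonneg)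
  then show "x \<in> {a..0} \<Longrightarrow> u x = amplitude \<Lambda> * ratio \<Lambda> * left.U \<Lambda> x"
    and "x \<in> {a..0} \<Longrightarrow> k x * deriv_within u {a..0} x = amplitude \<Lambda> * ratio \<Lambda> * left.V \<Lambda> x"
    and "x \<in> {0..b} \<Longrightarrow> u x = amplitude \<Lambda> * ur \<Lambda> x"
    and "x \<in> {0..b} \<Longrightarrow> \<kappa> x * deriv_within u {0..b} x = amplitude \<Lambda> * vr \<Lambda> x"
    using c(1,2) \<alpha> by auto
qed

lemma amplitude_tendsto:
  assumes L: "(L \<longlongrightarrow> \<mu>) F" and U: "left.U \<mu> 0 \<noteq> 0" and F: "F \<noteq> bot"
  shows "((\<lambda>\<epsilon>. ratio (L \<epsilon>)) \<longlongrightarrow> ratio \<mu>) F" "((\<lambda>\<epsilon>. amplitude (L \<epsilon>)) \<longlongrightarrow> amplitude \<mu>) F"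
proof -
  note ul = left.UV_uniform_limit(1)[OF L] and uR = right_uniform_limit(1)[OF L]
  have "((\<lambda>\<epsilon>. left.U (L \<epsilon>) 0) \<longlongrightarrow> left.U \<mu> 0) F" "((\<lambda>\<epsilon>. ur (L \<epsilon>) 0) \<longlongrightarrow> ur \<mu> 0) F"
    using tendsto_uniform_limitI[OF ul, of 0] tendsto_uniform_limitI[OF uR, of 0] a0 b0 by auto
  then show r: "((\<lambda>\<epsilon>. ratio (L \<epsilon>)) \<longlongrightarrow> ratio \<mu>) F"
    unfolding ratio_def using U by (intro tendsto_divide)
  have "((\<lambda>\<epsilon>. I1 (L \<epsilon>)) \<longlongrightarrow> I1 \<mu>) F"
    using uniform_limit_integral_product[OF ul ul _ _ contr _ F] left_continuous(1)
    by (simp add: I1_def power2_eq_square mult.assoc)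
  moreover have "((\<lambda>\<epsilon>. I2 (L \<epsilon>)) \<longlongrightarrow> I2 \<mu>) F"
    using uniform_limit_integral_product[OF uR uR _ _ cont\<rho> _ F] right_continuous(1)
    by (simp add: I2_def power2_eq_square mult.assoc)
  ultimately show "((\<lambda>\<epsilon>. amplitude (L \<epsilon>)) \<longlongrightarrow> amplitude \<mu>) F"
    unfolding amplitude_def using r amplitude_arg_pos[of \<mu>] by (intro tendsto_intros) auto
qed

lemma eigenfunction_uniform_limits:
  assumes n: "\<And>\<epsilon>. \<epsilon> > 0 \<Longrightarrow> normalized_eigenfunction_P a b k r \<kappa> \<rho> \<epsilon> (\<epsilon> * L \<epsilon>) (u \<epsilon>)"
    and L: "(L \<longlongrightarrow> \<mu>) (at_right 0)" and U: "left.U \<mu> 0 \<noteq> 0"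
  shows "uniform_limit {a..0} u (\<lambda>x. amplitude \<mu> * ratio \<mu> * left.U \<mu> x) (at_right 0)"
    and "uniform_limit {a..0} (\<lambda>\<epsilon> x. k x * deriv_within (u \<epsilon>) {a..0} x) (\<lambda>x. amplitude \<mu> * ratio \<mu> * left.V \<mu> x) (at_right 0)"
    and "uniform_limit {0..b} u (\<lambda>x. amplitude \<mu> * ur \<mu> x) (at_right 0)"
    and "uniform_limit {0..b} (\<lambda>\<epsilon> x. \<kappa> x * deriv_within (u \<epsilon>) {0..b} x) (\<lambda>x. amplitude \<mu> * vr \<mu> x) (at_right 0)"
proof -
  note ul = left.UV_uniform_limit[OF L] and uR = right_uniform_limit[OF L]
  have F: "at_right (0::real) \<noteq> bot" by (rule trivial_limit_at_right_real)
  note t = amplitude_tendsto[OF L U F]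
  have "((\<lambda>\<epsilon>. left.U (L \<epsilon>) 0) \<longlongrightarrow> left.U \<mu> 0) (at_right 0)"
    using tendsto_uniform_limitI[OF ul(1), of 0] a0 by auto
  then have "\<forall>\<^sub>F \<epsilon> in at_right 0. left.U (L \<epsilon>) 0 \<noteq> 0"
    using U by (rule tendsto_imp_eventually_ne)
  with eventually_at_right_less[of "0::real"]
  have pos: "\<forall>\<^sub>F \<epsilon> in at_right 0. 0 < \<epsilon> \<and> left.U (L \<epsilon>) 0 \<noteq> 0" by eventually_elim simp
  note form = normalized_eigenfunction_form[OF n]
  have ev1: "\<forall>\<^sub>F \<epsilon> in at_right 0. \<forall>x\<in>{a..0}. u \<epsilon> x = (amplitude (L \<epsilon>) * ratio (L \<epsilon>)) * left.U (L \<epsilon>) x"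
    using pos by eventually_elim (use form(1) in blast)
  have ev2: "\<forall>\<^sub>F \<epsilon> in at_right 0. \<forall>x\<in>{a..0}. k x * deriv_within (u \<epsilon>) {a..0} x = (amplitude (L \<epsilon>) * ratio (L \<epsilon>)) * left.V (L \<epsilon>) x"
    using pos by eventually_elim (use form(2) in blast)
  have ev3: "\<forall>\<^sub>F \<epsilon> in at_right 0. \<forall>x\<in>{0..b}. u \<epsilon> x = amplitude (L \<epsilon>) * ur (L \<epsilon>) x"
    using pos by eventually_elim (use form(3) in blast)
  have ev4: "\<forall>\<^sub>F \<epsilon> in at_right 0. \<forall>x\<in>{0..b}. \<kappa> x * deriv_within (u \<epsilon>) {0..b} x = amplitude (L \<epsilon>) * vr (L \<epsilon>) x"
    using pos by eventually_elim (use form(4) in blast)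
  have trans: "uniform_limit S f l (at_right 0)"
    if "uniform_limit S g l (at_right 0)" "\<forall>\<^sub>F \<epsilon> in at_right 0. \<forall>x\<in>S. f \<epsilon> x = g \<epsilon> x" for S l and f g :: "real \<Rightarrow> real \<Rightarrow> real"
    by (rule uniform_limit_cong[THEN iffD2, OF that(2) refl that(1)])
  note ar = tendsto_mult[OF t(2,1)]
  show "uniform_limit {a..0} u (\<lambda>x. amplitude \<mu> * ratio \<mu> * left.U \<mu> x) (at_right 0)"
    by (rule trans[OF uniform_limit_scalar[OF ar ul(1) left_continuous(1)] ev1])
  show "uniform_limit {a..0} (\<lambda>\<epsilon> x. k x * deriv_within (u \<epsilon>) {a..0} x) (\<lambda>x. amplitude \<mu> * ratio \<mu> * left.V \<mu> x) (at_right 0)"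
    by (rule trans[OF uniform_limit_scalar[OF ar ul(2) left_continuous(2)] ev2])
  show "uniform_limit {0..b} u (\<lambda>x. amplitude \<mu> * ur \<mu> x) (at_right 0)"
    by (rule trans[OF uniform_limit_scalar[OF t(2) uR(1) right_continuous(1)] ev3])
  show "uniform_limit {0..b} (\<lambda>\<epsilon> x. \<kappa> x * deriv_within (u \<epsilon>) {0..b} x) (\<lambda>x. amplitude \<mu> * vr \<mu> x) (at_right 0)"
    by (rule trans[OF uniform_limit_scalar[OF t(2) uR(2) right_continuous(2)] ev4])
qed

lemma problem_P_systems:
  fixes u :: "real \<Rightarrow> real"
  assumes P: "problem_P a b k r \<kappa> \<rho> \<epsilon> (\<epsilon> * \<Lambda>) u" and e: "\<epsilon> > 0"
  shows "sl_sys k {a..0} (\<lambda>x. - \<Lambda> * r x * u x) u (\<lambda>x. k x * deriv_within u {a..0} x)"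
    and "sl_sys \<kappa> {0..b} (\<lambda>x. - \<Lambda> * \<rho> x * u x) u (\<lambda>x. \<kappa> x * deriv_within u {0..b} x)"
    and "u a = 0" "u b = 0" "k 0 * deriv_within u {a..0} 0 = \<epsilon> * (\<kappa> 0 * deriv_within u {0..b} 0)"
proof -
  define \<alpha> where "\<alpha> = k a * deriv_within u {a..0} a"
  define \<beta> where "\<beta> = \<kappa> b * deriv_within u {0..b} b"
  note c = problem_P_cases[OF P e, folded \<alpha>_def \<beta>_def]
  show "sl_sys k {a..0} (\<lambda>x. - \<Lambda> * r x * u x) u (\<lambda>x. k x * deriv_within u {a..0} x)"
    by (rule sl_sys_cong[OF sl_sys_scale[OF sys_left[of \<Lambda>], of \<alpha>]]) (simp_all add: c(1))
  show "sl_sys \<kappa> {0..b} (\<lambda>x. - \<Lambda> * \<rho> x * u x) u (\<lambda>x. \<kappa> x * deriv_within u {0..b} x)"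
    by (rule sl_sys_cong[OF sl_sys_scale[OF sys_right[of \<Lambda>], of \<beta>]]) (simp_all add: c(2))
  show "u a = 0" "u b = 0" "k 0 * deriv_within u {a..0} 0 = \<epsilon> * (\<kappa> 0 * deriv_within u {0..b} 0)"
    using P by (auto simp: problem_P_def)
qed

text \<open>Uniform convergence of the functions and of their fluxes on both halves gives convergence in
  \<open>H\<^sup>1\<close>.\<close>

theorem eigenfunction_tendsto_H1:
  assumes n: "\<And>\<epsilon>. \<epsilon> > 0 \<Longrightarrow> normalized_eigenfunction_P a b k r \<kappa> \<rho> \<epsilon> (\<epsilon> * L \<epsilon>) (u \<epsilon>)"
    and L: "(L \<longlongrightarrow> \<mu>) (at_right 0)" and U: "left.U \<mu> 0 \<noteq> 0"
  shows "tendsto_H1 a b u (glue (\<lambda>x. amplitude \<mu> * ratio \<mu> * left.U \<mu> x) (\<lambda>x. amplitude \<mu> * ur \<mu> x)) (at_right 0)"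
proof -
  define y where "y = (\<lambda>x. amplitude \<mu> * ratio \<mu> * left.U \<mu> x)"
  define vy where "vy = (\<lambda>x. amplitude \<mu> * ratio \<mu> * left.V \<mu> x)"
  define z where "z = (\<lambda>x. amplitude \<mu> * ur \<mu> x)"
  define vz where "vz = (\<lambda>x. amplitude \<mu> * vr \<mu> x)"
  have lim1: "uniform_limit {a..0} u y (at_right 0)"
    unfolding y_def by (rule eigenfunction_uniform_limits(1)[OF n L U])
  have lim2: "uniform_limit {a..0} (\<lambda>\<epsilon> x. k x * deriv_within (u \<epsilon>) {a..0} x) vy (at_right 0)"
    unfolding vy_def by (rule eigenfunction_uniform_limits(2)[OF n L U])
  have lim3: "uniform_limit {0..b} u z (at_right 0)"
    unfolding z_def by (rule eigenfunction_uniform_limits(3)[OF n L U])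
  have lim4: "uniform_limit {0..b} (\<lambda>\<epsilon> x. \<kappa> x * deriv_within (u \<epsilon>) {0..b} x) vz (at_right 0)"
    unfolding vz_def by (rule eigenfunction_uniform_limits(4)[OF n L U])
  note lim = lim1 lim2 lim3 lim4
  have sy: "sl_sys k {a..0} (\<lambda>x. amplitude \<mu> * ratio \<mu> * (- \<mu> * r x * left.U \<mu> x)) y vy"
    unfolding y_def vy_def by (rule sl_sys_scale[OF sys_left])
  have sz: "sl_sys \<kappa> {0..b} (\<lambda>x. amplitude \<mu> * (- \<mu> * \<rho> x * ur \<mu> x)) z vz"
    unfolding z_def vz_def by (rule sl_sys_scale[OF sys_right])
  have kn: "k x \<noteq> 0" if "x \<in> {a..0}" for x using posk[OF that] by simp
  have \<kappa>n: "\<kappa> x \<noteq> 0" if "x \<in> {0..b}" for x using pos\<kappa>[OF that] by simp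
  have yz0: "y 0 = z 0" using U by (simp add: y_def z_def ratio_def)
  obtain K where K: "K \<ge> 0" "\<forall>M f1 g1 f2 g2. flux_bounded M f1 g1 f2 g2 \<longrightarrow>
       H1_norm a b (glue f1 f2) \<le> K * M \<and> H1_norm a 0 f1 \<le> K * M \<and> H1_norm 0 b f2 \<le> K * M"
    by (rule H1_norm_glue_bound)
  show ?thesis
    unfolding tendsto_H1_def y_def[symmetric] z_def[symmetric]
  proof (intro conjI)
    show "glue y z \<in> H1 a b"
    proof (rule glue_in_H1[of y "\<lambda>x. vy x / k x" z "\<lambda>x. vz x / \<kappa> x"])
      show "continuous_on {a..0} (\<lambda>x. vy x / k x)" "continuous_on {0..b} (\<lambda>x. vz x / \<kappa> x)"
        using sl_sys_continuous(2)[OF sy] sl_sys_continuous(2)[OF sz] contk cont\<kappa> kn \<kappa>n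
        by (auto intro!: continuous_on_divide)
    qed (use sy sz yz0 in \<open>auto simp: sl_sys_def glue_def\<close>)
    show "\<forall>\<^sub>F \<epsilon> in at_right 0. u \<epsilon> \<in> H1 a b"
      using eventually_at_right_less[of "0::real"]
    proof eventually_elim
      case (elim \<epsilon>)
      have "problem_P a b k r \<kappa> \<rho> \<epsilon> (\<epsilon> * L \<epsilon>) (u \<epsilon>)" using n[OF elim] by (simp add: normalized_eigenfunction_P_def)
      note s = problem_P_systems[OF this elim]
      show ?case
      proof (rule glue_in_H1[of "u \<epsilon>" "\<lambda>x. (k x * deriv_within (u \<epsilon>) {a..0} x) / k x" "u \<epsilon>" "\<lambda>x. (\<kappa> x * deriv_within (u \<epsilon>) {0..b} x) / \<kappa> x"])
        show "continuous_on {a..0} (\<lambda>x. (k x * deriv_within (u \<epsilon>) {a..0} x) / k x)"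
          using sl_sys_continuous(2)[OF s(1)] contk kn by (intro continuous_on_divide) auto
        show "continuous_on {0..b} (\<lambda>x. (\<kappa> x * deriv_within (u \<epsilon>) {0..b} x) / \<kappa> x)"
          using sl_sys_continuous(2)[OF s(2)] cont\<kappa> \<kappa>n by (intro continuous_on_divide) auto
      qed (use s(1,2) in \<open>auto simp only: sl_sys_def\<close>)
    qed
    show "((\<lambda>\<epsilon>. H1_norm a b (\<lambda>x. u \<epsilon> x - glue y z x)) \<longlongrightarrow> 0) (at_right 0)"
    proof (rule tendstoI)
      fix e :: real assume e: "e > 0"
      define M where "M = e / (2 * (K + 1))"
      have M: "M > 0" "K * M < e"
      proof -
        have "0 \<le> K * e" using e K(1) by simp
        then have "K * e < e * (2 * (K + 1))" using e unfolding distrib_left by (simp add: algebra_simps)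
        moreover have "0 < 2 * (K + 1)" using K(1) by simp
        ultimately show "M > 0" "K * M < e" using e by (simp_all add: M_def divide_less_eq)
      qed
      from eventually_at_right_less[of "0::real"] uniform_limitD[OF lim(1) M(1)] uniform_limitD[OF lim(2) M(1)]
        uniform_limitD[OF lim(3) M(1)] uniform_limitD[OF lim(4) M(1)]
      show "\<forall>\<^sub>F \<epsilon> in at_right 0. dist (H1_norm a b (\<lambda>x. u \<epsilon> x - glue y z x)) 0 < e"
      proof eventually_elim
        case (elim \<epsilon>)
        have "problem_P a b k r \<kappa> \<rho> \<epsilon> (\<epsilon> * L \<epsilon>) (u \<epsilon>)" using n[OF elim(1)] by (simp add: normalized_eigenfunction_P_def)
        note s = problem_P_systems[OF this elim(1)]
        note d1 = sl_sys_lincomb[OF s(1) sy, of 1 "-1"] and d2 = sl_sys_lincomb[OF s(2) sz, of 1 "-1"]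
        have "flux_bounded M (\<lambda>x. 1 * u \<epsilon> x + - 1 * y x) (\<lambda>x. 1 * (k x * deriv_within (u \<epsilon>) {a..0} x) + - 1 * vy x)
            (\<lambda>x. 1 * u \<epsilon> x + - 1 * z x) (\<lambda>x. 1 * (\<kappa> x * deriv_within (u \<epsilon>) {0..b} x) + - 1 * vz x)"
          unfolding flux_bounded_def
        proof (intro conjI ballI)
          fix x assume x: "x \<in> {a..0}"
          show "((\<lambda>x. 1 * u \<epsilon> x + - 1 * y x) has_real_derivative (1 * (k x * deriv_within (u \<epsilon>) {a..0} x) + - 1 * vy x) / k x) (at x within {a..0})"
            using d1 x unfolding sl_sys_def by blast
          show "\<bar>1 * u \<epsilon> x + - 1 * y x\<bar> \<le> M" "\<bar>1 * (k x * deriv_within (u \<epsilon>) {a..0} x) + - 1 * vy x\<bar> \<le> M"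
            using bspec[OF elim(2) x] bspec[OF elim(3) x] by (simp_all add: dist_real_def)
        next
          fix x assume x: "x \<in> {0..b}"
          show "((\<lambda>x. 1 * u \<epsilon> x + - 1 * z x) has_real_derivative (1 * (\<kappa> x * deriv_within (u \<epsilon>) {0..b} x) + - 1 * vz x) / \<kappa> x) (at x within {0..b})"
            using d2 x unfolding sl_sys_def by blast
          show "\<bar>1 * u \<epsilon> x + - 1 * z x\<bar> \<le> M" "\<bar>1 * (\<kappa> x * deriv_within (u \<epsilon>) {0..b} x) + - 1 * vz x\<bar> \<le> M"
            using bspec[OF elim(4) x] bspec[OF elim(5) x] by (simp_all add: dist_real_def)
        qed
        then have "H1_norm a b (glue (\<lambda>x. 1 * u \<epsilon> x + - 1 * y x) (\<lambda>x. 1 * u \<epsilon> x + - 1 * z x)) \<le> K * M"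
          using K(2) by blast
        moreover have "glue (\<lambda>x. 1 * u \<epsilon> x + - 1 * y x) (\<lambda>x. 1 * u \<epsilon> x + - 1 * z x) = (\<lambda>x. u \<epsilon> x - glue y z x)"
          by (rule ext) (simp add: glue_def)
        ultimately have "H1_norm a b (\<lambda>x. u \<epsilon> x - glue y z x) < e" using M(2) by simp
        then show ?case using H1_norm_nonneg[of a b "\<lambda>x. u \<epsilon> x - glue y z x"] by (simp add: dist_real_def)
      qed
    qed
  qed
qed

end

section \<open>Truncated expansions and the expansion of the eigenvalue\<close>

lemma sl_sys_sum:
  assumes "finite I" "\<And>i. i \<in> I \<Longrightarrow> sl_sys p S (f i) (u i) (v i)"
  shows "sl_sys p S (\<lambda>x. \<Sum>i\<in>I. c i * f i x) (\<lambda>x. \<Sum>i\<in>I. c i * u i x) (\<lambda>x. \<Sum>i\<in>I. c i * v i x)"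
  unfolding sl_sys_def
proof (intro ballI conjI)
  fix x assume x: "x \<in> S"
  have d: "(u i has_real_derivative v i x / p x) (at x within S)" "(v i has_real_derivative f i x) (at x within S)" if "i \<in> I" for i
    using assms(2)[OF that] x by (auto simp: sl_sys_def)
  have "((\<lambda>x. \<Sum>i\<in>I. c i * u i x) has_real_derivative (\<Sum>i\<in>I. c i * (v i x / p x))) (at x within S)"
    by (intro DERIV_sum DERIV_cmult d)
  then show "((\<lambda>x. \<Sum>i\<in>I. c i * u i x) has_real_derivative (\<Sum>i\<in>I. c i * v i x) / p x) (at x within S)"
    by (simp add: sum_divide_distrib)
  show "((\<lambda>x. \<Sum>i\<in>I. c i * v i x) has_real_derivative (\<Sum>i\<in>I. c i * f i x)) (at x within S)"
    by (intro DERIV_sum DERIV_cmult d)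
qed

text \<open>The product of two truncated series differs from the truncated product series by the terms of
  degree above \<open>n\<close>.\<close>

lemma cauchy_truncation_bound:
  fixes p y :: "nat \<Rightarrow> real"
  assumes e: "\<bar>e\<bar> \<le> 1"
  shows "\<bar>(\<Sum>i\<le>n. e ^ i * p i) * (\<Sum>l\<le>n. e ^ l * y l) - (\<Sum>m\<le>n. e ^ m * (\<Sum>i\<le>m. p i * y (m - i)))\<bar>
     \<le> \<bar>e\<bar> ^ Suc n * ((\<Sum>i\<le>n. \<bar>p i\<bar>) * (\<Sum>l\<le>n. \<bar>y l\<bar>))"
proof -
  define g where "g = (\<lambda>(i, l). e ^ (i + l) * (p i * y l))"
  define T where "T = {(i, l). i + l \<le> n}"
  have TS: "T \<subseteq> {..n} \<times> {..n}" by (auto simp: T_def)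
  have "(\<Sum>i\<le>n. e ^ i * p i) * (\<Sum>l\<le>n. e ^ l * y l) = sum g ({..n} \<times> {..n})"
    by (simp add: sum_product sum.cartesian_product g_def power_add mult_ac)
  moreover have "(\<Sum>m\<le>n. e ^ m * (\<Sum>i\<le>m. p i * y (m - i))) = sum g T"
  proof -
    have "sum g T = (\<Sum>m\<le>n. \<Sum>i\<le>m. e ^ (i + (m - i)) * (p i * y (m - i)))"
      unfolding T_def g_def using sum.triangle_reindex_eq[of "\<lambda>i l. e ^ (i + l) * (p i * y l)" n] by simp
    also have "\<dots> = (\<Sum>m\<le>n. e ^ m * (\<Sum>i\<le>m. p i * y (m - i)))"
      by (intro sum.cong refl) (simp add: sum_distrib_left)
    finally show ?thesis by simp
  qed
  ultimately have "(\<Sum>i\<le>n. e ^ i * p i) * (\<Sum>l\<le>n. e ^ l * y l) - (\<Sum>m\<le>n. e ^ m * (\<Sum>i\<le>m. p i * y (m - i)))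
     = sum g ({..n} \<times> {..n} - T)"
    using TS by (simp add: sum_diff)
  also have "\<bar>\<dots>\<bar> \<le> (\<Sum>z\<in>{..n} \<times> {..n} - T. \<bar>g z\<bar>)" by (rule sum_abs)
  also have "\<dots> \<le> (\<Sum>z\<in>{..n} \<times> {..n} - T. \<bar>e\<bar> ^ Suc n * (\<bar>p (fst z)\<bar> * \<bar>y (snd z)\<bar>))"
  proof (rule sum_mono)
    fix z assume "z \<in> {..n} \<times> {..n} - T"
    then obtain i l where z: "z = (i, l)" "Suc n \<le> i + l" by (cases z) (auto simp: T_def)
    have "\<bar>e\<bar> ^ (i + l) \<le> \<bar>e\<bar> ^ Suc n" using z e by (intro power_decreasing) auto
    then show "\<bar>g z\<bar> \<le> \<bar>e\<bar> ^ Suc n * (\<bar>p (fst z)\<bar> * \<bar>y (snd z)\<bar>)"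
      by (simp add: z(1) g_def abs_mult power_abs del: power_Suc) (intro mult_right_mono, auto)
  qed
  also have "\<dots> \<le> (\<Sum>z\<in>{..n} \<times> {..n}. \<bar>e\<bar> ^ Suc n * (\<bar>p (fst z)\<bar> * \<bar>y (snd z)\<bar>))"
    by (intro sum_mono2) auto
  also have "\<dots> = \<bar>e\<bar> ^ Suc n * ((\<Sum>i\<le>n. \<bar>p i\<bar>) * (\<Sum>l\<le>n. \<bar>y l\<bar>))"
    by (subst sum_product, subst sum.cartesian_product, subst sum_distrib_left) (simp add: case_prod_unfold)
  finally show ?thesis .
qed

lemma eventually_small: "\<forall>\<^sub>F \<epsilon>::real in at_right 0. \<bar>\<epsilon>\<bar> \<le> 1"
proof -
  have "\<forall>\<^sub>F \<epsilon>::real in at_right 0. \<epsilon> < 1" by (rule eventually_at_right_real[THEN eventually_mono, of 0 1]) auto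
  with eventually_at_right_less[of "0::real"] show ?thesis by eventually_elim simp
qed

lemma ordo_partial_sum:
  assumes small: "\<forall>\<^sub>F \<epsilon> in F. \<bar>\<epsilon>\<bar> \<le> 1" and f: "\<And>i. continuous_on {c..d} (f i)"
  shows "ordo F {c..d} 0 (\<lambda>\<epsilon>. partial_sum f \<epsilon> n)"
  unfolding partial_sum_def
  by (intro ordo_sum ordo_mult_left ordo_param_power_0[OF small] ordo_continuous f) simp

lemma partial_sum_uniform_limit:
  assumes f: "\<And>i. continuous_on {c..d} (f i)"
  shows "uniform_limit {c..d} (\<lambda>\<epsilon>. partial_sum f \<epsilon> n) (f 0) (at_right 0)"
proof -
  have "ordo (at_right 0) {c..d} 1 (\<lambda>\<epsilon> x. \<epsilon> ^ 1 * partial_sum (\<lambda>i. f (Suc i)) \<epsilon> (n - 1) x)"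
    by (intro ordo_mult_right ordo_param_power ordo_partial_sum eventually_small f)
  then obtain C where C0: "C \<ge> 0" and C: "\<forall>\<^sub>F \<epsilon> in at_right 0. \<forall>x\<in>{c..d}. \<bar>\<epsilon> ^ 1 * partial_sum (\<lambda>i. f (Suc i)) \<epsilon> (n - 1) x\<bar> \<le> C * \<bar>\<epsilon>\<bar> ^ 1"
    by (rule ordoE)
  show ?thesis
  proof (cases n)
    case 0
    then have "(\<lambda>\<epsilon>. partial_sum f \<epsilon> n) = (\<lambda>_. f 0)" by (intro ext) (simp add: partial_sum_def)
    then show ?thesis by (simp add: uniform_limit_const)
  next
    case (Suc m)
    have eq: "partial_sum f \<epsilon> n x = f 0 x + \<epsilon> ^ 1 * partial_sum (\<lambda>i. f (Suc i)) \<epsilon> (n - 1) x" for \<epsilon> x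
      by (simp add: partial_sum_def Suc sum.atMost_Suc_shift sum_distrib_left mult.assoc del: sum.atMost_Suc)
    show ?thesis
    proof (rule uniform_limitI)
      fix e :: real assume e: "e > 0"
      have "((\<lambda>\<epsilon>::real. C * \<bar>\<epsilon>\<bar> ^ 1) \<longlongrightarrow> C * \<bar>0\<bar> ^ 1) (at_right 0)" by (intro tendsto_intros)
      then have "\<forall>\<^sub>F \<epsilon> in at_right 0. C * \<bar>\<epsilon>\<bar> ^ 1 < e" by (rule order_tendstoD) (use e in simp)
      with C show "\<forall>\<^sub>F \<epsilon> in at_right 0. \<forall>x\<in>{c..d}. dist (partial_sum f \<epsilon> n x) (f 0 x) < e"
      proof eventually_elim
        case (elim \<epsilon>)
        show ?case
        proof
          fix x assume "x \<in> {c..d}"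
          then have "\<bar>\<epsilon> ^ 1 * partial_sum (\<lambda>i. f (Suc i)) \<epsilon> (n - 1) x\<bar> < e" using elim by force
          then show "dist (partial_sum f \<epsilon> n x) (f 0 x) < e" unfolding eq dist_real_def by simp
        qed
      qed
    qed
  qed
qed

lemma partial_sum_tendsto:
  "((\<lambda>\<epsilon>. partial_sum f \<epsilon> n x) \<longlongrightarrow> f 0 x) (at_right 0)"
proof -
  have "((\<lambda>\<epsilon>. partial_sum f \<epsilon> n x) \<longlongrightarrow> (\<Sum>i\<le>n. 0 ^ i * f i x)) (at_right 0)"
    unfolding partial_sum_def by (intro tendsto_intros)
  moreover have "(\<Sum>i\<le>n. 0 ^ i * f i x) = f 0 x"
    by (subst sum.remove[of _ 0]) (auto intro: sum.neutral)
  ultimately show ?thesis by simp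
qed

text \<open>Passes from the limit filter to an interval of parameters. The threshold may be lowered, so that
  several quantities can share one interval.\<close>

lemma ordo_localize:
  assumes "ordo (at_right 0) S 0 f"
  obtains \<delta> where "\<delta> > 0" "\<And>\<delta>'. \<delta>' \<le> \<delta> \<Longrightarrow> ordo (principal {0<..<\<delta>'}) S 0 f"
proof -
  obtain C where C: "\<forall>\<^sub>F \<epsilon> in at_right 0. \<forall>x\<in>S. \<bar>f \<epsilon> x\<bar> \<le> C * \<bar>\<epsilon>\<bar> ^ 0" by (rule ordoE[OF assms])
  then obtain \<delta> where "\<delta> > 0" "\<And>\<epsilon>. 0 < \<epsilon> \<Longrightarrow> \<epsilon> < \<delta> \<Longrightarrow> \<forall>x\<in>S. \<bar>f \<epsilon> x\<bar> \<le> C * \<bar>\<epsilon>\<bar> ^ 0"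
    unfolding eventually_at_right_field by auto
  then show thesis by (intro that[of \<delta>] ordoI[where C = C]) (auto simp: eventually_principal)
qed

context transmission begin

lemma ordo_H1_norm:
  assumes s1: "\<forall>\<^sub>F \<epsilon> in F. sl_sys k {a..0} (h1 \<epsilon>) (f1 \<epsilon>) (g1 \<epsilon>)"
    and s2: "\<forall>\<^sub>F \<epsilon> in F. sl_sys \<kappa> {0..b} (h2 \<epsilon>) (f2 \<epsilon>) (g2 \<epsilon>)"
    and o: "ordo F {a..0} m f1" "ordo F {a..0} m g1" "ordo F {0..b} m f2" "ordo F {0..b} m g2"
  shows "ordo F T m (\<lambda>\<epsilon> _. H1_norm a b (glue (f1 \<epsilon>) (f2 \<epsilon>)))"
    "ordo F T m (\<lambda>\<epsilon> _. H1_norm a 0 (f1 \<epsilon>))" "ordo F T m (\<lambda>\<epsilon> _. H1_norm 0 b (f2 \<epsilon>))"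
proof -
  obtain K where K: "K \<ge> 0" "\<forall>M f1 g1 f2 g2. flux_bounded M f1 g1 f2 g2 \<longrightarrow>
       H1_norm a b (glue f1 f2) \<le> K * M \<and> H1_norm a 0 f1 \<le> K * M \<and> H1_norm 0 b f2 \<le> K * M"
    by (rule H1_norm_glue_bound)
  obtain C1 where C1: "C1 \<ge> 0" "\<forall>\<^sub>F \<epsilon> in F. \<forall>x\<in>{a..0}. \<bar>f1 \<epsilon> x\<bar> \<le> C1 * \<bar>\<epsilon>\<bar> ^ m" by (rule ordoE[OF o(1)])
  obtain C2 where C2: "C2 \<ge> 0" "\<forall>\<^sub>F \<epsilon> in F. \<forall>x\<in>{a..0}. \<bar>g1 \<epsilon> x\<bar> \<le> C2 * \<bar>\<epsilon>\<bar> ^ m" by (rule ordoE[OF o(2)])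
  obtain C3 where C3: "C3 \<ge> 0" "\<forall>\<^sub>F \<epsilon> in F. \<forall>x\<in>{0..b}. \<bar>f2 \<epsilon> x\<bar> \<le> C3 * \<bar>\<epsilon>\<bar> ^ m" by (rule ordoE[OF o(3)])
  obtain C4 where C4: "C4 \<ge> 0" "\<forall>\<^sub>F \<epsilon> in F. \<forall>x\<in>{0..b}. \<bar>g2 \<epsilon> x\<bar> \<le> C4 * \<bar>\<epsilon>\<bar> ^ m" by (rule ordoE[OF o(4)])
  define C where "C = C1 + C2 + C3 + C4"
  have "\<forall>\<^sub>F \<epsilon> in F. H1_norm a b (glue (f1 \<epsilon>) (f2 \<epsilon>)) \<le> K * (C * \<bar>\<epsilon>\<bar> ^ m) \<and> H1_norm a 0 (f1 \<epsilon>) \<le> K * (C * \<bar>\<epsilon>\<bar> ^ m) \<and> H1_norm 0 b (f2 \<epsilon>) \<le> K * (C * \<bar>\<epsilon>\<bar> ^ m)"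
    using s1 s2 C1(2) C2(2) C3(2) C4(2)
  proof eventually_elim
    case (elim \<epsilon>)
    have le: "C1 * \<bar>\<epsilon>\<bar> ^ m \<le> C * \<bar>\<epsilon>\<bar> ^ m" "C2 * \<bar>\<epsilon>\<bar> ^ m \<le> C * \<bar>\<epsilon>\<bar> ^ m" "C3 * \<bar>\<epsilon>\<bar> ^ m \<le> C * \<bar>\<epsilon>\<bar> ^ m" "C4 * \<bar>\<epsilon>\<bar> ^ m \<le> C * \<bar>\<epsilon>\<bar> ^ m"
      using C1(1) C2(1) C3(1) C4(1) by (auto simp: C_def intro!: mult_right_mono)
    have "flux_bounded (C * \<bar>\<epsilon>\<bar> ^ m) (f1 \<epsilon>) (g1 \<epsilon>) (f2 \<epsilon>) (g2 \<epsilon>)"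
      unfolding flux_bounded_def
    proof (intro conjI ballI)
      fix x assume x: "x \<in> {a..0}"
      show "(f1 \<epsilon> has_real_derivative g1 \<epsilon> x / k x) (at x within {a..0})" using elim(1) x by (simp add: sl_sys_def)
      show "\<bar>f1 \<epsilon> x\<bar> \<le> C * \<bar>\<epsilon>\<bar> ^ m" "\<bar>g1 \<epsilon> x\<bar> \<le> C * \<bar>\<epsilon>\<bar> ^ m"
        using bspec[OF elim(3) x] bspec[OF elim(4) x] le by linarith+
    next
      fix x assume x: "x \<in> {0..b}"
      show "(f2 \<epsilon> has_real_derivative g2 \<epsilon> x / \<kappa> x) (at x within {0..b})" using elim(2) x by (simp add: sl_sys_def)
      show "\<bar>f2 \<epsilon> x\<bar> \<le> C * \<bar>\<epsilon>\<bar> ^ m" "\<bar>g2 \<epsilon> x\<bar> \<le> C * \<bar>\<epsilon>\<bar> ^ m"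
        using bspec[OF elim(5) x] bspec[OF elim(6) x] le by linarith+
    qed
    then show ?case using K(2) by blast
  qed
  then show "ordo F T m (\<lambda>\<epsilon> _. H1_norm a b (glue (f1 \<epsilon>) (f2 \<epsilon>)))"
    "ordo F T m (\<lambda>\<epsilon> _. H1_norm a 0 (f1 \<epsilon>))" "ordo F T m (\<lambda>\<epsilon> _. H1_norm 0 b (f2 \<epsilon>))"
    by (auto intro!: ordoI[where C = "K * C"] elim!: eventually_mono simp: H1_norm_nonneg mult.assoc)
qed

end

text \<open>\<open>L \<epsilon>\<close> is the scaled eigenvalue \<open>\<lambda> / \<epsilon>\<close> and \<open>u \<epsilon>\<close> its eigenfunction.\<close>

locale expansion = transmission +
  fixes L :: "real \<Rightarrow> real" and u :: "real \<Rightarrow> real \<Rightarrow> real" and \<mu> :: real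
    and \<nu> :: "nat \<Rightarrow> real" and Y Z :: "nat \<Rightarrow> real \<Rightarrow> real"
  assumes eig: "\<And>\<epsilon>. \<epsilon> > 0 \<Longrightarrow> normalized_eigenfunction_P a b k r \<kappa> \<rho> \<epsilon> (\<epsilon> * L \<epsilon>) (u \<epsilon>)"
    and Lim: "(L \<longlongrightarrow> \<mu>) (at_right 0)" and V\<mu>: "left.V \<mu> 0 = 0"
    and coeffs: "expansion_coeffs a b k r \<kappa> \<rho> \<mu> \<nu> Y Z"
begin

text \<open>The coefficient \<open>\<mu>\<close> of order zero joins the \<open>\<nu> i\<close>, so that the equation of order \<open>n\<close> takes the
  convolution form \<open>(k y\<^sub>n')' = - r (\<Sum>i\<le>n. p i y\<^bsub>n-i\<^esub>)\<close> for every \<open>n\<close>. The functions \<open>\<eta>\<close> and \<open>\<zeta>\<close>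
  are the fluxes of the coefficients, \<open>vl\<close> and \<open>vr'\<close> those of the eigenfunction, and \<open>Ls n\<close> is the
  truncated expansion of \<open>L\<close>.\<close>

definition p :: "nat \<Rightarrow> real" where "p i = (if i = 0 then \<mu> else \<nu> i)"
definition \<eta> :: "nat \<Rightarrow> real \<Rightarrow> real" where "\<eta> n x = k x * deriv_within (Y n) {a..0} x"
definition \<zeta> :: "nat \<Rightarrow> real \<Rightarrow> real" where "\<zeta> n x = \<kappa> x * deriv_within (Z n) {0..b} x"
definition Ls :: "nat \<Rightarrow> real \<Rightarrow> real" where "Ls n \<epsilon> = (\<Sum>i\<le>n. \<epsilon> ^ i * p i)"
definition vl :: "real \<Rightarrow> real \<Rightarrow> real" where "vl \<epsilon> x = k x * deriv_within (u \<epsilon>) {a..0} x"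
definition vr' :: "real \<Rightarrow> real \<Rightarrow> real" where "vr' \<epsilon> x = \<kappa> x * deriv_within (u \<epsilon>) {0..b} x"

lemma Ls_eq: "Ls n \<epsilon> = \<mu> + (\<Sum>i=1..n. \<epsilon> ^ i * \<nu> i)"
proof -
  have "{..n} = insert 0 {1..n}" by auto
  then have "Ls n \<epsilon> = \<epsilon> ^ 0 * p 0 + (\<Sum>i=1..n. \<epsilon> ^ i * p i)"
    unfolding Ls_def by (simp only: finite_atLeastAtMost sum.insert) simp
  also have "(\<Sum>i=1..n. \<epsilon> ^ i * p i) = (\<Sum>i=1..n. \<epsilon> ^ i * \<nu> i)"
    by (rule sum.cong) (auto simp: p_def)
  finally show ?thesis by (simp add: p_def)
qed

lemma sys_Y: "sl_sys k {a..0} (\<lambda>x. - r x * (\<Sum>i\<le>n. p i * Y (n - i) x)) (Y n) (\<eta> n)"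
proof (cases "n = 0")
  case True
  have "sl_solution k {a..0} (\<lambda>x. - (\<mu> * r x * Y 0 x)) (Y 0)"
    using coeffs by (simp add: expansion_coeffs_def y_problem_def)
  from sl_solution_imp_sys[OF this posk] show ?thesis
    by (rule sl_sys_cong) (auto simp: True p_def \<eta>_def)
next
  case False
  then have n: "n \<ge> 1" by simp
  have "sl_solution k {a..0}
          (\<lambda>x. - \<nu> n * r x * Y 0 x - r x * (\<Sum>i=1..<n. \<nu> i * Y (n - i) x) - \<mu> * r x * Y n x) (Y n)"
    using coeffs[unfolded expansion_coeffs_def] n by blast
  from sl_solution_imp_sys[OF this posk] show ?thesis
  proof (rule sl_sys_cong)
    fix x
    have "{..n} = insert 0 (insert n {1..<n})" using n by auto
    then have "(\<Sum>i\<le>n. p i * Y (n - i) x) = p 0 * Y n x + (p n * Y 0 x + (\<Sum>i=1..<n. p i * Y (n - i) x))"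
      using n by simp
    also have "(\<Sum>i=1..<n. p i * Y (n - i) x) = (\<Sum>i=1..<n. \<nu> i * Y (n - i) x)"
      by (rule sum.cong) (auto simp: p_def)
    finally show "- \<nu> n * r x * Y 0 x - r x * (\<Sum>i=1..<n. \<nu> i * Y (n - i) x) - \<mu> * r x * Y n x
       = - r x * (\<Sum>i\<le>n. p i * Y (n - i) x)"
      using n by (simp add: p_def algebra_simps)
  qed (auto simp: \<eta>_def)
qed

lemma sys_Z: "sl_sys \<kappa> {0..b} (\<lambda>x. - \<rho> x * (\<Sum>i\<le>n. p i * Z (n - i) x)) (Z n) (\<zeta> n)"
proof (cases "n = 0")
  case True
  have "sl_solution \<kappa> {0..b} (\<lambda>x. - (\<mu> * \<rho> x * Z 0 x)) (Z 0)"
    using coeffs by (simp add: expansion_coeffs_def z_problem_def)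
  from sl_solution_imp_sys[OF this pos\<kappa>] show ?thesis
    by (rule sl_sys_cong) (auto simp: True p_def \<zeta>_def)
next
  case False
  then have n: "n \<ge> 1" by simp
  have "sl_solution \<kappa> {0..b} (\<lambda>x. - \<rho> x * (\<Sum>i=1..n. \<nu> i * Z (n - i) x) - \<mu> * \<rho> x * Z n x) (Z n)"
    using coeffs[unfolded expansion_coeffs_def] n by blast
  from sl_solution_imp_sys[OF this pos\<kappa>] show ?thesis
  proof (rule sl_sys_cong)
    fix x
    have "{..n} = insert 0 {1..n}" by auto
    then have "(\<Sum>i\<le>n. p i * Z (n - i) x) = p 0 * Z n x + (\<Sum>i=1..n. p i * Z (n - i) x)"
      by simp
    also have "(\<Sum>i=1..n. p i * Z (n - i) x) = (\<Sum>i=1..n. \<nu> i * Z (n - i) x)"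
      by (rule sum.cong) (auto simp: p_def)
    finally show "- \<rho> x * (\<Sum>i=1..n. \<nu> i * Z (n - i) x) - \<mu> * \<rho> x * Z n x = - \<rho> x * (\<Sum>i\<le>n. p i * Z (n - i) x)"
      by (simp add: p_def algebra_simps)
  qed (auto simp: \<zeta>_def)
qed

lemma coeff_boundary:
  "Y n a = 0" "Z n b = 0" "Z n 0 = Y n 0" "\<eta> 0 0 = 0" "\<eta> (Suc n) 0 = \<zeta> n 0" "Y 0 0 > 0"
  "integral {a..0} (\<lambda>x. r x * (Y 0 x)\<^sup>2) = 1" "n \<ge> 1 \<Longrightarrow> integral {a..0} (\<lambda>x. r x * Y n x * Y 0 x) = 0"
proof -
  show "Y n a = 0" "Z n b = 0" "Z n 0 = Y n 0"
    using coeffs by (cases "n = 0"; auto simp: expansion_coeffs_def y_problem_def z_problem_def)+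
  show "\<eta> 0 0 = 0" "\<eta> (Suc n) 0 = \<zeta> n 0" "Y 0 0 > 0" "integral {a..0} (\<lambda>x. r x * (Y 0 x)\<^sup>2) = 1"
    "n \<ge> 1 \<Longrightarrow> integral {a..0} (\<lambda>x. r x * Y n x * Y 0 x) = 0"
    using coeffs by (auto simp: expansion_coeffs_def y_problem_def \<eta>_def \<zeta>_def)
qed

lemma coeff_continuous:
  "continuous_on {a..0} (Y n)" "continuous_on {a..0} (\<eta> n)" "continuous_on {0..b} (Z n)" "continuous_on {0..b} (\<zeta> n)"
  using sl_sys_continuous[OF sys_Y] sl_sys_continuous[OF sys_Z] by auto

lemma coeff_zero:
  "\<eta> 0 a \<noteq> 0" "\<zeta> 0 b \<noteq> 0"
  "\<And>x. x \<in> {a..0} \<Longrightarrow> Y 0 x = \<eta> 0 a * left.U \<mu> x" "\<And>x. x \<in> {0..b} \<Longrightarrow> Z 0 x = \<zeta> 0 b * ur \<mu> x"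
proof -
  have "sl_sys k {a..0} (\<lambda>x. - \<mu> * r x * Y 0 x) (Y 0) (\<eta> 0)"
    by (rule sl_sys_cong[OF sys_Y[of 0]]) (auto simp: p_def)
  from left.sys_multiple(1)[OF this coeff_boundary(1)]
  show y: "Y 0 x = \<eta> 0 a * left.U \<mu> x" if "x \<in> {a..0}" for x using that .
  have "sl_sys \<kappa> {0..b} (\<lambda>x. - \<mu> * \<rho> x * Z 0 x) (Z 0) (\<zeta> 0)"
    by (rule sl_sys_cong[OF sys_Z[of 0]]) (auto simp: p_def)
  from sys_right_multiple(1)[OF this coeff_boundary(2)]
  show z: "Z 0 x = \<zeta> 0 b * ur \<mu> x" if "x \<in> {0..b}" for x using that .
  show "\<eta> 0 a \<noteq> 0" using y[of 0] coeff_boundary(6) a0 by auto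
  show "\<zeta> 0 b \<noteq> 0" using z[of 0] coeff_boundary(3)[of 0] coeff_boundary(6) b0 by auto
qed

lemma U\<mu>: "left.U \<mu> 0 \<noteq> 0"
  using left.UV_not_both_zero[of \<mu>] V\<mu> by simp

text \<open>The factor between the limit of the normalised eigenfunctions and the pair \<open>(Y 0, Z 0)\<close>. It is
  negative when the two sign conventions disagree.\<close>

definition c0 :: real where "c0 = amplitude \<mu> / \<zeta> 0 b"

lemma c0: "c0 \<noteq> 0" "amplitude \<mu> = c0 * \<zeta> 0 b" "amplitude \<mu> * ratio \<mu> = c0 * \<eta> 0 a"
proof -
  show "c0 \<noteq> 0" "amplitude \<mu> = c0 * \<zeta> 0 b" using coeff_zero amplitude_pos[of \<mu>] by (auto simp: c0_def)
  have "\<eta> 0 a * left.U \<mu> 0 = \<zeta> 0 b * ur \<mu> 0"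
    using coeff_zero(3)[of 0] coeff_zero(4)[of 0] coeff_boundary(3)[of 0] a0 b0 by simp
  then show "amplitude \<mu> * ratio \<mu> = c0 * \<eta> 0 a"
    using U\<mu> coeff_zero(2) by (simp add: c0_def ratio_def field_simps)
qed

lemma u_limits:
  "uniform_limit {a..0} u (\<lambda>x. c0 * Y 0 x) (at_right 0)"
  "((\<lambda>\<epsilon>. vl \<epsilon> a) \<longlongrightarrow> c0 * \<eta> 0 a) (at_right 0)"
  "uniform_limit {0..b} u (\<lambda>x. c0 * Z 0 x) (at_right 0)"
  "((\<lambda>\<epsilon>. vr' \<epsilon> b) \<longlongrightarrow> c0 * \<zeta> 0 b) (at_right 0)"
  "ordo (at_right 0) {a..0} 0 u" "ordo (at_right 0) {a..0} 0 vl" "ordo (at_right 0) {0..b} 0 u" "ordo (at_right 0) {0..b} 0 vr'"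
proof -
  note lim = eigenfunction_uniform_limits[OF eig Lim U\<mu>]
  have lim2: "uniform_limit {a..0} vl (\<lambda>x. amplitude \<mu> * ratio \<mu> * left.V \<mu> x) (at_right 0)"
    using lim(2) by (simp add: vl_def[abs_def])
  have lim4: "uniform_limit {0..b} vr' (\<lambda>x. amplitude \<mu> * vr \<mu> x) (at_right 0)"
    using lim(4) by (simp add: vr'_def[abs_def])
  show y: "uniform_limit {a..0} u (\<lambda>x. c0 * Y 0 x) (at_right 0)"
    by (rule uniform_limit_cong'[THEN iffD1, OF _ _ lim(1)]) (auto simp: c0(3) coeff_zero(3))
  show z: "uniform_limit {0..b} u (\<lambda>x. c0 * Z 0 x) (at_right 0)"
    by (rule uniform_limit_cong'[THEN iffD1, OF _ _ lim(3)]) (auto simp: c0(2) coeff_zero(4))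
  show "((\<lambda>\<epsilon>. vl \<epsilon> a) \<longlongrightarrow> c0 * \<eta> 0 a) (at_right 0)"
    using tendsto_uniform_limitI[OF lim2, of a] a0 by (simp add: c0(3))
  show "((\<lambda>\<epsilon>. vr' \<epsilon> b) \<longlongrightarrow> c0 * \<zeta> 0 b) (at_right 0)"
    using tendsto_uniform_limitI[OF lim4, of b] b0 by (simp add: c0(2))
  show "ordo (at_right 0) {a..0} 0 u" "ordo (at_right 0) {0..b} 0 u"
    using ordo_uniform_limit[OF y continuous_on_mult_left[OF coeff_continuous(1)]]
      ordo_uniform_limit[OF z continuous_on_mult_left[OF coeff_continuous(3)]] by auto
  show "ordo (at_right 0) {a..0} 0 vl" "ordo (at_right 0) {0..b} 0 vr'"
    using ordo_uniform_limit[OF lim2 continuous_on_mult_left[OF left_continuous(2)]]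
      ordo_uniform_limit[OF lim4 continuous_on_mult_left[OF right_continuous(2)]] by auto
qed

lemma sys_u:
  assumes "\<epsilon> > 0"
  shows "sl_sys k {a..0} (\<lambda>x. - L \<epsilon> * r x * u \<epsilon> x) (u \<epsilon>) (vl \<epsilon>)"
    and "sl_sys \<kappa> {0..b} (\<lambda>x. - L \<epsilon> * \<rho> x * u \<epsilon> x) (u \<epsilon>) (vr' \<epsilon>)"
    and "u \<epsilon> a = 0" "u \<epsilon> b = 0" "vl \<epsilon> 0 = \<epsilon> * vr' \<epsilon> 0"
    and "integral {a..0} (\<lambda>x. r x * (u \<epsilon> x)\<^sup>2) + integral {0..b} (\<lambda>x. \<rho> x * (u \<epsilon> x)\<^sup>2) = 1"
proof -
  have P: "problem_P a b k r \<kappa> \<rho> \<epsilon> (\<epsilon> * L \<epsilon>) (u \<epsilon>)" using eig[OF assms] by (simp add: normalized_eigenfunction_P_def)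
  note s = problem_P_systems[OF P assms]
  show s12: "sl_sys k {a..0} (\<lambda>x. - L \<epsilon> * r x * u \<epsilon> x) (u \<epsilon>) (vl \<epsilon>)" "sl_sys \<kappa> {0..b} (\<lambda>x. - L \<epsilon> * \<rho> x * u \<epsilon> x) (u \<epsilon>) (vr' \<epsilon>)"
    "u \<epsilon> a = 0" "u \<epsilon> b = 0" "vl \<epsilon> 0 = \<epsilon> * vr' \<epsilon> 0"
    using s by (simp_all add: vl_def[abs_def] vr'_def[abs_def])
  have "integral {a..b} (\<lambda>x. glue r \<rho> x * (u \<epsilon> x)\<^sup>2) = 1" using eig[OF assms] by (simp add: normalized_eigenfunction_P_def)
  then show "integral {a..0} (\<lambda>x. r x * (u \<epsilon> x)\<^sup>2) + integral {0..b} (\<lambda>x. \<rho> x * (u \<epsilon> x)\<^sup>2) = 1"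
    using weighted_integral_split[of "u \<epsilon>" "u \<epsilon>" "u \<epsilon>"] sl_sys_continuous(1)[OF s12(1)] sl_sys_continuous(1)[OF s12(2)] by simp
qed

abbreviation "PY n \<epsilon> \<equiv> partial_sum Y \<epsilon> n"
abbreviation "PZ n \<epsilon> \<equiv> partial_sum Z \<epsilon> n"
abbreviation "PE n \<epsilon> \<equiv> partial_sum \<eta> \<epsilon> n"
abbreviation "PF n \<epsilon> \<equiv> partial_sum \<zeta> \<epsilon> n"

text \<open>The residuals of the truncated expansions: what remains when \<open>PY\<close> and \<open>PZ\<close> are inserted into the
  equations with spectral parameter \<open>Ls n \<epsilon>\<close>.\<close>

definition GY :: "nat \<Rightarrow> real \<Rightarrow> real \<Rightarrow> real" where
  "GY n \<epsilon> x = Ls n \<epsilon> * PY n \<epsilon> x - (\<Sum>m\<le>n. \<epsilon> ^ m * (\<Sum>i\<le>m. p i * Y (m - i) x))"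
definition GZ :: "nat \<Rightarrow> real \<Rightarrow> real \<Rightarrow> real" where
  "GZ n \<epsilon> x = Ls n \<epsilon> * PZ n \<epsilon> x - (\<Sum>m\<le>n. \<epsilon> ^ m * (\<Sum>i\<le>m. p i * Z (m - i) x))"

lemma sys_PY: "sl_sys k {a..0} (\<lambda>x. - r x * (Ls n \<epsilon> * PY n \<epsilon> x - GY n \<epsilon> x)) (PY n \<epsilon>) (PE n \<epsilon>)"
  by (rule sl_sys_cong[OF sl_sys_sum[of "{..n}", OF _ sys_Y, of "\<lambda>i. \<epsilon> ^ i"]])
     (auto simp: partial_sum_def GY_def sum_distrib_left mult_ac sum_negf)

lemma sys_PZ: "sl_sys \<kappa> {0..b} (\<lambda>x. - \<rho> x * (Ls n \<epsilon> * PZ n \<epsilon> x - GZ n \<epsilon> x)) (PZ n \<epsilon>) (PF n \<epsilon>)"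
  by (rule sl_sys_cong[OF sl_sys_sum[of "{..n}", OF _ sys_Z, of "\<lambda>i. \<epsilon> ^ i"]])
     (auto simp: partial_sum_def GZ_def sum_distrib_left mult_ac sum_negf)

lemma residual_bound:
  fixes f :: "nat \<Rightarrow> real \<Rightarrow> real"
  assumes small: "\<forall>\<^sub>F \<epsilon> in F. \<bar>\<epsilon>\<bar> \<le> 1" and f: "\<And>i. continuous_on {c..d} (f i)"
  shows "ordo F {c..d} (Suc n) (\<lambda>\<epsilon> x. Ls n \<epsilon> * partial_sum f \<epsilon> n x - (\<Sum>m\<le>n. \<epsilon> ^ m * (\<Sum>i\<le>m. p i * f (m - i) x)))"
proof -
  have "continuous_on {c..d} (\<lambda>x. (\<Sum>i\<le>n. \<bar>p i\<bar>) * (\<Sum>l\<le>n. \<bar>f l x\<bar>))" using f by (intro continuous_intros)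
  then have "bounded ((\<lambda>x. (\<Sum>i\<le>n. \<bar>p i\<bar>) * (\<Sum>l\<le>n. \<bar>f l x\<bar>)) ` {c..d})"
    by (intro compact_imp_bounded compact_continuous_image) auto
  then obtain C where C: "\<forall>y\<in>(\<lambda>x. (\<Sum>i\<le>n. \<bar>p i\<bar>) * (\<Sum>l\<le>n. \<bar>f l x\<bar>)) ` {c..d}. norm y \<le> C" unfolding bounded_iff by blast
  show ?thesis
  proof (rule ordoI[where C = C], use small in eventually_elim, intro ballI)
    fix \<epsilon> x assume e: "\<bar>\<epsilon>\<bar> \<le> (1::real)" and x: "x \<in> {c..d}"
    have "(\<Sum>i\<le>n. \<bar>p i\<bar>) * (\<Sum>l\<le>n. \<bar>f l x\<bar>) \<le> C" using C x by fastforce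
    then have "\<bar>\<epsilon>\<bar> ^ Suc n * ((\<Sum>i\<le>n. \<bar>p i\<bar>) * (\<Sum>l\<le>n. \<bar>f l x\<bar>)) \<le> \<bar>\<epsilon>\<bar> ^ Suc n * C"
      by (intro mult_left_mono) auto
    then show "\<bar>Ls n \<epsilon> * partial_sum f \<epsilon> n x - (\<Sum>m\<le>n. \<epsilon> ^ m * (\<Sum>i\<le>m. p i * f (m - i) x))\<bar> \<le> C * \<bar>\<epsilon>\<bar> ^ Suc n"
      using cauchy_truncation_bound[OF e, where n = n and p = p and y = "\<lambda>l. f l x"]
      unfolding Ls_def partial_sum_def by (simp add: mult.commute del: power_Suc)
  qed
qed

lemma ordo_GY: "ordo (at_right 0) {a..0} (Suc n) (GY n)"
  unfolding GY_def[abs_def] by (intro residual_bound eventually_small coeff_continuous)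
lemma ordo_GZ: "ordo (at_right 0) {0..b} (Suc n) (GZ n)"
  unfolding GZ_def[abs_def] by (intro residual_bound eventually_small coeff_continuous)

lemma cont_P:
  "continuous_on {a..0} (PY n \<epsilon>)" "continuous_on {a..0} (PE n \<epsilon>)" "continuous_on {0..b} (PZ n \<epsilon>)" "continuous_on {0..b} (PF n \<epsilon>)"
  using sl_sys_continuous[OF sys_PY] sl_sys_continuous[OF sys_PZ] by auto

lemma cont_G: "continuous_on {a..0} (GY n \<epsilon>)" "continuous_on {0..b} (GZ n \<epsilon>)"
  unfolding GY_def[abs_def] GZ_def[abs_def] by (intro continuous_intros cont_P coeff_continuous)+

text \<open>The coefficients satisfy \<open>\<eta> (n + 1) 0 = \<zeta> n 0\<close>, so the flux condition of the truncated expansion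
  telescopes and fails only by the first omitted term.\<close>

lemma P_boundary:
  "PY n \<epsilon> a = 0" "PZ n \<epsilon> b = 0" "PZ n \<epsilon> 0 = PY n \<epsilon> 0" "PE n \<epsilon> 0 - \<epsilon> * PF n \<epsilon> 0 = - (\<epsilon> ^ Suc n * \<zeta> n 0)"
proof -
  show "PY n \<epsilon> a = 0" "PZ n \<epsilon> b = 0" "PZ n \<epsilon> 0 = PY n \<epsilon> 0"
    by (simp_all add: partial_sum_def coeff_boundary)
  have "PE n \<epsilon> 0 = (\<Sum>i<n. \<epsilon> ^ Suc i * \<eta> (Suc i) 0)"
    by (simp add: partial_sum_def sum.atMost_shift coeff_boundary)
  also have "\<dots> = \<epsilon> * (\<Sum>i<n. \<epsilon> ^ i * \<zeta> i 0)" by (simp add: coeff_boundary sum_distrib_left mult.assoc)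
  also have "\<dots> = \<epsilon> * PF n \<epsilon> 0 - \<epsilon> ^ Suc n * \<zeta> n 0"
    by (simp add: partial_sum_def lessThan_Suc_atMost[symmetric] algebra_simps)
  finally show "PE n \<epsilon> 0 - \<epsilon> * PF n \<epsilon> 0 = - (\<epsilon> ^ Suc n * \<zeta> n 0)" by simp
qed

text \<open>The weight \<open>\<epsilon>\<close> on the right half is dictated by the flux condition: with it the boundary terms
  at \<open>0\<close> from the two halves combine.\<close>

definition J :: "nat \<Rightarrow> real \<Rightarrow> real" where
  "J n \<epsilon> = integral {a..0} (\<lambda>x. r x * u \<epsilon> x * PY n \<epsilon> x) + \<epsilon> * integral {0..b} (\<lambda>x. \<rho> x * u \<epsilon> x * PZ n \<epsilon> x)"
definition R :: "nat \<Rightarrow> real \<Rightarrow> real" where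
  "R n \<epsilon> = integral {a..0} (\<lambda>x. r x * u \<epsilon> x * GY n \<epsilon> x) + \<epsilon> * integral {0..b} (\<lambda>x. \<rho> x * u \<epsilon> x * GZ n \<epsilon> x)"

text \<open>The Lagrange identity between an exact solution with parameter \<open>l\<close> and an approximate one with
  parameter \<open>m\<close> and residual \<open>G\<close>.\<close>

lemma lagrange_half:
  assumes U: "sl_sys P {c..d} (\<lambda>x. - l * q x * w x) w v" and W: "sl_sys P {c..d} (\<lambda>x. - q x * (m * W x - G x)) W X"
    and cd: "c \<le> d" and cont: "continuous_on {c..d} q" "continuous_on {c..d} G"
  shows "(w d * X d - W d * v d) - (w c * X c - W c * v c) =
      (l - m) * integral {c..d} (\<lambda>x. q x * w x * W x) + integral {c..d} (\<lambda>x. q x * w x * G x)"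
proof -
  have "((\<lambda>x. (l - m) * (q x * w x * W x) + q x * w x * G x) has_integral
      ((w d * X d - W d * v d) - (w c * X c - W c * v c))) {c..d}"
  proof (rule fundamental_theorem_of_calculus[OF cd])
    fix x assume "x \<in> {c..d}"
    from sl_sys_wronskian[OF U W this]
    show "((\<lambda>x. w x * X x - W x * v x) has_vector_derivative (l - m) * (q x * w x * W x) + q x * w x * G x) (at x within {c..d})"
      by (simp add: has_real_derivative_iff_has_vector_derivative algebra_simps)
  qed
  moreover have "((\<lambda>x. (l - m) * (q x * w x * W x) + q x * w x * G x) has_integral
      ((l - m) * integral {c..d} (\<lambda>x. q x * w x * W x) + integral {c..d} (\<lambda>x. q x * w x * G x))) {c..d}"
    using cont sl_sys_continuous(1)[OF U] sl_sys_continuous(1)[OF W]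
    by (intro has_integral_add has_integral_mult_right integrable_integral integrable_continuous_interval continuous_intros)
  ultimately show ?thesis by (rule has_integral_unique)
qed

text \<open>Tests the eigenfunction against the truncated expansion. The outer boundary terms vanish, those
  at \<open>0\<close> reduce to the flux defect of the truncated expansion.\<close>

lemma lagrange_identity:
  assumes e: "\<epsilon> > 0"
  shows "(L \<epsilon> - Ls n \<epsilon>) * J n \<epsilon> = - (\<epsilon> ^ Suc n * (u \<epsilon> 0 * \<zeta> n 0)) - R n \<epsilon>"
proof -
  note s = sys_u[OF e]
  have 1: "u \<epsilon> 0 * PE n \<epsilon> 0 - PY n \<epsilon> 0 * vl \<epsilon> 0 =
      (L \<epsilon> - Ls n \<epsilon>) * integral {a..0} (\<lambda>x. r x * u \<epsilon> x * PY n \<epsilon> x) + integral {a..0} (\<lambda>x. r x * u \<epsilon> x * GY n \<epsilon> x)"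
    using lagrange_half[OF s(1) sys_PY _ contr cont_G(1)] a0 s(3) P_boundary(1) by simp
  have 2: "- (u \<epsilon> 0 * PF n \<epsilon> 0 - PY n \<epsilon> 0 * vr' \<epsilon> 0) =
      (L \<epsilon> - Ls n \<epsilon>) * integral {0..b} (\<lambda>x. \<rho> x * u \<epsilon> x * PZ n \<epsilon> x) + integral {0..b} (\<lambda>x. \<rho> x * u \<epsilon> x * GZ n \<epsilon> x)"
    using lagrange_half[OF s(2) sys_PZ _ cont\<rho> cont_G(2)] b0 s(4) P_boundary(2,3) by simp
  have "(L \<epsilon> - Ls n \<epsilon>) * J n \<epsilon> + R n \<epsilon> =
    (u \<epsilon> 0 * PE n \<epsilon> 0 - PY n \<epsilon> 0 * vl \<epsilon> 0) + \<epsilon> * (- (u \<epsilon> 0 * PF n \<epsilon> 0 - PY n \<epsilon> 0 * vr' \<epsilon> 0))"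
    unfolding 1 2 J_def R_def by (simp add: algebra_simps)
  also have "\<dots> = u \<epsilon> 0 * (PE n \<epsilon> 0 - \<epsilon> * PF n \<epsilon> 0)" unfolding s(5) by (simp add: algebra_simps)
  also have "\<dots> = - (\<epsilon> ^ Suc n * (u \<epsilon> 0 * \<zeta> n 0))" unfolding P_boundary(4) by simp
  finally show ?thesis by linarith
qed

text \<open>The right half carries the factor \<open>\<epsilon>\<close>; on the left the limit is \<open>c0 \<integral> r y\<^sub>0\<^sup>2 = c0\<close>.\<close>

lemma J_tendsto: "(J n \<longlongrightarrow> c0) (at_right 0)"
proof -
  have F: "at_right (0::real) \<noteq> bot" by (rule trivial_limit_at_right_real)
  have c: "\<forall>\<^sub>F \<epsilon> in at_right 0. continuous_on {a..0} (u \<epsilon>) \<and> continuous_on {a..0} (PY n \<epsilon>)"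
     "\<forall>\<^sub>F \<epsilon> in at_right 0. continuous_on {0..b} (u \<epsilon>) \<and> continuous_on {0..b} (PZ n \<epsilon>)"
    using eventually_at_right_less[of "0::real"]
    by (auto elim!: eventually_mono intro: cont_P sl_sys_continuous(1)[OF sys_u(1)] sl_sys_continuous(1)[OF sys_u(2)])
  have 1: "((\<lambda>\<epsilon>. integral {a..0} (\<lambda>x. r x * u \<epsilon> x * PY n \<epsilon> x)) \<longlongrightarrow> integral {a..0} (\<lambda>x. r x * (c0 * Y 0 x) * Y 0 x)) (at_right 0)"
    by (rule uniform_limit_integral_product[OF u_limits(1) partial_sum_uniform_limit _ _ contr c(1) F])
       (auto intro!: coeff_continuous continuous_intros)
  have 2: "((\<lambda>\<epsilon>. integral {0..b} (\<lambda>x. \<rho> x * u \<epsilon> x * PZ n \<epsilon> x)) \<longlongrightarrow> integral {0..b} (\<lambda>x. \<rho> x * (c0 * Z 0 x) * Z 0 x)) (at_right 0)"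
    by (rule uniform_limit_integral_product[OF u_limits(3) partial_sum_uniform_limit _ _ cont\<rho> c(2) F])
       (auto intro!: coeff_continuous continuous_intros)
  have "integral {a..0} (\<lambda>x. r x * (c0 * Y 0 x) * Y 0 x) = c0 * integral {a..0} (\<lambda>x. r x * (Y 0 x)\<^sup>2)"
    by (simp add: integral_mult_right[symmetric] power2_eq_square mult_ac del: integral_mult_right)
  then have lim1: "((\<lambda>\<epsilon>. integral {a..0} (\<lambda>x. r x * u \<epsilon> x * PY n \<epsilon> x)) \<longlongrightarrow> c0) (at_right 0)"
    using 1 coeff_boundary(7) by simp
  have "((\<lambda>\<epsilon>. \<epsilon>) \<longlongrightarrow> 0) (at_right (0::real))" by (rule tendsto_ident_at)
  from tendsto_add[OF lim1 tendsto_mult[OF this 2]] show ?thesis by (simp add: J_def[abs_def])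
qed

lemma weights_ordo: "ordo F {a..0} 0 (\<lambda>_. r)" "ordo F {0..b} 0 (\<lambda>_. \<rho>)"
  by (rule ordo_continuous[OF contr] ordo_continuous[OF cont\<rho>])+

lemma ordo_P:
  assumes small: "\<forall>\<^sub>F \<epsilon> in F. \<bar>\<epsilon>\<bar> \<le> 1"
  shows "ordo F {a..0} 0 (PY n)" "ordo F {a..0} 0 (PE n)" "ordo F {0..b} 0 (PZ n)" "ordo F {0..b} 0 (PF n)"
  using ordo_partial_sum[OF small] coeff_continuous by blast+

text \<open>In the identity \<open>(L - Ls n) J n = O(\<epsilon>\<^bsup>n+1\<^esup>)\<close> the factor \<open>J n\<close> has a nonzero limit.\<close>

theorem eigenvalue_expansion: "ordo (at_right 0) S (Suc n) (\<lambda>\<epsilon> _. L \<epsilon> - Ls n \<epsilon>)"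
proof -
  have R1: "ordo (at_right 0) S (Suc n) (\<lambda>\<epsilon> _. integral {a..0} (\<lambda>x. r x * u \<epsilon> x * GY n \<epsilon> x))"
    by (intro ordo_integral ordo_mult_left ordo_mult_right weights_ordo u_limits ordo_GY) (use a0 in auto)
  have R2: "ordo (at_right 0) S (Suc n) (\<lambda>\<epsilon> _. integral {0..b} (\<lambda>x. \<rho> x * u \<epsilon> x * GZ n \<epsilon> x))"
    by (intro ordo_integral ordo_mult_left ordo_mult_right weights_ordo u_limits ordo_GZ) (use b0 in auto)
  have e0: "ordo (at_right 0) S 0 (\<lambda>\<epsilon> _. \<epsilon>)" by (rule ordo_tendsto[OF tendsto_ident_at])
  have "ordo (at_right 0) S (Suc n) (\<lambda>\<epsilon> _. R n \<epsilon>)"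
    unfolding R_def by (intro ordo_add R1 ordo_mult_left e0 R2)
  moreover have "ordo (at_right 0) S 0 (\<lambda>\<epsilon> _. u \<epsilon> 0)" by (rule ordo_at[OF u_limits(5)]) (use a0 in auto)
  ultimately have rhs: "ordo (at_right 0) S (Suc n) (\<lambda>\<epsilon> _. - (\<epsilon> ^ Suc n * (u \<epsilon> 0 * \<zeta> n 0)) - R n \<epsilon>)"
    by (intro ordo_diff ordo_uminus ordo_mult_right[OF ordo_param_power] ordo_mult_left[OF _ ordo_const])
  have "((\<lambda>\<epsilon>. inverse (J n \<epsilon>)) \<longlongrightarrow> inverse c0) (at_right 0)"
    by (rule tendsto_inverse[OF J_tendsto c0(1)])
  from ordo_mult_left[OF ordo_tendsto[OF this] rhs]
  have "ordo (at_right 0) S (Suc n) (\<lambda>\<epsilon> _. inverse (J n \<epsilon>) * (- (\<epsilon> ^ Suc n * (u \<epsilon> 0 * \<zeta> n 0)) - R n \<epsilon>))" .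
  moreover have "\<forall>\<^sub>F \<epsilon> in at_right 0. J n \<epsilon> \<noteq> 0" by (rule tendsto_imp_eventually_ne[OF J_tendsto c0(1)])
  with eventually_at_right_less[of "0::real"]
  have "\<forall>\<^sub>F \<epsilon> in at_right 0. \<forall>x\<in>S. inverse (J n \<epsilon>) * (- (\<epsilon> ^ Suc n * (u \<epsilon> 0 * \<zeta> n 0)) - R n \<epsilon>) = L \<epsilon> - Ls n \<epsilon>"
    by eventually_elim (simp add: lagrange_identity[symmetric] del: power_Suc)
  ultimately show ?thesis by (rule ordo_cong)
qed

end

section \<open>The expansion of the eigenfunction\<close>

lemma sl_sys_diff:
  assumes "sl_sys p S f u v" "sl_sys p S g U V"
  shows "sl_sys p S (\<lambda>x. f x - t * g x) (\<lambda>x. u x - t * U x) (\<lambda>x. v x - t * V x)"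
  using sl_sys_lincomb[OF assms, of 1 "- t"] by simp

context expansion begin

text \<open>The quotients of the fluxes at the outer end points. Subtracting this multiple of the truncated
  expansion from the eigenfunction leaves zero data at the end point.\<close>

definition tL :: "nat \<Rightarrow> real \<Rightarrow> real" where "tL n \<epsilon> = vl \<epsilon> a / PE n \<epsilon> a"
definition tR :: "nat \<Rightarrow> real \<Rightarrow> real" where "tR n \<epsilon> = vr' \<epsilon> b / PF n \<epsilon> b"

lemma t_tendsto: "(tL n \<longlongrightarrow> c0) (at_right 0)" "(tR n \<longlongrightarrow> c0) (at_right 0)"
proof -
  have "(tL n \<longlongrightarrow> c0 * \<eta> 0 a / \<eta> 0 a) (at_right 0)"
    unfolding tL_def[abs_def] by (intro tendsto_divide u_limits partial_sum_tendsto coeff_zero)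
  then show "(tL n \<longlongrightarrow> c0) (at_right 0)" using coeff_zero(1) by simp
  have "(tR n \<longlongrightarrow> c0 * \<zeta> 0 b / \<zeta> 0 b) (at_right 0)"
    unfolding tR_def[abs_def] by (intro tendsto_divide u_limits partial_sum_tendsto coeff_zero)
  then show "(tR n \<longlongrightarrow> c0) (at_right 0)" using coeff_zero(2) by simp
qed

text \<open>The difference starts from zero data at \<open>a\<close>, and its forcing consists of the eigenvalue error
  and the residual.\<close>

lemma left_error:
  "ordo (at_right 0) {a..0} (Suc n) (\<lambda>\<epsilon> x. u \<epsilon> x - tL n \<epsilon> * PY n \<epsilon> x)"
  "ordo (at_right 0) {a..0} (Suc n) (\<lambda>\<epsilon> x. vl \<epsilon> x - tL n \<epsilon> * PE n \<epsilon> x)"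
proof -
  \<comment> \<open>The forcing that remains when the difference is made to obey the equation with parameter \<open>L \<epsilon>\<close>.\<close>
  define g where "g = (\<lambda>\<epsilon> x. - ((L \<epsilon> - Ls n \<epsilon>) * (tL n \<epsilon> * (r x * PY n \<epsilon> x))) - tL n \<epsilon> * (r x * GY n \<epsilon> x))"
  have s: "\<forall>\<^sub>F \<epsilon> in at_right 0. sl_sys k {a..0} (\<lambda>x. (- L \<epsilon> * r x) * (u \<epsilon> x - tL n \<epsilon> * PY n \<epsilon> x) + g \<epsilon> x)
      (\<lambda>x. u \<epsilon> x - tL n \<epsilon> * PY n \<epsilon> x) (\<lambda>x. vl \<epsilon> x - tL n \<epsilon> * PE n \<epsilon> x)"
    using eventually_at_right_less[of "0::real"]
  proof eventually_elim
    case (elim \<epsilon>)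
    show ?case
      by (rule sl_sys_cong[OF sl_sys_diff[OF sys_u(1)[OF elim] sys_PY[where n = n and \<epsilon> = \<epsilon>], of "tL n \<epsilon>"]])
         (simp_all add: g_def algebra_simps)
  qed
  have h: "ordo (at_right 0) {a..0} 0 (\<lambda>\<epsilon> x. - L \<epsilon> * r x)"
    by (intro ordo_mult_left weights_ordo ordo_uminus ordo_tendsto[OF Lim])
  have o: "ordo (at_right 0) {a..0} (Suc n) g"
    unfolding g_def
    by (intro ordo_diff ordo_uminus ordo_mult_right[OF eigenvalue_expansion] ordo_mult_left[OF ordo_tendsto[OF t_tendsto(1)]]
        ordo_mult_left[OF weights_ordo(1)] ordo_P ordo_GY eventually_small)
  have init: "\<forall>\<^sub>F \<epsilon> in at_right 0. u \<epsilon> a - tL n \<epsilon> * PY n \<epsilon> a = 0 \<and> vl \<epsilon> a - tL n \<epsilon> * PE n \<epsilon> a = 0"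
    using eventually_at_right_less[of "0::real"] tendsto_imp_eventually_ne[OF partial_sum_tendsto[of \<eta> n a] coeff_zero(1)]
  proof eventually_elim
    case (elim \<epsilon>)
    then show ?case using sys_u(3)[OF elim(1)] by (simp add: P_boundary tL_def)
  qed
  show "ordo (at_right 0) {a..0} (Suc n) (\<lambda>\<epsilon> x. u \<epsilon> x - tL n \<epsilon> * PY n \<epsilon> x)"
    by (rule ordo_apriori(1)[where h = "\<lambda>\<epsilon> x. - L \<epsilon> * r x" and g = g and e = a
        and u = "\<lambda>\<epsilon> x. u \<epsilon> x - tL n \<epsilon> * PY n \<epsilon> x" and v = "\<lambda>\<epsilon> x. vl \<epsilon> x - tL n \<epsilon> * PE n \<epsilon> x",
        OF a0 contk posk s h o _ init]) simp_all
  show "ordo (at_right 0) {a..0} (Suc n) (\<lambda>\<epsilon> x. vl \<epsilon> x - tL n \<epsilon> * PE n \<epsilon> x)"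
    by (rule ordo_apriori(2)[where h = "\<lambda>\<epsilon> x. - L \<epsilon> * r x" and g = g and e = a
        and u = "\<lambda>\<epsilon> x. u \<epsilon> x - tL n \<epsilon> * PY n \<epsilon> x" and v = "\<lambda>\<epsilon> x. vl \<epsilon> x - tL n \<epsilon> * PE n \<epsilon> x",
        OF a0 contk posk s h o _ init]) simp_all
qed

lemma right_error:
  "ordo (at_right 0) {0..b} (Suc n) (\<lambda>\<epsilon> x. u \<epsilon> x - tR n \<epsilon> * PZ n \<epsilon> x)"
  "ordo (at_right 0) {0..b} (Suc n) (\<lambda>\<epsilon> x. vr' \<epsilon> x - tR n \<epsilon> * PF n \<epsilon> x)"
proof -
  define g where "g = (\<lambda>\<epsilon> x. - ((L \<epsilon> - Ls n \<epsilon>) * (tR n \<epsilon> * (\<rho> x * PZ n \<epsilon> x))) - tR n \<epsilon> * (\<rho> x * GZ n \<epsilon> x))"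
  have s: "\<forall>\<^sub>F \<epsilon> in at_right 0. sl_sys \<kappa> {0..b} (\<lambda>x. (- L \<epsilon> * \<rho> x) * (u \<epsilon> x - tR n \<epsilon> * PZ n \<epsilon> x) + g \<epsilon> x)
      (\<lambda>x. u \<epsilon> x - tR n \<epsilon> * PZ n \<epsilon> x) (\<lambda>x. vr' \<epsilon> x - tR n \<epsilon> * PF n \<epsilon> x)"
    using eventually_at_right_less[of "0::real"]
  proof eventually_elim
    case (elim \<epsilon>)
    show ?case
      by (rule sl_sys_cong[OF sl_sys_diff[OF sys_u(2)[OF elim] sys_PZ[where n = n and \<epsilon> = \<epsilon>], of "tR n \<epsilon>"]])
         (simp_all add: g_def algebra_simps)
  qed
  have h: "ordo (at_right 0) {0..b} 0 (\<lambda>\<epsilon> x. - L \<epsilon> * \<rho> x)"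
    by (intro ordo_mult_left weights_ordo ordo_uminus ordo_tendsto[OF Lim])
  have o: "ordo (at_right 0) {0..b} (Suc n) g"
    unfolding g_def
    by (intro ordo_diff ordo_uminus ordo_mult_right[OF eigenvalue_expansion] ordo_mult_left[OF ordo_tendsto[OF t_tendsto(2)]]
        ordo_mult_left[OF weights_ordo(2)] ordo_P ordo_GZ eventually_small)
  have init: "\<forall>\<^sub>F \<epsilon> in at_right 0. u \<epsilon> b - tR n \<epsilon> * PZ n \<epsilon> b = 0 \<and> vr' \<epsilon> b - tR n \<epsilon> * PF n \<epsilon> b = 0"
    using eventually_at_right_less[of "0::real"] tendsto_imp_eventually_ne[OF partial_sum_tendsto[of \<zeta> n b] coeff_zero(2)]
  proof eventually_elim
    case (elim \<epsilon>)
    then show ?case using sys_u(4)[OF elim(1)] by (simp add: P_boundary tR_def)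
  qed
  show "ordo (at_right 0) {0..b} (Suc n) (\<lambda>\<epsilon> x. u \<epsilon> x - tR n \<epsilon> * PZ n \<epsilon> x)"
    by (rule ordo_apriori(1)[where h = "\<lambda>\<epsilon> x. - L \<epsilon> * \<rho> x" and g = g and e = b
        and u = "\<lambda>\<epsilon> x. u \<epsilon> x - tR n \<epsilon> * PZ n \<epsilon> x" and v = "\<lambda>\<epsilon> x. vr' \<epsilon> x - tR n \<epsilon> * PF n \<epsilon> x",
        OF b0 cont\<kappa> pos\<kappa> s h o _ init]) simp_all
  show "ordo (at_right 0) {0..b} (Suc n) (\<lambda>\<epsilon> x. vr' \<epsilon> x - tR n \<epsilon> * PF n \<epsilon> x)"
    by (rule ordo_apriori(2)[where h = "\<lambda>\<epsilon> x. - L \<epsilon> * \<rho> x" and g = g and e = b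
        and u = "\<lambda>\<epsilon> x. u \<epsilon> x - tR n \<epsilon> * PZ n \<epsilon> x" and v = "\<lambda>\<epsilon> x. vr' \<epsilon> x - tR n \<epsilon> * PF n \<epsilon> x",
        OF b0 cont\<kappa> pos\<kappa> s h o _ init]) simp_all
qed

text \<open>The multiplier of the expansion: the projection of the eigenfunction onto \<open>y\<^sub>0\<close>. Because the
  higher coefficients are orthogonal to \<open>y\<^sub>0\<close>, the same multiplier serves every truncation order.\<close>

definition \<omega> :: "real \<Rightarrow> real" where "\<omega> \<epsilon> = integral {a..0} (\<lambda>x. r x * u \<epsilon> x * Y 0 x)"

lemma projection_partial_sum: "integral {a..0} (\<lambda>x. r x * PY n \<epsilon> x * Y 0 x) = 1"
proof -
  have int: "(\<lambda>x. \<epsilon> ^ i * (r x * Y i x * Y 0 x)) integrable_on {a..0}" for i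
    by (intro integrable_continuous_interval continuous_intros contr coeff_continuous)
  have "integral {a..0} (\<lambda>x. r x * PY n \<epsilon> x * Y 0 x) = integral {a..0} (\<lambda>x. \<Sum>i\<le>n. \<epsilon> ^ i * (r x * Y i x * Y 0 x))"
    by (rule integral_cong) (simp add: partial_sum_def sum_distrib_left sum_distrib_right mult_ac)
  also have "\<dots> = (\<Sum>i\<le>n. integral {a..0} (\<lambda>x. \<epsilon> ^ i * (r x * Y i x * Y 0 x)))"
    by (rule integral_sum) (use int in auto)
  also have "\<dots> = (\<Sum>i\<le>n. if i = 0 then 1 else 0)"
    by (rule sum.cong) (use coeff_boundary(7,8) in \<open>auto simp: power2_eq_square mult.assoc\<close>)
  finally show ?thesis by simp
qed

lemma \<omega>_tendsto: "(\<omega> \<longlongrightarrow> c0) (at_right 0)"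
proof -
  have c: "\<forall>\<^sub>F \<epsilon> in at_right 0. continuous_on {a..0} (u \<epsilon>) \<and> continuous_on {a..0} (Y 0)"
    using eventually_at_right_less[of "0::real"]
    by (auto elim!: eventually_mono intro: coeff_continuous sl_sys_continuous(1)[OF sys_u(1)])
  have "(\<omega> \<longlongrightarrow> integral {a..0} (\<lambda>x. r x * (c0 * Y 0 x) * Y 0 x)) (at_right 0)"
    unfolding \<omega>_def[abs_def]
    by (rule uniform_limit_integral_product[OF u_limits(1) uniform_limit_const _ _ contr c trivial_limit_at_right_real])
       (auto intro!: coeff_continuous continuous_intros)
  moreover have "integral {a..0} (\<lambda>x. r x * (c0 * Y 0 x) * Y 0 x) = c0 * integral {a..0} (\<lambda>x. r x * (Y 0 x)\<^sup>2)"
    by (simp add: integral_mult_right[symmetric] power2_eq_square mult_ac del: integral_mult_right)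
  ultimately show ?thesis using coeff_boundary(7) by simp
qed

text \<open>\<open>\<omega> - tL n\<close> is the projection of the left error onto \<open>y\<^sub>0\<close>.\<close>

lemma \<omega>_tL: "ordo (at_right 0) S (Suc n) (\<lambda>\<epsilon> _. \<omega> \<epsilon> - tL n \<epsilon>)"
proof (rule ordo_cong)
  show "ordo (at_right 0) S (Suc n) (\<lambda>\<epsilon> _. integral {a..0} (\<lambda>x. r x * (u \<epsilon> x - tL n \<epsilon> * PY n \<epsilon> x) * Y 0 x))"
    by (intro ordo_integral ordo_mult_right[OF ordo_mult_left[OF weights_ordo(1) left_error(1)]] ordo_continuous coeff_continuous)
       (use a0 in auto)
  show "\<forall>\<^sub>F \<epsilon> in at_right 0. \<forall>x\<in>S. integral {a..0} (\<lambda>x. r x * (u \<epsilon> x - tL n \<epsilon> * PY n \<epsilon> x) * Y 0 x) = \<omega> \<epsilon> - tL n \<epsilon>"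
    using eventually_at_right_less[of "0::real"]
  proof eventually_elim
    case (elim \<epsilon>)
    have "((\<lambda>x. r x * u \<epsilon> x * Y 0 x - tL n \<epsilon> * (r x * PY n \<epsilon> x * Y 0 x)) has_integral
        (\<omega> \<epsilon> - tL n \<epsilon> * integral {a..0} (\<lambda>x. r x * PY n \<epsilon> x * Y 0 x))) {a..0}"
      unfolding \<omega>_def
      by (intro has_integral_diff has_integral_mult_right integrable_integral integrable_continuous_interval
          continuous_intros contr coeff_continuous cont_P sl_sys_continuous(1)[OF sys_u(1)[OF elim]])
    then have "integral {a..0} (\<lambda>x. r x * u \<epsilon> x * Y 0 x - tL n \<epsilon> * (r x * PY n \<epsilon> x * Y 0 x)) = \<omega> \<epsilon> - tL n \<epsilon>"
      using projection_partial_sum by (simp add: integral_unique)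
    then show ?case by (simp add: algebra_simps)
  qed
qed

text \<open>Eigenfunction and truncated expansion are both continuous at \<open>0\<close>, where the truncated expansion
  stays away from zero.\<close>

lemma tR_tL: "ordo (at_right 0) S (Suc n) (\<lambda>\<epsilon> _. tR n \<epsilon> - tL n \<epsilon>)"
proof (rule ordo_cong)
  have "ordo (at_right 0) S (Suc n) (\<lambda>\<epsilon> _. (u \<epsilon> 0 - tL n \<epsilon> * PY n \<epsilon> 0) - (u \<epsilon> 0 - tR n \<epsilon> * PZ n \<epsilon> 0))"
    by (intro ordo_diff ordo_at[OF left_error(1)] ordo_at[OF right_error(1)]) (use a0 b0 in auto)
  moreover have "((\<lambda>\<epsilon>. inverse (PY n \<epsilon> 0)) \<longlongrightarrow> inverse (Y 0 0)) (at_right 0)"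
    using coeff_boundary(6) by (intro tendsto_inverse partial_sum_tendsto) simp
  ultimately show "ordo (at_right 0) S (Suc n) (\<lambda>\<epsilon> _. inverse (PY n \<epsilon> 0) * ((u \<epsilon> 0 - tL n \<epsilon> * PY n \<epsilon> 0) - (u \<epsilon> 0 - tR n \<epsilon> * PZ n \<epsilon> 0)))"
    by (intro ordo_mult_left[OF ordo_tendsto])
  have "\<forall>\<^sub>F \<epsilon> in at_right 0. PY n \<epsilon> 0 \<noteq> 0"
    by (rule tendsto_imp_eventually_ne[OF partial_sum_tendsto]) (use coeff_boundary(6) in simp)
  then show "\<forall>\<^sub>F \<epsilon> in at_right 0. \<forall>x\<in>S. inverse (PY n \<epsilon> 0) * ((u \<epsilon> 0 - tL n \<epsilon> * PY n \<epsilon> 0) - (u \<epsilon> 0 - tR n \<epsilon> * PZ n \<epsilon> 0)) = tR n \<epsilon> - tL n \<epsilon>"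
    by eventually_elim (simp add: P_boundary field_simps)
qed

lemma eigenfunction_error:
  "ordo (at_right 0) {a..0} (Suc n) (\<lambda>\<epsilon> x. u \<epsilon> x - \<omega> \<epsilon> * PY n \<epsilon> x)"
  "ordo (at_right 0) {a..0} (Suc n) (\<lambda>\<epsilon> x. vl \<epsilon> x - \<omega> \<epsilon> * PE n \<epsilon> x)"
  "ordo (at_right 0) {0..b} (Suc n) (\<lambda>\<epsilon> x. u \<epsilon> x - \<omega> \<epsilon> * PZ n \<epsilon> x)"
  "ordo (at_right 0) {0..b} (Suc n) (\<lambda>\<epsilon> x. vr' \<epsilon> x - \<omega> \<epsilon> * PF n \<epsilon> x)"
proof -
  have l: "ordo (at_right 0) {a..0} (Suc n) (\<lambda>\<epsilon> x. (w \<epsilon> x - tL n \<epsilon> * W \<epsilon> x) - (\<omega> \<epsilon> - tL n \<epsilon>) * W \<epsilon> x)"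
    if "ordo (at_right 0) {a..0} (Suc n) (\<lambda>\<epsilon> x. w \<epsilon> x - tL n \<epsilon> * W \<epsilon> x)" "ordo (at_right 0) {a..0} 0 W" for w W
    by (intro ordo_diff that ordo_mult_right[OF \<omega>_tL])
  show "ordo (at_right 0) {a..0} (Suc n) (\<lambda>\<epsilon> x. u \<epsilon> x - \<omega> \<epsilon> * PY n \<epsilon> x)"
    "ordo (at_right 0) {a..0} (Suc n) (\<lambda>\<epsilon> x. vl \<epsilon> x - \<omega> \<epsilon> * PE n \<epsilon> x)"
    using l[OF left_error(1) ordo_P(1)[OF eventually_small]] l[OF left_error(2) ordo_P(2)[OF eventually_small]]
    by (simp_all add: algebra_simps)
  have rr: "ordo (at_right 0) {0..b} (Suc n) (\<lambda>\<epsilon> x. (w \<epsilon> x - tR n \<epsilon> * W \<epsilon> x) - ((\<omega> \<epsilon> - tL n \<epsilon>) - (tR n \<epsilon> - tL n \<epsilon>)) * W \<epsilon> x)"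
    if "ordo (at_right 0) {0..b} (Suc n) (\<lambda>\<epsilon> x. w \<epsilon> x - tR n \<epsilon> * W \<epsilon> x)" "ordo (at_right 0) {0..b} 0 W" for w W
    by (intro ordo_diff that ordo_mult_right \<omega>_tL tR_tL)
  show "ordo (at_right 0) {0..b} (Suc n) (\<lambda>\<epsilon> x. u \<epsilon> x - \<omega> \<epsilon> * PZ n \<epsilon> x)"
    "ordo (at_right 0) {0..b} (Suc n) (\<lambda>\<epsilon> x. vr' \<epsilon> x - \<omega> \<epsilon> * PF n \<epsilon> x)"
    using rr[OF right_error(1) ordo_P(3)[OF eventually_small]] rr[OF right_error(2) ordo_P(4)[OF eventually_small]]
    by (simp_all add: algebra_simps)
qed

text \<open>The sign of \<open>c0\<close>, hence \<open>\<sigma> \<omega>\<close> has a positive limit.\<close>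

definition \<sigma> :: real where "\<sigma> = orientation b Z"

lemma \<sigma>: "\<sigma> * \<sigma> = 1" "\<sigma> * c0 = \<bar>c0\<bar>" "\<bar>\<sigma>\<bar> = 1"
proof -
  have "\<zeta> 0 b / \<kappa> b = deriv_within (Z 0) {0..b} b" using pos\<kappa>[of b] b0 by (simp add: \<zeta>_def)
  then have "\<sigma> = sgn (\<zeta> 0 b / \<kappa> b)" by (simp add: \<sigma>_def orientation_def)
  also have "\<dots> = sgn (\<zeta> 0 b)" using pos\<kappa>[of b] b0 by (simp add: sgn_divide)
  also have "\<dots> = sgn c0"
  proof -
    have "c0 * \<zeta> 0 b > 0" using c0(2) amplitude_pos[of \<mu>] by simp
    then show ?thesis by (auto simp: zero_less_mult_iff)
  qed
  finally have "\<sigma> = sgn c0" .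
  then show "\<sigma> * \<sigma> = 1" "\<sigma> * c0 = \<bar>c0\<bar>" "\<bar>\<sigma>\<bar> = 1" using c0(1) by (auto simp: sgn_if)
qed

text \<open>\<open>N n = 1 / sqrt (In n)\<close> normalises the truncated expansion in the weighted norm.\<close>

definition In :: "nat \<Rightarrow> real \<Rightarrow> real" where
  "In n \<epsilon> = integral {a..0} (\<lambda>x. r x * (PY n \<epsilon> x)\<^sup>2) + integral {0..b} (\<lambda>x. \<rho> x * (PZ n \<epsilon> x)\<^sup>2)"

definition N :: "nat \<Rightarrow> real \<Rightarrow> real" where "N n \<epsilon> = normalizer a b r \<rho> (approx_U Y Z \<epsilon> n)"

lemma N_eq: "N n \<epsilon> = 1 / sqrt (In n \<epsilon>)"
proof -
  have "integral {a..b} (\<lambda>x. glue r \<rho> x * (approx_U Y Z \<epsilon> n x)\<^sup>2) = In n \<epsilon>"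
    unfolding In_def
  proof (rule weighted_integral_split)
    fix x assume "x \<in> {a..0}"
    then show "approx_U Y Z \<epsilon> n x = PY n \<epsilon> x" using P_boundary(3)[where n = n and \<epsilon> = \<epsilon>] by (cases "x = 0") (auto simp: approx_U_def glue_def)
  qed (auto simp: approx_U_def glue_def cont_P)
  then show ?thesis by (simp add: N_def normalizer_def)
qed

text \<open>Expand \<open>0 \<le> \<integral> r (PY - y\<^sub>0)\<^sup>2\<close>: both the projection \<open>\<integral> r PY y\<^sub>0\<close> and \<open>\<integral> r y\<^sub>0\<^sup>2\<close> are \<open>1\<close>. The
  normaliser is therefore bounded for all \<open>\<epsilon>\<close>, without a smallness condition that depends on \<open>n\<close>.\<close>

lemma In_ge_1: "In n \<epsilon> \<ge> 1"
proof -
  have "((\<lambda>x. r x * (PY n \<epsilon> x)\<^sup>2 - 2 * (r x * PY n \<epsilon> x * Y 0 x) + r x * (Y 0 x)\<^sup>2) has_integral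
     (integral {a..0} (\<lambda>x. r x * (PY n \<epsilon> x)\<^sup>2) - 2 * integral {a..0} (\<lambda>x. r x * PY n \<epsilon> x * Y 0 x) + integral {a..0} (\<lambda>x. r x * (Y 0 x)\<^sup>2))) {a..0}"
    by (intro has_integral_add has_integral_diff has_integral_mult_right integrable_integral
        integrable_continuous_interval continuous_intros contr cont_P coeff_continuous)
  moreover have "0 \<le> r x * (PY n \<epsilon> x)\<^sup>2 - 2 * (r x * PY n \<epsilon> x * Y 0 x) + r x * (Y 0 x)\<^sup>2" if "x \<in> {a..0}" for x
  proof -
    have "0 \<le> r x * (PY n \<epsilon> x - Y 0 x)\<^sup>2" using posr[OF that] by simp
    then show ?thesis by (simp add: power2_eq_square algebra_simps)
  qed
  ultimately have "0 \<le> integral {a..0} (\<lambda>x. r x * (PY n \<epsilon> x)\<^sup>2) - 2 * integral {a..0} (\<lambda>x. r x * PY n \<epsilon> x * Y 0 x) + integral {a..0} (\<lambda>x. r x * (Y 0 x)\<^sup>2)"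
    by (rule has_integral_nonneg)
  then have "1 \<le> integral {a..0} (\<lambda>x. r x * (PY n \<epsilon> x)\<^sup>2)"
    using projection_partial_sum[where n = n and \<epsilon> = \<epsilon>] coeff_boundary(7) by simp
  moreover have "0 \<le> integral {0..b} (\<lambda>x. \<rho> x * (PZ n \<epsilon> x)\<^sup>2)"
    using pos\<rho> by (intro integral_nonneg_any) (auto simp: less_imp_le)
  ultimately show ?thesis by (simp add: In_def)
qed

lemma N_bounds: "0 < N n \<epsilon>" "N n \<epsilon> \<le> 1"
proof -
  have "1 \<le> sqrt (In n \<epsilon>)" using In_ge_1[of n \<epsilon>] by simp
  then show "0 < N n \<epsilon>" "N n \<epsilon> \<le> 1" unfolding N_eq by (simp_all add: field_simps)
qed

text \<open>Both sides are weighted integrals of squares, of \<open>u\<close> and of \<open>\<omega>\<close> times the truncated expansion,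
  and \<open>u\<^sup>2 - \<omega>\<^sup>2 PY\<^sup>2\<close> has the factor \<open>u - \<omega> PY\<close> of order \<open>n + 1\<close>.\<close>

lemma normalization_defect: "ordo (at_right 0) S (Suc n) (\<lambda>\<epsilon> _. 1 - (\<omega> \<epsilon>)\<^sup>2 * In n \<epsilon>)"
proof (rule ordo_cong)
  note small = eventually_small
  have w0: "ordo (at_right 0) T 0 (\<lambda>\<epsilon> _. \<omega> \<epsilon>)" for T by (rule ordo_tendsto[OF \<omega>_tendsto])
  have 1: "ordo (at_right 0) {a..0} (Suc n) (\<lambda>\<epsilon> x. r x * ((u \<epsilon> x - \<omega> \<epsilon> * PY n \<epsilon> x) * (u \<epsilon> x + \<omega> \<epsilon> * PY n \<epsilon> x)))"
    by (intro ordo_mult_left[OF weights_ordo(1)] ordo_mult_right[OF eigenfunction_error(1)] ordo_add u_limits ordo_mult_left w0 ordo_P small)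
  have 2: "ordo (at_right 0) {0..b} (Suc n) (\<lambda>\<epsilon> x. \<rho> x * ((u \<epsilon> x - \<omega> \<epsilon> * PZ n \<epsilon> x) * (u \<epsilon> x + \<omega> \<epsilon> * PZ n \<epsilon> x)))"
    by (intro ordo_mult_left[OF weights_ordo(2)] ordo_mult_right[OF eigenfunction_error(3)] ordo_add u_limits ordo_mult_left w0 ordo_P small)
  show "ordo (at_right 0) S (Suc n) (\<lambda>\<epsilon> _. integral {a..0} (\<lambda>x. r x * ((u \<epsilon> x - \<omega> \<epsilon> * PY n \<epsilon> x) * (u \<epsilon> x + \<omega> \<epsilon> * PY n \<epsilon> x)))
      + integral {0..b} (\<lambda>x. \<rho> x * ((u \<epsilon> x - \<omega> \<epsilon> * PZ n \<epsilon> x) * (u \<epsilon> x + \<omega> \<epsilon> * PZ n \<epsilon> x))))"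
    by (intro ordo_add ordo_integral 1 2) (use a0 b0 in auto)
  show "\<forall>\<^sub>F \<epsilon> in at_right 0. \<forall>x\<in>S. integral {a..0} (\<lambda>x. r x * ((u \<epsilon> x - \<omega> \<epsilon> * PY n \<epsilon> x) * (u \<epsilon> x + \<omega> \<epsilon> * PY n \<epsilon> x)))
      + integral {0..b} (\<lambda>x. \<rho> x * ((u \<epsilon> x - \<omega> \<epsilon> * PZ n \<epsilon> x) * (u \<epsilon> x + \<omega> \<epsilon> * PZ n \<epsilon> x))) = 1 - (\<omega> \<epsilon>)\<^sup>2 * In n \<epsilon>"
    using eventually_at_right_less[of "0::real"]
  proof eventually_elim
    case (elim \<epsilon>)
    have split: "integral {c..d} (\<lambda>x. q x * ((w x - t * W x) * (w x + t * W x))) =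
        integral {c..d} (\<lambda>x. q x * (w x)\<^sup>2) - t\<^sup>2 * integral {c..d} (\<lambda>x. q x * (W x)\<^sup>2)"
      if "continuous_on {c..d} q" "continuous_on {c..d} w" "continuous_on {c..d} W" for c d t and q w W :: "real \<Rightarrow> real"
    proof -
      have "((\<lambda>x. q x * (w x)\<^sup>2 - t\<^sup>2 * (q x * (W x)\<^sup>2)) has_integral
        (integral {c..d} (\<lambda>x. q x * (w x)\<^sup>2) - t\<^sup>2 * integral {c..d} (\<lambda>x. q x * (W x)\<^sup>2))) {c..d}"
        by (intro has_integral_diff has_integral_mult_right integrable_integral integrable_continuous_interval continuous_intros that)
      moreover have "(\<lambda>x. q x * (w x)\<^sup>2 - t\<^sup>2 * (q x * (W x)\<^sup>2)) = (\<lambda>x. q x * ((w x - t * W x) * (w x + t * W x)))"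
        by (rule ext) (simp add: power2_eq_square algebra_simps)
      ultimately show ?thesis by (simp add: integral_unique)
    qed
    note s = sys_u[OF elim]
    show ?case
      unfolding split[OF contr sl_sys_continuous(1)[OF s(1)] cont_P(1)] split[OF cont\<rho> sl_sys_continuous(1)[OF s(2)] cont_P(3)]
      using s(6) by (simp add: In_def algebra_simps)
  qed
qed

lemma normalizer_error: "ordo (at_right 0) S (Suc n) (\<lambda>\<epsilon> _. \<sigma> * \<omega> \<epsilon> - N n \<epsilon>)"
proof -
  obtain C where C: "\<forall>\<^sub>F \<epsilon> in at_right 0. \<forall>x\<in>S. \<bar>1 - (\<omega> \<epsilon>)\<^sup>2 * In n \<epsilon>\<bar> \<le> C * \<bar>\<epsilon>\<bar> ^ Suc n"
    by (rule ordoE[OF normalization_defect])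
  have "((\<lambda>\<epsilon>. \<sigma> * \<omega> \<epsilon>) \<longlongrightarrow> \<sigma> * c0) (at_right 0)" by (intro tendsto_intros \<omega>_tendsto)
  then have "\<forall>\<^sub>F \<epsilon> in at_right 0. 0 < \<sigma> * \<omega> \<epsilon>" by (rule order_tendstoD) (use \<sigma>(2) c0(1) in simp)
  with C have "\<forall>\<^sub>F \<epsilon> in at_right 0. \<forall>x\<in>S. \<bar>\<sigma> * \<omega> \<epsilon> - N n \<epsilon>\<bar> \<le> C * \<bar>\<epsilon>\<bar> ^ Suc n"
  proof eventually_elim
    case (elim \<epsilon>)
    define \<theta> where "\<theta> = \<sigma> * \<omega> \<epsilon>"
    define S where "S = sqrt (In n \<epsilon>)"
    have \<theta>: "\<theta> > 0" "\<theta>\<^sup>2 = (\<omega> \<epsilon>)\<^sup>2" using elim(2) \<sigma>(1) by (auto simp: \<theta>_def power2_eq_square mult_ac)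
    have S: "S \<ge> 1" "S\<^sup>2 = In n \<epsilon>" using In_ge_1[of n \<epsilon>] by (auto simp: S_def)
    \<comment> \<open>As \<open>S \<ge> 1\<close> and \<open>\<theta> S + 1 \<ge> 1\<close>, the error is at most \<open>\<bar>\<theta>\<^sup>2 S\<^sup>2 - 1\<bar>\<close>, the normalisation defect.\<close>
    have "\<theta> - N n \<epsilon> = (\<theta> * S - 1) / S" using S(1) by (simp add: N_eq S_def[symmetric] field_simps)
    then have "\<bar>\<theta> - N n \<epsilon>\<bar> = \<bar>\<theta> * S - 1\<bar> / S" using S(1) by (simp add: abs_divide)
    also have "\<dots> \<le> \<bar>\<theta> * S - 1\<bar>" using S(1) by (simp add: divide_le_eq mult_right_le_one_le mult_le_cancel_left1)
    also have "\<dots> \<le> \<bar>\<theta> * S - 1\<bar> * (\<theta> * S + 1)"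
      using \<theta>(1) S(1) by (simp add: mult_le_cancel_left1)
    also have "\<dots> = \<bar>(\<theta> * S - 1) * (\<theta> * S + 1)\<bar>" using \<theta>(1) S(1) by (simp add: abs_mult)
    also have "(\<theta> * S - 1) * (\<theta> * S + 1) = - (1 - (\<omega> \<epsilon>)\<^sup>2 * In n \<epsilon>)"
      unfolding \<theta>(2)[symmetric] S(2)[symmetric] by (simp add: power2_eq_square algebra_simps)
    finally have "\<bar>\<theta> - N n \<epsilon>\<bar> \<le> \<bar>1 - (\<omega> \<epsilon>)\<^sup>2 * In n \<epsilon>\<bar>" by simp
    then show ?case using elim(1) by (auto simp: \<theta>_def intro: order_trans)
  qed
  then show ?thesis by (rule ordoI)
qed

lemma H1_error:
  assumes F: "\<forall>\<^sub>F \<epsilon> in F. \<epsilon> > 0"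
    and o: "ordo F {a..0} m (\<lambda>\<epsilon> x. u \<epsilon> x - t \<epsilon> * PY n \<epsilon> x)" "ordo F {a..0} m (\<lambda>\<epsilon> x. vl \<epsilon> x - t \<epsilon> * PE n \<epsilon> x)"
     "ordo F {0..b} m (\<lambda>\<epsilon> x. u \<epsilon> x - t \<epsilon> * PZ n \<epsilon> x)" "ordo F {0..b} m (\<lambda>\<epsilon> x. vr' \<epsilon> x - t \<epsilon> * PF n \<epsilon> x)"
  shows "ordo F T m (\<lambda>\<epsilon> _. H1_norm a b (\<lambda>x. u \<epsilon> x - t \<epsilon> * approx_U Y Z \<epsilon> n x))"
    "ordo F T m (\<lambda>\<epsilon> _. H1_norm a 0 (\<lambda>x. u \<epsilon> x - t \<epsilon> * PY n \<epsilon> x))"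
    "ordo F T m (\<lambda>\<epsilon> _. H1_norm 0 b (\<lambda>x. u \<epsilon> x - t \<epsilon> * PZ n \<epsilon> x))"
proof -
  have s1: "\<forall>\<^sub>F \<epsilon> in F. sl_sys k {a..0} (\<lambda>x. - L \<epsilon> * r x * u \<epsilon> x - t \<epsilon> * (- r x * (Ls n \<epsilon> * PY n \<epsilon> x - GY n \<epsilon> x)))
      (\<lambda>x. u \<epsilon> x - t \<epsilon> * PY n \<epsilon> x) (\<lambda>x. vl \<epsilon> x - t \<epsilon> * PE n \<epsilon> x)"
    using F by eventually_elim (intro sl_sys_diff sys_u sys_PY)
  have s2: "\<forall>\<^sub>F \<epsilon> in F. sl_sys \<kappa> {0..b} (\<lambda>x. - L \<epsilon> * \<rho> x * u \<epsilon> x - t \<epsilon> * (- \<rho> x * (Ls n \<epsilon> * PZ n \<epsilon> x - GZ n \<epsilon> x)))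
      (\<lambda>x. u \<epsilon> x - t \<epsilon> * PZ n \<epsilon> x) (\<lambda>x. vr' \<epsilon> x - t \<epsilon> * PF n \<epsilon> x)"
    using F by eventually_elim (intro sl_sys_diff sys_u sys_PZ)
  have "(\<lambda>x. u \<epsilon> x - t \<epsilon> * approx_U Y Z \<epsilon> n x) = glue (\<lambda>x. u \<epsilon> x - t \<epsilon> * PY n \<epsilon> x) (\<lambda>x. u \<epsilon> x - t \<epsilon> * PZ n \<epsilon> x)" for \<epsilon>
    by (rule ext) (simp add: approx_U_def glue_def)
  then show "ordo F T m (\<lambda>\<epsilon> _. H1_norm a b (\<lambda>x. u \<epsilon> x - t \<epsilon> * approx_U Y Z \<epsilon> n x))"
    "ordo F T m (\<lambda>\<epsilon> _. H1_norm a 0 (\<lambda>x. u \<epsilon> x - t \<epsilon> * PY n \<epsilon> x))"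
    "ordo F T m (\<lambda>\<epsilon> _. H1_norm 0 b (\<lambda>x. u \<epsilon> x - t \<epsilon> * PZ n \<epsilon> x))"
    using ordo_H1_norm[OF s1 s2 o] by simp_all
qed

text \<open>The estimates are claimed on one interval of parameters for all orders \<open>n\<close>. The finitely many
  quantities that enter all of them are bounded on such an interval.\<close>

lemma uniform_window:
  obtains \<epsilon>0 where "0 < \<epsilon>0" "\<epsilon>0 \<le> 1"
    "ordo (principal {0<..<\<epsilon>0}) {0} 0 (\<lambda>\<epsilon> _. L \<epsilon>)"
    "ordo (principal {0<..<\<epsilon>0}) {a..0} 0 u" "ordo (principal {0<..<\<epsilon>0}) {a..0} 0 vl"
    "ordo (principal {0<..<\<epsilon>0}) {0..b} 0 u" "ordo (principal {0<..<\<epsilon>0}) {0..b} 0 vr'"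
proof -
  obtain d1 where d1: "d1 > 0" "\<And>\<delta>. \<delta> \<le> d1 \<Longrightarrow> ordo (principal {0<..<\<delta>}) {0} 0 (\<lambda>\<epsilon> _. L \<epsilon>)"
    using ordo_localize[OF ordo_tendsto[OF Lim]] by metis
  obtain d2 where d2: "d2 > 0" "\<And>\<delta>. \<delta> \<le> d2 \<Longrightarrow> ordo (principal {0<..<\<delta>}) {a..0} 0 u"
    using ordo_localize[OF u_limits(5)] by metis
  obtain d3 where d3: "d3 > 0" "\<And>\<delta>. \<delta> \<le> d3 \<Longrightarrow> ordo (principal {0<..<\<delta>}) {a..0} 0 vl"
    using ordo_localize[OF u_limits(6)] by metis
  obtain d4 where d4: "d4 > 0" "\<And>\<delta>. \<delta> \<le> d4 \<Longrightarrow> ordo (principal {0<..<\<delta>}) {0..b} 0 u"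
    using ordo_localize[OF u_limits(7)] by metis
  obtain d5 where d5: "d5 > 0" "\<And>\<delta>. \<delta> \<le> d5 \<Longrightarrow> ordo (principal {0<..<\<delta>}) {0..b} 0 vr'"
    using ordo_localize[OF u_limits(8)] by metis
  define \<epsilon>0 where "\<epsilon>0 = min 1 (min d1 (min d2 (min d3 (min d4 d5))))"
  show thesis
  proof (rule that[of \<epsilon>0])
    show "0 < \<epsilon>0" "\<epsilon>0 \<le> 1" using d1 d2 d3 d4 d5 by (auto simp: \<epsilon>0_def)
    show "ordo (principal {0<..<\<epsilon>0}) {0} 0 (\<lambda>\<epsilon> _. L \<epsilon>)" by (rule d1(2)) (simp add: \<epsilon>0_def)
    show "ordo (principal {0<..<\<epsilon>0}) {a..0} 0 u" by (rule d2(2)) (simp add: \<epsilon>0_def)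
    show "ordo (principal {0<..<\<epsilon>0}) {a..0} 0 vl" by (rule d3(2)) (simp add: \<epsilon>0_def)
    show "ordo (principal {0<..<\<epsilon>0}) {0..b} 0 u" by (rule d4(2)) (simp add: \<epsilon>0_def)
    show "ordo (principal {0<..<\<epsilon>0}) {0..b} 0 vr'" by (rule d5(2)) (simp add: \<epsilon>0_def)
  qed
qed

text \<open>The estimates of each order hold for small \<open>\<epsilon>\<close>; boundedness on the common interval extends them
  to it.\<close>

theorem expansion_estimates:
  obtains \<epsilon>0 where "\<epsilon>0 > 0"
    "\<And>n. \<exists>c. \<forall>\<epsilon>. 0 < \<epsilon> \<and> \<epsilon> < \<epsilon>0 \<longrightarrow> \<bar>L \<epsilon> - Ls n \<epsilon>\<bar> \<le> c * \<epsilon> ^ (n + 1)"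
    "\<And>n. \<exists>C. \<forall>\<epsilon>. 0 < \<epsilon> \<and> \<epsilon> < \<epsilon>0 \<longrightarrow> H1_norm a b (\<lambda>x. u \<epsilon> x - \<omega> \<epsilon> * approx_U Y Z \<epsilon> n x) \<le> C * \<epsilon> ^ (n + 1)"
    "\<And>n. \<exists>C. \<forall>\<epsilon>. 0 < \<epsilon> \<and> \<epsilon> < \<epsilon>0 \<longrightarrow> H1_norm a b (\<lambda>x. u \<epsilon> x - \<sigma> * N n \<epsilon> * approx_U Y Z \<epsilon> n x) \<le> C * \<epsilon> ^ (n + 1)"
proof -
  obtain \<epsilon>0 where \<epsilon>0: "0 < \<epsilon>0" "\<epsilon>0 \<le> 1"
    and bL: "ordo (principal {0<..<\<epsilon>0}) {0} 0 (\<lambda>\<epsilon> _. L \<epsilon>)"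
    and bu: "ordo (principal {0<..<\<epsilon>0}) {a..0} 0 u" "ordo (principal {0<..<\<epsilon>0}) {a..0} 0 vl"
    "ordo (principal {0<..<\<epsilon>0}) {0..b} 0 u" "ordo (principal {0<..<\<epsilon>0}) {0..b} 0 vr'"
    by (rule uniform_window)
  define F where "F = principal {0<..<\<epsilon>0}"
  have small: "\<forall>\<^sub>F \<epsilon> in F. \<bar>\<epsilon>\<bar> \<le> 1" and pos: "\<forall>\<^sub>F \<epsilon> in F. \<epsilon> > 0"
    using \<epsilon>0 by (auto simp: F_def eventually_principal)
  note bL = bL[folded F_def] and bu = bu[folded F_def]
  note loc = ordo_principal[of _ _ _ \<epsilon>0, folded F_def]
  have conv: "\<exists>c. \<forall>\<epsilon>. 0 < \<epsilon> \<and> \<epsilon> < \<epsilon>0 \<longrightarrow> f \<epsilon> \<le> c * \<epsilon> ^ (n + 1)" if f: "ordo F {0} (Suc n) (\<lambda>\<epsilon> _. f \<epsilon>)" for f n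
  proof -
    obtain C where "\<forall>\<^sub>F \<epsilon> in F. \<forall>x\<in>{0::real}. \<bar>f \<epsilon>\<bar> \<le> C * \<bar>\<epsilon>\<bar> ^ Suc n" by (rule ordoE[OF f])
    then have "\<forall>\<epsilon>\<in>{0<..<\<epsilon>0}. \<bar>f \<epsilon>\<bar> \<le> C * \<bar>\<epsilon>\<bar> ^ Suc n" by (simp add: F_def eventually_principal del: power_Suc)
    then show ?thesis by (intro exI[of _ C]) (auto dest!: bspec simp del: power_Suc)
  qed
  have w0: "ordo F S 0 (\<lambda>\<epsilon> _. \<omega> \<epsilon>)" for S
    unfolding \<omega>_def
    by (intro ordo_integral ordo_mult_right ordo_mult_left weights_ordo bu ordo_continuous coeff_continuous) (use a0 in auto)
  have err: "ordo F {a..0} (Suc n) (\<lambda>\<epsilon> x. u \<epsilon> x - \<omega> \<epsilon> * PY n \<epsilon> x)"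
    "ordo F {a..0} (Suc n) (\<lambda>\<epsilon> x. vl \<epsilon> x - \<omega> \<epsilon> * PE n \<epsilon> x)"
    "ordo F {0..b} (Suc n) (\<lambda>\<epsilon> x. u \<epsilon> x - \<omega> \<epsilon> * PZ n \<epsilon> x)"
    "ordo F {0..b} (Suc n) (\<lambda>\<epsilon> x. vr' \<epsilon> x - \<omega> \<epsilon> * PF n \<epsilon> x)" for n
    by (rule loc[OF eigenfunction_error(1)] loc[OF eigenfunction_error(2)] loc[OF eigenfunction_error(3)] loc[OF eigenfunction_error(4)],
        intro ordo_diff bu ordo_mult_left w0 ordo_P small)+
  have N0: "ordo F S 0 (\<lambda>\<epsilon> _. N n \<epsilon>)" for S n
    by (rule ordoI[where C = 1]) (use N_bounds in \<open>auto simp: less_imp_le\<close>)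
  have Nerr: "ordo F S (Suc n) (\<lambda>\<epsilon> _. \<sigma> * \<omega> \<epsilon> - N n \<epsilon>)" for S n
    by (rule loc[OF normalizer_error]) (intro ordo_diff ordo_mult_left ordo_const w0 N0)
  have swap: "ordo F S (Suc n) (\<lambda>\<epsilon> x. w \<epsilon> x - \<sigma> * N n \<epsilon> * W \<epsilon> x)"
    if "ordo F S (Suc n) (\<lambda>\<epsilon> x. w \<epsilon> x - \<omega> \<epsilon> * W \<epsilon> x)" "ordo F S 0 W" for S n w W
  proof -
    have "ordo F S (Suc n) (\<lambda>\<epsilon> x. (w \<epsilon> x - \<omega> \<epsilon> * W \<epsilon> x) + (\<sigma> * (\<sigma> * \<omega> \<epsilon> - N n \<epsilon>)) * W \<epsilon> x)"
      by (intro ordo_add that ordo_mult_right ordo_mult_left[OF ordo_const] Nerr)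
    moreover have "(w \<epsilon> x - \<omega> \<epsilon> * W \<epsilon> x) + (\<sigma> * (\<sigma> * \<omega> \<epsilon> - N n \<epsilon>)) * W \<epsilon> x = w \<epsilon> x - \<sigma> * N n \<epsilon> * W \<epsilon> x" for \<epsilon> x
    proof -
      have "\<sigma> * (\<sigma> * \<omega> \<epsilon>) = \<omega> \<epsilon>" using \<sigma>(1) by (simp add: mult.assoc[symmetric])
      then show ?thesis by (simp add: algebra_simps)
    qed
    ultimately show ?thesis by simp
  qed
  have eval: "ordo F {0} (Suc n) (\<lambda>\<epsilon> _. \<bar>L \<epsilon> - Ls n \<epsilon>\<bar>)" for n
  proof -
    have "ordo F {0} (Suc n) (\<lambda>\<epsilon> _. L \<epsilon> - Ls n \<epsilon>)"
      by (rule loc[OF eigenvalue_expansion], unfold Ls_def)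
         (intro ordo_diff bL ordo_sum ordo_mult_left ordo_param_power_0 small ordo_const finite_atMost)
    then show ?thesis by (simp add: ordo_def)
  qed
  show thesis
  proof (rule that[OF \<epsilon>0(1)])
    fix n
    show "\<exists>c. \<forall>\<epsilon>. 0 < \<epsilon> \<and> \<epsilon> < \<epsilon>0 \<longrightarrow> \<bar>L \<epsilon> - Ls n \<epsilon>\<bar> \<le> c * \<epsilon> ^ (n + 1)"
      by (rule conv[OF eval])
    show "\<exists>C. \<forall>\<epsilon>. 0 < \<epsilon> \<and> \<epsilon> < \<epsilon>0 \<longrightarrow> H1_norm a b (\<lambda>x. u \<epsilon> x - \<omega> \<epsilon> * approx_U Y Z \<epsilon> n x) \<le> C * \<epsilon> ^ (n + 1)"
      by (rule conv[OF H1_error(1)[OF pos err]])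
    show "\<exists>C. \<forall>\<epsilon>. 0 < \<epsilon> \<and> \<epsilon> < \<epsilon>0 \<longrightarrow> H1_norm a b (\<lambda>x. u \<epsilon> x - \<sigma> * N n \<epsilon> * approx_U Y Z \<epsilon> n x) \<le> C * \<epsilon> ^ (n + 1)"
      by (rule conv[OF H1_error(1)[OF pos]]) (intro swap err ordo_P small)+
  qed
qed

lemma N_tendsto: "(N n \<longlongrightarrow> \<bar>c0\<bar>) (at_right 0)"
proof -
  have "(\<lambda>\<epsilon>. \<sigma> * \<omega> \<epsilon> - N n \<epsilon>) \<in> o[at_right 0](\<lambda>\<epsilon>. \<epsilon> ^ n)"
    by (rule ordo_imp_smallo[OF normalizer_error[of "{0}"]]) simp
  then have "((\<lambda>\<epsilon>. (\<sigma> * \<omega> \<epsilon> - N n \<epsilon>) / \<epsilon> ^ n) \<longlongrightarrow> 0) (at_right 0)" by (rule smalloD_tendsto)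
  moreover have "((\<lambda>\<epsilon>::real. \<epsilon> ^ n) \<longlongrightarrow> 0 ^ n) (at_right 0)" by (intro tendsto_intros)
  ultimately have "((\<lambda>\<epsilon>. (\<sigma> * \<omega> \<epsilon> - N n \<epsilon>) / \<epsilon> ^ n * \<epsilon> ^ n) \<longlongrightarrow> 0 * 0 ^ n) (at_right 0)" by (rule tendsto_mult)
  then have "((\<lambda>\<epsilon>. \<sigma> * \<omega> \<epsilon> - N n \<epsilon>) \<longlongrightarrow> 0) (at_right 0)"
    by (simp, elim Lim_transform_eventually)
       (use eventually_at_right_less[of "0::real"] in eventually_elim, simp)
  moreover have "((\<lambda>\<epsilon>. \<sigma> * \<omega> \<epsilon>) \<longlongrightarrow> \<sigma> * c0) (at_right 0)" by (intro tendsto_intros \<omega>_tendsto)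
  ultimately have "((\<lambda>\<epsilon>. \<sigma> * \<omega> \<epsilon> - (\<sigma> * \<omega> \<epsilon> - N n \<epsilon>)) \<longlongrightarrow> \<sigma> * c0 - 0) (at_right 0)" by (intro tendsto_diff)
  then show ?thesis by (simp add: \<sigma>(2))
qed

end

section \<open>Assembling the limit and the expansions\<close>

lemma smooth_on_C1:
  assumes "smooth_on S f"
  obtains f' where "\<And>x. x \<in> S \<Longrightarrow> (f has_real_derivative f' x) (at x within S)" "continuous_on S f'"
proof -
  obtain d :: "nat \<Rightarrow> real \<Rightarrow> real" where d0: "\<And>x. x \<in> S \<Longrightarrow> d 0 x = f x"
    and d: "\<And>n x. x \<in> S \<Longrightarrow> (d n has_real_derivative d (Suc n) x) (at x within S)"
    using assms unfolding smooth_on_def by blast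
  show thesis
  proof (rule that[of "d 1"])
    show "(f has_real_derivative d 1 x) (at x within S)" if "x \<in> S" for x
      using DERIV_transform_on[OF d[OF that, of 0] that] d0 by simp
    show "continuous_on S (d 1)" by (rule DERIV_continuous_on[OF d])
  qed
qed

context transmission_C1 begin

text \<open>A nonzero solution of the Dirichlet problem destroys uniqueness for the right-hand side \<open>0\<close>.\<close>

lemma E2_imp_spectrum_A2:
  assumes E: "E2 c"
  shows "complex_of_real c \<in> spectrum_A2 b \<kappa> \<rho>"
proof -
  have dom: "w \<in> dom_A2 b" "AE x in lebesgue_on {0..b}. sl_expr \<kappa> \<rho> {0..b} w x - of_real c * w x = 0"
    if "sl_solution \<kappa> {0..b} (\<lambda>x. - (of_real (\<rho> x) * (of_real c * w x))) w" "w 0 = 0" "w b = 0" "\<And>x. x \<notin> {0..b} \<Longrightarrow> w x = 0"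
    for w :: "real \<Rightarrow> complex"
  proof -
    have s: "sl_solution \<kappa> {0..b} (\<lambda>x. - (of_real (\<rho> x) * (of_real c * w x + 0))) w" using that(1) by simp
    have c: "continuous_on {0..b} (\<lambda>_. 0 :: complex)" by simp
    note e = classical_imp_H2_weak_solution[OF b0 d\<kappa> cont\<kappa>' cont\<rho> pos\<kappa> pos\<rho> c s]
    show "w \<in> dom_A2 b" using e(1) that by (simp add: dom_A2_def)
    show "AE x in lebesgue_on {0..b}. sl_expr \<kappa> \<rho> {0..b} w x - of_real c * w x = 0" using e(2) by simp
  qed
  have Z: "Z c 0 = 0" "Z c b = 0" "\<And>x. x \<notin> {0..b} \<Longrightarrow> Z c x = 0"
    using E b0 by (auto simp: Z_def extend0_def E2_def ur_def)
  define P where "P = (\<lambda>w. w \<in> dom_A2 b \<and> (AE x in lebesgue_on {0..b}. sl_expr \<kappa> \<rho> {0..b} w x - of_real c * w x = 0))"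
  have PZ: "P (Z c)" unfolding P_def by (intro conjI dom Z_solution Z)
  have P0: "P (\<lambda>_. 0)"
    unfolding P_def using sl_solution_zero(2)[OF b0, of \<kappa>, where 'a = complex] by (intro conjI dom) simp_all
  have z: "(\<lambda>_. 0 :: complex) \<in> L2w \<rho> {0..b}" by (simp add: L2w_def integrable_0)
  have nex: "\<not> (\<exists>!w. P w)"
  proof
    assume "\<exists>!w. P w"
    then obtain w0 where w0: "\<forall>w. P w \<longrightarrow> w = w0" by (elim ex1E)
    have "Z c = w0" "(\<lambda>_. 0) = w0" using w0[THEN spec, THEN mp, OF PZ] w0[THEN spec, THEN mp, OF P0] .
    then show False using YZ_nonzero(2)[of c] by simp
  qed
  show ?thesis
  proof (rule ccontr)
    assume "complex_of_real c \<notin> spectrum_A2 b \<kappa> \<rho>"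
    then obtain C where C: "\<forall>f\<in>L2w \<rho> {0..b}.
       (\<exists>!w. w \<in> dom_A2 b \<and> (AE x in lebesgue_on {0..b}. sl_expr \<kappa> \<rho> {0..b} w x - of_real c * w x = f x)) \<and>
       (\<forall>w\<in>dom_A2 b. (AE x in lebesgue_on {0..b}. sl_expr \<kappa> \<rho> {0..b} w x - of_real c * w x = f x) \<longrightarrow>
          L2w_norm \<rho> {0..b} w \<le> C * L2w_norm \<rho> {0..b} f)"
      unfolding spectrum_A2_def spectrum_L2_def mem_Collect_eq not_not by (elim exE)
    from conjunct1[OF bspec[OF C z]] show False using nex unfolding P_def by (rule notE[rotated])
  qed
qed

end

context expansion begin

lemma expansion_conclusion:
  assumes lam: "\<And>\<epsilon>. \<epsilon> > 0 \<Longrightarrow> lam \<epsilon> = \<epsilon> * L \<epsilon>"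
  shows "(\<forall>n. (\<lambda>\<epsilon>. lam \<epsilon> - \<epsilon> * (\<mu> + (\<Sum>i=1..n. \<epsilon> ^ i * \<nu> i))) \<in> o[at_right 0](\<lambda>\<epsilon>. \<epsilon> ^ (n + 1))) \<and>
        (\<exists>\<theta> Lc \<epsilon>0. (\<theta> \<longlongrightarrow> Lc) (at_right 0) \<and> Lc > 0 \<and> \<epsilon>0 > 0 \<and>
          (\<forall>n.
            (\<lambda>\<epsilon>. H1_norm a 0 (\<lambda>x. u \<epsilon> x - orientation b Z * \<theta> \<epsilon> * partial_sum Y \<epsilon> n x))
              \<in> o[at_right 0](\<lambda>\<epsilon>. \<epsilon> ^ n) \<and>
            (\<lambda>\<epsilon>. H1_norm 0 b (\<lambda>x. u \<epsilon> x - orientation b Z * \<theta> \<epsilon> * partial_sum Z \<epsilon> n x))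
              \<in> o[at_right 0](\<lambda>\<epsilon>. \<epsilon> ^ n) \<and>
            (\<exists>c. \<forall>\<epsilon>. 0 < \<epsilon> \<and> \<epsilon> < \<epsilon>0 \<longrightarrow>
              \<bar>lam \<epsilon> / \<epsilon> - (\<mu> + (\<Sum>i=1..n. \<epsilon> ^ i * \<nu> i))\<bar> \<le> c * \<epsilon> ^ (n + 1)) \<and>
            (\<exists>C. \<forall>\<epsilon>. 0 < \<epsilon> \<and> \<epsilon> < \<epsilon>0 \<longrightarrow>
              H1_norm a b (\<lambda>x. u \<epsilon> x - orientation b Z * \<theta> \<epsilon> * approx_U Y Z \<epsilon> n x)
                \<le> C * \<epsilon> ^ (n + 1)) \<and>
            ((\<lambda>\<epsilon>. normalizer a b r \<rho> (approx_U Y Z \<epsilon> n)) \<longlongrightarrow> Lc) (at_right 0) \<and>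
            (\<exists>C. \<forall>\<epsilon>. 0 < \<epsilon> \<and> \<epsilon> < \<epsilon>0 \<longrightarrow>
              H1_norm a b (\<lambda>x. u \<epsilon> x - orientation b Z * normalizer a b r \<rho> (approx_U Y Z \<epsilon> n)
                                            * approx_U Y Z \<epsilon> n x)
                \<le> C * \<epsilon> ^ (n + 1))))"
proof (intro conjI allI)
  fix n
  have "ordo (at_right 0) {0} (Suc (n + 1)) (\<lambda>\<epsilon> _. lam \<epsilon> - \<epsilon> * Ls n \<epsilon>)"
  proof (rule ordo_cong)
    show "ordo (at_right 0) {0} (Suc (n + 1)) (\<lambda>\<epsilon> _. \<epsilon> ^ 1 * (L \<epsilon> - Ls n \<epsilon>))"
      using ordo_mult[OF ordo_param_power[of _ _ 1] eigenvalue_expansion[of "{0}" n]] by (simp del: power_Suc)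
    show "\<forall>\<^sub>F \<epsilon> in at_right 0. \<forall>x\<in>{0::real}. \<epsilon> ^ 1 * (L \<epsilon> - Ls n \<epsilon>) = lam \<epsilon> - \<epsilon> * Ls n \<epsilon>"
      using eventually_at_right_less[of "0::real"] by eventually_elim (simp add: lam algebra_simps)
  qed
  from ordo_imp_smallo[OF this]
  show "(\<lambda>\<epsilon>. lam \<epsilon> - \<epsilon> * (\<mu> + (\<Sum>i=1..n. \<epsilon> ^ i * \<nu> i))) \<in> o[at_right 0](\<lambda>\<epsilon>. \<epsilon> ^ (n + 1))"
    by (simp add: Ls_eq)
next
  obtain \<epsilon>0 where \<epsilon>0: "\<epsilon>0 > 0"
    and e1: "\<And>n. \<exists>c. \<forall>\<epsilon>. 0 < \<epsilon> \<and> \<epsilon> < \<epsilon>0 \<longrightarrow> \<bar>L \<epsilon> - Ls n \<epsilon>\<bar> \<le> c * \<epsilon> ^ (n + 1)"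
    and e2: "\<And>n. \<exists>C. \<forall>\<epsilon>. 0 < \<epsilon> \<and> \<epsilon> < \<epsilon>0 \<longrightarrow> H1_norm a b (\<lambda>x. u \<epsilon> x - \<omega> \<epsilon> * approx_U Y Z \<epsilon> n x) \<le> C * \<epsilon> ^ (n + 1)"
    and e3: "\<And>n. \<exists>C. \<forall>\<epsilon>. 0 < \<epsilon> \<and> \<epsilon> < \<epsilon>0 \<longrightarrow> H1_norm a b (\<lambda>x. u \<epsilon> x - \<sigma> * N n \<epsilon> * approx_U Y Z \<epsilon> n x) \<le> C * \<epsilon> ^ (n + 1)"
    by (rule expansion_estimates) (rule that; assumption)
  have so: "\<sigma> * (\<sigma> * \<omega> \<epsilon>) = \<omega> \<epsilon>" for \<epsilon> using \<sigma>(1) by (simp add: mult.assoc[symmetric])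
  show "\<exists>\<theta> Lc \<epsilon>0. (\<theta> \<longlongrightarrow> Lc) (at_right 0) \<and> Lc > 0 \<and> \<epsilon>0 > 0 \<and>
          (\<forall>n.
            (\<lambda>\<epsilon>. H1_norm a 0 (\<lambda>x. u \<epsilon> x - orientation b Z * \<theta> \<epsilon> * partial_sum Y \<epsilon> n x))
              \<in> o[at_right 0](\<lambda>\<epsilon>. \<epsilon> ^ n) \<and>
            (\<lambda>\<epsilon>. H1_norm 0 b (\<lambda>x. u \<epsilon> x - orientation b Z * \<theta> \<epsilon> * partial_sum Z \<epsilon> n x))
              \<in> o[at_right 0](\<lambda>\<epsilon>. \<epsilon> ^ n) \<and>
            (\<exists>c. \<forall>\<epsilon>. 0 < \<epsilon> \<and> \<epsilon> < \<epsilon>0 \<longrightarrow>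
              \<bar>lam \<epsilon> / \<epsilon> - (\<mu> + (\<Sum>i=1..n. \<epsilon> ^ i * \<nu> i))\<bar> \<le> c * \<epsilon> ^ (n + 1)) \<and>
            (\<exists>C. \<forall>\<epsilon>. 0 < \<epsilon> \<and> \<epsilon> < \<epsilon>0 \<longrightarrow>
              H1_norm a b (\<lambda>x. u \<epsilon> x - orientation b Z * \<theta> \<epsilon> * approx_U Y Z \<epsilon> n x)
                \<le> C * \<epsilon> ^ (n + 1)) \<and>
            ((\<lambda>\<epsilon>. normalizer a b r \<rho> (approx_U Y Z \<epsilon> n)) \<longlongrightarrow> Lc) (at_right 0) \<and>
            (\<exists>C. \<forall>\<epsilon>. 0 < \<epsilon> \<and> \<epsilon> < \<epsilon>0 \<longrightarrow>
              H1_norm a b (\<lambda>x. u \<epsilon> x - orientation b Z * normalizer a b r \<rho> (approx_U Y Z \<epsilon> n)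
                                            * approx_U Y Z \<epsilon> n x)
                \<le> C * \<epsilon> ^ (n + 1)))"
    unfolding \<sigma>_def[symmetric] N_def[symmetric]
  proof (rule exI[of _ "\<lambda>\<epsilon>. \<sigma> * \<omega> \<epsilon>"], rule exI[of _ "\<bar>c0\<bar>"], rule exI[of _ \<epsilon>0], intro conjI allI, unfold so)
    have "((\<lambda>\<epsilon>. \<sigma> * \<omega> \<epsilon>) \<longlongrightarrow> \<sigma> * c0) (at_right 0)" by (intro tendsto_intros \<omega>_tendsto)
    then show "((\<lambda>\<epsilon>. \<sigma> * \<omega> \<epsilon>) \<longlongrightarrow> \<bar>c0\<bar>) (at_right 0)" by (simp add: \<sigma>(2))
    show "0 < \<bar>c0\<bar>" "0 < \<epsilon>0" using c0(1) \<epsilon>0 by auto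
    fix n
    have pos: "\<forall>\<^sub>F \<epsilon>::real in at_right 0. \<epsilon> > 0" by (rule eventually_at_right_less)
    note h = H1_error(2,3)[OF pos eigenfunction_error, of "{0}"]
    show "(\<lambda>\<epsilon>. H1_norm a 0 (\<lambda>x. u \<epsilon> x - \<omega> \<epsilon> * PY n \<epsilon> x)) \<in> o[at_right 0](\<lambda>\<epsilon>. \<epsilon> ^ n)"
      by (rule ordo_imp_smallo[OF h(1)]) simp
    show "(\<lambda>\<epsilon>. H1_norm 0 b (\<lambda>x. u \<epsilon> x - \<omega> \<epsilon> * PZ n \<epsilon> x)) \<in> o[at_right 0](\<lambda>\<epsilon>. \<epsilon> ^ n)"
      by (rule ordo_imp_smallo[OF h(2)]) simp
    obtain c where "\<forall>\<epsilon>. 0 < \<epsilon> \<and> \<epsilon> < \<epsilon>0 \<longrightarrow> \<bar>L \<epsilon> - Ls n \<epsilon>\<bar> \<le> c * \<epsilon> ^ (n + 1)" using e1[of n] by (elim exE)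
    then show "\<exists>c. \<forall>\<epsilon>. 0 < \<epsilon> \<and> \<epsilon> < \<epsilon>0 \<longrightarrow> \<bar>lam \<epsilon> / \<epsilon> - (\<mu> + (\<Sum>i=1..n. \<epsilon> ^ i * \<nu> i))\<bar> \<le> c * \<epsilon> ^ (n + 1)"
      by (intro exI[of _ c]) (simp add: lam Ls_eq)
    show "\<exists>C. \<forall>\<epsilon>. 0 < \<epsilon> \<and> \<epsilon> < \<epsilon>0 \<longrightarrow> H1_norm a b (\<lambda>x. u \<epsilon> x - \<omega> \<epsilon> * approx_U Y Z \<epsilon> n x) \<le> C * \<epsilon> ^ (n + 1)"
      by (rule e2)
    show "(N n \<longlongrightarrow> \<bar>c0\<bar>) (at_right 0)" by (rule N_tendsto)
    show "\<exists>C. \<forall>\<epsilon>. 0 < \<epsilon> \<and> \<epsilon> < \<epsilon>0 \<longrightarrow> H1_norm a b (\<lambda>x. u \<epsilon> x - \<sigma> * N n \<epsilon> * approx_U Y Z \<epsilon> n x) \<le> C * \<epsilon> ^ (n + 1)"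
      by (rule e3)
  qed
qed

end

theorem theorem3:
  fixes a b :: real
    and k r \<kappa> \<rho> :: "real \<Rightarrow> real"
    and lam :: "real \<Rightarrow> nat \<Rightarrow> real"
    and u :: "real \<Rightarrow> nat \<Rightarrow> real \<Rightarrow> real"
    and \<mu> :: "nat \<Rightarrow> real"
    and j :: nat
  assumes "a < 0" and "0 < b"
    and "smooth_on {a..0} k" and "smooth_on {a..0} r"
    and "smooth_on {0..b} \<kappa>" and "smooth_on {0..b} \<rho>"
    and "\<And>x. x \<in> {a..0} \<Longrightarrow> k x > 0 \<and> r x > 0"
    and "\<And>x. x \<in> {0..b} \<Longrightarrow> \<kappa> x > 0 \<and> \<rho> x > 0"
    and "\<And>\<epsilon>. \<epsilon> > 0 \<Longrightarrow> enumerates_spectrum_P a b k r \<kappa> \<rho> \<epsilon> (lam \<epsilon>)"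
    and "\<And>\<epsilon> i. \<epsilon> > 0 \<Longrightarrow> i \<ge> 1 \<Longrightarrow>
           normalized_eigenfunction_P a b k r \<kappa> \<rho> \<epsilon> (lam \<epsilon> i) (u \<epsilon> i)"
    and "enumerates_eigenvalues_A a b k r \<kappa> \<rho> \<mu>"
    and "j \<ge> 1"
    and "complex_of_real (\<mu> j) \<in> spectrum_A1 a k r - spectrum_A2 b \<kappa> \<rho>"
  shows "\<exists>y z.
    y_problem a k r (\<mu> j) y \<and> (\<exists>x\<in>{a..0}. y x \<noteq> 0) \<and>
    z_problem b \<kappa> \<rho> (\<mu> j) (y 0) z \<and>
    (\<forall>w. z_problem b \<kappa> \<rho> (\<mu> j) (y 0) w \<longrightarrow> (\<forall>x\<in>{0..b}. w x = z x)) \<and>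
    tendsto_H1 a b (\<lambda>\<epsilon>. u \<epsilon> j) (glue y z) (at_right 0) \<and>
    (deriv_within z {0..b} 0 = 0 \<longrightarrow>
      (\<forall>\<epsilon>>0. lam \<epsilon> j = \<epsilon> * \<mu> j \<and> (\<forall>x\<in>{a..b}. u \<epsilon> j x = glue y z x))) \<and>
    (deriv_within z {0..b} 0 \<noteq> 0 \<longrightarrow>
      (\<forall>\<nu> Y Z. expansion_coeffs a b k r \<kappa> \<rho> (\<mu> j) \<nu> Y Z \<longrightarrow>
        (\<forall>n. (\<lambda>\<epsilon>. lam \<epsilon> j - \<epsilon> * (\<mu> j + (\<Sum>i=1..n. \<epsilon> ^ i * \<nu> i))) \<in> o[at_right 0](\<lambda>\<epsilon>. \<epsilon> ^ (n + 1))) \<and>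
        (\<exists>\<theta> L \<epsilon>0. (\<theta> \<longlongrightarrow> L) (at_right 0) \<and> L > 0 \<and> \<epsilon>0 > 0 \<and>
          (\<forall>n.
            (\<lambda>\<epsilon>. H1_norm a 0 (\<lambda>x. u \<epsilon> j x - orientation b Z * \<theta> \<epsilon> * partial_sum Y \<epsilon> n x))
              \<in> o[at_right 0](\<lambda>\<epsilon>. \<epsilon> ^ n) \<and>
            (\<lambda>\<epsilon>. H1_norm 0 b (\<lambda>x. u \<epsilon> j x - orientation b Z * \<theta> \<epsilon> * partial_sum Z \<epsilon> n x))
              \<in> o[at_right 0](\<lambda>\<epsilon>. \<epsilon> ^ n) \<and>
            (\<exists>c. \<forall>\<epsilon>. 0 < \<epsilon> \<and> \<epsilon> < \<epsilon>0 \<longrightarrow>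
              \<bar>lam \<epsilon> j / \<epsilon> - (\<mu> j + (\<Sum>i=1..n. \<epsilon> ^ i * \<nu> i))\<bar> \<le> c * \<epsilon> ^ (n + 1)) \<and>
            (\<exists>C. \<forall>\<epsilon>. 0 < \<epsilon> \<and> \<epsilon> < \<epsilon>0 \<longrightarrow>
              H1_norm a b (\<lambda>x. u \<epsilon> j x - orientation b Z * \<theta> \<epsilon> * approx_U Y Z \<epsilon> n x)
                \<le> C * \<epsilon> ^ (n + 1)) \<and>
            ((\<lambda>\<epsilon>. normalizer a b r \<rho> (approx_U Y Z \<epsilon> n)) \<longlongrightarrow> L) (at_right 0) \<and>
            (\<exists>C. \<forall>\<epsilon>. 0 < \<epsilon> \<and> \<epsilon> < \<epsilon>0 \<longrightarrow>
              H1_norm a b (\<lambda>x. u \<epsilon> j x - orientation b Z * normalizer a b r \<rho> (approx_U Y Z \<epsilon> n)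
                                            * approx_U Y Z \<epsilon> n x)
                \<le> C * \<epsilon> ^ (n + 1))))))"
proof -
  obtain k' where k': "\<And>x. x \<in> {a..0} \<Longrightarrow> (k has_real_derivative k' x) (at x within {a..0})" "continuous_on {a..0} k'"
    by (rule smooth_on_C1[OF assms(3)]) (rule that; assumption)
  obtain r' where r': "\<And>x. x \<in> {a..0} \<Longrightarrow> (r has_real_derivative r' x) (at x within {a..0})" "continuous_on {a..0} r'"
    by (rule smooth_on_C1[OF assms(4)]) (rule that; assumption)
  obtain \<kappa>' where \<kappa>': "\<And>x. x \<in> {0..b} \<Longrightarrow> (\<kappa> has_real_derivative \<kappa>' x) (at x within {0..b})" "continuous_on {0..b} \<kappa>'"
    by (rule smooth_on_C1[OF assms(5)]) (rule that; assumption)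
  obtain \<rho>' where \<rho>': "\<And>x. x \<in> {0..b} \<Longrightarrow> (\<rho> has_real_derivative \<rho>' x) (at x within {0..b})" "continuous_on {0..b} \<rho>'"
    by (rule smooth_on_C1[OF assms(6)]) (rule that; assumption)
  interpret transmission_C1 a b k r \<kappa> \<rho> k' \<kappa>'
  proof unfold_locales
    show "continuous_on {a..0} k" "continuous_on {a..0} r" "continuous_on {0..b} \<kappa>" "continuous_on {0..b} \<rho>"
      by (rule DERIV_continuous_on, erule k' r' \<kappa>' \<rho>')+
  qed (use assms k' \<kappa>' in auto)
  define m where "m = \<mu> j"
  \<comment> \<open>\<open>m\<close> is a zero of \<open>left.V\<close> but not of \<open>right.U\<close>, and the zero count up to it is \<open>j\<close>.\<close>
  have nE2: "\<not> E2 m" using E2_imp_spectrum_A2 assms(13) by (auto simp: m_def)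
  note idx = eigenvalue_index[OF assms(11,12) nE2[unfolded m_def], folded m_def]
  have m0: "m > 0" using E_pos(1)[OF idx(1)] .
  have V0: "left.V m 0 = 0" using idx(1) by (simp add: E1_def)
  have U0: "left.U m 0 \<noteq> 0" using left.UV_not_both_zero[of m] V0 by simp
  have R0: "right.U m 0 \<noteq> 0" using nE2 by (simp add: E2_def)
  have ur0: "ur m 0 \<noteq> 0" using R0 by (simp add: ur_def)
  define L where "L = (\<lambda>\<epsilon>. lam \<epsilon> j / \<epsilon>)"
  have lam: "lam \<epsilon> j = \<epsilon> * L \<epsilon>" if "\<epsilon> > 0" for \<epsilon> using that by (simp add: L_def)
  have Lim: "(L \<longlongrightarrow> m) (at_right 0)"
    unfolding L_def by (rule scaled_eigenvalue_tendsto[OF assms(9) m0 V0 R0 idx(2) assms(12)])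
  have eig: "normalized_eigenfunction_P a b k r \<kappa> \<rho> \<epsilon> (\<epsilon> * L \<epsilon>) (u \<epsilon> j)" if "\<epsilon> > 0" for \<epsilon>
    using assms(10)[OF that assms(12)] lam[OF that] by simp
  define y where "y = (\<lambda>x. amplitude m * ratio m * left.U m x)"
  define z where "z = (\<lambda>x. amplitude m * ur m x)"
  have sy: "sl_sys k {a..0} (\<lambda>x. amplitude m * ratio m * (- m * r x * left.U m x)) y (\<lambda>x. amplitude m * ratio m * left.V m x)"
    unfolding y_def by (rule sl_sys_scale[OF sys_left])
  have sz: "sl_sys \<kappa> {0..b} (\<lambda>x. amplitude m * (- m * \<rho> x * ur m x)) z (\<lambda>x. amplitude m * vr m x)"
    unfolding z_def by (rule sl_sys_scale[OF sys_right])
  have yz0: "y 0 = z 0" using U0 by (simp add: y_def z_def ratio_def)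
  have y0: "y 0 \<noteq> 0" using yz0 ur0 amplitude_pos[of m] by (simp add: z_def)
  have 1: "y_problem a k r m y"
    unfolding y_problem_def
  proof (intro conjI)
    show "sl_solution k {a..0} (\<lambda>x. - (m * r x * y x)) y"
      by (rule sl_solution_cong[OF sl_sys_imp_solution[OF sy a0 posk]]) (simp_all add: y_def)
    show "y a = 0" by (simp add: y_def)
    show "deriv_within y {a..0} 0 = 0" using sl_sys_deriv_within[OF sy a0, of 0] a0 V0 by simp
  qed
  have 2: "z_problem b \<kappa> \<rho> m (y 0) z"
    unfolding z_problem_def
  proof (intro conjI)
    show "sl_solution \<kappa> {0..b} (\<lambda>x. - (m * \<rho> x * z x)) z"
      by (rule sl_solution_cong[OF sl_sys_imp_solution[OF sz b0 pos\<kappa>]]) (simp_all add: z_def)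
    show "z b = 0" by (simp add: z_def)
  qed (simp add: yz0)
  have 3: "w x = z x" if w: "z_problem b \<kappa> \<rho> m (y 0) w" and x: "x \<in> {0..b}" for w x
  proof -
    have s: "sl_solution \<kappa> {0..b} (\<lambda>x. - (m * \<rho> x * w x)) w" and wb: "w b = 0" "w 0 = z 0"
      using w yz0 by (auto simp: z_problem_def)
    have "sl_sys \<kappa> {0..b} (\<lambda>x. - m * \<rho> x * w x) w (\<lambda>x. \<kappa> x * deriv_within w {0..b} x)"
      by (rule sl_sys_cong[OF sl_solution_imp_sys[OF s pos\<kappa>]]) auto
    note mult = sys_right_multiple(1)[OF this wb(1)]
    have "(\<kappa> b * deriv_within w {0..b} b) * ur m 0 = amplitude m * ur m 0"
      using mult[of 0] wb(2) b0 by (auto simp: z_def)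
    then have "\<kappa> b * deriv_within w {0..b} b = amplitude m" using ur0 by simp
    then show ?thesis using mult[OF x] by (simp add: z_def)
  qed
  have 4: "tendsto_H1 a b (\<lambda>\<epsilon>. u \<epsilon> j) (glue y z) (at_right 0)"
    unfolding y_def z_def by (rule eigenfunction_tendsto_H1[OF eig Lim U0])
  have 5: "lam \<epsilon> j = \<epsilon> * m \<and> (\<forall>x\<in>{a..b}. u \<epsilon> j x = glue y z x)"
    if dz: "deriv_within z {0..b} 0 = 0" and e: "\<epsilon> > 0" for \<epsilon>
  proof -
    have "amplitude m * vr m 0 / \<kappa> 0 = 0" using sl_sys_deriv_within[OF sz b0, of 0] dz b0 by simp
    \<comment> \<open>\<open>z' 0 = 0\<close> makes \<open>m\<close> a zero of \<open>D \<epsilon>\<close> for every \<open>\<epsilon>\<close>, of index \<open>j\<close>. The explicit form of the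
      eigenfunction depends on \<open>\<epsilon>\<close> only through the scaled eigenvalue, which is now constant.\<close>
    then have "right.V m 0 = 0" using amplitude_pos[of m] pos\<kappa>[of 0] b0 by (simp add: vr_def)
    then have l: "lam \<epsilon> j = \<epsilon> * m"
      using scaled_eigenvalue_exact[OF assms(9)[OF e] e _ V0 _ idx(2)] m0 by simp
    then have "normalized_eigenfunction_P a b k r \<kappa> \<rho> \<epsilon> (\<epsilon> * m) (u \<epsilon> j)" using assms(10)[OF e assms(12)] by simp
    note form = normalized_eigenfunction_form[OF this e U0]
    show ?thesis using l form(1,3) by (auto simp: glue_def y_def z_def)
  qed
  show ?thesis
    unfolding m_def[symmetric]
  proof (rule exI[of _ y], rule exI[of _ z], intro conjI impI allI ballI, goal_cases)
    case 1 show ?case by fact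
  next
    case 2 show ?case using y0 a0 by (intro bexI[of _ 0]) auto
  next
    case 3 show ?case by fact
  next
    case (4 w x) then show ?case using \<open>\<And>w x. z_problem b \<kappa> \<rho> m (y 0) w \<Longrightarrow> x \<in> {0..b} \<Longrightarrow> w x = z x\<close> by blast
  next
    case 5 show ?case by fact
  next
    case (6 \<epsilon>) then show ?case using \<open>\<And>\<epsilon>. deriv_within z {0..b} 0 = 0 \<Longrightarrow> 0 < \<epsilon> \<Longrightarrow> lam \<epsilon> j = \<epsilon> * m \<and> (\<forall>x\<in>{a..b}. u \<epsilon> j x = glue y z x)\<close> by blast
  next
    case (7 \<epsilon> x) then show ?case using \<open>\<And>\<epsilon>. deriv_within z {0..b} 0 = 0 \<Longrightarrow> 0 < \<epsilon> \<Longrightarrow> lam \<epsilon> j = \<epsilon> * m \<and> (\<forall>x\<in>{a..b}. u \<epsilon> j x = glue y z x)\<close> by blast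
  next
    case (8 \<nu> Y Z n)
    then interpret expansion a b k r \<kappa> \<rho> L "\<lambda>\<epsilon>. u \<epsilon> j" m \<nu> Y Z
      by unfold_locales (use eig Lim V0 in auto)
    show ?case using expansion_conclusion[of "\<lambda>\<epsilon>. lam \<epsilon> j"] lam by blast
  next
    case (9 \<nu> Y Z)
    then interpret expansion a b k r \<kappa> \<rho> L "\<lambda>\<epsilon>. u \<epsilon> j" m \<nu> Y Z
      by unfold_locales (use eig Lim V0 in auto)
    show ?case using expansion_conclusion[of "\<lambda>\<epsilon>. lam \<epsilon> j"] lam by blast
  qed
qed

end
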